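(* Let $W$ be an $\mathbb{R}^2$-valued process which is either a fractional Brownian motion with Hurst parameter $H\in(0,+\infty)\setminus\mathbb{N}$ or a $\beta$-stable Lévy process with $\beta\in(0,2]$, and let $\alpha\in(\alpha_W,1)$. Let $u$, $(u_q)_q$, $(\kappa_q)_q$ be the velocity field, its approximations and the noise intensities constructed in the context, with $\delta$ sufficiently small (so that $u\in C^\alpha([0,1]\times\mathbb{T}^2;\mathbb{R}^2)$) and $a_0$ sufficiently small. Let $X^{\kappa}_t(x,\omega)$ be the stochastic flow of $X^\kappa_t=x+\int_0^tu(r,X^\kappa_r)\,\mathrm{d}r+\kappa W_t$ and let $X^q_t(x)$ be the deterministic flow of $\dot X^q_t=u_q(t,X^q_t)$, $X^q_0=x$. Then for Lebesgue a.e. $x\in\mathbb{T}^2$ it holds that $$\mathbb{P}\Big(\omega\in\Omega:\ \lim_{q\to\infty}\mathrm{d}\big(X^{\kappa_q}_1(x,\omega),X^q_1(x)\big)=0\Big)=1.$$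
   Context: $\mathbb{T}^2\cong[0,1]^2/\!\sim$ with distance $\mathrm{d}$. Noise. Fractional Brownian motion: for $H\in(0,1)$ the continuous centered Gaussian process with covariance $\frac12(t^{2H}+s^{2H}-|t-s|^{2H})$; for $H\in(1,\infty)\setminus\mathbb N$, recursively $W^{H+1}_t=\int_0^tW^H_r\,\mathrm dr$; coordinates i.i.d. $\beta$-stable Lévy process: for $\beta\in(0,2)$ the isotropic one with generator $-|\nabla|^\beta=-(-\Delta)^{\beta/2}$, for $\beta=2$ standard Brownian motion. $\alpha_W=\max\{1-\frac1{2H},0\}$ for fBm and $\alpha_W=1-\frac\beta2$ for Lévy. If $u\in C^\alpha([0,1]\times\mathbb{T}^2)$ with $\alpha>\alpha_W$, the SDE is known to admit, for each $\kappa>0$, a unique stochastic flow $X^\kappa_t(x,\omega)$ on the canonical space $(\Omega,\mathcal F,\mathbb P)$. Parameters. Fix $\gamma$ with: $\frac12<\gamma<1$ if $W$ is fBm with $H<\frac12$; $\max\{1-\frac1{4H},\frac12\}<\gamma<1$ if $W$ is fBm with $H\ge\frac12$; $\max\{1-\frac\beta4,\frac12\}<\gamma<1$ if $W$ is $\beta$-stable. Let $\delta\in(0,1/100)$ and $a_0\in(0,1)$, and let $(a_q)_{q\in\mathbb N}$ satisfy $a_q/a_{q+1}\in[a_q^{-\delta},a_q^{-\delta}+4]\cap4\mathbb N$ and $1/a_q\in2\mathbb N$ for all $q\ge0$. Set $\ell_q=a_q^\gamma a_{q+1}^{1-\gamma}$, $\kappa_q=a_q^{1/2}a_{q+1}^{1/2}$,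 $t_0=0$, $t_{q+1}=t_q+\frac{3}{\pi^2(q+1)^2}$ (so $t_q\uparrow\frac12$). $a_0$ is taken small enough that $\sum_{q\ge j}a_q^{\delta(1-\gamma)}<4a_j^{\delta(1-\gamma)}$ for all $j\ge0$ and $10q^4\kappa_q\le\ell_q$ for all $q$. Construction of $u$. Let $\varphi_{q+1}:\mathbb{R}\to\mathbb{R}$ be the continuous, piecewise linear, $2a_q$-periodic function with $\varphi_{q+1}(0)=0$ such that on each interval $(2ia_{q+1},2(i+1)a_{q+1}]\subset(0,a_q]$ ($i\in\mathbb{N}$) its slope is $+1$ on the first half and $-1$ on the second half, and $\varphi_{q+1}(x)=-\varphi_{q+1}(x-a_q)$ for $x\in(a_q,2a_q]$; it is regarded as a $1$-periodic function. Define $v_{q+1,1}(x_1,x_2)=\frac{a_q}{2}(\varphi_{q+1}'(x_2),0)$, $v_{q+1,2}(x_1,x_2)=\frac{a_{q+1}}{2}(0,\varphi_{q+1}'(x_1)+1)$, and the constant field $v_{\mathrm{swap},q}=(a_{q+1},0)$. Split $[t_q,t_{q+1})$ into three consecutive intervals $J_{q,1},J_{q,2},J_{q,3}$ of equal length $\frac{t_{q+1}-t_q}3$ (in increasing order, closed on the left and open on the right). Let $\eta_{q,i}\in C_c^\infty(J_{q,i};[0,\infty))$ with $\int\eta_{q,i}=1$ and $\|\eta_{q,i}\|_{C^k}\le C_k(t_{q+1}-t_q)^{-k-1}$ for all $k\in\mathbb{N}$, with $C_k$ independent of $q$. Let $\chi:\mathbb{R}\to[0,1]$ be a standard mollifier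 and $\chi_\ell(\cdot)=\ell^{-1}\chi(\cdot/\ell)$. For $t\in[t_q,t_{q+1})$ set $u(t,x)=\eta_{q,1}(t)(\chi_{\ell_{q+1}}\star v_{q+1,1})(x_2)$ if $t\in J_{q,1}$, $u(t,x)=\eta_{q,2}(t)(\chi_{\ell_{q+1}}\star v_{q+1,2})(x_1)$ if $t\in J_{q,2}$, and $u(t,x)=0$ if $t\in J_{q,3}$. Set $u(1/2,\cdot)=0$ and, for $t\in(1/2,1]$, $u(t,x)=-u(1-t,x)+\sum_{q\ge0}\eta_{q,3}(1-t)\,v_{\mathrm{swap},q}$. The field $u$ is divergence-free in space and, given $\alpha\in(0,1)$ and $\gamma$, belongs to $C^\alpha([0,1]\times\mathbb T^2;\mathbb R^2)$ for $\delta$ small enough. Approximations. $u_q(t,x)=u(t,x)\,\mathbf 1_{[t_q,1-t_q]^c}(t)$, which is smooth. *)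

theory Defs
  imports "HOL-Probability.Probability"
begin

section \<open>The torus\<close>

text \<open>
  Points of the torus are represented by points of the plane, functions on the torus by functions
  of the plane that are 1-periodic in each variable, and torus-valued curves by their lifts.
\<close>

type_synonym pt = "real \<times> real"

definition lattice :: "pt set" where
  "lattice = \<int> \<times> \<int>"

definition torus_dist :: "pt \<Rightarrow> pt \<Rightarrow> real" where
  "torus_dist x y = (INF k\<in>lattice. dist x (y + k))"

definition holder_torus :: "real \<Rightarrow> (real \<Rightarrow> pt \<Rightarrow> pt) \<Rightarrow> bool" where
  "holder_torus \<alpha> b \<longleftrightarrow>
     (\<exists>C. \<forall>s\<in>{0..1}. \<forall>t\<in>{0..1}. \<forall>x y.
        norm (b s x - b t y) \<le> C * (\<bar>s - t\<bar> + torus_dist x y) powr \<alpha>)"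


section \<open>The noise\<close>

definition gaussian_rv :: "'w measure \<Rightarrow> ('w \<Rightarrow> real) \<Rightarrow> bool" where
  "gaussian_rv M X \<longleftrightarrow> X \<in> borel_measurable M \<and>
     ((\<exists>\<mu>. AE \<omega> in M. X \<omega> = \<mu>) \<or>
      (\<exists>\<mu> \<sigma>. 0 < \<sigma> \<and> distributed M lborel X (normal_density \<mu> \<sigma>)))"

definition gaussian_process :: "'w measure \<Rightarrow> real set \<Rightarrow> (real \<Rightarrow> 'w \<Rightarrow> real) \<Rightarrow> bool" where
  "gaussian_process M I B \<longleftrightarrow>
     (\<forall>J c. finite J \<and> J \<subseteq> I \<longrightarrow> gaussian_rv M (\<lambda>\<omega>. \<Sum>t\<in>J. c t * B t \<omega>))"

text \<open>
  All processes are considered on the time interval from 0 to 1. Path properties are required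
  almost surely, so that the canonical process on any of the usual path spaces is covered.
\<close>

inductive fbm_real :: "'w measure \<Rightarrow> real \<Rightarrow> (real \<Rightarrow> 'w \<Rightarrow> real) \<Rightarrow> bool" for M where
  base: "\<lbrakk>0 < H; H < 1;
     gaussian_process M {0..1} B;
     \<And>t. t \<in> {0..1} \<Longrightarrow> (\<integral>\<omega>. B t \<omega> \<partial>M) = 0;
     \<And>s t. \<lbrakk>s \<in> {0..1}; t \<in> {0..1}\<rbrakk> \<Longrightarrow>
       (\<integral>\<omega>. B s \<omega> * B t \<omega> \<partial>M)
         = (t powr (2 * H) + s powr (2 * H) - \<bar>t - s\<bar> powr (2 * H)) / 2;
     AE \<omega> in M. continuous_on {0..1} (\<lambda>t. B t \<omega>)\<rbrakk>
   \<Longrightarrow> fbm_real M H B"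
| step: "\<lbrakk>fbm_real M H B;
     \<And>t. t \<in> {0..1} \<Longrightarrow> B' t \<in> borel_measurable M;
     AE \<omega> in M. \<forall>t\<in>{0..1}. B' t \<omega> = integral {0..t} (\<lambda>r. B r \<omega>)\<rbrakk>
   \<Longrightarrow> fbm_real M (H + 1) B'"

definition fbm :: "'w measure \<Rightarrow> real \<Rightarrow> (real \<Rightarrow> 'w \<Rightarrow> pt) \<Rightarrow> bool" where
  "fbm M H W \<longleftrightarrow>
     fbm_real M H (\<lambda>t \<omega>. fst (W t \<omega>)) \<and> fbm_real M H (\<lambda>t \<omega>. snd (W t \<omega>)) \<and>
     prob_space.indep_var M
       (PiM {0..1} (\<lambda>_. borel)) (\<lambda>\<omega>. \<lambda>t\<in>{0..1}. fst (W t \<omega>))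
       (PiM {0..1} (\<lambda>_. borel)) (\<lambda>\<omega>. \<lambda>t\<in>{0..1}. snd (W t \<omega>))"

definition cadlag :: "(real \<Rightarrow> pt) \<Rightarrow> bool" where
  "cadlag f \<longleftrightarrow>
     (\<forall>t\<in>{0..<1}. (f \<longlongrightarrow> f t) (at_right t)) \<and>
     (\<forall>t\<in>{0<..1}. \<exists>l. (f \<longlongrightarrow> l) (at_left t))"

text \<open>
  The generator of a Levy process with characteristic function
  \<open>exp (- t * \<psi> \<xi>)\<close> is the Fourier multiplier with symbol \<open>- \<psi> \<xi>\<close>. So the generator
  \<open>-(-\<Delta>)\<close> to the power \<open>\<beta>/2\<close> means that \<open>\<psi> \<xi>\<close> is the \<open>\<beta>\<close>-th power of the norm. Standard
  Brownian motion has the generator \<open>\<Delta>/2\<close>, which is not the value at \<open>\<beta> = 2\<close> of this formula.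
\<close>

definition stable_exponent :: "real \<Rightarrow> pt \<Rightarrow> real" where
  "stable_exponent \<beta> \<xi> = (if \<beta> = 2 then (norm \<xi>)\<^sup>2 / 2 else norm \<xi> powr \<beta>)"

definition stable_process :: "'w measure \<Rightarrow> real \<Rightarrow> (real \<Rightarrow> 'w \<Rightarrow> pt) \<Rightarrow> bool" where
  "stable_process M \<beta> W \<longleftrightarrow>
     (\<forall>t\<in>{0..1}. W t \<in> borel_measurable M) \<and>
     (AE \<omega> in M. W 0 \<omega> = 0) \<and>
     (\<forall>n (\<tau> :: nat \<Rightarrow> real). mono \<tau> \<and> range \<tau> \<subseteq> {0..1} \<longrightarrow>
        prob_space.indep_vars M (\<lambda>_. borel) (\<lambda>i \<omega>. W (\<tau> (Suc i)) \<omega> - W (\<tau> i) \<omega>) {..<n}) \<and>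
     (\<forall>s t \<xi>. 0 \<le> s \<and> s \<le> t \<and> t \<le> 1 \<longrightarrow>
        (\<integral>\<omega>. cis (inner \<xi> (W t \<omega> - W s \<omega>)) \<partial>M)
          = complex_of_real (exp (- ((t - s) * stable_exponent \<beta> \<xi>)))) \<and>
     (AE \<omega> in M. if \<beta> = 2 then continuous_on {0..1} (\<lambda>t. W t \<omega>) else cadlag (\<lambda>t. W t \<omega>))"

datatype noise = FBM real | Stable real

fun valid_noise :: "noise \<Rightarrow> bool" where
  "valid_noise (FBM H) \<longleftrightarrow> 0 < H \<and> H \<notin> \<nat>"
| "valid_noise (Stable \<beta>) \<longleftrightarrow> 0 < \<beta> \<and> \<beta> \<le> 2"

fun is_noise :: "noise \<Rightarrow> 'w measure \<Rightarrow> (real \<Rightarrow> 'w \<Rightarrow> pt) \<Rightarrow> bool" where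
  "is_noise (FBM H) M W \<longleftrightarrow> fbm M H W"
| "is_noise (Stable \<beta>) M W \<longleftrightarrow> stable_process M \<beta> W"

fun alpha_noise :: "noise \<Rightarrow> real" where
  "alpha_noise (FBM H) = max (1 - 1 / (2 * H)) 0"
| "alpha_noise (Stable \<beta>) = 1 - \<beta> / 2"

fun admissible_gamma :: "noise \<Rightarrow> real \<Rightarrow> bool" where
  "admissible_gamma (FBM H) \<gamma> \<longleftrightarrow>
     (if H < 1/2 then 1/2 < \<gamma> else max (1 - 1 / (4 * H)) (1/2) < \<gamma>) \<and> \<gamma> < 1"
| "admissible_gamma (Stable \<beta>) \<gamma> \<longleftrightarrow> max (1 - \<beta> / 4) (1/2) < \<gamma> \<and> \<gamma> < 1"


section \<open>Flows\<close>

definition ode_flow :: "(real \<Rightarrow> pt \<Rightarrow> pt) \<Rightarrow> (real \<Rightarrow> pt \<Rightarrow> pt) \<Rightarrow> bool" where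
  "ode_flow b X \<longleftrightarrow>
     (\<forall>x. X 0 x = x \<and>
       (\<forall>t\<in>{0..1}. ((\<lambda>r. X r x) has_vector_derivative b t (X t x)) (at t within {0..1})))"

definition noise_history :: "'w measure \<Rightarrow> (real \<Rightarrow> 'w \<Rightarrow> pt) \<Rightarrow> real \<Rightarrow> 'w measure" where
  "noise_history M W t =
     vimage_algebra (space M) (\<lambda>\<omega>. \<lambda>r\<in>{0..t}. W r \<omega>) (PiM {0..t} (\<lambda>_. borel))"

text \<open>
  \<open>X s t x \<omega>\<close> is the position at time \<open>t\<close> of the solution started at time \<open>s\<close> from \<open>x\<close>; the
  one-parameter flow is \<open>X 0 t x \<omega>\<close>. It is adapted to the completed filtration of the
  noise. The compatibility with translations by the lattice says that \<open>X\<close> is the lift of a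
  flow on the torus.
\<close>

definition stochastic_flow ::
  "'w measure \<Rightarrow> (real \<Rightarrow> 'w \<Rightarrow> pt) \<Rightarrow> (real \<Rightarrow> pt \<Rightarrow> pt) \<Rightarrow> real
     \<Rightarrow> (real \<Rightarrow> real \<Rightarrow> pt \<Rightarrow> 'w \<Rightarrow> pt) \<Rightarrow> bool" where
  "stochastic_flow M W b \<kappa> X \<longleftrightarrow>
     (\<forall>s t x. 0 \<le> s \<and> s \<le> t \<and> t \<le> 1 \<longrightarrow>
        X s t x \<in> borel_measurable M \<and>
        (\<exists>Y \<in> borel_measurable (noise_history M W t). AE \<omega> in M. X s t x \<omega> = Y \<omega>)) \<and>
     (AE \<omega> in M. \<forall>s t. 0 \<le> s \<and> s \<le> t \<and> t \<le> 1 \<longrightarrow>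
        (\<forall>x. ((\<lambda>r. b r (X s r x \<omega>)) has_integral
                 (X s t x \<omega> - x - \<kappa> *\<^sub>R (W t \<omega> - W s \<omega>))) {s..t}) \<and>
        (\<forall>x. \<forall>r\<in>{s..t}. X s t x \<omega> = X r t (X s r x \<omega>) \<omega>) \<and>
        (\<forall>x. \<forall>k\<in>lattice. X s t (x + k) \<omega> = X s t x \<omega> + k) \<and>
        continuous_on UNIV (\<lambda>x. X s t x \<omega>))"


section \<open>The velocity field\<close>

definition ell :: "(nat \<Rightarrow> real) \<Rightarrow> real \<Rightarrow> nat \<Rightarrow> real" where
  "ell a \<gamma> q = a q powr \<gamma> * a (Suc q) powr (1 - \<gamma>)"

definition kappa :: "(nat \<Rightarrow> real) \<Rightarrow> nat \<Rightarrow> real" where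
  "kappa a q = a q powr (1/2) * a (Suc q) powr (1/2)"

definition admissible_scales :: "real \<Rightarrow> real \<Rightarrow> (nat \<Rightarrow> real) \<Rightarrow> bool" where
  "admissible_scales \<delta> \<gamma> a \<longleftrightarrow>
     0 < a 0 \<and> a 0 < 1 \<and>
     (\<forall>q. a q / a (Suc q) \<in> {a q powr (-\<delta>) .. a q powr (-\<delta>) + 4} \<inter> range (\<lambda>n::nat. 4 * real n)) \<and>
     (\<forall>q. 1 / a q \<in> range (\<lambda>n::nat. 2 * real n)) \<and>
     summable (\<lambda>q. a q powr (\<delta> * (1 - \<gamma>))) \<and>
     (\<forall>j. (\<Sum>q. a (j + q) powr (\<delta> * (1 - \<gamma>))) < 4 * a j powr (\<delta> * (1 - \<gamma>))) \<and>
     (\<forall>q. 10 * real q ^ 4 * kappa a q \<le> ell a \<gamma> q)"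

primrec tm :: "nat \<Rightarrow> real" where
  "tm 0 = 0"
| "tm (Suc q) = tm q + 3 / (pi\<^sup>2 * (real q + 1)\<^sup>2)"

definition J :: "nat \<Rightarrow> nat \<Rightarrow> real set" where
  "J q i = {tm q + (real i - 1) * (tm (Suc q) - tm q) / 3 ..<
            tm q + real i * (tm (Suc q) - tm q) / 3}"

definition smooth :: "(real \<Rightarrow> real) \<Rightarrow> bool" where
  "smooth f \<longleftrightarrow> (\<forall>k x. (deriv ^^ k) f differentiable (at x))"

definition standard_mollifier :: "(real \<Rightarrow> real) \<Rightarrow> bool" where
  "standard_mollifier \<rho> \<longleftrightarrow> smooth \<rho> \<and> range \<rho> \<subseteq> {0..1} \<and>
     (\<forall>x. \<rho> x \<noteq> 0 \<longrightarrow> \<bar>x\<bar> \<le> 1) \<and> (\<rho> has_integral 1) UNIV"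

text \<open>The functions \<open>\<eta> q i\<close> are only used for \<open>i = 1, 2, 3\<close>.\<close>

definition cutoffs :: "(nat \<Rightarrow> nat \<Rightarrow> real \<Rightarrow> real) \<Rightarrow> bool" where
  "cutoffs \<eta> \<longleftrightarrow>
     (\<forall>q. \<forall>i\<in>{1,2,3}. smooth (\<eta> q i) \<and> (\<forall>t. 0 \<le> \<eta> q i t) \<and>
        closure {t. \<eta> q i t \<noteq> 0} \<subseteq> J q i \<and> (\<eta> q i has_integral 1) UNIV) \<and>
     (\<exists>C :: nat \<Rightarrow> real. \<forall>k q. \<forall>i\<in>{1,2,3}. \<forall>j\<le>k. \<forall>t.
        \<bar>(deriv ^^ j) (\<eta> q i) t\<bar> \<le> C k / (tm (Suc q) - tm q) ^ (k + 1))"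

text \<open>
  \<open>sawtooth A b \<phi>\<close> determines \<open>\<phi>\<close> uniquely when \<open>A\<close> is a multiple of \<open>2 * b\<close>, because the
  intervals of length \<open>2 * b\<close> then tile \<open>{0<..A}\<close>.
\<close>

definition sawtooth :: "real \<Rightarrow> real \<Rightarrow> (real \<Rightarrow> real) \<Rightarrow> bool" where
  "sawtooth A b \<phi> \<longleftrightarrow>
     continuous_on UNIV \<phi> \<and> (\<forall>x. \<phi> (x + 2 * A) = \<phi> x) \<and> \<phi> 0 = 0 \<and>
     (\<forall>i::nat. {2 * real i * b <.. 2 * (real i + 1) * b} \<subseteq> {0<..A} \<longrightarrow>
        (\<forall>x\<in>{2 * real i * b <..< (2 * real i + 1) * b}. (\<phi> has_real_derivative 1) (at x)) \<and>
        (\<forall>x\<in>{(2 * real i + 1) * b <..< 2 * (real i + 1) * b}. (\<phi> has_real_derivative -1) (at x))) \<and>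
     (\<forall>x\<in>{A<..2*A}. \<phi> x = - \<phi> (x - A))"

definition mollify :: "(real \<Rightarrow> real) \<Rightarrow> real \<Rightarrow> (real \<Rightarrow> pt) \<Rightarrow> real \<Rightarrow> pt" where
  "mollify \<rho> l f z = (\<integral>y. (\<rho> ((z - y) / l) / l) *\<^sub>R f y \<partial>lborel)"

text \<open>
  The fields \<open>v1\<close> and \<open>v2\<close> depend on one coordinate only, the second and the first one
  respectively; \<open>deriv (\<phi> q)\<close> is meaningful outside a discrete set.
\<close>

definition v1 :: "(nat \<Rightarrow> real) \<Rightarrow> (nat \<Rightarrow> real \<Rightarrow> real) \<Rightarrow> nat \<Rightarrow> real \<Rightarrow> pt" where
  "v1 a \<phi> q z = (a q / 2) *\<^sub>R (deriv (\<phi> (Suc q)) z, 0)"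

definition v2 :: "(nat \<Rightarrow> real) \<Rightarrow> (nat \<Rightarrow> real \<Rightarrow> real) \<Rightarrow> nat \<Rightarrow> real \<Rightarrow> pt" where
  "v2 a \<phi> q z = (a (Suc q) / 2) *\<^sub>R (0, deriv (\<phi> (Suc q)) z + 1)"

definition v_swap :: "(nat \<Rightarrow> real) \<Rightarrow> nat \<Rightarrow> pt" where
  "v_swap a q = (a (Suc q), 0)"

definition level :: "real \<Rightarrow> nat" where
  "level t = (THE q. t \<in> {tm q ..< tm (Suc q)})"

text \<open>The velocity field at times in \<open>{0..<1/2}\<close>.\<close>

definition u_early ::
  "(nat \<Rightarrow> real) \<Rightarrow> real \<Rightarrow> (nat \<Rightarrow> real \<Rightarrow> real) \<Rightarrow> (real \<Rightarrow> real) \<Rightarrow> (nat \<Rightarrow> nat \<Rightarrow> real \<Rightarrow> real)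
     \<Rightarrow> real \<Rightarrow> pt \<Rightarrow> pt" where
  "u_early a \<gamma> \<phi> \<rho> \<eta> t x =
     (let q = level t in
      if t \<in> J q 1 then \<eta> q 1 t *\<^sub>R mollify \<rho> (ell a \<gamma> (Suc q)) (v1 a \<phi> q) (snd x)
      else if t \<in> J q 2 then \<eta> q 2 t *\<^sub>R mollify \<rho> (ell a \<gamma> (Suc q)) (v2 a \<phi> q) (fst x)
      else 0)"

definition u ::
  "(nat \<Rightarrow> real) \<Rightarrow> real \<Rightarrow> (nat \<Rightarrow> real \<Rightarrow> real) \<Rightarrow> (real \<Rightarrow> real) \<Rightarrow> (nat \<Rightarrow> nat \<Rightarrow> real \<Rightarrow> real)
     \<Rightarrow> real \<Rightarrow> pt \<Rightarrow> pt" where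
  "u a \<gamma> \<phi> \<rho> \<eta> t x =
     (if 0 \<le> t \<and> t < 1/2 then u_early a \<gamma> \<phi> \<rho> \<eta> t x
      else if 1/2 < t \<and> t \<le> 1 then
        - u_early a \<gamma> \<phi> \<rho> \<eta> (1 - t) x + (\<Sum>q. \<eta> q 3 (1 - t) *\<^sub>R v_swap a q)
      else 0)"

definition u_approx ::
  "(nat \<Rightarrow> real) \<Rightarrow> real \<Rightarrow> (nat \<Rightarrow> real \<Rightarrow> real) \<Rightarrow> (real \<Rightarrow> real) \<Rightarrow> (nat \<Rightarrow> nat \<Rightarrow> real \<Rightarrow> real)
     \<Rightarrow> nat \<Rightarrow> real \<Rightarrow> pt \<Rightarrow> pt" where
  "u_approx a \<gamma> \<phi> \<rho> \<eta> q t x =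
     indicator (- {tm q .. 1 - tm q}) t *\<^sub>R u a \<gamma> \<phi> \<rho> \<eta> t x"

end

theory Submission
  imports Defs
begin

text \<open>
  Before time \<open>tm q\<close> and after time \<open>1 - tm q\<close> the velocity is made of shears that are mollified at
  scales above \<open>ell a \<gamma> q\<close>, which dominates the noise amplitude \<open>kappa a q\<close>. By Borel-Cantelli almost
  every starting point stays, from some stage on, far from the jumps of these shears, where they are
  locally constant: there noisy and noiseless solution differ by a translation, and finitely many
  earlier stages only contribute a Lipschitz factor. In between, where \<open>u_approx\<close> vanishes, the only
  shear of amplitude larger than \<open>a (Suc q)\<close> is the first one of stage \<open>q\<close>. It oscillates at the scale
  \<open>a (Suc q)\<close>, which is much smaller than \<open>kappa a q\<close>, so the noise averages it out: its Fourier modes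
  are tested against the occupation measure of the noise, whose characteristic function is small in
  mean square because the increments of the noise decorrelate. The condition on \<open>\<gamma>\<close> makes what is left
  small compared with \<open>ell a \<gamma> q\<close>.
\<close>

section \<open>Square waves along a path\<close>

text \<open>The offset at which the noisy solution enters the fast shear depends on the noise
  itself, so averaging has to hold for all offsets at once. The Fourier coefficients of a square
  wave decay only like 1/n, which is not summable; but decorrelation makes the mean of the n-th mode
  smaller by a further power of n, so a first moment of the sum of absolute values suffices. The
  exponents balance as follows. Put r = \<open>a (Suc q) / a q\<close>. The noise of size
  \<open>kappa a q\<close> runs through r powr (-1/2) cells of the fast shear. If frequency xi
  decorrelates within time xi powr (-p), the modes have mean size about r powr (p/4), whereas
  \<open>ell a \<gamma> q / a q\<close> is r powr (1 - \<gamma>). So 1 - \<gamma> < p/4 is the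
  condition, with p = 1/H, 1 or \<beta>; that the noise stays below \<open>ell a \<gamma> q\<close>
  is \<gamma> > 1/2. Everything at scales finer than that shear moves the solution by a multiple of
  \<open>a (Suc q)\<close> only, by a geometric series running through time 1/2. Subtracting the
  noise from the solution separates the two worlds: the stages are then treated path by path, and
  probability only supplies the bound on the modes.\<close>

lemma sum_cos_odd:
  "(\<Sum>n<N. cos ((2 * real n + 1) * \<theta>)) * (2 * sin \<theta>) = sin (2 * real N * \<theta>)"
proof (induction N)
  case (Suc N)
  have "sin (2 * real (Suc N) * \<theta>) - sin (2 * real N * \<theta>) = cos ((2 * real N + 1) * \<theta>) * (2 * sin \<theta>)"
  proof -
    have "sin (2 * real (Suc N) * \<theta>) = sin ((2 * real N + 1) * \<theta> + \<theta>)"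
      "sin (2 * real N * \<theta>) = sin ((2 * real N + 1) * \<theta> - \<theta>)"
      by (simp_all add: algebra_simps)
    then show ?thesis by (simp add: sin_add sin_diff)
  qed
  with Suc show ?case by (simp add: distrib_right)
qed simp

text \<open>The derivative of the sine sum is an oscillating Dirichlet kernel, given by
  \<open>sum_cos_odd\<close>. One integration by parts makes it of size 1/N as long as the argument
  keeps away from the zeros of the sine, so the sums become constant at a rate that is uniform on
  [\<epsilon>, pi - \<epsilon>].\<close>

lemma sum_sin_odd_bound:
  fixes \<theta> \<epsilon> :: real
  assumes "0 < \<epsilon>" "\<epsilon> \<le> \<theta>" "\<theta> \<le> pi - \<epsilon>" "N > 0"
  shows "\<bar>(\<Sum>n<N. sin ((2 * real n + 1) * \<theta>) / (2 * real n + 1)) - (\<Sum>n<N. (-1) ^ n / (2 * real n + 1))\<bar>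
     \<le> (3 / (sin \<epsilon>)\<^sup>2) / real N"
proof -
  define D where "D = (\<lambda>\<theta>. \<Sum>n<N. sin ((2 * real n + 1) * \<theta>) / (2 * real n + 1))"
  \<comment> \<open>\<open>Q\<close> adds to \<open>D\<close> the boundary term of the integration
    by parts, so that the term with \<open>sin (2 * real N * \<theta>)\<close> cancels in the
    derivative.\<close>
  define Q where "Q = (\<lambda>\<theta>. D \<theta> + cos (2 * real N * \<theta>) / (4 * real N * sin \<theta>))"
  define Q' where "Q' = (\<lambda>\<theta>. - cos (2 * real N * \<theta>) * cos \<theta> / (4 * real N * (sin \<theta>)\<^sup>2))"
  have epi: "\<epsilon> \<le> pi / 2" using assms by simp
  have sine: "0 < sin \<epsilon>" using assms epi by (intro sin_gt_zero) auto
  have sin_ge: "sin \<epsilon> \<le> sin y" if "y \<in> {\<epsilon>..pi-\<epsilon>}" for y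
  proof (cases "y \<le> pi / 2")
    case True then show ?thesis using that assms epi
      by (subst sin_mono_le_eq) auto
  next
    case False
    have "sin \<epsilon> \<le> sin (pi - y)" using that assms epi False
      by (subst sin_mono_le_eq) auto
    then show ?thesis by simp
  qed
  have der: "(Q has_real_derivative Q' y) (at y within {\<epsilon>..pi-\<epsilon>})" if y: "y \<in> {\<epsilon>..pi-\<epsilon>}" for y
  proof -
    have s: "sin y > 0" using sin_ge[OF y] sine by linarith
    have "(D has_real_derivative (\<Sum>n<N. cos ((2 * real n + 1) * y))) (at y)"
      unfolding D_def by (auto intro!: derivative_eq_intros sum.cong)
         (metis of_nat_1 of_nat_add of_nat_eq_0_iff of_nat_mult of_nat_numeral add_eq_0_iff_both_eq_0 one_neq_zero)?
    moreover have "(\<Sum>n<N. cos ((2 * real n + 1) * y)) = sin (2 * real N * y) / (2 * sin y)"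
      using sum_cos_odd[of y N] s by (simp add: field_simps)
    ultimately have "(Q has_real_derivative Q' y) (at y)"
      unfolding Q_def Q'_def using s \<open>N > 0\<close>
      by (auto intro!: derivative_eq_intros simp: field_simps power2_eq_square)
    then show ?thesis by (rule has_field_derivative_at_within)
  qed
  have bd: "\<bar>Q' y\<bar> \<le> 1 / (4 * real N * (sin \<epsilon>)\<^sup>2)" if y: "y \<in> {\<epsilon>..pi-\<epsilon>}" for y
  proof -
    have "\<bar>cos (2 * real N * y) * cos y\<bar> \<le> 1 * 1"
      unfolding abs_mult by (intro mult_mono) auto
    moreover have "(sin \<epsilon>)\<^sup>2 \<le> (sin y)\<^sup>2" using sin_ge[OF y] sine by (intro power_mono) auto
    ultimately show ?thesis unfolding Q'_def using sine \<open>N > 0\<close>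
      by (auto simp: abs_mult intro!: frac_le)
  qed
  have "\<bar>Q \<theta> - Q (pi/2)\<bar> \<le> 1 / (4 * real N * (sin \<epsilon>)\<^sup>2) * \<bar>\<theta> - pi/2\<bar>"
    using field_differentiable_bound[of "{\<epsilon>..pi-\<epsilon>}" Q Q' "1 / (4 * real N * (sin \<epsilon>)\<^sup>2)" \<theta> "pi/2"]
      der bd assms epi by auto
  also have "\<dots> \<le> 1 / (4 * real N * (sin \<epsilon>)\<^sup>2) * 4"
    using assms pi_less_4 epi sine by (intro mult_left_mono) auto
  finally have 1: "\<bar>Q \<theta> - Q (pi/2)\<bar> \<le> 1 / (real N * (sin \<epsilon>)\<^sup>2)" by simp
  have 2: "\<bar>cos (2 * real N * y) / (4 * real N * sin y)\<bar> \<le> 1 / (real N * (sin \<epsilon>)\<^sup>2)" if y: "y \<in> {\<epsilon>..pi-\<epsilon>}" for y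
  proof -
    have "(sin \<epsilon>)\<^sup>2 \<le> sin \<epsilon>" using sine by (simp add: power2_eq_square mult_left_le)
    then have "(sin \<epsilon>)\<^sup>2 \<le> sin y" using sin_ge[OF y] by linarith
    then show ?thesis unfolding abs_divide using sine \<open>N > 0\<close>
      by (intro frac_le) (auto simp: abs_mult intro!: mult_mono)
  qed
  \<comment> \<open>At pi/2 the sines alternate and the sum is a partial sum of the Leibniz
    series.\<close>
  have D2: "D (pi/2) = (\<Sum>n<N. (-1) ^ n / (2 * real n + 1))"
  proof -
    have "sin ((2 * real n + 1) * (pi/2)) = (-1) ^ n" for n
    proof -
      have "sin ((2 * real n + 1) * (pi/2)) = sin (pi/2 + real n * pi)" by (simp add: algebra_simps add_divide_distrib)
      then show ?thesis by (simp add: sin_add)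
    qed
    then show ?thesis unfolding D_def by simp
  qed
  have "\<bar>D \<theta> - D (pi/2)\<bar> \<le> \<bar>Q \<theta> - Q (pi/2)\<bar> + \<bar>cos (2 * real N * \<theta>) / (4 * real N * sin \<theta>)\<bar>
     + \<bar>cos (2 * real N * (pi/2)) / (4 * real N * sin (pi/2))\<bar>"
    unfolding Q_def by linarith
  also have "\<dots> \<le> 3 * (1 / (real N * (sin \<epsilon>)\<^sup>2))"
  proof -
    have "\<theta> \<in> {\<epsilon>..pi-\<epsilon>}" "pi/2 \<in> {\<epsilon>..pi-\<epsilon>}" using assms epi by auto
    have triple: "c + c + c = 3 * c" for c :: real by simp
    show ?thesis
      unfolding triple[symmetric]
      using \<open>\<theta> \<in> _\<close> \<open>pi/2 \<in> _\<close> by (intro add_mono 1 2)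
  qed
  finally show ?thesis unfolding D2 unfolding D_def by (simp add: mult.commute)
qed

section \<open>Square wave and triangle wave\<close>

definition sqw :: "real \<Rightarrow> real" where
  "sqw x = (if even \<lfloor>x\<rfloor> then 1 else - 1)"

text \<open>A triangle wave, given by its Fourier series because only the modes are estimated later.
  Its coefficients are absolutely summable, unlike those of \<open>sqw\<close>. As
  \<open>sqw\<close> is right continuous at the integers, it is a multiple of the right derivative
  of \<open>triw\<close> at every point, so no assumption on the time a path spends at jumps is
  needed.\<close>

definition triw :: "real \<Rightarrow> real" where
  "triw x = (\<Sum>n. cos ((2 * real n + 1) * (pi * x)) / (2 * real n + 1)\<^sup>2)"

lemma summable_inverse_odd_squares: "summable (\<lambda>n. 1 / (2 * real n + 1)\<^sup>2)"
proof (rule summable_comparison_test')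
  show "summable (\<lambda>n. 1 / real (Suc n) ^ 2)"
    using inverse_squares_sums by (simp add: sums_iff add.commute)
  show "norm (1 / (2 * real n + 1)\<^sup>2) \<le> 1 / real (Suc n) ^ 2" for n
    by (auto intro!: frac_le power_mono)
qed

lemma triw_term_le: "norm (cos ((2 * real n + 1) * (pi * x)) / (2 * real n + 1)\<^sup>2) \<le> 1 / (2 * real n + 1)\<^sup>2"
  by (simp add: divide_right_mono)

lemma triw_sums: "(\<lambda>n. cos ((2 * real n + 1) * (pi * x)) / (2 * real n + 1)\<^sup>2) sums triw x"
  unfolding triw_def
  by (intro summable_sums summable_comparison_test'[OF summable_inverse_odd_squares] triw_term_le)

lemma continuous_triw: "continuous_on A triw"
proof -
  have "continuous_on UNIV triw"
  proof (rule uniform_limit_theorem)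
    show "uniform_limit UNIV (\<lambda>N x. \<Sum>n<N. cos ((2 * real n + 1) * (pi * x)) / (2 * real n + 1)\<^sup>2) triw sequentially"
      unfolding triw_def
      by (rule Weierstrass_m_test[OF _ summable_inverse_odd_squares]) (use triw_term_le in auto)
  qed (auto intro!: always_eventually continuous_intros)
  then show ?thesis by (rule continuous_on_subset) auto
qed

text \<open>On compact parts of (0, pi) the derivatives of the partial sums converge uniformly to
  -pi/4, by \<open>sum_sin_odd_bound\<close> and the Leibniz series. At the midpoint pi/2 every term
  vanishes, which fixes the constant of integration.\<close>

lemma triw_interior:
  assumes "0 < x" "x < 1"
  shows "triw x = pi\<^sup>2 / 8 * (1 - 2 * x)"
proof -
  define \<epsilon> where "\<epsilon> = pi * min x (1 - x)"
  define L where "L = (\<lambda>N. \<Sum>n<N. (-1) ^ n / (2 * real n + 1))"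
  define P where "P = (\<lambda>N \<theta>. (\<Sum>n<N. cos ((2 * real n + 1) * \<theta>) / (2 * real n + 1)\<^sup>2) + (pi / 4) * (\<theta> - pi / 2))"
  have eps: "0 < \<epsilon>" using assms by (simp add: \<epsilon>_def)
  have epsle: "\<epsilon> \<le> pi * (1/2)" unfolding \<epsilon>_def by (intro mult_left_mono) (auto simp: min_def)
  have xin: "\<epsilon> \<le> pi * x" "pi * x \<le> pi - \<epsilon>"
  proof -
    show "\<epsilon> \<le> pi * x" unfolding \<epsilon>_def by (intro mult_left_mono) auto
    have "\<epsilon> \<le> pi * (1 - x)" unfolding \<epsilon>_def by (intro mult_left_mono) auto
    then show "pi * x \<le> pi - \<epsilon>" by (simp add: algebra_simps)
  qed
  have Llim: "L \<longlonglongrightarrow> pi / 4"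
  proof -
    have "(\<lambda>k. (-1) ^ k * 1 / real (k * 2 + 1)) sums (pi / 4)"
      using pi_series summable_arctan_series[of 1] by (simp add: sums_iff)
    then show ?thesis unfolding L_def sums_def by (simp add: mult.commute add.commute)
  qed
  have P0: "P N (pi / 2) = 0" for N
  proof -
    have "cos ((2 * real n + 1) * (pi/2)) = 0" for n
    proof -
      have "cos ((2 * real n + 1) * (pi/2)) = cos (pi/2 + real n * pi)" by (simp add: algebra_simps add_divide_distrib)
      then show ?thesis by (simp add: cos_add)
    qed
    then show ?thesis unfolding P_def by simp
  qed
  have bound: "\<bar>P N (pi * x)\<bar> \<le> (3 / (sin \<epsilon>)\<^sup>2 / real N + \<bar>L N - pi / 4\<bar>) * 4" if N: "N > 0" for N
  proof -
    define P' where "P' = (\<lambda>\<theta>. - (\<Sum>n<N. sin ((2 * real n + 1) * \<theta>) / (2 * real n + 1)) + pi / 4)"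
    have odd_nz: "2 * real n + 1 \<noteq> 0" for n
      by (smt (verit) of_nat_0_le_iff)
    have der: "(P N has_real_derivative P' y) (at y within S)" for y S
    proof -
      have "(P N has_real_derivative P' y) (at y)"
        unfolding P_def P'_def
        by (auto intro!: derivative_eq_intros simp: sum_negf[symmetric] odd_nz power2_eq_square)
      then show ?thesis by (rule has_field_derivative_at_within)
    qed
    have bd: "\<bar>P' y\<bar> \<le> 3 / (sin \<epsilon>)\<^sup>2 / real N + \<bar>L N - pi / 4\<bar>" if "y \<in> {\<epsilon>..pi-\<epsilon>}" for y
    proof -
      have "\<bar>(\<Sum>n<N. sin ((2 * real n + 1) * y) / (2 * real n + 1)) - L N\<bar> \<le> 3 / (sin \<epsilon>)\<^sup>2 / real N"
        unfolding L_def using sum_sin_odd_bound[OF eps] that N by auto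
      then show ?thesis unfolding P'_def by linarith
    qed
    have "\<bar>P N (pi * x) - P N (pi / 2)\<bar> \<le> (3 / (sin \<epsilon>)\<^sup>2 / real N + \<bar>L N - pi / 4\<bar>) * \<bar>pi * x - pi / 2\<bar>"
      using field_differentiable_bound[of "{\<epsilon>..pi-\<epsilon>}" "P N" P' "3 / (sin \<epsilon>)\<^sup>2 / real N + \<bar>L N - pi / 4\<bar>" "pi * x" "pi / 2"]
        der bd xin eps epsle by auto
    also have "\<dots> \<le> (3 / (sin \<epsilon>)\<^sup>2 / real N + \<bar>L N - pi / 4\<bar>) * 4"
      using xin eps pi_less_4 by (intro mult_left_mono) auto
    finally show ?thesis by (simp add: P0)
  qed
  have lim0: "(\<lambda>N. P N (pi * x)) \<longlonglongrightarrow> 0"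
  proof (rule Lim_null_comparison)
    show "eventually (\<lambda>N. norm (P N (pi * x)) \<le> (3 / (sin \<epsilon>)\<^sup>2 / real N + \<bar>L N - pi / 4\<bar>) * 4) sequentially"
      using eventually_gt_at_top[of 0] by eventually_elim (use bound in auto)
    have "(\<lambda>N. (3 / (sin \<epsilon>)\<^sup>2 / real N + \<bar>L N - pi / 4\<bar>) * 4) \<longlonglongrightarrow> (0 + \<bar>pi/4 - pi / 4\<bar>) * 4"
      by (intro tendsto_intros Llim lim_const_over_n)
    then show "(\<lambda>N. (3 / (sin \<epsilon>)\<^sup>2 / real N + \<bar>L N - pi / 4\<bar>) * 4) \<longlonglongrightarrow> 0" by simp
  qed
  have "(\<lambda>N. P N (pi * x)) \<longlonglongrightarrow> triw x + (pi / 4) * (pi * x - pi / 2)"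
    unfolding P_def using triw_sums[of x] unfolding sums_def by (intro tendsto_intros)
  from LIMSEQ_unique[OF this lim0] show ?thesis by (simp add: algebra_simps power2_eq_square)
qed

lemma triw_unit:
  assumes "0 \<le> x" "x \<le> 1"
  shows "triw x = pi\<^sup>2 / 8 * (1 - 2 * x)"
proof -
  have "triw x - pi\<^sup>2 / 8 * (1 - 2 * x) = 0"
  proof (rule continuous_constant_on_closure[of "{0<..<1}" "\<lambda>x. triw x - pi\<^sup>2 / 8 * (1 - 2 * x)"])
    show "continuous_on (closure {0<..<1}) (\<lambda>x. triw x - pi\<^sup>2 / 8 * (1 - 2 * x))"
      by (intro continuous_intros continuous_triw)
  qed (use assms triw_interior in auto)
  then show ?thesis by simp
qed

lemma triw_shift_one: "triw (x + 1) = - triw x"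
proof -
  have "cos ((2 * real n + 1) * (pi * (x + 1))) = - cos ((2 * real n + 1) * (pi * x))" for n
  proof -
    have "(2 * real n + 1) * (pi * (x + 1)) = ((2 * real n + 1) * (pi * x) + pi) + 2 * real n * pi"
      by (simp add: algebra_simps)
    then have "cos ((2 * real n + 1) * (pi * (x + 1))) = cos (((2 * real n + 1) * (pi * x) + pi) + 2 * real n * pi)"
      by (rule arg_cong)
    also have "\<dots> = cos ((2 * real n + 1) * (pi * x) + pi)"
      by (subst cos_add) (simp only: cos_2npi sin_2npi mult_1_right mult_zero_right diff_zero)
    finally show ?thesis by simp
  qed
  then show ?thesis unfolding triw_def by (simp add: suminf_minus[OF sums_summable[OF triw_sums]])
qed


lemma triw_shift_int: "triw (x + of_int k) = (if even k then 1 else - 1) * triw x"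
proof (induction k rule: int_induct[of _ 0])
  case (step1 i)
  have "triw (x + of_int (i + 1)) = triw ((x + of_int i) + 1)" by (simp add: algebra_simps)
  also have "\<dots> = - triw (x + of_int i)" by (rule triw_shift_one)
  finally show ?case using step1 by simp
next
  case (step2 i)
  have "triw (x + of_int i) = triw ((x + of_int (i - 1)) + 1)" by (simp add: algebra_simps)
  also have "\<dots> = - triw (x + of_int (i - 1))" by (rule triw_shift_one)
  finally have "triw (x + of_int (i - 1)) = - triw (x + of_int i)" by simp
  then show ?case unfolding step2 by simp
qed simp

text \<open>Between consecutive integers the triangle wave is affine. The bound on \<open>h\<close>
  keeps \<open>x + h\<close> in the closed cell of \<open>x\<close>, whose slope is recorded by
  \<open>sqw x\<close>.\<close>

lemma triw_increment:
  assumes "0 \<le> h" "h \<le> 1 - frac x"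
  shows "triw (x + h) - triw x = - (pi\<^sup>2 / 4) * h * sqw x"
proof -
  have x: "x = frac x + of_int \<lfloor>x\<rfloor>" by (simp add: frac_def)
  have 1: "triw x = (if even \<lfloor>x\<rfloor> then 1 else - 1) * triw (frac x)"
    by (subst x, subst triw_shift_int) simp
  have "x + h = (frac x + h) + of_int \<lfloor>x\<rfloor>" using x by simp
  then have 2: "triw (x + h) = (if even \<lfloor>x\<rfloor> then 1 else - 1) * triw (frac x + h)"
    by (simp only: triw_shift_int)
  have "triw (frac x) = pi\<^sup>2 / 8 * (1 - 2 * frac x)"
    using frac_ge_0[of x] frac_lt_1[of x] by (intro triw_unit) auto
  moreover have "triw (frac x + h) = pi\<^sup>2 / 8 * (1 - 2 * (frac x + h))"
    using frac_ge_0[of x] frac_lt_1[of x] assms by (intro triw_unit) auto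
  ultimately show ?thesis unfolding 1 2 sqw_def by (auto simp: algebra_simps)
qed

lemma sqw_right_derivative:
  "(\<lambda>m. - (4 / pi\<^sup>2) * ((triw (x + 1 / real (Suc m)) - triw x) * real (Suc m))) \<longlonglongrightarrow> sqw x"
proof (rule tendsto_eventually)
  have "eventually (\<lambda>m. 1 / real (Suc m) < 1 - frac x) sequentially"
    using order_tendstoD(2)[OF LIMSEQ_inverse_real_of_nat, of "1 - frac x"] frac_lt_1[of x]
    by (simp add: inverse_eq_divide)
  then show "\<forall>\<^sub>F m in sequentially. - (4 / pi\<^sup>2) * ((triw (x + 1 / real (Suc m)) - triw x) * real (Suc m)) = sqw x"
  proof eventually_elim
    case (elim m)
    have "triw (x + 1 / real (Suc m)) - triw x = - (pi\<^sup>2 / 4) * (1 / real (Suc m)) * sqw x"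
      using elim by (intro triw_increment) auto
    then have "- (4 / pi\<^sup>2) * ((triw (x + 1 / real (Suc m)) - triw x) * real (Suc m))
       = (4 / pi\<^sup>2) * (pi\<^sup>2 / 4) * (1 / real (Suc m) * real (Suc m)) * sqw x"
      by (simp only: minus_mult_minus mult_minus_left mult.assoc) (simp add: mult_ac)
    then show ?case by simp
  qed
qed

lemma sqw_measurable [measurable]: "sqw \<in> borel_measurable borel"
proof -
  have "sqw = (\<lambda>x. if even \<lfloor>x\<rfloor> then 1 else - 1)" by (auto simp: sqw_def)
  moreover have "(\<lambda>x::real. if even \<lfloor>x\<rfloor> then 1 else - 1::real) \<in> borel_measurable borel" by measurable
  ultimately show ?thesis by simp
qed

lemma triw_diff_le:
  assumes "0 \<le> h" "h \<le> 1"
  shows "\<bar>triw (x + h) - triw x\<bar> \<le> pi\<^sup>2 / 4 * h"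
proof (cases "h \<le> 1 - frac x")
  case True
  with assms show ?thesis by (subst triw_increment) (auto simp: sqw_def abs_mult)
next
  case False
  \<comment> \<open>The next integer: the slope changes sign there, and both pieces are
    affine.\<close>
  define x' where "x' = x + (1 - frac x)"
  have fr: "frac x' = 0" by (simp add: x'_def frac_def)
  have 1: "\<bar>triw x' - triw x\<bar> = pi\<^sup>2 / 4 * (1 - frac x)"
    unfolding x'_def using frac_lt_1[of x] by (subst triw_increment) (auto simp: sqw_def abs_mult)
  have h: "x + h = x' + (h - (1 - frac x))" by (simp add: x'_def)
  have 2: "\<bar>triw (x + h) - triw x'\<bar> = pi\<^sup>2 / 4 * (h - (1 - frac x))"
    unfolding h using False assms frac_ge_0[of x] frac_lt_1[of x] by (subst triw_increment) (auto simp: sqw_def abs_mult fr simp del: frac_eq_0_iff)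
  have "\<bar>triw (x + h) - triw x\<bar> \<le> pi\<^sup>2 / 4 * (1 - frac x) + pi\<^sup>2 / 4 * (h - (1 - frac x))"
    using 1 2 by linarith
  also have "\<dots> = pi\<^sup>2 / 4 * h" unfolding distrib_left[symmetric] by simp
  finally show ?thesis .
qed

lemma cis_measurable [measurable]: "cis \<in> borel_measurable borel"
  by (intro borel_measurable_continuous_onI continuous_on_cis continuous_on_id)

lemma cmod_cis_diff_le: "cmod (cis x - cis y) \<le> \<bar>x - y\<bar>"
proof -
  have "cis x - cis y = cis y * (cis (x - y) - 1)"
    by (simp add: right_diff_distrib cis_mult)
  then have "cmod (cis x - cis y) = cmod (cis (x - y) - 1)"
    by (simp add: norm_mult)
  also have "\<dots> \<le> \<bar>x - y\<bar>"
    using iexp_approx1[of "x - y" 0] by (simp add: cis_conv_exp)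
  finally show ?thesis .
qed

text \<open>
  The square wave is the right derivative of the triangle wave \<open>triw\<close>, up to a factor. The Fourier
  coefficients of \<open>triw\<close> decay quadratically, so its difference quotients are bounded by the sum
  below, uniformly in the step and in the offset \<open>Y\<close>.
\<close>

lemma sqw_integral_le:
  fixes e w :: "real \<Rightarrow> real"
  defines "\<mu> \<equiv> (\<lambda>n::nat. cmod (\<integral>t. e t *\<^sub>R cis ((2 * real n + 1) * (pi * w t)) \<partial>lborel) / (2 * real n + 1))"
  assumes e: "integrable lborel e" and w [measurable]: "w \<in> borel_measurable lborel"
    and sm: "summable \<mu>"
  shows "\<bar>\<integral>t. e t * sqw (Y + w t) \<partial>lborel\<bar> \<le> 4 / pi * suminf \<mu>"
proof -
  have em [measurable]: "e \<in> borel_measurable lborel" using e by auto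
  have mu0: "0 \<le> \<mu> n" for n unfolding \<mu>_def by auto
  have [measurable]: "triw \<in> borel_measurable borel"
    by (intro borel_measurable_continuous_onI continuous_triw)
  have int_cis: "integrable lborel (\<lambda>t. e t *\<^sub>R cis (c * (pi * w t)))" for c
    by (rule Bochner_Integration.integrable_bound[OF e]) auto
  have step: "\<bar>\<integral>t. e t * (triw (Y + h + w t) - triw (Y + w t)) \<partial>lborel\<bar> \<le> pi * h * suminf \<mu>" if h: "0 \<le> h" for h
  proof (rule LIMSEQ_le_const2)
    define S where "S = (\<lambda>N x. \<Sum>n<N. cos ((2 * real n + 1) * (pi * x)) / (2 * real n + 1)\<^sup>2)"
    define B where "B = (\<Sum>n. 1 / (2 * real n + 1)\<^sup>2)"
    have [measurable]: "S N \<in> borel_measurable borel" for N unfolding S_def by measurable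
    have SB: "\<bar>S N x\<bar> \<le> B" for N x
    proof -
      have "\<bar>S N x\<bar> \<le> (\<Sum>n<N. 1 / (2 * real n + 1)\<^sup>2)"
        unfolding S_def using triw_term_le by (intro sum_norm_le[where 'a=real, simplified]) auto
      also have "\<dots> \<le> B" unfolding B_def by (intro sum_le_suminf summable_inverse_odd_squares) auto
      finally show ?thesis .
    qed
    show "(\<lambda>N. \<bar>\<integral>t. e t * (S N (Y + h + w t) - S N (Y + w t)) \<partial>lborel\<bar>) \<longlonglongrightarrow> \<bar>\<integral>t. e t * (triw (Y + h + w t) - triw (Y + w t)) \<partial>lborel\<bar>"
    proof (intro tendsto_rabs integral_dominated_convergence[where w = "\<lambda>t. \<bar>e t\<bar> * (2 * B)"] AE_I2)
      show "integrable lborel (\<lambda>t. \<bar>e t\<bar> * (2 * B))" using e by auto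
      show "(\<lambda>N. e t * (S N (Y + h + w t) - S N (Y + w t))) \<longlonglongrightarrow> e t * (triw (Y + h + w t) - triw (Y + w t))" for t
        using triw_sums unfolding sums_def S_def by (intro tendsto_intros) auto
      show "norm (e t * (S N (Y + h + w t) - S N (Y + w t))) \<le> \<bar>e t\<bar> * (2 * B)" for N t
        unfolding real_norm_def abs_mult
        by (intro mult_left_mono order_trans[OF abs_triangle_ineq4] order_trans[OF add_mono[OF SB SB]]) auto
    qed measurable
    have "\<bar>\<integral>t. e t * (S N (Y + h + w t) - S N (Y + w t)) \<partial>lborel\<bar> \<le> pi * h * suminf \<mu>" for N
    proof -
      \<comment> \<open>Change of the n-th Fourier coefficient under a shift by \<open>h\<close>. Of
        its quadratic decay one power is traded for the factor \<open>h\<close>, which cancels when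
        the difference quotient is formed.\<close>
      define c where "c = (\<lambda>n::nat. (cis ((2 * real n + 1) * (pi * (Y + h))) - cis ((2 * real n + 1) * (pi * Y))) /\<^sub>R (2 * real n + 1)\<^sup>2)"
      have pt: "e t * (S N (Y + h + w t) - S N (Y + w t)) = (\<Sum>n<N. Re (c n * (e t *\<^sub>R cis ((2 * real n + 1) * (pi * w t)))))" for t
        unfolding S_def c_def sum_subtractf[symmetric] sum_distrib_left
        by (intro sum.cong) (auto simp: algebra_simps cos_add sin_add divide_inverse)
      have "(\<integral>t. e t * (S N (Y + h + w t) - S N (Y + w t)) \<partial>lborel)
         = (\<Sum>n<N. Re (c n * (\<integral>t. e t *\<^sub>R cis ((2 * real n + 1) * (pi * w t)) \<partial>lborel)))"
      proof -
        have ic: "integrable lborel (\<lambda>t. c n * (e t *\<^sub>R cis ((2 * real n + 1) * (pi * w t))))" for n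
          by (rule integrable_mult_right) (rule int_cis)
        have "(\<integral>t. (\<Sum>n<N. Re (c n * (e t *\<^sub>R cis ((2 * real n + 1) * (pi * w t))))) \<partial>lborel)
          = (\<Sum>n<N. \<integral>t. Re (c n * (e t *\<^sub>R cis ((2 * real n + 1) * (pi * w t)))) \<partial>lborel)"
          by (rule Bochner_Integration.integral_sum) (rule integrable_Re[OF ic])
        also have "\<dots> = (\<Sum>n<N. Re (c n * (\<integral>t. e t *\<^sub>R cis ((2 * real n + 1) * (pi * w t)) \<partial>lborel)))"
          unfolding integral_Re[OF ic] by (simp only: integral_mult_right_zero)
        finally show ?thesis unfolding pt .
      qed
      also have "\<bar>\<dots>\<bar> \<le> (\<Sum>n<N. pi * h * \<mu> n)"
      proof (intro sum_norm_le[where 'a=real, simplified])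
        fix n
        have "cmod (cis ((2 * real n + 1) * (pi * (Y + h))) - cis ((2 * real n + 1) * (pi * Y))) \<le> (2 * real n + 1) * (pi * h)"
          using cmod_cis_diff_le[of "(2 * real n + 1) * (pi * (Y + h))" "(2 * real n + 1) * (pi * Y)"] h
          by (simp add: algebra_simps)
        then have "cmod (c n) \<le> pi * h / (2 * real n + 1)"
          unfolding c_def by (simp add: divide_simps power2_eq_square mult.commute)
        then have "cmod (c n * (\<integral>t. e t *\<^sub>R cis ((2 * real n + 1) * (pi * w t)) \<partial>lborel)) \<le> pi * h * \<mu> n"
          unfolding norm_mult \<mu>_def by (metis (no_types, lifting) mult.commute mult_right_mono norm_ge_zero times_divide_eq_left times_divide_eq_right)
        then show "\<bar>Re (c n * (\<integral>t. e t *\<^sub>R cis ((2 * real n + 1) * (pi * w t)) \<partial>lborel))\<bar> \<le> pi * h * \<mu> n"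
          using abs_Re_le_cmod order_trans by blast
      qed
      also have "\<dots> \<le> pi * h * suminf \<mu>"
        unfolding sum_distrib_left[symmetric] using h mu0 sm by (intro mult_left_mono sum_le_suminf) auto
      finally show ?thesis .
    qed
    then show "\<exists>N0. \<forall>N\<ge>N0. \<bar>\<integral>t. e t * (S N (Y + h + w t) - S N (Y + w t)) \<partial>lborel\<bar> \<le> pi * h * suminf \<mu>" by blast
  qed
  show ?thesis
  proof (rule LIMSEQ_le_const2)
    \<comment> \<open>Difference quotients normalised to converge to \<open>sqw\<close>; by the
      Lipschitz bound \<open>triw_diff_le\<close> they are dominated by 1.\<close>
    define q where "q = (\<lambda>m x. - (4 / pi\<^sup>2) * ((triw (x + 1 / real (Suc m)) - triw x) * real (Suc m)))"
    have [measurable]: "q m \<in> borel_measurable borel" for m unfolding q_def by measurable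
    have q1: "\<bar>q m x\<bar> \<le> 1" for m x
    proof -
      have "\<bar>triw (x + 1 / real (Suc m)) - triw x\<bar> \<le> pi\<^sup>2 / 4 * (1 / real (Suc m))"
        using triw_diff_le[of "1 / real (Suc m)" x] by simp
      then have "\<bar>triw (x + 1 / real (Suc m)) - triw x\<bar> * real (Suc m) \<le> pi\<^sup>2 / 4"
        by (simp only: times_divide_eq_right mult_1_right pos_le_divide_eq of_nat_0_less_iff zero_less_Suc)
      then have "(4 / pi\<^sup>2) * (\<bar>triw (x + 1 / real (Suc m)) - triw x\<bar> * real (Suc m)) \<le> (4 / pi\<^sup>2) * (pi\<^sup>2 / 4)"
        by (intro mult_left_mono) auto
      moreover have "\<bar>q m x\<bar> = (4 / pi\<^sup>2) * (\<bar>triw (x + 1 / real (Suc m)) - triw x\<bar> * real (Suc m))"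
        unfolding q_def by (simp only: abs_mult abs_minus_cancel) simp
      ultimately show ?thesis by simp
    qed
    show "(\<lambda>m. \<bar>\<integral>t. e t * q m (Y + w t) \<partial>lborel\<bar>) \<longlonglongrightarrow> \<bar>\<integral>t. e t * sqw (Y + w t) \<partial>lborel\<bar>"
    proof (intro tendsto_rabs integral_dominated_convergence[where w = "\<lambda>t. \<bar>e t\<bar>"] AE_I2)
      show "integrable lborel (\<lambda>t. \<bar>e t\<bar>)" using e by auto
      show "(\<lambda>m. e t * q m (Y + w t)) \<longlonglongrightarrow> e t * sqw (Y + w t)" for t
        unfolding q_def by (intro tendsto_intros sqw_right_derivative)
      show "norm (e t * q m (Y + w t)) \<le> \<bar>e t\<bar>" for m t
        unfolding real_norm_def abs_mult using q1 by (intro mult_left_le) auto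
    qed measurable
    have "\<bar>\<integral>t. e t * q m (Y + w t) \<partial>lborel\<bar> \<le> 4 / pi * suminf \<mu>" for m
    proof -
      have "(\<integral>t. e t * q m (Y + w t) \<partial>lborel) = - (4 / pi\<^sup>2) * real (Suc m) * (\<integral>t. e t * (triw (Y + 1 / real (Suc m) + w t) - triw (Y + w t)) \<partial>lborel)"
      proof -
        have "Y + w t + 1 / real (Suc m) = Y + 1 / real (Suc m) + w t" for t by simp
        then have "e t * q m (Y + w t) = (- (4 / pi\<^sup>2) * real (Suc m)) * (e t * (triw (Y + 1 / real (Suc m) + w t) - triw (Y + w t)))" for t
          unfolding q_def by (simp only: mult_ac)
        then show ?thesis by (simp only: integral_mult_right_zero)
      qed
      then have "\<bar>\<integral>t. e t * q m (Y + w t) \<partial>lborel\<bar> = 4 / pi\<^sup>2 * real (Suc m) * \<bar>\<integral>t. e t * (triw (Y + 1 / real (Suc m) + w t) - triw (Y + w t)) \<partial>lborel\<bar>"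
        by (simp add: abs_mult)
      also have "\<dots> \<le> 4 / pi\<^sup>2 * real (Suc m) * (pi * (1 / real (Suc m)) * suminf \<mu>)"
        by (intro mult_left_mono step) auto
      also have "\<dots> = 4 / pi\<^sup>2 * pi * suminf \<mu> * (real (Suc m) * (1 / real (Suc m)))" by (simp only: mult_ac)
      also have "\<dots> = 4 / pi * suminf \<mu>" by (simp add: power2_eq_square)
      finally show ?thesis .
    qed
    then show "\<exists>m0. \<forall>m\<ge>m0. \<bar>\<integral>t. e t * q m (Y + w t) \<partial>lborel\<bar> \<le> 4 / pi * suminf \<mu>" by blast
  qed
qed

section \<open>Mollified sawtooth fields\<close>

lemma sqw_add_one: "sqw (x + 1) = - sqw x"
  by (simp add: sqw_def)

lemma sqw_add_even: "even k \<Longrightarrow> sqw (x + of_int k) = sqw x"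
  by (simp add: sqw_def)

lemma sqw_eqI: "of_int n < x \<Longrightarrow> x < of_int n + 1 \<Longrightarrow> sqw x = (if even n then 1 else - 1)"
  using floor_unique[of n x] by (simp add: sqw_def)

lemma abs_sqw: "\<bar>sqw x\<bar> = 1"
  by (simp add: sqw_def)

text \<open>The slope alternates on cells of length \<open>b\<close>, and antiperiodicity reverses
  it on the second half of the period \<open>2 * A\<close>: a fast square wave times a slow one.
  Since \<open>A / b\<close> is a multiple of 4, the shift by \<open>A\<close> moves by an even
  number of fast cells and flips the slow factor only. The excluded multiples of \<open>b\<close>
  contain the jumps of both factors.\<close>

lemma sawtooth_has_derivative:
  assumes saw: "sawtooth A b \<phi>" and b: "0 < b" and A: "A = 4 * real n * b" and n: "0 < n"
    and x: "x / b \<notin> \<int>"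
  shows "(\<phi> has_real_derivative sqw (x / b) * sqw (x / A)) (at x)"
proof -
  have Apos: "0 < A" using assms by simp
  have Ab: "A / b = of_int (4 * int n)" using A b by simp
  have per: "\<phi> (x + 2 * A) = \<phi> x" for x using saw by (simp add: sawtooth_def)
  have base: "(\<phi> has_real_derivative sqw (x / b) * sqw (x / A)) (at x)"
    if x: "x / b \<notin> \<int>" "0 < x" "x < A" for x
  proof -
    define k where "k = nat \<lfloor>x / b\<rfloor>"
    define i where "i = k div 2"
    have "0 \<le> \<lfloor>x / b\<rfloor>" using x b by simp
    then have k: "\<lfloor>x / b\<rfloor> = int k" by (simp add: k_def)
    have k1: "real k < x / b" using x k floor_correct[of "x / b"]
      by (metis Ints_of_int of_int_of_nat_eq order_le_less)
    have k2: "x / b < real k + 1" using floor_correct[of "x / b"] k by linarith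
    have "x / b < A / b" using x b by (simp add: divide_strict_right_mono)
    then have "real k < 4 * real n" using k1 Ab by simp
    then have "k < 4 * n" by linarith
    then have i: "2 * i + 2 \<le> 4 * n" unfolding i_def by presburger
    have "2 * (real i + 1) * b \<le> A" unfolding A using i b by (intro mult_right_mono) auto
    then have sub: "{2 * real i * b <.. 2 * (real i + 1) * b} \<subseteq> {0<..A}"
    proof -
      have "0 \<le> 2 * real i * b" using b by simp
      then show ?thesis
        using \<open>2 * (real i + 1) * b \<le> A\<close> by (intro subsetI) (unfold greaterThanAtMost_iff, linarith)
    qed
    have sA: "sqw (x / A) = 1" using sqw_eqI[of 0 "x / A"] x Apos by simp
    show ?thesis
    proof (cases "even k")
      case True
      then have "k = 2 * i" by (simp add: i_def)
      then have "x \<in> {2 * real i * b <..< (2 * real i + 1) * b}" using k1 k2 b by (simp add: field_simps)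
      then have "(\<phi> has_real_derivative 1) (at x)" using saw sub unfolding sawtooth_def by blast
      moreover have "sqw (x / b) = 1" unfolding sqw_def k using True by simp
      ultimately show ?thesis using sA by simp
    next
      case False
      then have "k = 2 * i + 1" by (simp add: i_def)
      then have "x \<in> {(2 * real i + 1) * b <..< 2 * (real i + 1) * b}" using k1 k2 b by (simp add: field_simps)
      then have "(\<phi> has_real_derivative -1) (at x)" using saw sub unfolding sawtooth_def by blast
      moreover have "sqw (x / b) = - 1" unfolding sqw_def k using False by simp
      ultimately show ?thesis using sA by simp
    qed
  qed
  have upper: "(\<phi> has_real_derivative sqw (x / b) * sqw (x / A)) (at x)"
    if x: "x / b \<notin> \<int>" "A < x" "x < 2 * A" for x
  proof -
    have e: "x / b = (x - A) / b + of_int (4 * int n)" using Ab by (simp add: diff_divide_distrib)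
    then have "(x - A) / b \<notin> \<int>" using x(1) by (metis Ints_add Ints_of_int)
    then have "(\<phi> has_real_derivative sqw ((x - A) / b) * sqw ((x - A) / A)) (at (x - A))"
      using x by (intro base) auto
    then have "((\<lambda>y. \<phi> (y - A)) has_real_derivative sqw ((x - A) / b) * sqw ((x - A) / A)) (at x)"
      using DERIV_shift[of \<phi> _ x "- A"] by simp
    then have "((\<lambda>y. - \<phi> (y - A)) has_real_derivative - (sqw ((x - A) / b) * sqw ((x - A) / A))) (at x)"
      by (rule DERIV_minus)
    moreover have "sqw ((x - A) / b) = sqw (x / b)" unfolding e by (rule sqw_add_even[symmetric]) simp
    moreover have "sqw ((x - A) / A) = - sqw (x / A)"
      using sqw_add_one[of "(x - A) / A"] Apos by (simp add: diff_divide_distrib)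
    ultimately have "((\<lambda>y. - \<phi> (y - A)) has_real_derivative sqw (x / b) * sqw (x / A)) (at x)" by simp
    then show ?thesis
    proof (rule has_field_derivative_transform_within_open[of _ _ _ "{A<..<2*A}"])
      show "- \<phi> (y - A) = \<phi> y" if "y \<in> {A<..<2*A}" for y
        using saw that unfolding sawtooth_def by auto
    qed (use x in auto)
  qed
  define j where "j = \<lfloor>x / (2 * A)\<rfloor>"
  define x0 where "x0 = x - of_int j * (2 * A)"
  have perj: "\<phi> (y + of_int j * (2 * A)) = \<phi> y" for y and j :: int
  proof (induction j rule: int_induct[of _ 0])
    case (step1 i)
    then show ?case using per[of "y + of_int i * (2 * A)"] by (simp add: algebra_simps)
  next
    case (step2 i)
    then show ?case using per[of "y + of_int (i - 1) * (2 * A)"] by (simp add: algebra_simps)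
  qed simp
  have x0: "0 \<le> x0" "x0 < 2 * A"
    unfolding x0_def j_def using floor_divide_lower[of "2 * A" x] floor_divide_upper[of "2 * A" x] Apos
    by (simp_all add: distrib_right)
  have eb: "x / b = x0 / b + of_int (8 * int n * j)"
    unfolding x0_def A using b by (simp add: field_simps)
  have eA: "x / A = x0 / A + of_int (2 * j)"
    unfolding x0_def using Apos by (simp add: field_simps)
  have nx0: "x0 / b \<notin> \<int>" using x unfolding eb by (metis Ints_add Ints_of_int)
  have "x0 \<noteq> 0" using nx0 by auto
  moreover have "x0 \<noteq> A" using nx0 Ab by (metis Ints_of_int)
  ultimately have "(\<phi> has_real_derivative sqw (x0 / b) * sqw (x0 / A)) (at x0)"
    using base[of x0] upper[of x0] nx0 x0 by (cases "x0 < A") auto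
  then have "((\<lambda>y. \<phi> (y - of_int j * (2 * A))) has_real_derivative sqw (x0 / b) * sqw (x0 / A)) (at x)"
    using DERIV_shift[of \<phi> _ x "- of_int j * (2 * A)"] by (simp add: x0_def)
  moreover have "(\<lambda>y. \<phi> (y - of_int j * (2 * A))) = \<phi>"
    using perj[of _ "- j"] by simp
  moreover have "sqw (x / b) = sqw (x0 / b)" unfolding eb by (rule sqw_add_even) simp
  moreover have "sqw (x / A) = sqw (x0 / A)" unfolding eA by (rule sqw_add_even) simp
  ultimately show ?thesis by simp
qed

text \<open>Convolution with the mollifier of width \<open>l\<close> after the substitution y = z -
  l * x: an average of shifted values of \<open>f\<close> against one fixed probability density. The
  form with a moving kernel is \<open>avg_eq_convolution\<close>.\<close>

definition avg :: "(real \<Rightarrow> real) \<Rightarrow> real \<Rightarrow> (real \<Rightarrow> real) \<Rightarrow> real \<Rightarrow> real" where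
  "avg \<rho> l f z = (\<integral>x. \<rho> x * f (z - l * x) \<partial>lborel)"

lemma standard_mollifierD:
  assumes "standard_mollifier \<rho>"
  shows "continuous_on UNIV \<rho>" "0 \<le> \<rho> x" "\<bar>x\<bar> > 1 \<Longrightarrow> \<rho> x = 0" "integrable lborel \<rho>" "(\<integral>x. \<rho> x \<partial>lborel) = 1"
    "\<exists>P\<ge>0. \<forall>x y. \<bar>\<rho> x - \<rho> y\<bar> \<le> P * \<bar>x - y\<bar>"
proof -
  have sm: "smooth \<rho>" and rng: "range \<rho> \<subseteq> {0..1}" and supp: "\<And>x. \<rho> x \<noteq> 0 \<Longrightarrow> \<bar>x\<bar> \<le> 1"
    and int: "(\<rho> has_integral 1) UNIV"
    using assms by (auto simp: standard_mollifier_def)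
  show cont: "continuous_on UNIV \<rho>"
    using sm[unfolded smooth_def, rule_format, of 0]
    by (auto intro!: continuous_at_imp_continuous_on differentiable_imp_continuous_within)
  show nn: "0 \<le> \<rho> x" for x using rng by (auto simp: image_subset_iff)
  have le1: "\<rho> x \<le> 1" for x using rng by (auto simp: image_subset_iff)
  show out: "\<bar>x\<bar> > 1 \<Longrightarrow> \<rho> x = 0" for x using supp[of x] by fastforce
  have [measurable]: "\<rho> \<in> borel_measurable borel" using cont by (rule borel_measurable_continuous_onI)
  show igr: "integrable lborel \<rho>"
  proof (rule Bochner_Integration.integrable_bound[of _ "indicator {-1..1} :: real \<Rightarrow> real"])
    show "AE x in lborel. norm (\<rho> x) \<le> norm (indicator {-1..1} x :: real)"
      using nn le1 out by (intro AE_I2) (auto simp: indicator_def abs_le_iff not_le)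
  qed auto
  show "(\<integral>x. \<rho> x \<partial>lborel) = 1"
    using has_integral_unique[OF has_integral_integral_lborel[OF igr] int] by simp
  have der: "(\<rho> has_real_derivative deriv \<rho> x) (at x)" for x
    using sm[unfolded smooth_def, rule_format, of 0 x]
    by (simp add: DERIV_deriv_iff_real_differentiable)
  have "continuous_on UNIV (deriv \<rho>)"
    using sm[unfolded smooth_def, rule_format, of 1]
    by (auto intro!: continuous_at_imp_continuous_on differentiable_imp_continuous_within)
  then have "compact (deriv \<rho> ` {-2..2})"
    by (intro compact_continuous_image) (auto intro: continuous_on_subset)
  then obtain P where P: "\<And>x. x \<in> {-2..2} \<Longrightarrow> \<bar>deriv \<rho> x\<bar> \<le> P"
    using compact_imp_bounded bounded_iff by (metis (no_types, lifting) imageI real_norm_def)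
  have P0: "0 \<le> P" using P[of 0] by auto
  have bd: "\<bar>deriv \<rho> x\<bar> \<le> P" for x
  proof (cases "x \<in> {-2..2}")
    case False
    have "((\<lambda>_. 0) has_real_derivative 0) (at x)" by auto
    then have "(\<rho> has_real_derivative 0) (at x)"
      by (rule has_field_derivative_transform_within_open[of _ _ _ "- {-1..1}"]) (use False out in auto)
    then have "deriv \<rho> x = 0" by (rule DERIV_imp_deriv)
    then show ?thesis using P0 by simp
  qed (rule P)
  have "\<bar>\<rho> x - \<rho> y\<bar> \<le> P * \<bar>x - y\<bar>" for x y
    using field_differentiable_bound[of UNIV \<rho> "deriv \<rho>" P x y] der bd by auto
  then show "\<exists>P\<ge>0. \<forall>x y. \<bar>\<rho> x - \<rho> y\<bar> \<le> P * \<bar>x - y\<bar>" using P0 by blast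
qed

lemma avg_integrable:
  assumes "standard_mollifier \<rho>" and f [measurable]: "f \<in> borel_measurable borel" and bd: "\<And>y. \<bar>f y\<bar> \<le> 1"
  shows "integrable lborel (\<lambda>x. \<rho> x * f (z - l * x))"
proof (rule Bochner_Integration.integrable_bound[OF standard_mollifierD(4)[OF assms(1)]])
  have [measurable]: "\<rho> \<in> borel_measurable borel"
    using standard_mollifierD(1)[OF assms(1)] by (rule borel_measurable_continuous_onI)
  show "(\<lambda>x. \<rho> x * f (z - l * x)) \<in> borel_measurable lborel" by measurable
  show "AE x in lborel. norm (\<rho> x * f (z - l * x)) \<le> norm (\<rho> x)"
    using bd by (intro AE_I2) (simp add: abs_mult mult_left_le)
qed

lemma abs_avg_le:
  assumes "standard_mollifier \<rho>" and "f \<in> borel_measurable borel" and bd: "\<And>y. \<bar>f y\<bar> \<le> 1"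
  shows "\<bar>avg \<rho> l f z\<bar> \<le> 1"
proof -
  have "\<bar>avg \<rho> l f z\<bar> \<le> (\<integral>x. \<rho> x \<partial>lborel)"
    unfolding avg_def
    by (rule order_trans[OF integral_abs_bound], rule integral_mono)
      (use avg_integrable[OF assms, of z l, THEN integrable_abs] standard_mollifierD[OF assms(1)] bd in \<open>auto simp: abs_mult mult_left_le\<close>)
  then show ?thesis using standard_mollifierD[OF assms(1)] by simp
qed

lemma avg_const:
  assumes "standard_mollifier \<rho>" and "0 \<le> l" and c: "\<And>y. \<bar>y - z\<bar> \<le> l \<Longrightarrow> f y = c"
  shows "avg \<rho> l f z = c"
proof -
  have "\<rho> x * f (z - l * x) = \<rho> x * c" for x
  proof (cases "\<bar>x\<bar> \<le> 1")
    case True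
    then have "l * \<bar>x\<bar> \<le> l" using assms(2) by (simp add: mult_left_le)
    then show ?thesis using c[of "z - l * x"] assms(2) by (simp add: abs_mult)
  qed (use standard_mollifierD(3)[OF assms(1)] in auto)
  then have "avg \<rho> l f z = (\<integral>x. \<rho> x * c \<partial>lborel)" unfolding avg_def by presburger
  then show ?thesis using standard_mollifierD(5)[OF assms(1)] by simp
qed

lemma avg_eq_convolution:
  assumes "0 < l"
  shows "avg \<rho> l f z = (\<integral>y. \<rho> ((z - y) / l) / l * f y \<partial>lborel)"
proof -
  have "(\<integral>y. \<rho> ((z - y) / l) / l * f y \<partial>lborel) = \<bar>-l\<bar> *\<^sub>R (\<integral>x. \<rho> ((z - (z + (-l) * x)) / l) / l * f (z + (-l) * x) \<partial>lborel)"
    using assms by (intro lborel_integral_real_affine) auto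
  also have "\<dots> = l * (\<integral>x. (\<rho> x * f (z - l * x)) * (1 / l) \<partial>lborel)"
    using assms by (auto intro!: Bochner_Integration.integral_cong)
  also have "\<dots> = avg \<rho> l f z" unfolding avg_def using assms by simp
  finally show ?thesis ..
qed

lemma convolution_integrable:
  assumes \<rho>: "standard_mollifier \<rho>" and f: "f \<in> borel_measurable borel"
    and bd: "\<And>y. \<bar>f y\<bar> \<le> 1" and l: "0 < l"
  shows "integrable lborel (\<lambda>y. \<rho> ((z - y) / l) / l * f y)"
proof -
  have "integrable lborel (\<lambda>x. \<rho> x * f (z - l * x))" by (rule avg_integrable[OF \<rho> f bd])
  then have "integrable lborel (\<lambda>y. \<rho> (z / l + (- 1 / l) * y) * f (z - l * (z / l + (- 1 / l) * y)))"
    using l by (subst lborel_integrable_real_affine_iff[of "- 1 / l"]) auto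
  then have "integrable lborel (\<lambda>y. (1 / l) * (\<rho> (z / l + (- 1 / l) * y) * f (z - l * (z / l + (- 1 / l) * y))))"
    by (rule integrable_mult_right)
  then show ?thesis using l by (simp add: field_simps)
qed

text \<open>Since \<open>f\<close> is merely bounded, the increment in \<open>z\<close> has to be
  carried by the kernel, which is Lipschitz. The two kernels live on intervals of total length 4 *
  l, hence the constant 4 * P / l.\<close>

lemma avg_lipschitz:
  assumes \<rho>: "standard_mollifier \<rho>" and f [measurable]: "f \<in> borel_measurable borel"
    and bd: "\<And>y. \<bar>f y\<bar> \<le> 1" and l: "0 < l"
  shows "\<exists>L\<ge>0. \<forall>z z'. \<bar>avg \<rho> l f z - avg \<rho> l f z'\<bar> \<le> L * \<bar>z - z'\<bar>"
proof -
  obtain P where P: "0 \<le> P" "\<And>x y. \<bar>\<rho> x - \<rho> y\<bar> \<le> P * \<bar>x - y\<bar>"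
    using standard_mollifierD(6)[OF \<rho>] by auto
  have [measurable]: "\<rho> \<in> borel_measurable borel"
    using standard_mollifierD(1)[OF \<rho>] by (rule borel_measurable_continuous_onI)
  note igr = convolution_integrable[OF \<rho> f bd l]
  have "\<bar>avg \<rho> l f z - avg \<rho> l f z'\<bar> \<le> 4 * P / l * \<bar>z - z'\<bar>" for z z'
  proof -
    define I where "I = (\<lambda>y. indicator {z - l..z + l} y + indicator {z' - l..z' + l} y :: real)"
    have iI: "integrable lborel I" "(\<integral>y. I y \<partial>lborel) = 4 * l" unfolding I_def using l
      by (auto simp: Bochner_Integration.integral_add)
    have pt: "\<bar>\<rho> ((z - y) / l) / l * f y - \<rho> ((z' - y) / l) / l * f y\<bar> \<le> P * \<bar>z - z'\<bar> / l / l * I y" for y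
    proof -
      have "\<bar>\<rho> ((z - y) / l) - \<rho> ((z' - y) / l)\<bar> \<le> P * \<bar>z - z'\<bar> / l * I y"
      proof (cases "I y \<ge> 1")
        case True
        have "\<bar>\<rho> ((z - y) / l) - \<rho> ((z' - y) / l)\<bar> \<le> P * \<bar>(z - y) / l - (z' - y) / l\<bar>" by (rule P)
        also have "\<dots> = P * \<bar>z - z'\<bar> / l" using l by (simp add: abs_divide diff_divide_distrib[symmetric])
        also have "\<dots> \<le> P * \<bar>z - z'\<bar> / l * I y" using mult_left_mono[OF True, of "P * \<bar>z - z'\<bar> / l"] P(1) l by simp
        finally show ?thesis .
      next
        case False
        then have "y \<notin> {z - l..z + l}" "y \<notin> {z' - l..z' + l}" by (auto simp: I_def indicator_def)
        then have "\<bar>(z - y) / l\<bar> > 1" "\<bar>(z' - y) / l\<bar> > 1" using l by (auto simp: abs_if field_simps)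
        then have "\<rho> ((z - y) / l) = 0" "\<rho> ((z' - y) / l) = 0" using standard_mollifierD(3)[OF \<rho>] by auto
        then show ?thesis using P(1) l by (simp add: I_def)
      qed
      then have "\<bar>(\<rho> ((z - y) / l) - \<rho> ((z' - y) / l)) / l\<bar> * \<bar>f y\<bar> \<le> P * \<bar>z - z'\<bar> / l / l * I y * 1"
        using bd l by (intro mult_mono) (auto simp: abs_divide divide_right_mono mult_left_mono P(1) I_def field_simps)
      then show ?thesis by (simp add: abs_mult[symmetric] algebra_simps diff_divide_distrib)
    qed
    have "\<bar>avg \<rho> l f z - avg \<rho> l f z'\<bar> = \<bar>\<integral>y. (\<rho> ((z - y) / l) / l * f y - \<rho> ((z' - y) / l) / l * f y) \<partial>lborel\<bar>"
      unfolding avg_eq_convolution[OF l] using igr by (subst Bochner_Integration.integral_diff) auto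
    also have "\<dots> \<le> (\<integral>y. P * \<bar>z - z'\<bar> / l / l * I y \<partial>lborel)"
      by (rule order_trans[OF integral_abs_bound], rule integral_mono)
        (use igr iI pt in auto)
    also have "\<dots> = P * \<bar>z - z'\<bar> / l / l * (4 * l)" using iI by simp
    also have "\<dots> = 4 * P / l * \<bar>z - z'\<bar>" using l by (simp add: field_simps)
    finally show ?thesis .
  qed
  then show ?thesis using P(1) l by (intro exI[of _ "4 * P / l"]) auto
qed

lemma mollify_v:
  assumes saw: "sawtooth (a q) (a (Suc q)) (\<phi> (Suc q))" and b: "0 < a (Suc q)"
    and A: "a q = 4 * real n * a (Suc q)" and n: "0 < n"
    and \<rho>: "standard_mollifier \<rho>" and l: "0 < l"
  defines "g \<equiv> avg \<rho> l (\<lambda>y. sqw (y / a (Suc q)) * sqw (y / a q))"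
  shows "mollify \<rho> l (v1 a \<phi> q) z = (a q / 2 * g z, 0)"
    "mollify \<rho> l (v2 a \<phi> q) z = (0, a (Suc q) / 2 * (g z + 1))"
proof -
  define s where "s = (\<lambda>y. sqw (y / a (Suc q)) * sqw (y / a q))"
  have [measurable]: "s \<in> borel_measurable borel" unfolding s_def by measurable
  have s1: "\<bar>s y\<bar> \<le> 1" for y by (simp add: s_def abs_mult abs_sqw)
  \<comment> \<open>The possible kinks of the sawtooth, where \<open>deriv\<close> carries no
    information. They are countable, so the integrals do not see them.\<close>
  define X where "X = range (\<lambda>k::int. of_int k * a (Suc q))"
  have X: "countable X" unfolding X_def by (rule countable_image) simp
  have ds: "deriv (\<phi> (Suc q)) y = s y" if "y \<notin> X" for y
  proof -
    have "y / a (Suc q) \<notin> \<int>"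
    proof
      assume "y / a (Suc q) \<in> \<int>"
      then obtain k where "y / a (Suc q) = of_int k" by (auto elim: Ints_cases)
      then have "y = of_int k * a (Suc q)" using b by (simp add: field_simps)
      then show False using that by (auto simp: X_def)
    qed
    from sawtooth_has_derivative[OF saw b A n this] show ?thesis
      unfolding s_def by (rule DERIV_imp_deriv)
  qed
  have [measurable]: "\<rho> \<in> borel_measurable borel"
    using standard_mollifierD(1)[OF \<rho>] by (rule borel_measurable_continuous_onI)
  note igr = convolution_integrable[OF \<rho> _ _ l]
  have g: "g z = (\<integral>y. \<rho> ((z - y) / l) / l * s y \<partial>lborel)"
    unfolding g_def s_def avg_eq_convolution[OF l] ..
  have one: "(\<integral>y. \<rho> ((z - y) / l) / l * 1 \<partial>lborel) = 1"
    using avg_eq_convolution[OF l, of \<rho> "\<lambda>_. 1" z] avg_const[OF \<rho>, of l z "\<lambda>_. 1" 1] l by simp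
  have "mollify \<rho> l (v1 a \<phi> q) z = (\<integral>y. (a q / 2) *\<^sub>R (\<rho> ((z - y) / l) / l * s y, 0::real) \<partial>lborel)"
    unfolding mollify_def
    by (rule integral_discrete_difference[OF X]) (auto simp: ds v1_def field_simps)
  also have "\<dots> = (a q / 2) *\<^sub>R (\<integral>y. \<rho> ((z - y) / l) / l * s y \<partial>lborel, 0)"
    by (rule integral_bounded_linear[of "\<lambda>t. (a q / 2) *\<^sub>R (t, 0)"])
      (intro bounded_linear_intros, intro igr s1, measurable)
  finally show "mollify \<rho> l (v1 a \<phi> q) z = (a q / 2 * g z, 0)" by (simp add: g)
  have "mollify \<rho> l (v2 a \<phi> q) z = (\<integral>y. (a (Suc q) / 2) *\<^sub>R (0::real, \<rho> ((z - y) / l) / l * s y + \<rho> ((z - y) / l) / l * 1) \<partial>lborel)"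
    unfolding mollify_def
    by (rule integral_discrete_difference[OF X]) (auto simp: ds v2_def algebra_simps)
  also have "\<dots> = (a (Suc q) / 2) *\<^sub>R (0, \<integral>y. \<rho> ((z - y) / l) / l * s y + \<rho> ((z - y) / l) / l * 1 \<partial>lborel)"
    by (rule integral_bounded_linear[of "\<lambda>t. (a (Suc q) / 2) *\<^sub>R (0, t)"])
      (intro bounded_linear_intros, intro Bochner_Integration.integrable_add igr s1, auto)
  also have "\<dots> = (a (Suc q) / 2) *\<^sub>R (0, g z + 1)"
    using igr[of s] igr[of "\<lambda>_. 1"] s1 one g by (subst Bochner_Integration.integral_add) auto
  finally show "mollify \<rho> l (v2 a \<phi> q) z = (0, a (Suc q) / 2 * (g z + 1))" by simp
qed

section \<open>Gaussian processes and their integrals\<close>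

lemma gaussian_rv_integrable:
  assumes "prob_space M" "gaussian_rv M X"
  shows "integrable M X" "integrable M (\<lambda>\<omega>. (X \<omega>)\<^sup>2)"
proof -
  interpret prob_space M by fact
  have [measurable]: "X \<in> borel_measurable M" using assms by (simp add: gaussian_rv_def)
  consider \<mu> where "AE \<omega> in M. X \<omega> = \<mu>" | \<mu> \<sigma> where "0 < \<sigma>" "distributed M lborel X (normal_density \<mu> \<sigma>)"
    using assms by (auto simp: gaussian_rv_def)
  then have "integrable M X \<and> integrable M (\<lambda>\<omega>. (X \<omega>)\<^sup>2)"
  proof cases
    case 1
    have "integrable M (\<lambda>\<omega>. X \<omega>)" by (rule integrable_cong_AE_imp[of _ "\<lambda>_. \<mu>"]) (use 1 in auto)
    moreover have "integrable M (\<lambda>\<omega>. (X \<omega>)\<^sup>2)" by (rule integrable_cong_AE_imp[of _ "\<lambda>_. \<mu>\<^sup>2"]) (use 1 in auto)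
    ultimately show ?thesis by simp
  next
    case 2
    have "integrable lborel (\<lambda>x. normal_density \<mu> \<sigma> x * x)"
      using integrable_normal_moment_nz_1[OF 2(1)] .
    then have i1: "integrable M X"
      using distributed_integrable[OF 2(2), of "\<lambda>x. x"] by simp
    have "integrable lborel (\<lambda>x. normal_density \<mu> \<sigma> x * (x - \<mu>)^2)"
      by (rule integrable_normal_moment[OF 2(1)])
    then have "integrable M (\<lambda>\<omega>. (X \<omega> - \<mu>)^2)"
      using distributed_integrable[OF 2(2), of "\<lambda>x. (x - \<mu>)^2"] by simp
    moreover have "(X \<omega>)\<^sup>2 = (X \<omega> - \<mu>)^2 + 2 * \<mu> * X \<omega> - \<mu>\<^sup>2" for \<omega>
      by (simp add: power2_eq_square algebra_simps)
    ultimately show ?thesis using i1 by simp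
  qed
  then show "integrable M X" "integrable M (\<lambda>\<omega>. (X \<omega>)\<^sup>2)" by auto
qed

lemma gaussian_rv_cis:
  assumes "prob_space M" "gaussian_rv M X" "(\<integral>\<omega>. X \<omega> \<partial>M) = 0"
  shows "(\<integral>\<omega>. cis (X \<omega>) \<partial>M) = complex_of_real (exp (- (\<integral>\<omega>. (X \<omega>)\<^sup>2 \<partial>M) / 2))"
proof -
  interpret prob_space M by fact
  have [measurable]: "X \<in> borel_measurable M" using assms by (simp add: gaussian_rv_def)
  consider \<mu> where "AE \<omega> in M. X \<omega> = \<mu>" | \<mu> \<sigma> where "0 < \<sigma>" "distributed M lborel X (normal_density \<mu> \<sigma>)"
    using assms by (auto simp: gaussian_rv_def)
  then show ?thesis
  proof cases
    case 1
    have "(\<integral>\<omega>. X \<omega> \<partial>M) = (\<integral>\<omega>. \<mu> \<partial>M)" by (rule integral_cong_AE) (use 1 in auto)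
    then have "\<mu> = 0" using assms(3) prob_space by simp
    have "(\<integral>\<omega>. cis (X \<omega>) \<partial>M) = (\<integral>\<omega>. 1 \<partial>M)" by (rule integral_cong_AE) (use 1 \<open>\<mu> = 0\<close> in auto)
    moreover have "(\<integral>\<omega>. (X \<omega>)\<^sup>2 \<partial>M) = (\<integral>\<omega>. 0 \<partial>M)" by (rule integral_cong_AE) (use 1 \<open>\<mu> = 0\<close> in auto)
    ultimately show ?thesis using prob_space by simp
  next
    case 2
    have mu: "\<mu> = 0" using normal_distributed_expectation[OF 2(1,2)] assms(3) by simp
    have var: "(\<integral>\<omega>. (X \<omega>)\<^sup>2 \<partial>M) = \<sigma>\<^sup>2"
      using normal_distributed_variance[OF 2(1,2)] assms(3) by simp
    have std: "distributed M lborel (\<lambda>\<omega>. X \<omega> / \<sigma>) std_normal_density"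
      using 2 normal_standard_normal_convert[OF 2(1), of X \<mu>] mu by simp
    have "(\<integral>\<omega>. cis (X \<omega>) \<partial>M) = (\<integral>\<omega>. iexp (\<sigma> * (X \<omega> / \<sigma>)) \<partial>M)"
      using 2(1) by (simp add: cis_conv_exp)
    also have "\<dots> = (\<integral>x. iexp (\<sigma> * x) \<partial>(distr M lborel (\<lambda>\<omega>. X \<omega> / \<sigma>)))"
      by (subst integral_distr) auto
    also have "\<dots> = char std_normal_distribution \<sigma>"
      unfolding distributed_distr_eq_density[OF std] char_def by simp
    finally show ?thesis unfolding var by (simp add: char_std_normal_distribution)
  qed
qed

text \<open>
  A centered Gaussian process with covariance \<open>k\<close>, expressed by characteristic functions because these
  pass to the limit of Riemann sums.
\<close>

definition gauss_cov :: "'w measure \<Rightarrow> (real \<Rightarrow> 'w \<Rightarrow> real) \<Rightarrow> (real \<times> real \<Rightarrow> real) \<Rightarrow> bool" where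
  "gauss_cov M B k \<longleftrightarrow> (\<forall>t\<in>{0..1}. B t \<in> borel_measurable M) \<and>
    (\<forall>J c. finite J \<and> J \<subseteq> {0..1} \<longrightarrow>
       (\<integral>\<omega>. cis (\<Sum>t\<in>J. c t * B t \<omega>) \<partial>M)
         = complex_of_real (exp (- (\<Sum>s\<in>J. \<Sum>t\<in>J. c s * c t * k (s, t)) / 2)))"

lemma gaussian_process_gauss_cov:
  assumes M: "prob_space M" and g: "gaussian_process M {0..1} B"
    and mean: "\<And>t. t \<in> {0..1} \<Longrightarrow> (\<integral>\<omega>. B t \<omega> \<partial>M) = 0"
  shows "gauss_cov M B (\<lambda>(s, t). \<integral>\<omega>. B s \<omega> * B t \<omega> \<partial>M)"
proof -
  interpret prob_space M by fact
  have gr: "gaussian_rv M (B t)" if "t \<in> {0..1}" for t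
    using g[unfolded gaussian_process_def, rule_format, of "{t}" "\<lambda>_. 1"] that by simp
  have meas: "B t \<in> borel_measurable M" if "t \<in> {0..1}" for t using gr[OF that] by (simp add: gaussian_rv_def)
  have prod: "integrable M (\<lambda>\<omega>. B s \<omega> * B t \<omega>)" if s: "s \<in> {0..1}" and t: "t \<in> {0..1}" for s t
  proof (rule Bochner_Integration.integrable_bound)
    show "integrable M (\<lambda>\<omega>. (B s \<omega>)\<^sup>2 + (B t \<omega>)\<^sup>2)"
      using gaussian_rv_integrable(2)[OF M gr] s t by auto
    have "\<bar>x * y\<bar> \<le> x\<^sup>2 + y\<^sup>2" for x y :: real
    proof -
      have "2 * (\<bar>x\<bar> * \<bar>y\<bar>) \<le> x\<^sup>2 + y\<^sup>2" using sum_squares_bound[of "\<bar>x\<bar>" "\<bar>y\<bar>"] by (simp add: mult.assoc)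
      moreover have "0 \<le> \<bar>x\<bar> * \<bar>y\<bar>" by simp
      ultimately show ?thesis unfolding abs_mult by linarith
    qed
    then show "AE \<omega> in M. norm (B s \<omega> * B t \<omega>) \<le> norm ((B s \<omega>)\<^sup>2 + (B t \<omega>)\<^sup>2)"
      by (intro AE_I2) (simp only: real_norm_def abs_of_nonneg[OF add_nonneg_nonneg[OF zero_le_power2 zero_le_power2]])
    show "(\<lambda>\<omega>. B s \<omega> * B t \<omega>) \<in> borel_measurable M" using meas s t by auto
  qed
  have "(\<integral>\<omega>. cis (\<Sum>t\<in>J. c t * B t \<omega>) \<partial>M)
         = complex_of_real (exp (- (\<Sum>s\<in>J. \<Sum>t\<in>J. c s * c t * (\<integral>\<omega>. B s \<omega> * B t \<omega> \<partial>M)) / 2))"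
    if J: "finite J" "J \<subseteq> {0..1}" for J c
  proof -
    have rv: "gaussian_rv M (\<lambda>\<omega>. \<Sum>t\<in>J. c t * B t \<omega>)" using g J by (simp add: gaussian_process_def)
    have z: "(\<integral>\<omega>. (\<Sum>t\<in>J. c t * B t \<omega>) \<partial>M) = 0"
    proof -
      have "(\<integral>\<omega>. (\<Sum>t\<in>J. c t * B t \<omega>) \<partial>M) = (\<Sum>t\<in>J. \<integral>\<omega>. c t * B t \<omega> \<partial>M)"
        using J gaussian_rv_integrable(1)[OF M gr] by (intro Bochner_Integration.integral_sum integrable_mult_right) auto
      then show ?thesis using J mean by (simp add: subset_eq)
    qed
    have ip: "integrable M (\<lambda>\<omega>. c s * c t * (B s \<omega> * B t \<omega>))" if "s \<in> J" "t \<in> J" for s t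
      using that J by (intro integrable_mult_right prod) auto
    have "(\<Sum>t\<in>J. c t * B t \<omega>)\<^sup>2 = (\<Sum>s\<in>J. \<Sum>t\<in>J. c s * c t * (B s \<omega> * B t \<omega>))" for \<omega>
      unfolding power2_eq_square sum_product by (intro sum.cong refl) (simp only: mult_ac)
    then have "(\<integral>\<omega>. (\<Sum>t\<in>J. c t * B t \<omega>)\<^sup>2 \<partial>M) = (\<integral>\<omega>. (\<Sum>s\<in>J. \<Sum>t\<in>J. c s * c t * (B s \<omega> * B t \<omega>)) \<partial>M)"
      by simp
    also have "\<dots> = (\<Sum>s\<in>J. \<integral>\<omega>. (\<Sum>t\<in>J. c s * c t * (B s \<omega> * B t \<omega>)) \<partial>M)"
      by (intro Bochner_Integration.integral_sum Bochner_Integration.integrable_sum ip)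
    also have "\<dots> = (\<Sum>s\<in>J. \<Sum>t\<in>J. \<integral>\<omega>. c s * c t * (B s \<omega> * B t \<omega>) \<partial>M)"
      by (intro sum.cong refl Bochner_Integration.integral_sum ip)
    also have "\<dots> = (\<Sum>s\<in>J. \<Sum>t\<in>J. c s * c t * (\<integral>\<omega>. B s \<omega> * B t \<omega> \<partial>M))"
      by (simp only: integral_mult_right_zero)
    finally show ?thesis using gaussian_rv_cis[OF M rv z] by simp
  qed
  then show ?thesis unfolding gauss_cov_def using meas by auto
qed

section \<open>Riemann sums by dominated convergence\<close>

definition grid :: "nat \<Rightarrow> real \<Rightarrow> real" where
  "grid n x = of_int \<lfloor>real n * x\<rfloor> / real n"

lemma grid_le: "0 < n \<Longrightarrow> grid n x \<le> x"
  unfolding grid_def by (simp add: field_simps)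

lemma grid_bounds: "0 < n \<Longrightarrow> x \<in> {0..<1} \<Longrightarrow> grid n x \<in> {0..<1}"
proof -
  assume "0 < n" "x \<in> {0..<1}"
  then have "grid n x < 1" using grid_le[of n x] by simp
  moreover have "0 \<le> grid n x" using \<open>x \<in> {0..<1}\<close> by (simp add: grid_def)
  ultimately show ?thesis by simp
qed

lemma grid_tendsto: "(\<lambda>n. grid (Suc n) x) \<longlonglongrightarrow> x"
proof (rule tendsto_sandwich)
  show "\<forall>\<^sub>F n in sequentially. x - 1 / real (Suc n) \<le> grid (Suc n) x"
  proof (intro always_eventually allI)
    fix n
    have "real (Suc n) * x - 1 \<le> of_int \<lfloor>real (Suc n) * x\<rfloor>" by linarith
    then have "(real (Suc n) * x - 1) / real (Suc n) \<le> grid (Suc n) x"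
      unfolding grid_def by (rule divide_right_mono) simp
    then show "x - 1 / real (Suc n) \<le> grid (Suc n) x" by (simp add: diff_divide_distrib)
  qed
  show "\<forall>\<^sub>F n in sequentially. grid (Suc n) x \<le> x" using grid_le by (intro always_eventually) auto
  have "(\<lambda>n. x - inverse (real (Suc n))) \<longlonglongrightarrow> x - 0"
    by (intro tendsto_intros LIMSEQ_inverse_real_of_nat)
  then show "(\<lambda>n. x - 1 / real (Suc n)) \<longlonglongrightarrow> x" by (simp add: inverse_eq_divide)
qed auto

lemma grid_measurable [measurable]: "grid n \<in> borel_measurable borel"
  unfolding grid_def by measurable

lemma grid_sum:
  fixes g :: "real \<Rightarrow> 'a::real_vector"
  assumes N: "0 < N"
  shows "indicator {0..<1} x *\<^sub>R g (grid N x)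
    = (\<Sum>i<N. indicator {real i / real N..<real (Suc i) / real N} x *\<^sub>R g (real i / real N))"
proof (cases "x \<in> {0..<1}")
  case True
  define k where "k = nat \<lfloor>real N * x\<rfloor>"
  have "0 \<le> \<lfloor>real N * x\<rfloor>" using True by simp
  then have fk: "\<lfloor>real N * x\<rfloor> = int k" by (simp add: k_def)
  have "real N * x < real N" using True N by simp
  then have kN: "k < N" using fk floor_correct[of "real N * x"] by linarith
  have ind: "indicator {real i / real N..<real (Suc i) / real N} x = (if i = k then 1 else 0::real)" for i
  proof -
    have "x \<in> {real i / real N..<real (Suc i) / real N} \<longleftrightarrow> real i \<le> real N * x \<and> real N * x < real i + 1"
      using N by (auto simp: field_simps)
    also have "\<dots> \<longleftrightarrow> \<lfloor>real N * x\<rfloor> = int i" by (auto simp: floor_eq_iff)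
    also have "\<dots> \<longleftrightarrow> i = k" using fk by auto
    finally show ?thesis by (auto simp: indicator_def)
  qed
  have "(\<Sum>i<N. indicator {real i / real N..<real (Suc i) / real N} x *\<^sub>R g (real i / real N))
     = (\<Sum>i<N. if i = k then g (real i / real N) else 0)"
    unfolding ind by (intro sum.cong) auto
  also have "\<dots> = g (real k / real N)" using kN by simp
  also have "\<dots> = indicator {0..<1} x *\<^sub>R g (grid N x)" using True by (simp add: grid_def fk)
  finally show ?thesis ..
next
  case False
  have "indicator {real i / real N..<real (Suc i) / real N} x *\<^sub>R g (real i / real N) = 0" if "i < N" for i
  proof -
    have "real (Suc i) / real N \<le> 1" using that N by simp
    moreover have "0 \<le> real i / real N" by simp
    ultimately have "x \<notin> {real i / real N..<real (Suc i) / real N}"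
      using False unfolding atLeastLessThan_iff by linarith
    then show ?thesis by simp
  qed
  then have "(\<Sum>i<N. indicator {real i / real N..<real (Suc i) / real N} x *\<^sub>R g (real i / real N)) = 0"
    by (intro sum.neutral) auto
  moreover have "indicator {0..<1} x = (0::real)" using False by simp
  ultimately show ?thesis by (simp only: scaleR_zero_left)
qed

text \<open>A Riemann sum is the integral of \<open>g\<close> composed with rounding down to the
  grid. Dominated convergence then gives the limit as soon as rounding is harmless almost
  everywhere, which allows for finitely many jumps of \<open>g\<close>.\<close>

lemma riemann_sum_1:
  fixes g :: "real \<Rightarrow> real"
  assumes [measurable]: "(\<lambda>x. indicator {0..<1} x * g x) \<in> borel_measurable borel"
    and bd: "\<And>x. x \<in> {0..<1} \<Longrightarrow> \<bar>g x\<bar> \<le> B"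
    and conv: "AE x in lborel. x \<in> {0..<1} \<longrightarrow> (\<lambda>n. g (grid (Suc n) x)) \<longlonglongrightarrow> g x"
  shows "(\<lambda>n. (\<Sum>i<Suc n. g (real i / real (Suc n))) / real (Suc n)) \<longlonglongrightarrow> (\<integral>x. indicator {0..<1} x * g x \<partial>lborel)"
proof -
  have eq: "indicator {0..<1} x * g (grid (Suc n) x)
     = (\<Sum>i<Suc n. indicator {real i / real (Suc n)..<real (Suc i) / real (Suc n)} x * g (real i / real (Suc n)))" for n x
    using grid_sum[of "Suc n" x g] by (simp only: real_scaleR_def zero_less_Suc)
  have "(\<lambda>n. \<integral>x. indicator {0..<1} x * g (grid (Suc n) x) \<partial>lborel) \<longlonglongrightarrow> (\<integral>x. indicator {0..<1} x * g x \<partial>lborel)"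
  proof (rule integral_dominated_convergence[where w = "\<lambda>x. indicator {0..<1} x * B"])
    show "AE x in lborel. (\<lambda>n. indicator {0..<1} x * g (grid (Suc n) x)) \<longlonglongrightarrow> indicator {0..<1} x * g x"
      using conv by eventually_elim (auto simp: indicator_def)
    show "AE x in lborel. norm (indicator {0..<1} x * g (grid (Suc n) x)) \<le> indicator {0..<1} x * B" for n
      using bd[OF grid_bounds[of "Suc n"]] by (intro AE_I2) (auto simp: indicator_def abs_mult)
    show "(\<lambda>x. indicator {0..<1} x * g (grid (Suc n) x)) \<in> borel_measurable lborel" for n
      unfolding eq by measurable
  qed auto
  moreover have "(\<integral>x. indicator {0..<1} x * g (grid (Suc n) x) \<partial>lborel) = (\<Sum>i<Suc n. g (real i / real (Suc n))) / real (Suc n)" for n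
  proof -
    have "(\<integral>x. indicator {0..<1} x * g (grid (Suc n) x) \<partial>lborel)
       = (\<integral>x. (\<Sum>i<Suc n. indicator {real i / real (Suc n)..<real (Suc i) / real (Suc n)} x * g (real i / real (Suc n))) \<partial>lborel)"
      unfolding eq ..
    also have "\<dots> = (\<Sum>i<Suc n. \<integral>x. indicator {real i / real (Suc n)..<real (Suc i) / real (Suc n)} x * g (real i / real (Suc n)) \<partial>lborel)"
    proof (intro Bochner_Integration.integral_sum integrable_mult_left integrable_real_indicator)
      fix i
      have "real i / real (Suc n) \<le> real (Suc i) / real (Suc n)" by (intro divide_right_mono) auto
      then show "emeasure lborel {real i / real (Suc n)..<real (Suc i) / real (Suc n)} < \<infinity>"
        by (simp only: emeasure_lborel_Ico) simp
    qed simp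
    also have "\<dots> = (\<Sum>i<Suc n. (1 / real (Suc n)) * g (real i / real (Suc n)))"
    proof (intro sum.cong refl)
      fix i
      have "real i / real (Suc n) \<le> real (Suc i) / real (Suc n)" by (intro divide_right_mono) auto
      moreover have "real (Suc i) / real (Suc n) - real i / real (Suc n) = 1 / real (Suc n)"
        unfolding diff_divide_distrib[symmetric] by simp
      ultimately have "measure lborel {real i / real (Suc n)..<real (Suc i) / real (Suc n)} = 1 / real (Suc n)"
        by (simp only: measure_lborel_Ico)
      then show "(\<integral>x. indicator {real i / real (Suc n)..<real (Suc i) / real (Suc n)} x * g (real i / real (Suc n)) \<partial>lborel)
        = (1 / real (Suc n)) * g (real i / real (Suc n))"
        by (simp only: integral_mult_left_zero) (simp del: of_nat_Suc)
    qed
    also have "\<dots> = (\<Sum>i<Suc n. g (real i / real (Suc n))) / real (Suc n)"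
      unfolding sum_divide_distrib by (intro sum.cong refl) simp
    finally show ?thesis .
  qed
  ultimately show ?thesis by (simp only:)
qed

lemma riemann_sum_2:
  fixes g :: "real \<times> real \<Rightarrow> real"
  defines "Q \<equiv> {0..<1} \<times> {0..<1}"
  assumes [measurable]: "(\<lambda>z. indicator Q z * g z) \<in> borel_measurable borel"
    and bd: "\<And>z. z \<in> Q \<Longrightarrow> \<bar>g z\<bar> \<le> B"
    and conv: "AE z in lborel. z \<in> Q \<longrightarrow> (\<lambda>n. g (grid (Suc n) (fst z), grid (Suc n) (snd z))) \<longlonglongrightarrow> g z"
  shows "(\<lambda>n. (\<Sum>i<Suc n. \<Sum>j<Suc n. g (real i / real (Suc n), real j / real (Suc n))) / (real (Suc n))\<^sup>2)
    \<longlonglongrightarrow> (\<integral>z. indicator Q z * g z \<partial>lborel)"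
proof -
  define I where "I = (\<lambda>n i. {real i / real (Suc n)..<real (Suc i) / real (Suc n)})"
  have Qm [measurable]: "Q \<in> sets borel" unfolding Q_def by (simp add: borel_Times)
  have Im [measurable]: "I n i \<times> I n j \<in> sets borel" for n i j unfolding I_def by (simp add: borel_Times)
  have emQ: "emeasure lborel Q = 1"
    unfolding Q_def lborel_prod[symmetric] by (subst lborel.emeasure_pair_measure_Times) auto
  have emI: "emeasure lborel (I n i \<times> I n j) = ennreal (1 / (real (Suc n))\<^sup>2)" for n i j
  proof -
    have 1: "emeasure lborel (I n i) = ennreal (1 / real (Suc n))" for i
    proof -
      have "real i / real (Suc n) \<le> real (Suc i) / real (Suc n)" by (intro divide_right_mono) auto
      moreover have "real (Suc i) / real (Suc n) - real i / real (Suc n) = 1 / real (Suc n)"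
        unfolding diff_divide_distrib[symmetric] by simp
      ultimately show ?thesis unfolding I_def by (simp only: emeasure_lborel_Ico)
    qed
    have "emeasure lborel (I n i \<times> I n j) = emeasure lborel (I n i) * emeasure lborel (I n j)"
      unfolding lborel_prod[symmetric] by (rule lborel.emeasure_pair_measure_Times) (auto simp: I_def)
    also have "\<dots> = ennreal (1 / (real (Suc n))\<^sup>2)"
      unfolding 1 by (subst ennreal_mult[symmetric]) (auto simp: power2_eq_square)
    finally show ?thesis .
  qed
  have eq: "indicator Q z * g (grid (Suc n) (fst z), grid (Suc n) (snd z))
     = (\<Sum>i<Suc n. \<Sum>j<Suc n. indicator (I n i \<times> I n j) z * g (real i / real (Suc n), real j / real (Suc n)))" for n z
  proof -
    have "indicator Q z * g (grid (Suc n) (fst z), grid (Suc n) (snd z))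
      = indicator {0..<1} (fst z) *\<^sub>R (indicator {0..<1} (snd z) *\<^sub>R g (grid (Suc n) (fst z), grid (Suc n) (snd z)))"
      by (cases z) (auto simp: Q_def indicator_def)
    also have "\<dots> = (\<Sum>i<Suc n. indicator (I n i) (fst z) *\<^sub>R (indicator {0..<1} (snd z) *\<^sub>R g (real i / real (Suc n), grid (Suc n) (snd z))))"
      unfolding I_def by (rule grid_sum) simp
    also have "\<dots> = (\<Sum>i<Suc n. \<Sum>j<Suc n. indicator (I n i) (fst z) *\<^sub>R (indicator (I n j) (snd z) *\<^sub>R g (real i / real (Suc n), real j / real (Suc n))))"
    proof (intro sum.cong refl)
      fix i
      have "indicator {0..<1} (snd z) *\<^sub>R g (real i / real (Suc n), grid (Suc n) (snd z))
        = (\<Sum>j<Suc n. indicator (I n j) (snd z) *\<^sub>R g (real i / real (Suc n), real j / real (Suc n)))"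
        unfolding I_def by (rule grid_sum) simp
      then show "indicator (I n i) (fst z) *\<^sub>R (indicator {0..<1} (snd z) *\<^sub>R g (real i / real (Suc n), grid (Suc n) (snd z)))
        = (\<Sum>j<Suc n. indicator (I n i) (fst z) *\<^sub>R (indicator (I n j) (snd z) *\<^sub>R g (real i / real (Suc n), real j / real (Suc n))))"
        by (simp only: scaleR_sum_right)
    qed
    also have "\<dots> = (\<Sum>i<Suc n. \<Sum>j<Suc n. indicator (I n i \<times> I n j) z * g (real i / real (Suc n), real j / real (Suc n)))"
      by (cases z, intro sum.cong refl) (auto simp: indicator_def)
    finally show ?thesis .
  qed
  have "(\<lambda>n. \<integral>z. indicator Q z * g (grid (Suc n) (fst z), grid (Suc n) (snd z)) \<partial>lborel) \<longlonglongrightarrow> (\<integral>z. indicator Q z * g z \<partial>lborel)"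
  proof (rule integral_dominated_convergence[where w = "\<lambda>z. indicator Q z * B"])
    show "AE x in lborel. (\<lambda>n. indicator Q x * g (grid (Suc n) (fst x), grid (Suc n) (snd x))) \<longlonglongrightarrow> indicator Q x * g x"
      using conv by eventually_elim (auto simp: indicator_def)
    show "AE x in lborel. norm (indicator Q x * g (grid (Suc n) (fst x), grid (Suc n) (snd x))) \<le> indicator Q x * B" for n
      using bd grid_bounds[of "Suc n"] by (intro AE_I2) (auto simp: indicator_def abs_mult Q_def)
    show "(\<lambda>x. indicator Q x * g (grid (Suc n) (fst x), grid (Suc n) (snd x))) \<in> borel_measurable lborel" for n
      unfolding eq by measurable
    show "integrable lborel (\<lambda>z. indicator Q z * B)" using emQ by (intro integrable_mult_left) auto
  qed auto
  moreover have "(\<integral>x. indicator Q x * g (grid (Suc n) (fst x), grid (Suc n) (snd x)) \<partial>lborel)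
     = (\<Sum>i<Suc n. \<Sum>j<Suc n. g (real i / real (Suc n), real j / real (Suc n))) / (real (Suc n))\<^sup>2" for n
  proof -
    have ii: "integrable lborel (\<lambda>z. indicator (I n i \<times> I n j) z * c)" for i j and c :: real
      using emI[of n i j] by (intro integrable_mult_left) (auto simp: )
    have iv: "(\<integral>z. indicator (I n i \<times> I n j) z * c \<partial>lborel) = c / (real (Suc n))\<^sup>2" for i j and c :: real
      using emI[of n i j] by (simp add: measure_def)
    show ?thesis unfolding eq
      by (subst Bochner_Integration.integral_sum, intro Bochner_Integration.integrable_sum ii,
          subst Bochner_Integration.integral_sum, rule ii) (simp only: iv sum_divide_distrib)
  qed
  ultimately show ?thesis by simp
qed

lemma step_fun_grid_tendsto:
  assumes "finite TT" "x \<notin> TT"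
  shows "(\<lambda>n. \<Sum>t\<in>TT. c t * of_bool (grid (Suc n) x < t)) \<longlonglongrightarrow> (\<Sum>t\<in>TT. c t * of_bool (x < t) :: real)"
proof (intro tendsto_sum tendsto_mult tendsto_const)
  fix t assume "t \<in> TT"
  then have "x < t \<or> t < x" using assms by (metis linorder_less_linear)
  then have "\<forall>\<^sub>F n in sequentially. of_bool (grid (Suc n) x < t) = (of_bool (x < t) :: real)"
  proof
    assume "x < t"
    then have "grid (Suc n) x < t" for n using grid_le[of "Suc n" x] by simp
    then show ?thesis using \<open>x < t\<close> by simp
  next
    assume "t < x"
    then have "\<forall>\<^sub>F n in sequentially. t < grid (Suc n) x" using order_tendstoD(1)[OF grid_tendsto] by blast
    then show ?thesis by eventually_elim (use \<open>t < x\<close> in auto)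
  qed
  then show "(\<lambda>n. of_bool (grid (Suc n) x < t)) \<longlonglongrightarrow> (of_bool (x < t) :: real)"
    by (rule tendsto_eventually)
qed

lemma AE_lborel_notin_finite: "finite TT \<Longrightarrow> AE x in lborel. x \<notin> (TT :: real set)"
  by (rule AE_not_in) (rule finite_imp_null_set_lborel)

lemma AE_lborel_pair_notin_finite:
  assumes "finite (TT :: real set)"
  shows "AE z in lborel. fst z \<notin> TT \<and> snd z \<notin> TT"
proof -
  have [measurable]: "TT \<in> sets borel" using assms by (simp add: finite_imp_closed)
  have n: "TT \<in> null_sets lborel" using assms by (rule finite_imp_null_set_lborel)
  have "AE z in lborel \<Otimes>\<^sub>M lborel. fst z \<notin> TT \<and> snd z \<notin> TT"
  proof (rule AE_I[of _ _ "TT \<times> UNIV \<union> UNIV \<times> TT"])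
    have "emeasure (lborel \<Otimes>\<^sub>M lborel) (TT \<times> UNIV) = 0" "emeasure (lborel \<Otimes>\<^sub>M lborel) (UNIV \<times> TT) = 0"
      using n by (auto simp: lborel.emeasure_pair_measure_Times null_setsD1)
    then have "TT \<times> UNIV \<in> null_sets (lborel \<Otimes>\<^sub>M lborel)" "UNIV \<times> TT \<in> null_sets (lborel \<Otimes>\<^sub>M lborel)"
      by (auto intro!: null_setsI)
    then have "TT \<times> UNIV \<union> UNIV \<times> TT \<in> null_sets (lborel \<Otimes>\<^sub>M lborel)" by (rule null_sets.Un)
    then show "emeasure (lborel \<Otimes>\<^sub>M lborel) (TT \<times> UNIV \<union> UNIV \<times> TT) = 0" "TT \<times> UNIV \<union> UNIV \<times> TT \<in> sets (lborel \<Otimes>\<^sub>M lborel)"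
      by auto
  qed auto
  then show ?thesis unfolding lborel_prod .
qed

text \<open>For times in [0, 1], the covariance of the time integral of a process with covariance
  \<open>k\<close>. The domain is fixed and the upper limits enter as indicators: continuity follows
  by dominated convergence, and second differences become integrals over small squares.\<close>

definition int_cov :: "(real \<times> real \<Rightarrow> real) \<Rightarrow> real \<times> real \<Rightarrow> real" where
  "int_cov k z = (\<integral>w. indicator ({0..<1} \<times> {0..<1}) w *
      (of_bool (fst w < fst z) * of_bool (snd w < snd z) * k w) \<partial>lborel)"

lemma unit_square_bounded:
  assumes "continuous_on ({0..1} \<times> {0..1}) (k :: real \<times> real \<Rightarrow> real)"
  obtains B where "0 \<le> B" "\<And>z. z \<in> {0..1} \<times> {0..1} \<Longrightarrow> \<bar>k z\<bar> \<le> B"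
proof -
  have "compact (k ` ({0..1} \<times> {0..1}))"
    by (intro compact_continuous_image assms compact_Times) auto
  then obtain B where B: "\<And>z. z \<in> {0..1} \<times> {0..1} \<Longrightarrow> \<bar>k z\<bar> \<le> B"
    using compact_imp_bounded bounded_iff by (metis (no_types, lifting) imageI real_norm_def)
  then have "0 \<le> B" using B[of "(0,0)"] order_trans[OF abs_ge_zero] by (meson SigmaI atLeastAtMost_iff order_refl zero_le_one)
  with B that show ?thesis by blast
qed

lemma unit_square_measurable:
  assumes "continuous_on ({0..1} \<times> {0..1}) (k :: real \<times> real \<Rightarrow> real)"
  shows "(\<lambda>z. indicator ({0..<1} \<times> {0..<1}) z * k z) \<in> borel_measurable borel"
proof -
  have "continuous_on ({0..<1} \<times> {0..<1}) k" using assms by (rule continuous_on_subset) auto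
  then have "(\<lambda>z. indicator ({0..<1} \<times> {0..<1}) z *\<^sub>R k z) \<in> borel_measurable borel"
    by (intro borel_measurable_continuous_on_indicator) (auto simp: borel_Times)
  then show ?thesis by simp
qed

lemma unit_square_emeasure: "emeasure lborel ({0..<1::real} \<times> {0..<1::real}) = 1"
  unfolding lborel_prod[symmetric] by (subst lborel.emeasure_pair_measure_Times) auto

lemma int_cov_integrand:
  fixes k :: "real \<times> real \<Rightarrow> real"
  assumes k: "continuous_on ({0..1} \<times> {0..1}) k"
  shows "(\<lambda>w. indicator ({0..<1} \<times> {0..<1}) w * (of_bool (fst w < s) * of_bool (snd w < t) * k w)) \<in> borel_measurable borel"
    and "integrable lborel (\<lambda>w. indicator ({0..<1} \<times> {0..<1}) w * (of_bool (fst w < s) * of_bool (snd w < t) * k w))"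
proof -
  obtain B where B: "0 \<le> B" "\<And>z. z \<in> {0..1} \<times> {0..1} \<Longrightarrow> \<bar>k z\<bar> \<le> B" using unit_square_bounded[OF k] by blast
  note unit_square_measurable[OF k, measurable]
  have "(\<lambda>w :: real \<times> real. of_bool (fst w < s) :: real) \<in> borel_measurable borel"
    "(\<lambda>w :: real \<times> real. of_bool (snd w < t) :: real) \<in> borel_measurable borel"
    unfolding borel_prod[symmetric] by measurable
  then have "(\<lambda>w. of_bool (fst w < s) * of_bool (snd w < t) * (indicator ({0..<1} \<times> {0..<1}) w * k w)) \<in> borel_measurable borel"
    by (intro borel_measurable_times unit_square_measurable[OF k])
  then show m: "(\<lambda>w. indicator ({0..<1} \<times> {0..<1}) w * (of_bool (fst w < s) * of_bool (snd w < t) * k w)) \<in> borel_measurable borel"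
    by (simp add: mult_ac)
  show "integrable lborel (\<lambda>w. indicator ({0..<1} \<times> {0..<1}) w * (of_bool (fst w < s) * of_bool (snd w < t) * k w))"
  proof (rule Bochner_Integration.integrable_bound[of _ "\<lambda>w. indicator ({0..<1} \<times> {0..<1}) w * B"])
    show "integrable lborel (\<lambda>w. indicator ({0..<1::real} \<times> {0..<1::real}) w * B)"
      using unit_square_emeasure by (intro integrable_mult_left integrable_real_indicator) (auto simp: borel_Times)
    show "AE w in lborel. norm (indicator ({0..<1} \<times> {0..<1}) w * (of_bool (fst w < s) * of_bool (snd w < t) * k w))
       \<le> norm (indicator ({0..<1} \<times> {0..<1}) w * B)"
      using B by (intro AE_I2) (auto simp: indicator_def abs_mult of_bool_def)
  qed (use m in auto)
qed

text \<open>A linear combination of values of \<open>B'\<close> is the integral of \<open>B\<close>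
  against a step function, hence almost surely a limit of Riemann sums, which are linear
  combinations of values of \<open>B\<close>. Bounded convergence applies to the characteristic
  functions, while their exponents are two-dimensional Riemann sums of the kernel.\<close>

lemma gauss_cov_integral:
  assumes M: "prob_space M" and g: "gauss_cov M B k" and k: "continuous_on ({0..1} \<times> {0..1}) k"
    and path: "AE \<omega> in M. continuous_on {0..1} (\<lambda>t. B t \<omega>)"
    and B'm: "\<And>t. t \<in> {0..1} \<Longrightarrow> B' t \<in> borel_measurable M"
    and B': "AE \<omega> in M. \<forall>t\<in>{0..1}. B' t \<omega> = integral {0..t} (\<lambda>r. B r \<omega>)"
  shows "gauss_cov M B' (int_cov k)"
  unfolding gauss_cov_def
proof (intro conjI ballI allI impI)
  show "B' t \<in> borel_measurable M" if "t \<in> {0..1}" for t by (rule B'm[OF that])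
next
  interpret prob_space M by fact
  fix TT :: "real set" and c :: "real \<Rightarrow> real" assume TT: "finite TT \<and> TT \<subseteq> {0..1}"
  \<comment> \<open>Summing first over \<open>TT\<close> turns the combination of integrals up to
    the times \<open>t\<close> into one integral with density \<open>F\<close>, which jumps only at
    points of \<open>TT\<close>.\<close>
  define F where "F = (\<lambda>x. \<Sum>t\<in>TT. c t * of_bool (x < t))"
  define CF where "CF = (\<Sum>t\<in>TT. \<bar>c t\<bar>)"
  define x where "x = (\<lambda>n i. real i / real (Suc n))"
  define X where "X = (\<lambda>n \<omega>. \<Sum>i<Suc n. F (x n i) * B (x n i) \<omega>)"
  define Q where "Q = {0..<1::real} \<times> {0..<1::real}"
  have [measurable]: "F \<in> borel_measurable borel" unfolding F_def by measurable
  have FC: "\<bar>F y\<bar> \<le> CF" for y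
    unfolding F_def CF_def by (rule order_trans[OF sum_abs], rule sum_mono) (auto simp: abs_mult of_bool_def)
  have CF0: "0 \<le> CF" unfolding CF_def by (rule sum_nonneg) auto
  have Bm: "B t \<in> borel_measurable M" if "t \<in> {0..1}" for t using g that by (simp add: gauss_cov_def)
  have B'm2: "\<And>t. t \<in> TT \<Longrightarrow> B' t \<in> borel_measurable M" using B'm TT by auto
  have xI: "x n i \<in> {0..1}" if "i < Suc n" for n i using that by (simp add: x_def)
  have inj: "inj_on (x n) A" for n A by (auto simp: inj_on_def x_def simp del: of_nat_Suc)
  have char: "(\<integral>\<omega>. cis (X n \<omega> / real (Suc n)) \<partial>M) = complex_of_real (exp (- ((\<Sum>i<Suc n. \<Sum>j<Suc n. F (x n i) * F (x n j) * k (x n i, x n j)) / (real (Suc n))\<^sup>2) / 2))" for n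
  proof -
    define G where "G = x n ` {..<Suc n}"
    have fG: "finite G" "G \<subseteq> {0..1}" using xI[of _ n] by (auto simp: G_def)
    have "X n \<omega> / real (Suc n) = (\<Sum>t\<in>G. (F t / real (Suc n)) * B t \<omega>)" for \<omega>
      unfolding X_def G_def sum.reindex[OF inj] sum_divide_distrib by (intro sum.cong) auto
    then have "(\<integral>\<omega>. cis (X n \<omega> / real (Suc n)) \<partial>M)
       = complex_of_real (exp (- (\<Sum>s\<in>G. \<Sum>t\<in>G. (F s / real (Suc n)) * (F t / real (Suc n)) * k (s, t)) / 2))"
      using g fG by (simp only: gauss_cov_def)
    also have "(\<Sum>s\<in>G. \<Sum>t\<in>G. (F s / real (Suc n)) * (F t / real (Suc n)) * k (s, t))
       = (\<Sum>i<Suc n. \<Sum>j<Suc n. F (x n i) * F (x n j) * k (x n i, x n j)) / (real (Suc n))\<^sup>2"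
      unfolding G_def sum.reindex[OF inj] sum_divide_distrib o_def
      by (intro sum.cong refl) (simp add: power2_eq_square del: of_nat_Suc)
    finally show ?thesis .
  qed
  have lim1: "(\<lambda>n. \<integral>\<omega>. cis (X n \<omega> / real (Suc n)) \<partial>M) \<longlonglongrightarrow> (\<integral>\<omega>. cis (\<Sum>t\<in>TT. c t * B' t \<omega>) \<partial>M)"
  proof (rule integral_dominated_convergence[where w = "\<lambda>_. 1"])
    show "(\<lambda>\<omega>. cis (\<Sum>t\<in>TT. c t * B' t \<omega>)) \<in> borel_measurable M"
      by (intro measurable_compose[OF _ cis_measurable] borel_measurable_sum borel_measurable_times B'm2) auto
    show "(\<lambda>\<omega>. cis (X n \<omega> / real (Suc n))) \<in> borel_measurable M" for n
      unfolding X_def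
      by (intro measurable_compose[OF _ cis_measurable] borel_measurable_divide borel_measurable_sum borel_measurable_times Bm xI borel_measurable_const) auto
    show "AE \<omega> in M. (\<lambda>n. cis (X n \<omega> / real (Suc n))) \<longlonglongrightarrow> cis (\<Sum>t\<in>TT. c t * B' t \<omega>)"
      using path B'
    proof eventually_elim
      case (elim \<omega>)
      define b where "b = (\<lambda>t. B t \<omega>)"
      have cb: "continuous_on {0..1} b" using elim(1) by (simp add: b_def)
      have bm: "(\<lambda>y. indicator {0..<1} y * b y) \<in> borel_measurable borel"
      proof -
        have "{0..<1} \<subseteq> {0..1::real}" by auto
        from borel_measurable_continuous_on_indicator[OF _ continuous_on_subset[OF cb this]] show ?thesis by simp
      qed
      have "compact (b ` {0..1})" by (intro compact_continuous_image cb) auto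
      then obtain BB where BB: "\<And>y. y \<in> {0..1} \<Longrightarrow> \<bar>b y\<bar> \<le> BB"
        using compact_imp_bounded bounded_iff by (metis (no_types, lifting) imageI real_norm_def)
      have "(\<lambda>n. (\<Sum>i<Suc n. F (x n i) * b (x n i)) / real (Suc n)) \<longlonglongrightarrow> (\<integral>y. indicator {0..<1} y * (F y * b y) \<partial>lborel)"
        unfolding x_def
      proof (rule riemann_sum_1[where g = "\<lambda>y. F y * b y"])
        have "(\<lambda>y. F y * (indicator {0..<1} y * b y)) \<in> borel_measurable borel" using bm by measurable
        then show "(\<lambda>y. indicator {0..<1} y * (F y * b y)) \<in> borel_measurable borel" by (simp add: mult_ac)
        show "\<bar>F y * b y\<bar> \<le> CF * BB" if "y \<in> {0..<1}" for y
          unfolding abs_mult using that FC CF0 BB by (intro mult_mono) auto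
        show "AE y in lborel. y \<in> {0..<1} \<longrightarrow> (\<lambda>n. F (grid (Suc n) y) * b (grid (Suc n) y)) \<longlonglongrightarrow> F y * b y"
          using AE_lborel_notin_finite[OF conjunct1[OF TT]]
        proof (eventually_elim, intro impI tendsto_mult)
          fix y assume elim: "y \<notin> TT" "y \<in> {0..<1::real}"
          show "(\<lambda>n. F (grid (Suc n) y)) \<longlonglongrightarrow> F y"
            unfolding F_def using TT elim by (intro step_fun_grid_tendsto) auto
          show "(\<lambda>n. b (grid (Suc n) y)) \<longlonglongrightarrow> b y"
            using elim grid_bounds[of "Suc _" y]
            by (intro continuous_on_tendsto_compose[OF cb grid_tendsto]) (auto intro!: always_eventually simp: less_imp_le)
        qed
      qed
      moreover have "(\<integral>y. indicator {0..<1} y * (F y * b y) \<partial>lborel) = (\<Sum>t\<in>TT. c t * B' t \<omega>)"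
      proof -
        have one: "has_bochner_integral lborel (\<lambda>y. c t * (indicator {0..t} y *\<^sub>R b y)) (c t * B' t \<omega>)" if t: "t \<in> TT" for t
        proof -
          have t1: "t \<in> {0..1}" using TT t by auto
          have ct: "continuous_on {0..t} b" using cb t1 by (auto intro: continuous_on_subset)
          have "set_integrable lborel {0..t} b" by (rule borel_integrable_atLeastAtMost') (rule ct)
          moreover from set_borel_integral_eq_integral(2)[OF this]
          have "(\<integral>y. indicator {0..t} y *\<^sub>R b y \<partial>lborel) = integral {0..t} b" by (simp add: set_lebesgue_integral_def)
          ultimately show ?thesis using elim(2) t1
            by (intro has_bochner_integral_mult_right) (auto simp: has_bochner_integral_iff set_integrable_def b_def)
        qed
        have "has_bochner_integral lborel (\<lambda>y. \<Sum>t\<in>TT. c t * (indicator {0..t} y *\<^sub>R b y)) (\<Sum>t\<in>TT. c t * B' t \<omega>)"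
          by (rule has_bochner_integral_sum) (rule one)
        moreover have "(\<integral>y. indicator {0..<1} y * (F y * b y) \<partial>lborel) = (\<integral>y. (\<Sum>t\<in>TT. c t * (indicator {0..t} y *\<^sub>R b y)) \<partial>lborel)"
        proof (rule integral_cong_AE)
          have "(\<lambda>y. F y * (indicator {0..<1} y * b y)) \<in> borel_measurable borel" using bm by measurable
          then show "(\<lambda>y. indicator {0..<1} y * (F y * b y)) \<in> borel_measurable lborel" by (simp add: mult_ac)
          show "(\<lambda>y. \<Sum>t\<in>TT. c t * (indicator {0..t} y *\<^sub>R b y)) \<in> borel_measurable lborel"
            using calculation by auto
          show "AE y in lborel. indicator {0..<1} y * (F y * b y) = (\<Sum>t\<in>TT. c t * (indicator {0..t} y *\<^sub>R b y))"
            using AE_lborel_notin_finite[OF conjunct1[OF TT]]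
          proof eventually_elim
            case (elim y)
            have "indicator {0..<1} y * (c t * of_bool (y < t) * b y) = c t * (indicator {0..t} y *\<^sub>R b y)" if "t \<in> TT" for t
            proof -
              have "y \<noteq> t" using elim that by auto
              moreover have "t \<in> {0..1}" using TT that by auto
              ultimately show ?thesis by (auto simp: indicator_def of_bool_def)
            qed
            then show ?case unfolding F_def sum_distrib_left sum_distrib_right by (intro sum.cong) auto
          qed
        qed
        ultimately show ?thesis by (simp add: has_bochner_integral_integral_eq)
      qed
      ultimately show ?case unfolding X_def b_def by (intro tendsto_cis) auto
    qed
  qed auto
  have lim2: "(\<lambda>n. (\<Sum>i<Suc n. \<Sum>j<Suc n. F (x n i) * F (x n j) * k (x n i, x n j)) / (real (Suc n))\<^sup>2)
    \<longlonglongrightarrow> (\<integral>z. indicator Q z * (F (fst z) * F (snd z) * k z) \<partial>lborel)"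
  proof -
    obtain BB where BB: "0 \<le> BB" "\<And>z. z \<in> {0..1} \<times> {0..1} \<Longrightarrow> \<bar>k z\<bar> \<le> BB" using unit_square_bounded[OF k] by blast
    have "(\<lambda>n. (\<Sum>i<Suc n. \<Sum>j<Suc n. (\<lambda>z. F (fst z) * F (snd z) * k z) (real i / real (Suc n), real j / real (Suc n))) / (real (Suc n))\<^sup>2)
    \<longlonglongrightarrow> (\<integral>z. indicator ({0..<1} \<times> {0..<1}) z * (\<lambda>z. F (fst z) * F (snd z) * k z) z \<partial>lborel)"
    proof (rule riemann_sum_2)
      have "(\<lambda>z. F (fst z) * F (snd z) * (indicator ({0..<1} \<times> {0..<1}) z * k z)) \<in> borel_measurable borel"
        using unit_square_measurable[OF k] by (simp add: borel_prod[symmetric])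
      then show "(\<lambda>z. indicator ({0..<1} \<times> {0..<1}) z * (F (fst z) * F (snd z) * k z)) \<in> borel_measurable borel"
        by (simp add: mult_ac)
      show "\<bar>F (fst z) * F (snd z) * k z\<bar> \<le> CF * CF * BB" if "z \<in> {0..<1} \<times> {0..<1}" for z
        unfolding abs_mult using that FC CF0 BB(1) BB(2)[of z] by (intro mult_mono) auto
      show "AE z in lborel. z \<in> {0..<1} \<times> {0..<1} \<longrightarrow>
         (\<lambda>n. F (fst (grid (Suc n) (fst z), grid (Suc n) (snd z))) * F (snd (grid (Suc n) (fst z), grid (Suc n) (snd z))) *
          k (grid (Suc n) (fst z), grid (Suc n) (snd z))) \<longlonglongrightarrow> F (fst z) * F (snd z) * k z"
        using AE_lborel_pair_notin_finite[OF conjunct1[OF TT]]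
      proof (eventually_elim, intro impI tendsto_mult)
        fix z assume z: "fst z \<notin> TT \<and> snd z \<notin> TT" "z \<in> {0..<1::real} \<times> {0..<1::real}"
        show "(\<lambda>n. F (fst (grid (Suc n) (fst z), grid (Suc n) (snd z)))) \<longlonglongrightarrow> F (fst z)"
          "(\<lambda>n. F (snd (grid (Suc n) (fst z), grid (Suc n) (snd z)))) \<longlonglongrightarrow> F (snd z)"
          unfolding F_def fst_conv snd_conv
          by (rule step_fun_grid_tendsto, use TT z in blast, use TT z in blast)+
        have "(\<lambda>n. (grid (Suc n) (fst z), grid (Suc n) (snd z))) \<longlonglongrightarrow> (fst z, snd z)"
          by (intro tendsto_Pair grid_tendsto)
        then show "(\<lambda>n. k (grid (Suc n) (fst z), grid (Suc n) (snd z))) \<longlonglongrightarrow> k z"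
          using z grid_bounds[of "Suc _" "fst z"] grid_bounds[of "Suc _" "snd z"]
          by (intro continuous_on_tendsto_compose[OF k]) (auto intro!: always_eventually simp: less_imp_le mem_Times_iff)
      qed
    qed
    then show ?thesis by (simp add: x_def Q_def)
  qed
  have lin: "(\<integral>z. indicator Q z * (F (fst z) * F (snd z) * k z) \<partial>lborel) = (\<Sum>s\<in>TT. \<Sum>t\<in>TT. c s * c t * int_cov k (s, t))"
  proof -
    have "indicator Q z * (F (fst z) * F (snd z) * k z)
      = (\<Sum>s\<in>TT. \<Sum>t\<in>TT. c s * c t * (indicator Q z * (of_bool (fst z < s) * of_bool (snd z < t) * k z)))" for z
    proof -
      have "F (fst z) * F (snd z) = (\<Sum>s\<in>TT. \<Sum>t\<in>TT. (c s * of_bool (fst z < s)) * (c t * of_bool (snd z < t)))"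
        unfolding F_def by (rule sum_product)
      then show ?thesis
        by (simp only: sum_distrib_left sum_distrib_right) (intro sum.cong refl, simp only: mult_ac)
    qed
    then have "(\<integral>z. indicator Q z * (F (fst z) * F (snd z) * k z) \<partial>lborel)
      = (\<integral>z. (\<Sum>s\<in>TT. \<Sum>t\<in>TT. c s * c t * (indicator Q z * (of_bool (fst z < s) * of_bool (snd z < t) * k z))) \<partial>lborel)" by simp
    also have "\<dots> = (\<Sum>s\<in>TT. \<Sum>t\<in>TT. \<integral>z. c s * c t * (indicator Q z * (of_bool (fst z < s) * of_bool (snd z < t) * k z)) \<partial>lborel)"
      unfolding Q_def
      by (subst Bochner_Integration.integral_sum, intro Bochner_Integration.integrable_sum integrable_mult_right int_cov_integrand(2)[OF k],
         intro sum.cong refl Bochner_Integration.integral_sum integrable_mult_right int_cov_integrand(2)[OF k])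
    also have "\<dots> = (\<Sum>s\<in>TT. \<Sum>t\<in>TT. c s * c t * int_cov k (s, t))"
      unfolding integral_mult_right_zero int_cov_def Q_def fst_conv snd_conv ..
    finally show ?thesis .
  qed
  have "(\<lambda>n. \<integral>\<omega>. cis (X n \<omega> / real (Suc n)) \<partial>M) \<longlonglongrightarrow> complex_of_real (exp (- (\<Sum>s\<in>TT. \<Sum>t\<in>TT. c s * c t * int_cov k (s, t)) / 2))"
    unfolding char using lim2 unfolding lin by (intro tendsto_intros) auto
  from LIMSEQ_unique[OF lim1 this]
  show "(\<integral>\<omega>. cis (\<Sum>t\<in>TT. c t * B' t \<omega>) \<partial>M) = complex_of_real (exp (- (\<Sum>s\<in>TT. \<Sum>t\<in>TT. c s * c t * int_cov k (s, t)) / 2))" .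
qed

lemma continuous_on_int_cov:
  fixes k :: "real \<times> real \<Rightarrow> real"
  assumes k: "continuous_on ({0..1} \<times> {0..1}) k"
  shows "continuous_on S (int_cov k)"
proof (rule continuous_on_sequentiallyI)
  fix u :: "nat \<Rightarrow> real \<times> real" and a assume u: "u \<longlonglongrightarrow> a"
  obtain B where B: "0 \<le> B" "\<And>z. z \<in> {0..1} \<times> {0..1} \<Longrightarrow> \<bar>k z\<bar> \<le> B" using unit_square_bounded[OF k] by blast
  have ob: "(\<lambda>n. of_bool (x < v n)) \<longlonglongrightarrow> (of_bool (x < b) :: real)" if "v \<longlonglongrightarrow> b" "x \<noteq> b" for x b and v :: "nat \<Rightarrow> real"
  proof (rule tendsto_eventually)
    show "\<forall>\<^sub>F n in sequentially. of_bool (x < v n) = (of_bool (x < b) :: real)"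
    proof (cases "x < b")
      case True
      then show ?thesis using order_tendstoD(1)[OF that(1)] by (auto elim: eventually_mono)
    next
      case False
      then have "b < x" using that by simp
      then have "\<forall>\<^sub>F n in sequentially. v n < x" using order_tendstoD(2)[OF that(1)] by blast
      then show ?thesis by eventually_elim (use False in auto)
    qed
  qed
  show "(\<lambda>n. int_cov k (u n)) \<longlonglongrightarrow> int_cov k a"
    unfolding int_cov_def
  proof (rule integral_dominated_convergence[where w = "\<lambda>w. indicator ({0..<1} \<times> {0..<1}) w * B"])
    show "integrable lborel (\<lambda>w. indicator ({0..<1::real} \<times> {0..<1::real}) w * B)"
      using unit_square_emeasure by (intro integrable_mult_left integrable_real_indicator) (auto simp: borel_Times)
    show "AE w in lborel. norm (indicator ({0..<1} \<times> {0..<1}) w * (of_bool (fst w < fst (u n)) * of_bool (snd w < snd (u n)) * k w))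
       \<le> indicator ({0..<1} \<times> {0..<1}) w * B" for n
      using B by (intro AE_I2) (auto simp: indicator_def abs_mult of_bool_def)
    have "AE w in lborel. fst w \<notin> {fst a, snd a} \<and> snd w \<notin> {fst a, snd a}"
      by (rule AE_lborel_pair_notin_finite) auto
    then show "AE w in lborel. (\<lambda>n. indicator ({0..<1} \<times> {0..<1}) w * (of_bool (fst w < fst (u n)) * of_bool (snd w < snd (u n)) * k w))
       \<longlonglongrightarrow> indicator ({0..<1} \<times> {0..<1}) w * (of_bool (fst w < fst a) * of_bool (snd w < snd a) * k w)"
    proof eventually_elim
      case (elim w)
      show ?case using elim
        by (intro tendsto_mult tendsto_const ob tendsto_fst[OF u] tendsto_snd[OF u]) auto
    qed
  qed (use int_cov_integrand(1)[OF k] in auto)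
qed

text \<open>
  Integrating a process with a positive kernel gives increments of variance at least a constant times
  \<open>(t - s)\<^sup>2\<close> away from time 0, which replaces local nondeterminism when the Hurst index exceeds 1.
\<close>

definition positive_kernel :: "(real \<times> real \<Rightarrow> real) \<Rightarrow> bool" where
  "positive_kernel k \<longleftrightarrow> (\<forall>z\<in>{0..1} \<times> {0..1}. 0 \<le> k z) \<and>
     (\<forall>\<epsilon>>0. \<exists>c>0. \<forall>s\<in>{\<epsilon>..1}. \<forall>t\<in>{\<epsilon>..1}. c \<le> k (s, t))"

lemma box_lborel:
  fixes a b c d :: real
  assumes "a \<le> b" "c \<le> d"
  shows "integrable lborel (\<lambda>w. indicator ({a..<b} \<times> {c..<d}) w * r)"
    "(\<integral>w. indicator ({a..<b} \<times> {c..<d}) w * r \<partial>lborel) = (b - a) * (d - c) * r"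
proof -
  have em: "emeasure lborel ({a..<b} \<times> {c..<d}) = ennreal ((b - a) * (d - c))"
    unfolding lborel_prod[symmetric] using assms
    by (subst lborel.emeasure_pair_measure_Times) (auto simp: ennreal_mult)
  show "integrable lborel (\<lambda>w. indicator ({a..<b} \<times> {c..<d}) w * r)"
    using em by (intro integrable_mult_left integrable_real_indicator) (auto simp: borel_Times)
  show "(\<integral>w. indicator ({a..<b} \<times> {c..<d}) w * r \<partial>lborel) = (b - a) * (d - c) * r"
    using em assms by (simp add: measure_def)
qed

lemma positive_kernel_int_cov:
  assumes k: "continuous_on ({0..1} \<times> {0..1}) k" and "positive_kernel k"
  shows "positive_kernel (int_cov k)"
  unfolding positive_kernel_def
proof (intro conjI ballI allI impI)
  have nn: "0 \<le> k z" if "z \<in> {0..<1} \<times> {0..<1}" for z using assms(2) that unfolding positive_kernel_def by auto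
  show "0 \<le> int_cov k z" for z
    unfolding int_cov_def using nn by (intro Bochner_Integration.integral_nonneg_AE AE_I2) (auto simp: indicator_def)
  fix \<epsilon> :: real assume e: "0 < \<epsilon>"
  show "\<exists>c>0. \<forall>s\<in>{\<epsilon>..1}. \<forall>t\<in>{\<epsilon>..1}. c \<le> int_cov k (s, t)"
  proof (cases "\<epsilon> \<le> 1")
    case True
    \<comment> \<open>The square with sides from \<epsilon>/2 to \<epsilon> lies in every domain of
      integration considered, and \<open>k\<close> is at least \<open>c\<close> on it.\<close>
    obtain c where c: "c > 0" "\<And>s t. s \<in> {\<epsilon>/2..1} \<Longrightarrow> t \<in> {\<epsilon>/2..1} \<Longrightarrow> c \<le> k (s, t)"
      using assms(2) e unfolding positive_kernel_def by (metis half_gt_zero)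
    have "(\<epsilon> - \<epsilon>/2) * (\<epsilon> - \<epsilon>/2) * c \<le> int_cov k (s, t)" if st: "s \<in> {\<epsilon>..1}" "t \<in> {\<epsilon>..1}" for s t
    proof -
      have h: "\<epsilon>/2 \<le> \<epsilon>" using e by simp
      have "(\<integral>w. indicator ({\<epsilon>/2..<\<epsilon>} \<times> {\<epsilon>/2..<\<epsilon>}) w * c \<partial>lborel) \<le> int_cov k (s, t)"
        unfolding int_cov_def
      proof (rule integral_mono)
        show "integrable lborel (\<lambda>w. indicator ({\<epsilon>/2..<\<epsilon>} \<times> {\<epsilon>/2..<\<epsilon>}) w * c)" using box_lborel(1)[OF h h] .
        fix w :: "real \<times> real"
        show "indicator ({\<epsilon>/2..<\<epsilon>} \<times> {\<epsilon>/2..<\<epsilon>}) w * c \<le>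
          indicator ({0..<1} \<times> {0..<1}) w * (of_bool (fst w < fst (s, t)) * of_bool (snd w < snd (s, t)) * k w)"
          using c(2)[of "fst w" "snd w"] nn[of w] st e True by (cases w) (auto simp: indicator_def of_bool_def)
      qed (rule int_cov_integrand(2)[OF k])
      then show ?thesis by (simp only: box_lborel(2)[OF h h])
    qed
    then show ?thesis using c e by (intro exI[of _ "(\<epsilon> - \<epsilon>/2) * (\<epsilon> - \<epsilon>/2) * c"]) auto
  qed (auto intro: exI[of _ 1])
qed

text \<open>By inclusion and exclusion the four corner terms are the integral of \<open>k\<close>
  over the square with side from \<open>s\<close> to \<open>t\<close>, where \<open>k\<close> is
  bounded below because the times keep away from 0.\<close>

lemma int_cov_increment:
  assumes k: "continuous_on ({0..1} \<times> {0..1}) k" and "positive_kernel k"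
  shows "\<exists>c>0. \<forall>s\<in>{3/10..7/10}. \<forall>t\<in>{3/10..7/10}.
    c * (t - s)\<^sup>2 \<le> int_cov k (s, s) - int_cov k (s, t) - int_cov k (t, s) + int_cov k (t, t)"
proof -
  obtain c where c: "c > 0" "\<And>s t. s \<in> {3/10..1} \<Longrightarrow> t \<in> {3/10..1} \<Longrightarrow> c \<le> k (s, t)"
    using assms(2) unfolding positive_kernel_def by (metis divide_pos_pos zero_less_numeral)
  have *: "c * (t - s)\<^sup>2 \<le> int_cov k (s, s) - int_cov k (s, t) - int_cov k (t, s) + int_cov k (t, t)"
    if st: "s \<in> {3/10..7/10}" "t \<in> {3/10..7/10}" "s \<le> t" for s t
  proof -
    define f where "f = (\<lambda>s t w. indicator ({0..<1} \<times> {0..<1}) w * (of_bool (fst w < s) * of_bool (snd w < t) * k w))"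
    have fi: "integrable lborel (f s t)" for s t unfolding f_def by (rule int_cov_integrand(2)[OF k])
    have "int_cov k (s, s) - int_cov k (s, t) - int_cov k (t, s) + int_cov k (t, t) = (\<integral>w. f s s w - f s t w - f t s w + f t t w \<partial>lborel)"
    proof -
      have ic: "int_cov k (s, t) = (\<integral>w. f s t w \<partial>lborel)" for s t by (simp add: int_cov_def f_def)
      show ?thesis unfolding ic using fi by simp
    qed
    moreover have "(\<integral>w. indicator ({s..<t} \<times> {s..<t}) w * c \<partial>lborel) \<le> (\<integral>w. f s s w - f s t w - f t s w + f t t w \<partial>lborel)"
    proof (rule integral_mono)
      show "integrable lborel (\<lambda>w. indicator ({s..<t} \<times> {s..<t}) w * c)" using box_lborel(1) st by auto
      show "integrable lborel (\<lambda>w. f s s w - f s t w - f t s w + f t t w)" using fi by simp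
      fix w :: "real \<times> real"
      have "f s s w - f s t w - f t s w + f t t w = indicator ({s..<t} \<times> {s..<t}) w * k w"
        using st by (cases w) (auto simp: f_def indicator_def of_bool_def)
      then show "indicator ({s..<t} \<times> {s..<t}) w * c \<le> f s s w - f s t w - f t s w + f t t w"
        using c(2)[of "fst w" "snd w"] st by (auto simp: indicator_def)
    qed
    ultimately have "(t - s) * (t - s) * c \<le> int_cov k (s, s) - int_cov k (s, t) - int_cov k (t, s) + int_cov k (t, t)"
      by (simp only: box_lborel(2)[OF st(3) st(3)])
    then show ?thesis by (simp add: power2_eq_square mult_ac)
  qed
  show ?thesis
  proof (intro exI conjI ballI)
    fix s t :: real assume st: "s \<in> {3/10..7/10}" "t \<in> {3/10..7/10}"
    show "c * (t - s)\<^sup>2 \<le> int_cov k (s, s) - int_cov k (s, t) - int_cov k (t, s) + int_cov k (t, t)"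
      using *[of s t] *[of t s] st by (cases "s \<le> t") (auto simp: power2_commute)
  qed (rule c)
qed

section \<open>Fractional Brownian motion and its iterated integrals\<close>

lemma gauss_cov_cong:
  assumes "gauss_cov M B k" "\<And>z. z \<in> {0..1} \<times> {0..1} \<Longrightarrow> k z = k' z"
  shows "gauss_cov M B k'"
proof -
  have "(\<Sum>s\<in>TT. \<Sum>t\<in>TT. c s * c t * k (s, t)) = (\<Sum>s\<in>TT. \<Sum>t\<in>TT. c s * c t * k' (s, t))" if "TT \<subseteq> {0..1}" for TT c
    using that assms(2) by (intro sum.cong refl) (auto simp: subset_eq)
  note eq = this
  show ?thesis unfolding gauss_cov_def
  proof (intro conjI allI impI)
    show "\<forall>t\<in>{0..1}. B t \<in> borel_measurable M" using assms(1) by (simp add: gauss_cov_def)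
    fix TT :: "real set" and c :: "real \<Rightarrow> real" assume TT: "finite TT \<and> TT \<subseteq> {0..1}"
    then have "(\<integral>\<omega>. cis (\<Sum>t\<in>TT. c t * B t \<omega>) \<partial>M) = complex_of_real (exp (- (\<Sum>s\<in>TT. \<Sum>t\<in>TT. c s * c t * k (s, t)) / 2))"
      using assms(1) unfolding gauss_cov_def by blast
    also have "(\<Sum>s\<in>TT. \<Sum>t\<in>TT. c s * c t * k (s, t)) = (\<Sum>s\<in>TT. \<Sum>t\<in>TT. c s * c t * k' (s, t))"
      using TT by (intro eq) simp
    finally show "(\<integral>\<omega>. cis (\<Sum>t\<in>TT. c t * B t \<omega>) \<partial>M) = complex_of_real (exp (- (\<Sum>s\<in>TT. \<Sum>t\<in>TT. c s * c t * k' (s, t)) / 2))" .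
  qed
qed

text \<open>For nonnegative times the distance of s and t is at most their maximum, so the
  subtracted power is outweighed by the larger one and half of \<open>min s t powr (2 * H)\<close>
  survives.\<close>

lemma fbm_cov_positive_kernel:
  assumes H: "0 < H"
  shows "positive_kernel (\<lambda>(s, t). (t powr (2 * H) + s powr (2 * H) - \<bar>t - s\<bar> powr (2 * H)) / 2)"
proof -
  have *: "min s t powr (2 * H) / 2 \<le> (t powr (2 * H) + s powr (2 * H) - \<bar>t - s\<bar> powr (2 * H)) / 2"
    if "0 \<le> s" "0 \<le> t" for s t :: real
  proof (cases "s \<le> t")
    case True
    have "\<bar>t - s\<bar> powr (2 * H) \<le> t powr (2 * H)" using that True H by (intro powr_mono2) auto
    then show ?thesis using True by simp
  next
    case False
    have "\<bar>t - s\<bar> powr (2 * H) \<le> s powr (2 * H)" using that False H by (intro powr_mono2) auto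
    then show ?thesis using False by simp
  qed
  show ?thesis unfolding positive_kernel_def
  proof (intro conjI ballI allI impI)
    fix z :: "real \<times> real" assume "z \<in> {0..1} \<times> {0..1}"
    then show "0 \<le> (case z of (s, t) \<Rightarrow> (t powr (2 * H) + s powr (2 * H) - \<bar>t - s\<bar> powr (2 * H)) / 2)"
    proof (cases z)
      case (Pair s t)
      have "0 \<le> min s t powr (2 * H) / 2" by simp
      also have "\<dots> \<le> (t powr (2 * H) + s powr (2 * H) - \<bar>t - s\<bar> powr (2 * H)) / 2"
        using \<open>z \<in> _\<close> Pair by (intro *) auto
      finally show ?thesis by (simp add: Pair)
    qed
  next
    fix \<epsilon> :: real assume e: "0 < \<epsilon>"
    have "\<epsilon> powr (2 * H) / 2 \<le> (t powr (2 * H) + s powr (2 * H) - \<bar>t - s\<bar> powr (2 * H)) / 2" if "s \<in> {\<epsilon>..1}" "t \<in> {\<epsilon>..1}" for s t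
    proof -
      have "\<epsilon> powr (2 * H) \<le> min s t powr (2 * H)" using that e H by (intro powr_mono2) auto
      moreover have "min s t powr (2 * H) / 2 \<le> (t powr (2 * H) + s powr (2 * H) - \<bar>t - s\<bar> powr (2 * H)) / 2"
        using that e by (intro *) auto
      ultimately show ?thesis by linarith
    qed
    then have "\<forall>s\<in>{\<epsilon>..1}. \<forall>t\<in>{\<epsilon>..1}. \<epsilon> powr (2 * H) / 2 \<le> (case (s, t) of (s, t) \<Rightarrow> (t powr (2 * H) + s powr (2 * H) - \<bar>t - s\<bar> powr (2 * H)) / 2)"
      unfolding split_conv by blast
    moreover have "0 < \<epsilon> powr (2 * H) / 2" using e by simp
    ultimately show "\<exists>c>0. \<forall>s\<in>{\<epsilon>..1}. \<forall>t\<in>{\<epsilon>..1}. c \<le> (case (s, t) of (s, t) \<Rightarrow> (t powr (2 * H) + s powr (2 * H) - \<bar>t - s\<bar> powr (2 * H)) / 2)"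
      by blast
  qed
qed

lemma fbm_cov_continuous:
  assumes H: "0 < H"
  shows "continuous_on ({0..1} \<times> {0..1}) (\<lambda>(s, t). (t powr (2 * H) + s powr (2 * H) - \<bar>t - s\<bar> powr (2 * H)) / 2 :: real)"
proof -
  have p: "continuous_on ({0..1} \<times> {0..1}) (\<lambda>z. f z powr (2 * H))"
    if "continuous_on ({0..1} \<times> {0..1}) f" "\<And>z. z \<in> {0..1} \<times> {0..1} \<Longrightarrow> 0 \<le> f z" for f :: "real \<times> real \<Rightarrow> real"
    using that H by (intro continuous_on_powr' continuous_on_const) auto
  show ?thesis unfolding split_def
    by (intro continuous_on_divide continuous_on_diff continuous_on_add p continuous_on_rabs
        continuous_on_fst continuous_on_snd continuous_on_id continuous_on_const) auto
qed

definition incr_var :: "(real \<times> real \<Rightarrow> real) \<Rightarrow> real \<Rightarrow> real \<Rightarrow> real" where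
  "incr_var k s t = k (s, s) - k (s, t) - k (t, s) + k (t, t)"

lemma gauss_cov_increment:
  assumes g: "gauss_cov M B k" and M: "prob_space M" and st: "s \<in> {0..1}" "t \<in> {0..1}"
  shows "(\<integral>\<omega>. cis (\<xi> * (B t \<omega> - B s \<omega>)) \<partial>M) = complex_of_real (exp (- \<xi>\<^sup>2 * incr_var k s t / 2))"
proof (cases "s = t")
  case True
  interpret prob_space M by fact
  show ?thesis using True prob_space by (simp add: incr_var_def)
next
  case False
  have "(\<integral>\<omega>. cis (\<Sum>u\<in>{s, t}. (if u = t then \<xi> else - \<xi>) * B u \<omega>) \<partial>M)
    = complex_of_real (exp (- (\<Sum>u\<in>{s, t}. \<Sum>v\<in>{s, t}. (if u = t then \<xi> else - \<xi>) * (if v = t then \<xi> else - \<xi>) * k (u, v)) / 2))"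
    by (rule g[unfolded gauss_cov_def, THEN conjunct2, rule_format]) (use st in auto)
  moreover have S: "(\<Sum>u\<in>{s, t}. f u) = f s + f t" for f :: "real \<Rightarrow> real" using False by simp
  have "(\<Sum>u\<in>{s, t}. (if u = t then \<xi> else - \<xi>) * B u \<omega>) = \<xi> * (B t \<omega> - B s \<omega>)" for \<omega>
    unfolding S using False by (simp add: right_diff_distrib)
  moreover have "(\<Sum>u\<in>{s, t}. \<Sum>v\<in>{s, t}. (if u = t then \<xi> else - \<xi>) * (if v = t then \<xi> else - \<xi>) * k (u, v)) = \<xi>\<^sup>2 * incr_var k s t"
    unfolding S incr_var_def using False by (simp add: algebra_simps power2_eq_square)
  ultimately show ?thesis by (simp only: minus_mult_left)
qed

text \<open>The invariant of the recursion: a continuous positive kernel is what the next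
  integration asks for, and it is reproduced by it. The variance of increments is known exactly at
  the base; after an integration only a quadratic lower bound on the central time window is
  kept.\<close>

lemma fbm_real_structure:
  assumes "fbm_real M H B" and M: "prob_space M"
  shows "(AE \<omega> in M. continuous_on {0..1} (\<lambda>t. B t \<omega>)) \<and>
    (\<exists>k. continuous_on ({0..1} \<times> {0..1}) k \<and> positive_kernel k \<and> gauss_cov M B k \<and>
      (0 < H \<and> H < 1 \<and> (\<forall>s\<in>{0..1}. \<forall>t\<in>{0..1}. incr_var k s t = \<bar>t - s\<bar> powr (2 * H))
       \<or> 1 < H \<and> (\<exists>c>0. \<forall>s\<in>{3/10..7/10}. \<forall>t\<in>{3/10..7/10}. c * (t - s)\<^sup>2 \<le> incr_var k s t)))"
  using assms(1)
proof induction
  case (base H B)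
  let ?k = "\<lambda>(s, t). (t powr (2 * H) + s powr (2 * H) - \<bar>t - s\<bar> powr (2 * H)) / 2"
  have "gauss_cov M B ?k"
    by (rule gauss_cov_cong[OF gaussian_process_gauss_cov[OF M base(3) base(4)]]) (use base(5) in auto)
  moreover have "incr_var ?k s t = \<bar>t - s\<bar> powr (2 * H)" for s t
    by (simp add: incr_var_def abs_minus_commute[of s t]) (simp add: field_simps)
  ultimately show ?case
    using base(1,2,6) fbm_cov_continuous[OF base(1)] fbm_cov_positive_kernel[OF base(1)]
    by (intro conjI exI[of _ ?k] disjI1 ballI)
next
  case (step H B B')
  from step.IH obtain k where k: "continuous_on ({0..1} \<times> {0..1}) k" "positive_kernel k" "gauss_cov M B k"
    and path: "AE \<omega> in M. continuous_on {0..1} (\<lambda>t. B t \<omega>)" and H: "0 < H" by auto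
  have "gauss_cov M B' (int_cov k)"
    by (rule gauss_cov_integral[OF M k(3,1) path step.hyps(2) step.hyps(3)])
  moreover have "AE \<omega> in M. continuous_on {0..1} (\<lambda>t. B' t \<omega>)"
    using path step.hyps(3)
  proof eventually_elim
    case (elim \<omega>)
    have "continuous_on {0..1} (\<lambda>t. integral {0..t} (\<lambda>r. B r \<omega>))"
      by (intro indefinite_integral_continuous_1 integrable_continuous_real elim)
    then show ?case by (rule continuous_on_eq) (use elim(2) in auto)
  qed
  moreover have "\<exists>c>0. \<forall>s\<in>{3/10..7/10}. \<forall>t\<in>{3/10..7/10}. c * (t - s)\<^sup>2 \<le> incr_var (int_cov k) s t"
    unfolding incr_var_def by (rule int_cov_increment[OF k(1,2)])
  ultimately show ?case
    using continuous_on_int_cov[OF k(1)] positive_kernel_int_cov[OF k(1,2)] H by auto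
qed

section \<open>Decorrelation of the noise\<close>

text \<open>The term of order n in the exponential series, with \<tau> * n at least 2, dominates the
  square of \<open>z\<close>. One Cauchy profile thus serves all noises, whatever the shape of their
  characteristic functions.\<close>

lemma exp_powr_decay:
  assumes "0 < \<tau>" "0 < (c :: real)"
  shows "\<exists>C\<ge>0. \<forall>z\<ge>0. exp (- (c * z powr \<tau>)) \<le> C / (1 + z\<^sup>2)"
proof -
  define n where "n = nat \<lceil>2 / \<tau>\<rceil>"
  have n: "2 \<le> \<tau> * real n"
  proof -
    have "2 / \<tau> \<le> real n" unfolding n_def by (rule real_nat_ceiling_ge)
    then show ?thesis using assms by (simp add: field_simps)
  qed
  have *: "(1 + z\<^sup>2) * exp (- (c * z powr \<tau>)) \<le> 2 + fact n / c ^ n" if z: "0 \<le> z" for z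
  proof (cases "z \<le> 1")
    case True
    then have "z\<^sup>2 \<le> 1" using z by (simp add: power_le_one)
    then have "(1 + z\<^sup>2) * exp (- (c * z powr \<tau>)) \<le> 2 * 1" using assms by (intro mult_mono) auto
    moreover have "0 \<le> fact n / c ^ n" using assms by simp
    ultimately show ?thesis by linarith
  next
    case False
    define y where "y = c * z powr \<tau>"
    have y0: "0 \<le> y" using assms by (simp add: y_def)
    have "y ^ n / fact n \<le> exp y"
    proof -
      have "(\<lambda>k. y ^ k / fact k) sums exp y" using exp_converges[of y] by (simp add: field_simps)
      then have "sum (\<lambda>k. y ^ k / fact k) {n} \<le> exp y"
        using y0 sum_le_suminf[of "\<lambda>k. y ^ k / fact k" "{n}"] by (auto simp: sums_iff)
      then show ?thesis by simp
    qed
    then have 1: "y ^ n \<le> fact n * exp y" by (simp add: field_simps)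
    have "z\<^sup>2 = z powr 2" using False by (simp add: powr_numeral)
    also have "\<dots> \<le> z powr (\<tau> * real n)" using False n by (intro powr_mono) auto
    also have "\<dots> = (z powr \<tau>) ^ n" using False by (simp add: powr_powr[symmetric] powr_realpow)
    also have "\<dots> = y ^ n / c ^ n" using assms by (simp add: y_def power_mult_distrib)
    also have "\<dots> \<le> fact n * exp y / c ^ n" using 1 assms by (intro divide_right_mono) auto
    finally have "z\<^sup>2 * exp (- y) \<le> fact n * exp y / c ^ n * exp (- y)" by (intro mult_right_mono) auto
    also have "\<dots> = fact n / c ^ n" by (simp add: exp_minus)
    finally have "z\<^sup>2 * exp (- y) \<le> fact n / c ^ n" .
    moreover have "exp (- y) \<le> 1" using y0 by simp
    moreover have "(1 + z\<^sup>2) * exp (- y) = exp (- y) + z\<^sup>2 * exp (- y)" by (simp only: distrib_right mult_1)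
    ultimately show ?thesis unfolding y_def[symmetric] by linarith
  qed
  have "exp (- (c * z powr \<tau>)) \<le> (2 + fact n / c ^ n) / (1 + z\<^sup>2)" if z: "0 \<le> z" for z
    using *[OF z] by (simp add: pos_le_divide_eq mult.commute add_pos_nonneg)
  then show ?thesis using assms by (intro exI[of _ "2 + fact n / c ^ n"]) auto
qed

text \<open>Frequency \<xi> is forgotten after a time of order \<xi> powr (-p). The profile is that
  of the Cauchy density, whose integral over time is explicit. The window around 1/2 contains the
  fast shears of all late stages and avoids time 0, near which increments of integrated processes
  degenerate.\<close>

definition decorrelating :: "'w measure \<Rightarrow> (real \<Rightarrow> 'w \<Rightarrow> real) \<Rightarrow> real \<Rightarrow> bool" where
  "decorrelating M B p \<longleftrightarrow> 0 < p \<and> (\<exists>L>0. \<exists>C\<ge>0. \<forall>s\<in>{3/10..7/10}. \<forall>t\<in>{3/10..7/10}. \<forall>\<xi>>0.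
     cmod (\<integral>\<omega>. cis (\<xi> * (B t \<omega> - B s \<omega>)) \<partial>M) \<le> C / (1 + (L * \<xi> powr p * \<bar>t - s\<bar>)\<^sup>2))"

text \<open>What continuous and cadlag paths share: right continuity yields a jointly measurable
  version, and boundedness makes \<open>kappa a q\<close> times the noise uniformly small.\<close>

definition regular_paths :: "'w measure \<Rightarrow> (real \<Rightarrow> 'w \<Rightarrow> pt) \<Rightarrow> bool" where
  "regular_paths M W \<longleftrightarrow> (\<forall>t\<in>{0..1}. W t \<in> borel_measurable M) \<and>
     (AE \<omega> in M. (\<forall>t\<in>{0..<1}. ((\<lambda>t. W t \<omega>) \<longlongrightarrow> W t \<omega>) (at_right t)) \<and> bounded ((\<lambda>t. W t \<omega>) ` {0..1}))"

section \<open>Path regularity and decorrelation of the two classes of noise\<close>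

lemma continuous_path_regular:
  fixes f :: "real \<Rightarrow> pt"
  assumes "continuous_on {0..1} f"
  shows "(\<forall>t\<in>{0..<1}. (f \<longlongrightarrow> f t) (at_right t)) \<and> bounded (f ` {0..1})"
proof
  show "bounded (f ` {0..1})"
    by (intro compact_imp_bounded compact_continuous_image assms) auto
  show "\<forall>t\<in>{0..<1}. (f \<longlongrightarrow> f t) (at_right t)"
  proof
    fix t :: real assume t: "t \<in> {0..<1}"
    have "(f \<longlongrightarrow> f t) (at t within {0..1})" using assms t by (auto simp: continuous_on_def)
    then have "(f \<longlongrightarrow> f t) (at t within {t..1})" by (rule tendsto_within_subset) (use t in auto)
    then show "(f \<longlongrightarrow> f t) (at_right t)" using at_within_Icc_at_right[of t 1] t by simp
  qed
qed

text \<open>One-sided limits bound the path near each point, and finitely many such neighbourhoods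
  cover [0, 1].\<close>

lemma cadlag_bounded:
  assumes "cadlag f"
  shows "bounded (f ` {0..1})"
proof -
  have "\<exists>U. open U \<and> t \<in> U \<and> bounded (f ` (U \<inter> {0..1}))" if t: "t \<in> {0..1}" for t
  proof -
    have r: "\<exists>b>t. bounded (f ` ({t<..<b} \<inter> {0..1}))"
    proof (cases "t < 1")
      case True
      then have "(f \<longlongrightarrow> f t) (at_right t)" using assms t by (auto simp: cadlag_def)
      then have "eventually (\<lambda>y. dist (f y) (f t) < 1) (at_right t)" by (rule tendstoD) simp
      then obtain b where b: "b > t" "\<And>y. t < y \<Longrightarrow> y < b \<Longrightarrow> dist (f y) (f t) < 1"
        unfolding eventually_at_right_field by auto
      then have "f ` ({t<..<b} \<inter> {0..1}) \<subseteq> cball (f t) 1" by (auto simp: dist_commute less_imp_le)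
      then show ?thesis using b(1) bounded_cball bounded_subset by blast
    next
      case False
      then have "{t<..<t+1} \<inter> {0..1} = {}" by auto
      then show ?thesis by (intro exI[of _ "t + 1"]) auto
    qed
    have l: "\<exists>b<t. bounded (f ` ({b<..<t} \<inter> {0..1}))"
    proof (cases "0 < t")
      case True
      then obtain l where "(f \<longlongrightarrow> l) (at_left t)" using assms t unfolding cadlag_def
        by (metis atLeastAtMost_iff greaterThanAtMost_iff)
      then have "eventually (\<lambda>y. dist (f y) l < 1) (at_left t)" by (rule tendstoD) simp
      then obtain b where b: "b < t" "\<And>y. b < y \<Longrightarrow> y < t \<Longrightarrow> dist (f y) l < 1"
        unfolding eventually_at_left_field by auto
      then have "f ` ({b<..<t} \<inter> {0..1}) \<subseteq> cball l 1" by (auto simp: dist_commute less_imp_le)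
      then show ?thesis using b(1) bounded_cball bounded_subset by blast
    next
      case False
      then have "{t-1<..<t} \<inter> {0..1} = {}" by auto
      then show ?thesis by (intro exI[of _ "t - 1"]) auto
    qed
    from r l obtain b b' where bb: "b > t" "b' < t" "bounded (f ` ({t<..<b} \<inter> {0..1}))" "bounded (f ` ({b'<..<t} \<inter> {0..1}))"
      by blast
    have "f ` ({b'<..<b} \<inter> {0..1}) \<subseteq> f ` ({t<..<b} \<inter> {0..1}) \<union> f ` ({b'<..<t} \<inter> {0..1}) \<union> {f t}"
      using linorder_less_linear[of _ t] by fastforce
    moreover have "bounded \<dots>" using bb by simp
    ultimately have "bounded (f ` ({b'<..<b} \<inter> {0..1}))" using bounded_subset by blast
    then show ?thesis using bb by (intro exI[of _ "{b'<..<b}"]) auto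
  qed
  then obtain U where U: "\<And>t. t \<in> {0..1} \<Longrightarrow> open (U t) \<and> t \<in> U t \<and> bounded (f ` (U t \<inter> {0..1}))" by metis
  obtain D where D: "D \<subseteq> {0..1}" "finite D" "{0..1} \<subseteq> (\<Union>t\<in>D. U t)"
    by (rule compactE_image[of "{0..1::real}" "{0..1}" U]) (use U in auto)
  have "f ` {0..1} \<subseteq> (\<Union>t\<in>D. f ` (U t \<inter> {0..1}))" using D(3) by blast
  moreover have "bounded \<dots>" using D U by (intro bounded_UN) auto
  ultimately show ?thesis using bounded_subset by blast
qed

lemma fbm_regular:
  assumes M: "prob_space M" and f: "fbm M H W"
  shows "regular_paths M W"
proof -
  from f have f1: "fbm_real M H (\<lambda>t \<omega>. fst (W t \<omega>))" and f2: "fbm_real M H (\<lambda>t \<omega>. snd (W t \<omega>))"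
    by (auto simp: fbm_def)
  from fbm_real_structure[OF f1 M] obtain k1 where 1: "AE \<omega> in M. continuous_on {0..1} (\<lambda>t. fst (W t \<omega>))"
    "gauss_cov M (\<lambda>t \<omega>. fst (W t \<omega>)) k1" by blast
  from fbm_real_structure[OF f2 M] obtain k2 where 2: "AE \<omega> in M. continuous_on {0..1} (\<lambda>t. snd (W t \<omega>))"
    "gauss_cov M (\<lambda>t \<omega>. snd (W t \<omega>)) k2" by blast
  show ?thesis unfolding regular_paths_def
  proof
    show "\<forall>t\<in>{0..1}. W t \<in> borel_measurable M"
    proof
      fix t :: real assume "t \<in> {0..1}"
      then have "(\<lambda>\<omega>. (fst (W t \<omega>), snd (W t \<omega>))) \<in> borel_measurable M"
        using 1(2) 2(2) by (intro borel_measurable_Pair) (auto simp: gauss_cov_def)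
      then show "W t \<in> borel_measurable M" by simp
    qed
    show "AE \<omega> in M. (\<forall>t\<in>{0..<1}. ((\<lambda>t. W t \<omega>) \<longlongrightarrow> W t \<omega>) (at_right t)) \<and> bounded ((\<lambda>t. W t \<omega>) ` {0..1})"
      using 1(1) 2(1)
    proof eventually_elim
      case (elim \<omega>)
      have "continuous_on {0..1} (\<lambda>t. (fst (W t \<omega>), snd (W t \<omega>)))" using elim by (intro continuous_on_Pair)
      then show ?case by (intro continuous_path_regular) simp
    qed
  qed
qed

text \<open>For H < 1 the exponent of the characteristic function is, up to the factor 1/2, the
  power 2 * H of \<open>\<xi> powr (1 / H) * \<bar>t - s\<bar>\<close>, whence p = 1/H. For H > 1
  the paths are differentiable, and the quadratic lower bound on the variance gives the ballistic
  exponent 1.\<close>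

lemma fbm_decorrelating:
  assumes M: "prob_space M" and f: "fbm M H W"
  shows "decorrelating M (\<lambda>t \<omega>. snd (W t \<omega>)) (if H < 1 then 1 / H else 1)" "0 < H"
proof -
  from f have f2: "fbm_real M H (\<lambda>t \<omega>. snd (W t \<omega>))" by (auto simp: fbm_def)
  from fbm_real_structure[OF f2 M] obtain k where
    g: "gauss_cov M (\<lambda>t \<omega>. snd (W t \<omega>)) k" and
    alt: "0 < H \<and> H < 1 \<and> (\<forall>s\<in>{0..1}. \<forall>t\<in>{0..1}. incr_var k s t = \<bar>t - s\<bar> powr (2 * H))
       \<or> 1 < H \<and> (\<exists>c>0. \<forall>s\<in>{3/10..7/10}. \<forall>t\<in>{3/10..7/10}. c * (t - s)\<^sup>2 \<le> incr_var k s t)" by blast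
  show H: "0 < H" using alt by auto
  have inc: "cmod (\<integral>\<omega>. cis (\<xi> * (snd (W t \<omega>) - snd (W s \<omega>))) \<partial>M) = exp (- \<xi>\<^sup>2 * incr_var k s t / 2)"
    if "s \<in> {3/10..7/10}" "t \<in> {3/10..7/10}" for s t \<xi>
    using gauss_cov_increment[OF g M, of s t \<xi>] that by (simp del: of_real_exp)
  from alt show "decorrelating M (\<lambda>t \<omega>. snd (W t \<omega>)) (if H < 1 then 1 / H else 1)"
  proof (elim disjE conjE exE)
    assume H: "0 < H" "H < 1" and v: "\<forall>s\<in>{0..1}. \<forall>t\<in>{0..1}. incr_var k s t = \<bar>t - s\<bar> powr (2 * H)"
    obtain C where C: "0 \<le> C" "\<And>z. 0 \<le> z \<Longrightarrow> exp (- (1/2 * z powr (2 * H))) \<le> C / (1 + z\<^sup>2)"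
      using exp_powr_decay[of "2 * H" "1/2"] H by auto
    have "cmod (\<integral>\<omega>. cis (\<xi> * (snd (W t \<omega>) - snd (W s \<omega>))) \<partial>M) \<le> C / (1 + (1 * \<xi> powr (1 / H) * \<bar>t - s\<bar>)\<^sup>2)"
      if st: "s \<in> {3/10..7/10}" "t \<in> {3/10..7/10}" "0 < \<xi>" for s t \<xi>
    proof -
      have "(\<xi> powr (1 / H) * \<bar>t - s\<bar>) powr (2 * H) = \<xi>\<^sup>2 * \<bar>t - s\<bar> powr (2 * H)"
        using H st by (simp add: powr_mult powr_powr powr_numeral)
      then have "cmod (\<integral>\<omega>. cis (\<xi> * (snd (W t \<omega>) - snd (W s \<omega>))) \<partial>M) = exp (- (1/2 * (\<xi> powr (1 / H) * \<bar>t - s\<bar>) powr (2 * H)))"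
        unfolding inc[OF st(1,2)] using v st by simp
      then show ?thesis using C(2)[of "\<xi> powr (1 / H) * \<bar>t - s\<bar>"] by simp
    qed
    then show ?thesis unfolding decorrelating_def using H C(1)
      by (intro conjI exI[of _ 1] exI[of _ C]) auto
  next
    fix c assume H: "1 < H" and c: "0 < c" "\<forall>s\<in>{3/10..7/10}. \<forall>t\<in>{3/10..7/10}. c * (t - s)\<^sup>2 \<le> incr_var k s t"
    obtain C where C: "0 \<le> C" "\<And>z. 0 \<le> z \<Longrightarrow> exp (- (c/2 * z powr 2)) \<le> C / (1 + z\<^sup>2)"
      using exp_powr_decay[of 2 "c/2"] c by auto
    have "cmod (\<integral>\<omega>. cis (\<xi> * (snd (W t \<omega>) - snd (W s \<omega>))) \<partial>M) \<le> C / (1 + (1 * \<xi> powr 1 * \<bar>t - s\<bar>)\<^sup>2)"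
      if st: "s \<in> {3/10..7/10}" "t \<in> {3/10..7/10}" "0 < \<xi>" for s t \<xi>
    proof -
      have "\<xi>\<^sup>2 * (c * (t - s)\<^sup>2) \<le> \<xi>\<^sup>2 * incr_var k s t" using c st by (intro mult_left_mono) auto
      moreover have "(\<xi> * \<bar>t - s\<bar>) powr 2 = \<xi>\<^sup>2 * (t - s)\<^sup>2"
        using st by (cases "t = s") (auto simp: powr_numeral power_mult_distrib)
      ultimately have "exp (- \<xi>\<^sup>2 * incr_var k s t / 2) \<le> exp (- (c/2 * (\<xi> * \<bar>t - s\<bar>) powr 2))"
        by (simp add: mult_ac)
      also have "\<dots> \<le> C / (1 + (\<xi> * \<bar>t - s\<bar>)\<^sup>2)" using st by (intro C(2)) auto
      finally show ?thesis unfolding inc[OF st(1,2)] using st by simp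
    qed
    then show ?thesis unfolding decorrelating_def using H C(1)
      by (intro conjI exI[of _ 1] exI[of _ C]) auto
  qed
qed

lemma stable_decorrelating:
  assumes M: "prob_space M" and f: "stable_process M \<beta> W" and b: "0 < \<beta>"
  shows "decorrelating M (\<lambda>t \<omega>. snd (W t \<omega>)) \<beta>"
proof -
  obtain C where C: "0 \<le> C" "\<And>z. 0 \<le> z \<Longrightarrow> exp (- (1/2 * z powr 1)) \<le> C / (1 + z\<^sup>2 :: real)"
    using exp_powr_decay[of 1 "1/2"] by auto
  \<comment> \<open>The factor 1/2 is that of standard Brownian motion, \<beta> = 2; for the other
    exponents it is a harmless loss.\<close>
  have se: "1/2 * \<xi> powr \<beta> \<le> stable_exponent \<beta> (0, \<xi>)" if "0 < \<xi>" for \<xi>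
    using that by (simp add: stable_exponent_def norm_Pair powr_numeral)
  have *: "cmod (\<integral>\<omega>. cis (\<xi> * (snd (W t \<omega>) - snd (W s \<omega>))) \<partial>M) \<le> C / (1 + (1 * \<xi> powr \<beta> * \<bar>t - s\<bar>)\<^sup>2)"
    if st: "s \<in> {3/10..7/10}" "t \<in> {3/10..7/10}" "0 < \<xi>" "s \<le> t" for s t \<xi>
  proof -
    have "(\<integral>\<omega>. cis (inner (0, \<xi>) (W t \<omega> - W s \<omega>)) \<partial>M) = complex_of_real (exp (- ((t - s) * stable_exponent \<beta> (0, \<xi>))))"
    proof -
      have "\<forall>s t \<xi>. 0 \<le> s \<and> s \<le> t \<and> t \<le> 1 \<longrightarrow>
        (\<integral>\<omega>. cis (inner \<xi> (W t \<omega> - W s \<omega>)) \<partial>M) = complex_of_real (exp (- ((t - s) * stable_exponent \<beta> \<xi>)))"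
        using f unfolding stable_process_def by (elim conjE) assumption
      then show ?thesis using st by simp
    qed
    moreover have "inner (0, \<xi>) (W t \<omega> - W s \<omega>) = \<xi> * (snd (W t \<omega>) - snd (W s \<omega>))" for \<omega>
      by (simp add: inner_prod_def)
    ultimately have "cmod (\<integral>\<omega>. cis (\<xi> * (snd (W t \<omega>) - snd (W s \<omega>))) \<partial>M) = exp (- ((t - s) * stable_exponent \<beta> (0, \<xi>)))"
      by (simp del: of_real_exp)
    also have "\<dots> \<le> exp (- (1/2 * (\<xi> powr \<beta> * \<bar>t - s\<bar>) powr 1))"
      using mult_left_mono[OF se[OF st(3)], of "t - s"] st by (simp add: mult_ac)
    also have "\<dots> \<le> C / (1 + (\<xi> powr \<beta> * \<bar>t - s\<bar>)\<^sup>2)" by (intro C(2)) auto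
    finally show ?thesis by simp
  qed
  have "cmod (\<integral>\<omega>. cis (\<xi> * (snd (W t \<omega>) - snd (W s \<omega>))) \<partial>M) \<le> C / (1 + (1 * \<xi> powr \<beta> * \<bar>t - s\<bar>)\<^sup>2)"
    if st: "s \<in> {3/10..7/10}" "t \<in> {3/10..7/10}" "0 < \<xi>" for s t \<xi>
  proof (cases "s \<le> t")
    case False
    \<comment> \<open>Reversing an increment conjugates its characteristic function, so the order of
      the two times is immaterial.\<close>
    have "cis (\<xi> * (snd (W t \<omega>) - snd (W s \<omega>))) = cnj (cis (\<xi> * (snd (W s \<omega>) - snd (W t \<omega>))))" for \<omega>
      by (simp add: cis_cnj algebra_simps)
    then have "(\<integral>\<omega>. cis (\<xi> * (snd (W t \<omega>) - snd (W s \<omega>))) \<partial>M) = cnj (\<integral>\<omega>. cis (\<xi> * (snd (W s \<omega>) - snd (W t \<omega>))) \<partial>M)"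
      by (simp only: Bochner_Integration.integral_cnj)
    then show ?thesis using *[of t s \<xi>] st False by (simp add: abs_minus_commute)
  qed (use * st in auto)
  then show ?thesis unfolding decorrelating_def using b C(1)
    by (intro conjI exI[of _ 1] exI[of _ C]) auto
qed

lemma stable_regular:
  assumes "stable_process M \<beta> W"
  shows "regular_paths M W"
  unfolding regular_paths_def
proof
  show "\<forall>t\<in>{0..1}. W t \<in> borel_measurable M" using assms by (auto simp: stable_process_def)
  have "AE \<omega> in M. if \<beta> = 2 then continuous_on {0..1} (\<lambda>t. W t \<omega>) else cadlag (\<lambda>t. W t \<omega>)"
    using assms by (simp only: stable_process_def)
  then show "AE \<omega> in M. (\<forall>t\<in>{0..<1}. ((\<lambda>t. W t \<omega>) \<longlongrightarrow> W t \<omega>) (at_right t)) \<and> bounded ((\<lambda>t. W t \<omega>) ` {0..1})"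
  proof eventually_elim
    case (elim \<omega>)
    then show ?case using continuous_path_regular cadlag_bounded by (auto simp: cadlag_def split: if_splits)
  qed
qed

text \<open>The exponent p condenses \<open>admissible_gamma\<close> into 1 - \<gamma> < p/4. For p
  = \<beta>, and for p = 1/H with 1/2 \<le> H < 1, this is the lower bound on \<gamma> itself; for H
  < 1/2 one has p/4 > 1/2 > 1 - \<gamma>; for H > 1 the bound forces \<gamma> > 3/4, which is enough
  for p = 1.\<close>

lemma noise_properties:
  assumes "prob_space M" "valid_noise N" "is_noise N M W" "admissible_gamma N \<gamma>"
  shows "regular_paths M W" "\<exists>p. decorrelating M (\<lambda>t \<omega>. snd (W t \<omega>)) p \<and> 1 - \<gamma> < p / 4" "1/2 < \<gamma>" "\<gamma> < 1"
proof -
  show "regular_paths M W"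
    using assms(1,3) by (cases N) (simp_all only: is_noise.simps fbm_regular stable_regular)
  show "1/2 < \<gamma>" using assms(4)
    by (cases N) (simp_all only: admissible_gamma.simps max_less_iff_conj split: if_splits)
  show "\<gamma> < 1" using assms(4) by (cases N) simp_all
  show "\<exists>p. decorrelating M (\<lambda>t \<omega>. snd (W t \<omega>)) p \<and> 1 - \<gamma> < p / 4"
  proof (cases N)
    case (Stable \<beta>)
    then show ?thesis using stable_decorrelating[of M \<beta> W] assms by (intro exI[of _ \<beta>]) auto
  next
    case (FBM H)
    then have f: "fbm M H W" using assms by simp
    note d = fbm_decorrelating[OF assms(1) f]
    have "H \<noteq> 1" using assms(2) FBM by auto
    have "1 - \<gamma> < (if H < 1 then 1 / H else 1) / 4"
    proof (cases "H < 1/2")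
      case True
      then have "2 < 1 / H" using d(2) by (simp add: field_simps)
      then show ?thesis using assms(4) FBM True by simp
    next
      case False
      then have g: "1 - 1 / (4 * H) < \<gamma>" using assms(4) FBM by simp
      show ?thesis
      proof (cases "H < 1")
        case False
        then have "1 / (4 * H) \<le> 1 / 4" using \<open>H \<noteq> 1\<close> by (intro divide_left_mono) auto
        then have "3 / 4 < \<gamma>" using g by linarith
        then show ?thesis using False by simp
      qed (use g in simp)
    qed
    then show ?thesis using d by blast
  qed
qed

section \<open>Averaging a fast square wave along the noise\<close>

lemma integral_cauchy_density:
  assumes "0 < K"
  shows "integrable lborel (\<lambda>t. 1 / (1 + (K * \<bar>t - s\<bar>)\<^sup>2))"
    "(\<integral>t. 1 / (1 + (K * \<bar>t - s\<bar>)\<^sup>2) \<partial>lborel) = pi / K"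
proof -
  have eq: "1 / (1 + (K * \<bar>t - s\<bar>)\<^sup>2) = inverse (1 + (- K * s + K * t)\<^sup>2)" for t
  proof -
    have "(K * \<bar>t - s\<bar>)\<^sup>2 = (- K * s + K * t)\<^sup>2"
      by (simp add: power_mult_distrib) (simp add: power2_eq_square algebra_simps)
    then show ?thesis by (simp add: inverse_eq_divide)
  qed
  have "integrable lborel (\<lambda>x::real. inverse (1 + x\<^sup>2))"
    using integrable_inverse_1_plus_square by (simp add: set_integrable_def einterval_def)
  then show "integrable lborel (\<lambda>t. 1 / (1 + (K * \<bar>t - s\<bar>)\<^sup>2))"
    unfolding eq using assms by (subst lborel_integrable_real_affine_iff) auto
  have "(\<integral>x. inverse (1 + x\<^sup>2) \<partial>lborel) = pi"
    using LBINT_inverse_1_plus_square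
    by (simp add: interval_lebesgue_integral_def set_lebesgue_integral_def einterval_def)
  then show "(\<integral>t. 1 / (1 + (K * \<bar>t - s\<bar>)\<^sup>2) \<partial>lborel) = pi / K"
    unfolding eq using lborel_integral_real_affine[of K "\<lambda>x. inverse (1 + x\<^sup>2)" "- K * s"] assms
    by (simp add: field_simps)
qed

text \<open>The second moment of the oscillatory integral is a double time integral of correlations,
  each below the Cauchy profile. Bounding one of the weights by \<open>E\<close> and integrating its
  time over the whole line gives pi / K, and Cauchy-Schwarz passes to the first moment.\<close>

lemma mean_oscillation:
  fixes e :: "real \<Rightarrow> real" and V :: "real \<Rightarrow> 'w \<Rightarrow> real"
  assumes M: "prob_space M"
    and V: "(\<lambda>(t, \<omega>). V t \<omega>) \<in> borel_measurable (lborel \<Otimes>\<^sub>M M)"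
    and e: "integrable lborel e" "(\<integral>t. e t \<partial>lborel) = 1" "\<And>t. 0 \<le> e t" "\<And>t. e t \<le> E" "\<And>t. e t \<noteq> 0 \<Longrightarrow> t \<in> I"
    and K: "0 < K" and C: "0 \<le> C"
    and dec: "\<And>s t. s \<in> I \<Longrightarrow> t \<in> I \<Longrightarrow> cmod (\<integral>\<omega>. cis (\<xi> * (V t \<omega> - V s \<omega>)) \<partial>M) \<le> C / (1 + (K * \<bar>t - s\<bar>)\<^sup>2)"
  shows "(\<integral>\<omega>. cmod (\<integral>t. e t *\<^sub>R cis (\<xi> * V t \<omega>) \<partial>lborel) \<partial>M) \<le> sqrt (E * C * pi / K)"
    and "(\<lambda>\<omega>. cmod (\<integral>t. e t *\<^sub>R cis (\<xi> * V t \<omega>) \<partial>lborel)) \<in> borel_measurable M"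
    and "cmod (\<integral>t. e t *\<^sub>R cis (\<xi> * V t \<omega>) \<partial>lborel) \<le> 1"
proof -
  interpret M: prob_space M by fact
  have em [measurable]: "e \<in> borel_measurable borel" using e(1) by auto
  have E0: "0 \<le> E" using e(3,4)[of 0] by linarith
  \<comment> \<open>With \<open>e\<close> read as a probability measure in time, the product with
    \<open>M\<close> is a probability space: bounded integrands are integrable there and Fubini
    applies.\<close>
  define D where "D = density lborel (\<lambda>t. ennreal (e t))"
  have sD [measurable_cong]: "sets D = sets borel" by (simp add: D_def)
  have "emeasure D (space D) = ennreal (\<integral>t. e t \<partial>lborel)"
    unfolding D_def using e(1,3) by (simp add: emeasure_density nn_integral_eq_integral)
  then interpret D: prob_space D using e(2) by (intro prob_spaceI) simp
  interpret P: pair_prob_space D M ..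
  have Dint: "(\<integral>t. f t \<partial>D) = (\<integral>t. e t *\<^sub>R f t \<partial>lborel)" if "f \<in> borel_measurable borel" for f :: "real \<Rightarrow> 'b :: {banach, second_countable_topology}"
    unfolding D_def using that e(3) by (subst integral_density) auto
  have AED: "AE t in D. t \<in> I"
    unfolding D_def using e(5) by (subst AE_density) (auto simp: ennreal_eq_0_iff)
  have Vm: "(\<lambda>x. V (fst x) (snd x)) \<in> borel_measurable (D \<Otimes>\<^sub>M M)"
  proof -
    have "sets (D \<Otimes>\<^sub>M M) = sets (lborel \<Otimes>\<^sub>M M)" by (intro sets_pair_measure_cong) (auto simp: sD)
    then show ?thesis using V by (simp add: split_def cong: measurable_cong_sets)
  qed
  have Vt [measurable]: "V t \<in> borel_measurable M" for t
    using measurable_compose[OF measurable_Pair1'[of t D M] Vm] by (simp add: D_def)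
  have V\<omega> [measurable]: "(\<lambda>t. V t \<omega>) \<in> borel_measurable borel" if "\<omega> \<in> space M" for \<omega>
    using measurable_compose[OF measurable_Pair2'[of \<omega> M D] Vm] that by (simp add: sD cong: measurable_cong_sets)
  define Z where "Z = (\<lambda>\<omega>. \<integral>t. cis (\<xi> * V t \<omega>) \<partial>D)"
  have Zeq: "(\<integral>t. e t *\<^sub>R cis (\<xi> * V t \<omega>) \<partial>lborel) = Z \<omega>" if "\<omega> \<in> space M" for \<omega>
    unfolding Z_def using that by (subst Dint) auto
  have Zm [measurable]: "Z \<in> borel_measurable M"
  proof -
    have "(\<lambda>x. cis (\<xi> * V (snd x) (fst x))) \<in> borel_measurable (M \<Otimes>\<^sub>M D)"
      by (intro measurable_compose[OF _ cis_measurable] borel_measurable_times borel_measurable_const)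
        (use measurable_compose[OF measurable_pair_swap' Vm] in \<open>simp add: split_def\<close>)
    then show ?thesis unfolding Z_def by (intro D.borel_measurable_lebesgue_integral) (simp add: split_def)
  qed
  have Z1: "cmod (Z \<omega>) \<le> 1" for \<omega>
  proof -
    have "cmod (Z \<omega>) \<le> (\<integral>t. cmod (cis (\<xi> * V t \<omega>)) \<partial>D)" unfolding Z_def by (rule integral_norm_bound)
    then show ?thesis by (simp add: D.prob_space)
  qed
  show "(\<lambda>\<omega>. cmod (\<integral>t. e t *\<^sub>R cis (\<xi> * V t \<omega>) \<partial>lborel)) \<in> borel_measurable M"
    by (subst measurable_cong[OF arg_cong[OF Zeq, of _ cmod]]) auto
  show "cmod (\<integral>t. e t *\<^sub>R cis (\<xi> * V t \<omega>) \<partial>lborel) \<le> 1"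
  proof -
    have "cmod (\<integral>t. e t *\<^sub>R cis (\<xi> * V t \<omega>) \<partial>lborel) \<le> (\<integral>t. cmod (e t *\<^sub>R cis (\<xi> * V t \<omega>)) \<partial>lborel)"
      by (rule integral_norm_bound)
    then show ?thesis using e by simp
  qed
  have inner: "cmod (\<integral>\<omega>. Z \<omega> * cis (- (\<xi> * V s \<omega>)) \<partial>M) \<le> E * C * pi / K" if s: "s \<in> I" for s
  proof -
    have m: "(\<lambda>x. cis (\<xi> * (V (fst x) (snd x) - V s (snd x)))) \<in> borel_measurable (D \<Otimes>\<^sub>M M)"
      by (intro measurable_compose[OF _ cis_measurable] borel_measurable_times borel_measurable_const borel_measurable_diff Vm
          measurable_compose[OF measurable_snd Vt])
    have "(\<integral>\<omega>. Z \<omega> * cis (- (\<xi> * V s \<omega>)) \<partial>M) = (\<integral>\<omega>. (\<integral>t. cis (\<xi> * (V t \<omega> - V s \<omega>)) \<partial>D) \<partial>M)"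
      unfolding Z_def by (intro Bochner_Integration.integral_cong refl)
        (simp add: cis_mult right_diff_distrib flip: integral_mult_left_zero)
    also have "\<dots> = (\<integral>t. (\<integral>\<omega>. cis (\<xi> * (V t \<omega> - V s \<omega>)) \<partial>M) \<partial>D)"
      by (rule P.Fubini_integral) (rule P.P.integrable_const_bound[of _ 1], use m in \<open>auto simp: split_def\<close>)
    also have "cmod \<dots> \<le> (\<integral>t. C / (1 + (K * \<bar>t - s\<bar>)\<^sup>2) \<partial>D)"
    proof (rule order_trans[OF integral_norm_bound integral_mono_AE])
      show "integrable D (\<lambda>t. cmod (\<integral>\<omega>. cis (\<xi> * (V t \<omega> - V s \<omega>)) \<partial>M))"
        by (rule integrable_norm, rule P.integrable_fst'[of "\<lambda>x. cis (\<xi> * (V (fst x) (snd x) - V s (snd x)))", simplified])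
          (rule P.P.integrable_const_bound[of _ 1], use m in auto)
      show "integrable D (\<lambda>t. C / (1 + (K * \<bar>t - s\<bar>)\<^sup>2))"
      proof (rule D.integrable_const_bound[of _ C])
        have "C / (1 + (K * \<bar>t - s\<bar>)\<^sup>2) \<le> C / 1" for t
          using C by (intro divide_left_mono) (auto simp: add_pos_nonneg)
        then show "AE t in D. norm (C / (1 + (K * \<bar>t - s\<bar>)\<^sup>2)) \<le> C" using C by (intro AE_I2) (simp add: abs_of_nonneg)
      qed measurable
      show "AE t in D. cmod (\<integral>\<omega>. cis (\<xi> * (V t \<omega> - V s \<omega>)) \<partial>M) \<le> C / (1 + (K * \<bar>t - s\<bar>)\<^sup>2)"
        using AED by eventually_elim (rule dec[OF s])
    qed
    also have "\<dots> = (\<integral>t. e t * (C / (1 + (K * \<bar>t - s\<bar>)\<^sup>2)) \<partial>lborel)" by (subst Dint) auto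
    also have "\<dots> \<le> (\<integral>t. E * C * (1 / (1 + (K * \<bar>t - s\<bar>)\<^sup>2)) \<partial>lborel)"
    proof (rule integral_mono_AE)
      show i: "integrable lborel (\<lambda>t. E * C * (1 / (1 + (K * \<bar>t - s\<bar>)\<^sup>2)))"
        using integral_cauchy_density(1)[OF K] by (rule integrable_mult_right)
      have le: "e t * (C / (1 + (K * \<bar>t - s\<bar>)\<^sup>2)) \<le> E * C * (1 / (1 + (K * \<bar>t - s\<bar>)\<^sup>2))" for t
        using mult_right_mono[OF e(4)[of t], of "C / (1 + (K * \<bar>t - s\<bar>)\<^sup>2)"] C by simp
      then show "AE t in lborel. e t * (C / (1 + (K * \<bar>t - s\<bar>)\<^sup>2)) \<le> E * C * (1 / (1 + (K * \<bar>t - s\<bar>)\<^sup>2))" by simp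
      show "integrable lborel (\<lambda>t. e t * (C / (1 + (K * \<bar>t - s\<bar>)\<^sup>2)))"
      proof (rule Bochner_Integration.integrable_bound[OF i])
        show "AE t in lborel. norm (e t * (C / (1 + (K * \<bar>t - s\<bar>)\<^sup>2))) \<le> norm (E * C * (1 / (1 + (K * \<bar>t - s\<bar>)\<^sup>2)))"
        proof (intro AE_I2)
          fix t
          have "0 \<le> e t * (C / (1 + (K * \<bar>t - s\<bar>)\<^sup>2))" using e(3) C by simp
          then show "norm (e t * (C / (1 + (K * \<bar>t - s\<bar>)\<^sup>2))) \<le> norm (E * C * (1 / (1 + (K * \<bar>t - s\<bar>)\<^sup>2)))"
            using le[of t] unfolding real_norm_def by linarith
        qed
      qed measurable
    qed
    also have "\<dots> = E * C * pi / K"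
      unfolding integral_mult_right_zero integral_cauchy_density(2)[OF K] by simp
    finally show ?thesis .
  qed
  define R where "R = E * C * pi / K"
  have R0: "0 \<le> R" using E0 C K by (simp add: R_def)
  \<comment> \<open>The squared modulus is \<open>Z\<close> times its conjugate. Only the conjugate
    is expanded as an integral over \<open>s\<close>; for fixed \<open>s\<close> the remaining
    expectation is bounded by \<open>inner\<close>.\<close>
  have sq: "(\<integral>\<omega>. (cmod (Z \<omega>))\<^sup>2 \<partial>M) \<le> R"
  proof -
    have m: "(\<lambda>x. Z (snd x) * cis (- (\<xi> * V (fst x) (snd x)))) \<in> borel_measurable (D \<Otimes>\<^sub>M M)"
      by (intro borel_measurable_times measurable_compose[OF measurable_snd Zm] measurable_compose[OF _ cis_measurable]
          borel_measurable_uminus borel_measurable_const Vm)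
    have bd: "cmod (Z (snd x) * cis (- (\<xi> * V (fst x) (snd x)))) \<le> 1" for x using Z1 by (simp add: norm_mult)
    have "complex_of_real (\<integral>\<omega>. (cmod (Z \<omega>))\<^sup>2 \<partial>M) = (\<integral>\<omega>. complex_of_real ((cmod (Z \<omega>))\<^sup>2) \<partial>M)"
      by (rule integral_complex_of_real[symmetric])
    also have "\<dots> = (\<integral>\<omega>. (\<integral>s. Z \<omega> * cis (- (\<xi> * V s \<omega>)) \<partial>D) \<partial>M)"
    proof (intro Bochner_Integration.integral_cong refl)
      fix \<omega>
      have "cnj (Z \<omega>) = (\<integral>s. cis (- (\<xi> * V s \<omega>)) \<partial>D)"
        unfolding Z_def by (simp add: cis_cnj flip: Bochner_Integration.integral_cnj)
      then show "complex_of_real ((cmod (Z \<omega>))\<^sup>2) = (\<integral>s. Z \<omega> * cis (- (\<xi> * V s \<omega>)) \<partial>D)"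
        by (simp only: complex_norm_square integral_mult_right_zero)
    qed
    also have "\<dots> = (\<integral>s. (\<integral>\<omega>. Z \<omega> * cis (- (\<xi> * V s \<omega>)) \<partial>M) \<partial>D)"
      by (rule P.Fubini_integral) (rule P.P.integrable_const_bound[of _ 1], use m bd in \<open>auto simp: split_def\<close>)
    finally have "\<bar>\<integral>\<omega>. (cmod (Z \<omega>))\<^sup>2 \<partial>M\<bar> = cmod (\<integral>s. (\<integral>\<omega>. Z \<omega> * cis (- (\<xi> * V s \<omega>)) \<partial>M) \<partial>D)"
      by (metis norm_of_real)
    also have "\<dots> \<le> (\<integral>s. R \<partial>D)"
    proof (rule order_trans[OF integral_norm_bound integral_mono_AE])
      show "integrable D (\<lambda>s. cmod (\<integral>\<omega>. Z \<omega> * cis (- (\<xi> * V s \<omega>)) \<partial>M))"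
        by (rule integrable_norm, rule P.integrable_fst'[of "\<lambda>x. Z (snd x) * cis (- (\<xi> * V (fst x) (snd x)))", simplified])
          (rule P.P.integrable_const_bound[of _ 1], use m bd in auto)
      show "AE s in D. cmod (\<integral>\<omega>. Z \<omega> * cis (- (\<xi> * V s \<omega>)) \<partial>M) \<le> R"
        using AED unfolding R_def by eventually_elim (rule inner)
    qed simp
    finally show ?thesis by (simp add: D.prob_space)
  qed
  have iZ: "integrable M (\<lambda>\<omega>. cmod (Z \<omega>))" by (rule M.integrable_const_bound[of _ 1]) (use Z1 in auto)
  have iZ2: "integrable M (\<lambda>\<omega>. (cmod (Z \<omega>))\<^sup>2)" by (rule M.integrable_const_bound[of _ 1]) (use Z1 in \<open>auto simp: power_le_one\<close>)
  have "(\<integral>\<omega>. cmod (Z \<omega>) \<partial>M)\<^sup>2 \<le> (\<integral>\<omega>. (cmod (Z \<omega>))\<^sup>2 \<partial>M)"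
    using M.variance_eq[OF iZ iZ2] M.variance_positive[of "\<lambda>\<omega>. cmod (Z \<omega>)"] by simp
  then have "(\<integral>\<omega>. cmod (Z \<omega>) \<partial>M) \<le> sqrt R" using sq by (intro real_le_rsqrt) simp
  moreover have "(\<integral>\<omega>. cmod (\<integral>t. e t *\<^sub>R cis (\<xi> * V t \<omega>) \<partial>lborel) \<partial>M) = (\<integral>\<omega>. cmod (Z \<omega>) \<partial>M)"
    by (intro Bochner_Integration.integral_cong refl) (simp add: Zeq)
  ultimately show "(\<integral>\<omega>. cmod (\<integral>t. e t *\<^sub>R cis (\<xi> * V t \<omega>) \<partial>lborel) \<partial>M) \<le> sqrt (E * C * pi / K)"
    by (simp add: R_def)
qed


section \<open>Joint measurability and almost sure decay of the modes\<close>

lemma snd_borel_measurable: "f \<in> borel_measurable M \<Longrightarrow> (\<lambda>x. snd (f x :: pt)) \<in> borel_measurable M"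
  by (rule measurable_compose[of f M borel snd]) (auto intro!: borel_measurable_continuous_onI continuous_intros)

text \<open>Fubini needs joint measurability, whereas right continuity holds only almost surely. The
  limit of samples at grid times to the right of \<open>t\<close> is measurable over all paths and
  agrees with the noise on the regular ones.\<close>

lemma regular_paths_version:
  assumes M: "prob_space M" and W: "regular_paths M W"
  obtains V :: "real \<Rightarrow> 'w \<Rightarrow> real" where
    "(\<lambda>(t, \<omega>). V t \<omega>) \<in> borel_measurable (lborel \<Otimes>\<^sub>M M)"
    "AE \<omega> in M. \<forall>t\<in>{0..<1}. V t \<omega> = snd (W t \<omega>)"
proof -
  define B where "B = (\<lambda>t \<omega>. snd (W t \<omega>))"
  \<comment> \<open>The summand 1 puts the sampling time strictly after \<open>t\<close>, as
    convergence along \<open>at_right\<close> requires. Clamping keeps it in [0, 1], where the noise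
    is known to be measurable; for \<open>t\<close> in [0, 1) it is eventually inactive.\<close>
  define V where "V = (\<lambda>t \<omega>. lim (\<lambda>n. B (max 0 (min 1 (of_int (\<lfloor>real (Suc n) * t\<rfloor> + 1) / real (Suc n)))) \<omega>))"
  have Bm: "B t \<in> borel_measurable M" if "t \<in> {0..1}" for t
    using W that unfolding regular_paths_def B_def by (auto intro: snd_borel_measurable)
  show ?thesis
  proof
    have "(\<lambda>x. B (max 0 (min 1 (of_int (\<lfloor>real (Suc n) * fst x\<rfloor> + 1) / real (Suc n)))) (snd x)) \<in> borel_measurable (lborel \<Otimes>\<^sub>M M)" for n
    proof (rule measurable_compose_countable[where f = "\<lambda>k x. B (max 0 (min 1 (of_int (k + 1) / real (Suc n)))) (snd x)" and g = "\<lambda>x. \<lfloor>real (Suc n) * fst x\<rfloor>"])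
      show "(\<lambda>x. B (max 0 (min 1 (of_int (k + 1) / real (Suc n)))) (snd x)) \<in> borel_measurable (lborel \<Otimes>\<^sub>M M)" for k
        by (rule measurable_compose[OF measurable_snd Bm]) auto
      show "(\<lambda>x. \<lfloor>real (Suc n) * fst x\<rfloor>) \<in> lborel \<Otimes>\<^sub>M M \<rightarrow>\<^sub>M count_space UNIV"
        by measurable
    qed
    then show "(\<lambda>(t, \<omega>). V t \<omega>) \<in> borel_measurable (lborel \<Otimes>\<^sub>M M)"
      unfolding V_def split_def by (rule borel_measurable_lim_metric)
    have "AE \<omega> in M. \<forall>t\<in>{0..<1}. ((\<lambda>t. W t \<omega>) \<longlongrightarrow> W t \<omega>) (at_right t)"
      using W unfolding regular_paths_def by auto
    then show "AE \<omega> in M. \<forall>t\<in>{0..<1}. V t \<omega> = snd (W t \<omega>)"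
    proof (eventually_elim, intro ballI)
      fix \<omega> and t :: real assume r: "\<forall>t\<in>{0..<1}. ((\<lambda>t. W t \<omega>) \<longlongrightarrow> W t \<omega>) (at_right t)" and t: "t \<in> {0..<1}"
      define \<tau> where "\<tau> = (\<lambda>n. of_int (\<lfloor>real (Suc n) * t\<rfloor> + 1) / real (Suc n))"
      have gt: "t < \<tau> n" for n
      proof -
        have "real (Suc n) * t < of_int (\<lfloor>real (Suc n) * t\<rfloor> + 1)" by linarith
        then show ?thesis unfolding \<tau>_def by (simp add: field_simps del: of_int_add of_nat_Suc)
      qed
      have \<tau>lim: "\<tau> \<longlonglongrightarrow> t"
      proof -
        have "\<tau> = (\<lambda>n. grid (Suc n) t + inverse (real (Suc n)))"
          by (simp add: fun_eq_iff \<tau>_def grid_def add_divide_distrib inverse_eq_divide)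
        moreover have "(\<lambda>n. grid (Suc n) t + inverse (real (Suc n))) \<longlonglongrightarrow> t + 0"
          by (intro tendsto_add grid_tendsto LIMSEQ_inverse_real_of_nat)
        ultimately show ?thesis by (simp only: add_0_right)
      qed
      have fl: "filterlim \<tau> (at_right t) sequentially"
        using \<tau>lim gt by (intro tendsto_imp_filterlim_at_right always_eventually) auto
      have "((\<lambda>t. B t \<omega>) \<longlongrightarrow> B t \<omega>) (at_right t)"
        unfolding B_def using r t by (intro tendsto_snd) auto
      then have "(\<lambda>n. B (\<tau> n) \<omega>) \<longlonglongrightarrow> B t \<omega>" by (rule filterlim_compose[OF _ fl])
      moreover have "\<forall>\<^sub>F n in sequentially. B (\<tau> n) \<omega> = B (max 0 (min 1 (\<tau> n))) \<omega>"
      proof -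
        have "\<forall>\<^sub>F n in sequentially. \<tau> n < 1" using order_tendstoD(2)[OF \<tau>lim] t by auto
        then show ?thesis
        proof eventually_elim
          case (elim n)
          then have "max 0 (min 1 (\<tau> n)) = \<tau> n" using gt[of n] t by simp
          then show ?case by simp
        qed
      qed
      ultimately have "(\<lambda>n. B (max 0 (min 1 (\<tau> n))) \<omega>) \<longlonglongrightarrow> B t \<omega>"
        by (rule Lim_transform_eventually)
      then show "V t \<omega> = snd (W t \<omega>)" unfolding V_def \<tau>_def B_def by (rule limI)
    qed
  qed
qed

text \<open>The summand \<open>\<mu> n\<close> of \<open>sqw_integral_le\<close>: an odd mode along
  \<open>w\<close>, divided by its order as in the Fourier series of a square wave.\<close>

definition osc :: "(real \<Rightarrow> real) \<Rightarrow> (real \<Rightarrow> real) \<Rightarrow> nat \<Rightarrow> real" where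
  "osc e w n = cmod (\<integral>t. e t *\<^sub>R cis ((2 * real n + 1) * (pi * w t)) \<partial>lborel) / (2 * real n + 1)"

lemma summable_odd_powr:
  assumes "0 < p"
  shows "summable (\<lambda>n. (2 * real n + 1) powr (- 1 - p))"
proof (rule summable_comparison_test')
  show "summable (\<lambda>n. real (Suc n) powr (- 1 - p))"
    using assms by (subst summable_Suc_iff) (simp add: summable_real_powr_iff)
  show "norm ((2 * real n + 1) powr (- 1 - p)) \<le> real (Suc n) powr (- 1 - p)" for n
    using assms by (simp add: powr_mono2')
qed

text \<open>
  The bound on the correlations makes the mean of the \<open>n\<close>-th term of \<open>osc\<close> of order
  \<open>(2 n + 1) powr (- 1 - p / 2) * \<Lambda> q powr (- p / 2)\<close>, which is summable in \<open>n\<close>. So no second moment of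
  a supremum over offsets is needed.
\<close>

lemma AE_averaging:
  fixes e :: "nat \<Rightarrow> real \<Rightarrow> real"
  assumes M: "prob_space M" and W: "regular_paths M W" and d: "decorrelating M (\<lambda>t \<omega>. snd (W t \<omega>)) p"
    and e: "\<And>q. integrable lborel (e q)" "\<And>q. (\<integral>t. e q t \<partial>lborel) = 1" "\<And>q t. 0 \<le> e q t" "\<And>q t. e q t \<le> E q"
      "\<And>q t. e q t \<noteq> 0 \<Longrightarrow> t \<in> {3/10..7/10}"
    and \<Lambda>: "\<And>q. 0 < \<Lambda> q" and w: "\<And>q. 0 < w q"
    and sm: "summable (\<lambda>q. w q * sqrt (E q) * \<Lambda> q powr (- (p / 2)))"
  defines "B \<equiv> (\<lambda>\<omega> t. indicator {3/10..7/10} t * snd (W t \<omega>))"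
  shows "AE \<omega> in M. B \<omega> \<in> borel_measurable lborel \<and>
     (\<forall>q. summable (osc (e q) (\<lambda>t. \<Lambda> q * B \<omega> t))) \<and>
     (\<lambda>q. w q * (\<Sum>n. osc (e q) (\<lambda>t. \<Lambda> q * B \<omega> t) n)) \<longlonglongrightarrow> 0"
proof -
  interpret prob_space M by fact
  from regular_paths_version[OF M W] obtain V where
    V: "(\<lambda>(t, \<omega>). V t \<omega>) \<in> borel_measurable (lborel \<Otimes>\<^sub>M M)" and
    VW: "AE \<omega> in M. \<forall>t\<in>{0..<1}. V t \<omega> = snd (W t \<omega>)" by blast
  from d obtain L C where p: "0 < p" and L: "0 < L" and C: "0 \<le> C" and
    dec: "\<And>s t \<xi>. s \<in> {3/10..7/10} \<Longrightarrow> t \<in> {3/10..7/10} \<Longrightarrow> 0 < \<xi> \<Longrightarrow>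
     cmod (\<integral>\<omega>. cis (\<xi> * (snd (W t \<omega>) - snd (W s \<omega>))) \<partial>M) \<le> C / (1 + (L * \<xi> powr p * \<bar>t - s\<bar>)\<^sup>2)"
    unfolding decorrelating_def by blast
  have E0: "0 \<le> E q" for q using e(3,4)[of q 0] by linarith
  define \<xi> where "\<xi> = (\<lambda>q n. (2 * real n + 1) * pi * \<Lambda> q)"
  have \<xi>0: "0 < \<xi> q n" for q n using \<Lambda>[of q] by (simp add: \<xi>_def add_nonneg_pos)
  define Z where "Z = (\<lambda>q n \<omega>. cmod (\<integral>t. e q t *\<^sub>R cis (\<xi> q n * V t \<omega>) \<partial>lborel))"
  have decV: "cmod (\<integral>\<omega>. cis (x * (V t \<omega> - V s \<omega>)) \<partial>M) \<le> C / (1 + (L * x powr p * \<bar>t - s\<bar>)\<^sup>2)"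
    if "s \<in> {3/10..7/10}" "t \<in> {3/10..7/10}" "0 < x" for s t x
  proof -
    have Vt: "V t \<in> borel_measurable M" for t
      using measurable_compose[OF measurable_Pair1'[of t lborel M] V] by simp
    have Wt: "(\<lambda>\<omega>. snd (W t \<omega>)) \<in> borel_measurable M" if "t \<in> {3/10..7/10}" for t
      using W that unfolding regular_paths_def by (auto intro!: snd_borel_measurable)
    have "(\<integral>\<omega>. cis (x * (V t \<omega> - V s \<omega>)) \<partial>M) = (\<integral>\<omega>. cis (x * (snd (W t \<omega>) - snd (W s \<omega>))) \<partial>M)"
    proof (rule integral_cong_AE)
      show "AE \<omega> in M. cis (x * (V t \<omega> - V s \<omega>)) = cis (x * (snd (W t \<omega>) - snd (W s \<omega>)))"
        using VW by eventually_elim (use that in auto)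
    qed (intro measurable_compose[OF _ cis_measurable] borel_measurable_times borel_measurable_diff borel_measurable_const Vt Wt that)+
    then show ?thesis using dec[OF that] by simp
  qed
  have Lp: "0 < L * \<xi> q n powr p" for q n using L \<xi>0[of q n] by (intro mult_pos_pos) auto
  have dec\<xi>: "cmod (\<integral>\<omega>. cis (\<xi> q n * (V t \<omega> - V s \<omega>)) \<partial>M) \<le> C / (1 + (L * \<xi> q n powr p * \<bar>t - s\<bar>)\<^sup>2)"
    if "s \<in> {3/10..7/10}" "t \<in> {3/10..7/10}" for s t q n
    by (rule decV[OF that \<xi>0])
  have Zmean: "(\<integral>\<omega>. Z q n \<omega> \<partial>M) \<le> sqrt (E q * C * pi / (L * \<xi> q n powr p))" for q n
    unfolding Z_def by (rule mean_oscillation(1)[OF M V e(1,2,3,4,5) Lp C dec\<xi>])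
  have Zmeas [measurable]: "Z q n \<in> borel_measurable M" for q n
    unfolding Z_def by (rule mean_oscillation(2)[OF M V e(1,2,3,4,5) Lp C dec\<xi>])
  have Z1: "Z q n \<omega> \<le> 1" for q n \<omega>
    unfolding Z_def by (rule mean_oscillation(3)[OF M V e(1,2,3,4,5) Lp C dec\<xi>])
  have Z0: "0 \<le> Z q n \<omega>" for q n \<omega> by (simp add: Z_def)
  define c where "c = sqrt (C * pi / L) * pi powr (- (p / 2))"
  have Zmean': "(\<integral>\<omega>. Z q n \<omega> / (2 * real n + 1) \<partial>M) \<le> c * (sqrt (E q) * \<Lambda> q powr (- (p / 2))) * (2 * real n + 1) powr (- 1 - p / 2)" for q n
  proof -
    have n0: "0 < 2 * real n + 1" by (simp add: add_nonneg_pos)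
    have sq: "sqrt (\<xi> q n powr p) = \<xi> q n powr (p / 2)"
    proof (rule real_sqrt_unique)
      have "(\<xi> q n powr (p / 2))\<^sup>2 = \<xi> q n powr (p / 2 + p / 2)" unfolding power2_eq_square powr_add ..
      then show "(\<xi> q n powr (p / 2))\<^sup>2 = \<xi> q n powr p" by simp
    qed simp
    have "sqrt (E q * C * pi / (L * \<xi> q n powr p)) = sqrt (E q * (C * pi / L)) / sqrt (\<xi> q n powr p)"
      unfolding real_sqrt_divide[symmetric] by simp
    also have "\<dots> = sqrt (E q) * sqrt (C * pi / L) * \<xi> q n powr (- (p / 2))"
      unfolding sq real_sqrt_mult[of "E q"] powr_minus divide_inverse ..
    also have "\<xi> q n powr (- (p / 2)) = (2 * real n + 1) powr (- (p / 2)) * pi powr (- (p / 2)) * \<Lambda> q powr (- (p / 2))"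
      unfolding \<xi>_def using n0 \<Lambda>[of q] by (subst powr_mult, simp_all)+
    finally have "(\<integral>\<omega>. Z q n \<omega> \<partial>M) \<le> sqrt (E q) * sqrt (C * pi / L) * ((2 * real n + 1) powr (- (p / 2)) * pi powr (- (p / 2)) * \<Lambda> q powr (- (p / 2)))"
      using Zmean[of q n] by simp
    also have "\<dots> = c * (sqrt (E q) * \<Lambda> q powr (- (p / 2))) * (2 * real n + 1) powr (- (p / 2))"
      unfolding c_def by (simp only: mult_ac)
    finally have "(\<integral>\<omega>. Z q n \<omega> \<partial>M) / (2 * real n + 1) \<le> c * (sqrt (E q) * \<Lambda> q powr (- (p / 2))) * (2 * real n + 1) powr (- (p / 2)) / (2 * real n + 1)"
      using n0 by (intro divide_right_mono) auto
    also have "\<dots> = c * (sqrt (E q) * \<Lambda> q powr (- (p / 2))) * (2 * real n + 1) powr (- 1 - p / 2)"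
    proof -
      have "(2 * real n + 1) powr (- 1 - p / 2) = (2 * real n + 1) powr (- (p / 2) - 1)" by (rule arg_cong2) auto
      also have "\<dots> = (2 * real n + 1) powr (- (p / 2)) / (2 * real n + 1)"
        unfolding powr_diff using n0 by simp
      finally show ?thesis by simp
    qed
    finally show ?thesis by simp
  qed
  have c0: "0 \<le> c" using C L by (simp add: c_def)
  define S where "S = (\<Sum>n. (2 * real n + 1) powr (- 1 - p / 2))"
  \<comment> \<open>With values in the extended nonnegative reals Tonelli applies before convergence
    is known; finiteness of a mean gives it back almost surely.\<close>
  define G where "G = (\<lambda>q \<omega>. \<Sum>n. ennreal (Z q n \<omega> / (2 * real n + 1)))"
  have [measurable]: "G q \<in> borel_measurable M" for q unfolding G_def by measurable
  have Gmean: "(\<integral>\<^sup>+\<omega>. G q \<omega> \<partial>M) \<le> ennreal (c * (sqrt (E q) * \<Lambda> q powr (- (p / 2))) * S)" for q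
  proof -
    have "(\<integral>\<^sup>+\<omega>. G q \<omega> \<partial>M) = (\<Sum>n. \<integral>\<^sup>+\<omega>. ennreal (Z q n \<omega> / (2 * real n + 1)) \<partial>M)"
      unfolding G_def by (rule nn_integral_suminf) measurable
    also have "\<dots> \<le> (\<Sum>n. ennreal (c * (sqrt (E q) * \<Lambda> q powr (- (p / 2))) * (2 * real n + 1) powr (- 1 - p / 2)))"
    proof (intro suminf_le allI)
      fix n
      have "integrable M (\<lambda>\<omega>. Z q n \<omega> / (2 * real n + 1))"
        by (intro integrable_divide integrable_const_bound[of _ 1]) (use Z0 Z1 in auto)
      then have "(\<integral>\<^sup>+\<omega>. ennreal (Z q n \<omega> / (2 * real n + 1)) \<partial>M) = ennreal (\<integral>\<omega>. Z q n \<omega> / (2 * real n + 1) \<partial>M)"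
        using Z0 by (intro nn_integral_eq_integral) auto
      then show "(\<integral>\<^sup>+\<omega>. ennreal (Z q n \<omega> / (2 * real n + 1)) \<partial>M) \<le> ennreal (c * (sqrt (E q) * \<Lambda> q powr (- (p / 2))) * (2 * real n + 1) powr (- 1 - p / 2))"
        using Zmean'[of q n] by (simp add: ennreal_leI)
    qed auto
    also have "\<dots> = ennreal (c * (sqrt (E q) * \<Lambda> q powr (- (p / 2))) * S)"
      unfolding S_def using summable_odd_powr[of "p / 2"] p c0 E0
      by (subst suminf_mult[symmetric], simp, subst suminf_ennreal2) (auto intro!: summable_mult)
    finally show ?thesis .
  qed
  have S0: "0 \<le> S" unfolding S_def using summable_odd_powr[of "p / 2"] p by (intro suminf_nonneg) auto
  have "(\<integral>\<^sup>+\<omega>. (\<Sum>q. ennreal (w q) * G q \<omega>) \<partial>M) < \<infinity>"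
  proof -
    have "(\<integral>\<^sup>+\<omega>. (\<Sum>q. ennreal (w q) * G q \<omega>) \<partial>M) = (\<Sum>q. \<integral>\<^sup>+\<omega>. ennreal (w q) * G q \<omega> \<partial>M)"
      by (rule nn_integral_suminf) measurable
    also have "\<dots> \<le> (\<Sum>q. ennreal (c * S * (w q * sqrt (E q) * \<Lambda> q powr (- (p / 2)))))"
    proof (intro suminf_le allI)
      fix q
      have "(\<integral>\<^sup>+\<omega>. ennreal (w q) * G q \<omega> \<partial>M) = ennreal (w q) * (\<integral>\<^sup>+\<omega>. G q \<omega> \<partial>M)"
        by (rule nn_integral_cmult) measurable
      also have "\<dots> \<le> ennreal (w q) * ennreal (c * (sqrt (E q) * \<Lambda> q powr (- (p / 2))) * S)"
        by (rule mult_left_mono[OF Gmean]) simp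
      also have "\<dots> = ennreal (c * S * (w q * sqrt (E q) * \<Lambda> q powr (- (p / 2))))"
        using w[of q] c0 S0 E0 by (subst ennreal_mult[symmetric]) (auto simp: mult_ac)
      finally show "(\<integral>\<^sup>+\<omega>. ennreal (w q) * G q \<omega> \<partial>M) \<le> ennreal (c * S * (w q * sqrt (E q) * \<Lambda> q powr (- (p / 2))))" .
    qed auto
    also have "\<dots> = ennreal (\<Sum>q. c * S * (w q * sqrt (E q) * \<Lambda> q powr (- (p / 2))))"
      using w c0 S0 E0 sm by (intro suminf_ennreal2) (auto intro!: summable_mult mult_nonneg_nonneg simp: less_imp_le)
    finally show ?thesis by (simp add: order_le_less_trans)
  qed
  \<comment> \<open>A finite mean makes the weighted double sum over \<open>q\<close> and
    \<open>n\<close> finite almost surely. Each inner sum then converges, and the weighted inner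
    sums, being summable in \<open>q\<close>, tend to 0.\<close>
  then have "AE \<omega> in M. (\<Sum>q. ennreal (w q) * G q \<omega>) \<noteq> \<infinity>"
    by (intro nn_integral_PInf_AE) auto
  then show ?thesis using VW AE_space
  proof eventually_elim
    case (elim \<omega>)
    have Bm: "B \<omega> \<in> borel_measurable lborel"
    proof -
      have "(\<lambda>t. V t \<omega>) \<in> borel_measurable lborel"
        using measurable_compose[OF measurable_Pair2'[OF elim(3), of lborel] V] by simp
      then have "(\<lambda>t. indicator {3/10..7/10} t * V t \<omega>) \<in> borel_measurable lborel" by measurable
      moreover have "B \<omega> = (\<lambda>t. indicator {3/10..7/10} t * V t \<omega>)"
        using elim(2) by (auto simp: B_def indicator_def)
      ultimately show ?thesis by simp
    qed
    have oscZ: "osc (e q) (\<lambda>t. \<Lambda> q * B \<omega> t) n = Z q n \<omega> / (2 * real n + 1)" for q n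
    proof -
      have "e q t *\<^sub>R cis ((2 * real n + 1) * (pi * (\<Lambda> q * B \<omega> t))) = e q t *\<^sub>R cis (\<xi> q n * V t \<omega>)" for t
      proof (cases "e q t = 0")
        case False
        then have t: "t \<in> {3/10..7/10}" using e(5) by blast
        then have "B \<omega> t = V t \<omega>" using elim(2) by (simp add: B_def)
        then show ?thesis by (simp add: \<xi>_def mult_ac)
      qed simp
      then show ?thesis by (simp only: osc_def Z_def)
    qed
    have nn: "0 \<le> Z q n \<omega> / (2 * real n + 1)" for q n using Z0 by simp
    have Gfin: "G q \<omega> \<noteq> \<infinity>" for q
    proof
      assume "G q \<omega> = \<infinity>"
      then have "ennreal (w q) * G q \<omega> = \<infinity>" using w[of q] by (simp add: ennreal_mult_top)
      moreover have "ennreal (w q) * G q \<omega> \<le> (\<Sum>q. ennreal (w q) * G q \<omega>)"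
        using sum_le_suminf[of "\<lambda>q. ennreal (w q) * G q \<omega>" "{q}"] by simp
      ultimately show False using elim(1) by (simp add: top_unique)
    qed
    have sum: "summable (\<lambda>n. Z q n \<omega> / (2 * real n + 1))" for q
      using Gfin[of q] nn unfolding G_def by (intro summable_suminf_not_top) auto
    have Gval: "G q \<omega> = ennreal (\<Sum>n. Z q n \<omega> / (2 * real n + 1))" for q
      unfolding G_def using nn sum by (intro suminf_ennreal2) auto
    define T where "T = (\<lambda>q. w q * (\<Sum>n. Z q n \<omega> / (2 * real n + 1)))"
    have T0: "0 \<le> T q" for q unfolding T_def using w[of q] nn sum by (intro mult_nonneg_nonneg suminf_nonneg) auto
    have "(\<Sum>q. ennreal (T q)) \<noteq> \<infinity>"
    proof -
      have "ennreal (w q) * G q \<omega> = ennreal (T q)" for q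
        unfolding Gval T_def using w[of q] nn sum by (intro ennreal_mult[symmetric] suminf_nonneg) auto
      then show ?thesis using elim(1) by simp
    qed
    then have "summable T" using T0 by (intro summable_suminf_not_top) auto
    then have "T \<longlonglongrightarrow> 0" by (rule summable_LIMSEQ_zero)
    then show ?case unfolding oscZ T_def using Bm sum by simp
  qed
qed

text \<open>Under \<open>range\<close> the path stays in one cell of the slow wave, with room for
  the mollifier, so the slow factor is a constant sign. What is left is an average over shifts of
  the offset, and the bound of \<open>sqw_integral_le\<close>, uniform in the offset, survives it by
  Fubini.\<close>

lemma abs_integral_avg_le:
  fixes e w :: "real \<Rightarrow> real"
  assumes \<rho>: "standard_mollifier \<rho>" and l: "0 \<le> l"
    and e: "integrable lborel e" and w [measurable]: "w \<in> borel_measurable lborel"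
    and b: "0 < b" and A: "0 < A"
    and sm: "summable (osc e (\<lambda>t. w t / b))"
    and range: "\<And>t. e t \<noteq> 0 \<Longrightarrow> of_int n * A + l < Y + w t \<and> Y + w t < (of_int n + 1) * A - l"
  shows "\<bar>\<integral>t. e t * avg \<rho> l (\<lambda>y. sqw (y / b) * sqw (y / A)) (Y + w t) \<partial>lborel\<bar>
    \<le> 4 / pi * (\<Sum>n. osc e (\<lambda>t. w t / b) n)"
proof -
  define \<sigma> :: real where "\<sigma> = (if even n then 1 else - 1)"
  define K where "K = 4 / pi * (\<Sum>n. osc e (\<lambda>t. w t / b) n)"
  have em [measurable]: "e \<in> borel_measurable borel" using e by auto
  have rm [measurable]: "\<rho> \<in> borel_measurable borel"
    using standard_mollifierD(1)[OF \<rho>] by (rule borel_measurable_continuous_onI)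
  have wm [measurable]: "w \<in> borel_measurable borel" using w by simp
  have pt: "e t * avg \<rho> l (\<lambda>y. sqw (y / b) * sqw (y / A)) (Y + w t) = \<sigma> * (\<integral>x. \<rho> x * (e t * sqw ((Y - l * x) / b + w t / b)) \<partial>lborel)" for t
  proof (cases "e t = 0")
    case False
    have "\<rho> x * (sqw ((Y + w t - l * x) / b) * sqw ((Y + w t - l * x) / A)) = \<sigma> * (\<rho> x * sqw ((Y - l * x) / b + w t / b))" for x
    proof (cases "\<bar>x\<bar> \<le> 1")
      case True
      have "\<bar>l * x\<bar> \<le> l" using True l by (simp add: abs_mult mult_left_le)
      then have "of_int n * A < Y + w t - l * x" "Y + w t - l * x < (of_int n + 1) * A"
        using range[OF False] by auto
      then have "of_int n < (Y + w t - l * x) / A" "(Y + w t - l * x) / A < of_int n + 1"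
        using A by (simp_all add: field_simps)
      then have "sqw ((Y + w t - l * x) / A) = \<sigma>" unfolding \<sigma>_def by (rule sqw_eqI)
      moreover have "(Y - l * x) / b + w t / b = (Y + w t - l * x) / b"
        by (simp add: add_divide_distrib diff_divide_distrib)
      ultimately show ?thesis by simp
    qed (use standard_mollifierD(3)[OF \<rho>] in auto)
    then have "avg \<rho> l (\<lambda>y. sqw (y / b) * sqw (y / A)) (Y + w t) = \<sigma> * (\<integral>x. \<rho> x * sqw ((Y - l * x) / b + w t / b) \<partial>lborel)"
      unfolding avg_def by (simp only: integral_mult_right_zero)
    moreover have "(\<integral>x. \<rho> x * (e t * sqw ((Y - l * x) / b + w t / b)) \<partial>lborel) = e t * (\<integral>x. \<rho> x * sqw ((Y - l * x) / b + w t / b) \<partial>lborel)"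
      by (simp only: mult.left_commute[of _ "e t"] integral_mult_right_zero)
    ultimately show ?thesis by simp
  qed simp
  have int2: "integrable (lborel \<Otimes>\<^sub>M lborel) (\<lambda>(t, x). \<rho> x * (e t * sqw ((Y - l * x) / b + w t / b)))"
  proof (rule lborel_pair.Fubini_integrable)
    have eq: "(\<integral>x. norm (\<rho> x * (e t * sqw ((Y - l * x) / b + w t / b))) \<partial>lborel) = \<bar>e t\<bar> * (\<integral>x. \<bar>\<rho> x\<bar> \<partial>lborel)" for t
    proof -
      have "norm (\<rho> x * (e t * sqw ((Y - l * x) / b + w t / b))) = \<bar>e t\<bar> * \<bar>\<rho> x\<bar>" for x
        by (simp add: abs_mult abs_sqw)
      then show ?thesis by (simp only: integral_mult_right_zero)
    qed
    have "integrable lborel (\<lambda>t. \<bar>e t\<bar> * (\<integral>x. \<bar>\<rho> x\<bar> \<partial>lborel))"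
      by (intro integrable_mult_left integrable_abs e)
    then show "integrable lborel (\<lambda>t. \<integral>x. norm (case (t, x) of (t, x) \<Rightarrow> \<rho> x * (e t * sqw ((Y - l * x) / b + w t / b))) \<partial>lborel)"
      unfolding split_conv eq .
    show "AE t in lborel. integrable lborel (\<lambda>x. case (t, x) of (t, x) \<Rightarrow> \<rho> x * (e t * sqw ((Y - l * x) / b + w t / b)))"
    proof (intro AE_I2, unfold split_conv)
      fix t
      have "integrable lborel (\<lambda>x. \<rho> x * e t)" by (intro integrable_mult_left standard_mollifierD(4)[OF \<rho>])
      then show "integrable lborel (\<lambda>x. \<rho> x * (e t * sqw ((Y - l * x) / b + w t / b)))"
        by (rule Bochner_Integration.integrable_bound) (auto simp: abs_mult abs_sqw)
    qed
  qed measurable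
  have "(\<integral>t. e t * avg \<rho> l (\<lambda>y. sqw (y / b) * sqw (y / A)) (Y + w t) \<partial>lborel)
     = \<sigma> * (\<integral>t. (\<integral>x. \<rho> x * (e t * sqw ((Y - l * x) / b + w t / b)) \<partial>lborel) \<partial>lborel)"
    unfolding pt by (rule integral_mult_right_zero)
  also have "(\<integral>t. (\<integral>x. \<rho> x * (e t * sqw ((Y - l * x) / b + w t / b)) \<partial>lborel) \<partial>lborel)
     = (\<integral>x. (\<integral>t. \<rho> x * (e t * sqw ((Y - l * x) / b + w t / b)) \<partial>lborel) \<partial>lborel)"
    using lborel_pair.Fubini_integral[OF int2] by simp
  also have "\<dots> = (\<integral>x. \<rho> x * (\<integral>t. e t * sqw ((Y - l * x) / b + w t / b) \<partial>lborel) \<partial>lborel)"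
    by (simp only: integral_mult_right_zero)
  finally have eq: "(\<integral>t. e t * avg \<rho> l (\<lambda>y. sqw (y / b) * sqw (y / A)) (Y + w t) \<partial>lborel)
     = \<sigma> * (\<integral>x. \<rho> x * (\<integral>t. e t * sqw ((Y - l * x) / b + w t / b) \<partial>lborel) \<partial>lborel)" .
  have inner: "\<bar>\<integral>t. e t * sqw (y + w t / b) \<partial>lborel\<bar> \<le> K" for y
    unfolding K_def osc_def using sm unfolding osc_def by (intro sqw_integral_le e) auto
  have K0: "0 \<le> K" using inner[of 0] by linarith
  have "\<bar>\<integral>x. \<rho> x * (\<integral>t. e t * sqw ((Y - l * x) / b + w t / b) \<partial>lborel) \<partial>lborel\<bar> \<le> (\<integral>x. \<rho> x * K \<partial>lborel)"
  proof (rule order_trans[OF integral_abs_bound integral_mono])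
    have le: "\<bar>\<rho> x * (\<integral>t. e t * sqw ((Y - l * x) / b + w t / b) \<partial>lborel)\<bar> \<le> \<rho> x * K" for x
      unfolding abs_mult using inner standard_mollifierD(2)[OF \<rho>] by (intro mult_mono) auto
    then show "\<bar>\<rho> x * (\<integral>t. e t * sqw ((Y - l * x) / b + w t / b) \<partial>lborel)\<bar> \<le> \<rho> x * K" for x .
    show i: "integrable lborel (\<lambda>x. \<rho> x * K)" using standard_mollifierD(4)[OF \<rho>] by (rule integrable_mult_left)
    show "integrable lborel (\<lambda>x. \<bar>\<rho> x * (\<integral>t. e t * sqw ((Y - l * x) / b + w t / b) \<partial>lborel)\<bar>)"
      by (rule Bochner_Integration.integrable_bound[OF i]) (use le standard_mollifierD(2)[OF \<rho>] K0 in \<open>auto simp: abs_of_nonneg\<close>)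
  qed
  also have "\<dots> = K" using standard_mollifierD(5)[OF \<rho>] by simp
  finally show ?thesis unfolding eq K_def[symmetric] by (simp add: abs_mult \<sigma>_def)
qed

section \<open>Scales and time intervals\<close>

lemma tm_Suc_diff: "tm (Suc q) - tm q = 3 / (pi\<^sup>2 * (real q + 1)\<^sup>2)"
  by simp

lemma tm_less_Suc: "tm q < tm (Suc q)"
  by simp

lemma tm_strict_mono: "strict_mono tm"
  by (rule strict_mono_Suc_iff[THEN iffD2]) (simp del: tm.simps add: tm_less_Suc)

lemma tm_nonneg: "0 \<le> tm q"
  using strict_mono_less_eq[OF tm_strict_mono, of 0 q] by simp

lemma tm_tendsto: "tm \<longlonglongrightarrow> 1/2"
proof -
  have "tm n = (\<Sum>q<n. 3 / pi\<^sup>2 * (1 / real (q + 1) ^ 2))" for n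
    by (induction n) (auto simp: field_simps)
  then have "tm = (\<lambda>n. \<Sum>q<n. 3 / pi\<^sup>2 * (1 / real (q + 1) ^ 2))" by (rule ext)
  moreover have "(\<lambda>q. 3 / pi\<^sup>2 * (1 / real (q + 1) ^ 2)) sums (3 / pi\<^sup>2 * (pi\<^sup>2 / 6))"
    by (intro sums_mult) (use inverse_squares_sums in \<open>simp add: add.commute\<close>)
  then have "(\<lambda>q. 3 / pi\<^sup>2 * (1 / real (q + 1) ^ 2)) sums (1 / 2)" by simp
  ultimately show ?thesis unfolding sums_def by (simp only:)
qed

lemma tm_less_half: "tm q < 1/2"
proof -
  have "tm (Suc q) \<le> 1/2"
    by (rule incseq_le[OF _ tm_tendsto]) (use tm_strict_mono in \<open>auto simp: incseq_def strict_mono_less_eq\<close>)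
  then show ?thesis using tm_less_Suc[of q] by linarith
qed

text \<open>End points of the three subintervals, counted from 0, so that \<open>J q (Suc i)\<close>
  is \<open>{T q i..<T q (Suc i)}\<close>.\<close>

definition T :: "nat \<Rightarrow> nat \<Rightarrow> real" where
  "T q i = tm q + real i * (tm (Suc q) - tm q) / 3"

lemma T_0: "T q 0 = tm q" and T_3: "T q 3 = tm (Suc q)"
  by (simp_all del: tm.simps add: T_def diff_divide_distrib)

lemma J_eq: "J q (Suc i) = {T q i..<T q (Suc i)}"
  by (simp add: J_def T_def)

lemma T_mono: "i \<le> j \<Longrightarrow> T q i \<le> T q j"
  using tm_less_Suc[of q] by (simp del: tm.simps add: T_def divide_right_mono mult_right_mono)

lemma T_bounds: "i \<le> 3 \<Longrightarrow> tm q \<le> T q i" "i \<le> 3 \<Longrightarrow> T q i \<le> tm (Suc q)" "0 \<le> T q i" "i \<le> 3 \<Longrightarrow> T q i < 1/2"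
proof -
  show 1: "tm q \<le> T q i" if "i \<le> 3" using T_mono[of 0 i q] by (simp add: T_0)
  show "0 \<le> T q i" using T_mono[of 0 i q] tm_nonneg[of q] by (simp add: T_0)
  show 2: "T q i \<le> tm (Suc q)" if "i \<le> 3" using T_mono[OF that, of q] by (simp add: T_3 del: tm.simps)
  then show "T q i < 1/2" if "i \<le> 3" using tm_less_half[of "Suc q"] that by linarith
qed

lemma level_eq:
  assumes "tm q \<le> t" "t < tm (Suc q)"
  shows "level t = q"
  unfolding level_def
proof (rule the_equality)
  fix p assume "t \<in> {tm p..<tm (Suc p)}"
  then have "tm q < tm (Suc p)" "tm p < tm (Suc q)" using assms by auto
  then have "q < Suc p" "p < Suc q" by (simp_all only: strict_mono_less[OF tm_strict_mono])
  then show "p = q" by simp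
qed (use assms in auto)

lemma J_level:
  assumes "t \<in> J q i" "i \<in> {1, 2, 3}"
  shows "tm q \<le> t" "t < tm (Suc q)" "level t = q" "0 \<le> t" "t < 1/2"
proof -
  obtain i' where i': "i = Suc i'" "i' \<le> 2" using assms(2) by (cases i) auto
  then have "T q i' \<le> t" "t < T q (Suc i')" using assms(1) by (auto simp: J_eq)
  then show 1: "tm q \<le> t" and 2: "t < tm (Suc q)" using T_bounds(1)[of i' q] T_bounds(2)[of "Suc i'" q] i' by auto
  then show "level t = q" by (rule level_eq)
  show "0 \<le> t" "t < 1/2" using 1 2 tm_nonneg[of q] tm_less_half[of "Suc q"] by auto
qed

lemma J_disjoint:
  assumes "t \<in> J q i" "t \<in> J p j" "i \<in> {1, 2, 3}" "j \<in> {1, 2, 3}"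
  shows "q = p \<and> i = j"
proof -
  have "q = p" using J_level(3)[OF assms(1,3)] J_level(3)[OF assms(2,4)] by simp
  obtain i' j' where ij: "i = Suc i'" "j = Suc j'" using assms(3,4) by (metis One_nat_def Suc_1 eval_nat_numeral(3) insert_iff singletonD)
  then have "t \<in> {T q i'..<T q (Suc i')}" "t \<in> {T q j'..<T q (Suc j')}" using assms \<open>q = p\<close> by (auto simp: J_eq)
  then have "T q i' < T q (Suc j')" "T q j' < T q (Suc i')" by auto
  then have "\<not> Suc j' \<le> i'" "\<not> Suc i' \<le> j'" using T_mono by (metis not_le)+
  then show ?thesis using \<open>q = p\<close> ij by simp
qed

text \<open>A normalised weight on [s, t]. The Lebesgue integral serves the averaging along the
  noise, the gauge integral the integral equation of the solution.\<close>

definition bump :: "(real \<Rightarrow> real) \<Rightarrow> real \<Rightarrow> real \<Rightarrow> bool" where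
  "bump e s t \<longleftrightarrow> s \<le> t \<and> (\<forall>r. 0 \<le> e r) \<and> (\<forall>r. e r \<noteq> 0 \<longrightarrow> r \<in> {s..t}) \<and>
     integrable lborel e \<and> (\<integral>r. e r \<partial>lborel) = 1 \<and> (e has_integral 1) {s..t}"

lemma bumpI:
  assumes "s \<le> t" "\<And>r. 0 \<le> e r" "\<And>r. e r \<noteq> 0 \<Longrightarrow> r \<in> {s..t}" "integrable lborel e" "(\<integral>r. e r \<partial>lborel) = 1"
  shows "bump e s t"
proof -
  have "(e has_integral 1) UNIV" using has_integral_integral_lborel[OF assms(4)] assms(5) by simp
  moreover have "(\<lambda>r. if r \<in> {s..t} then e r else 0) = e"
    using assms(3) by (intro ext) (metis (full_types))
  ultimately have "(e has_integral 1) {s..t}" using has_integral_restrict_UNIV[of "{s..t}" e 1] by simp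
  then show ?thesis unfolding bump_def using assms by blast
qed

lemma cutoffs_bump:
  assumes "cutoffs \<eta>" "i < 3"
  shows "bump (\<eta> q (Suc i)) (T q i) (T q (Suc i))"
    "bump (\<lambda>t. \<eta> q (Suc i) (1 - t)) (1 - T q (Suc i)) (1 - T q i)"
proof -
  let ?e = "\<eta> q (Suc i)"
  have i: "Suc i \<in> {1, 2, 3}" using assms(2) by auto
  then have sm: "smooth ?e" and nn: "\<And>t. 0 \<le> ?e t" and supp: "closure {t. ?e t \<noteq> 0} \<subseteq> J q (Suc i)"
    and int: "(?e has_integral 1) UNIV"
    using assms(1) unfolding cutoffs_def by blast+
  have sup: "r \<in> {T q i..T q (Suc i)}" if "?e r \<noteq> 0" for r
    using that supp closure_subset[of "{t. ?e t \<noteq> 0}"] by (auto simp: J_eq)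
  have cont: "continuous_on UNIV ?e"
    using sm[unfolded smooth_def, rule_format, of 0]
    by (auto intro!: continuous_at_imp_continuous_on differentiable_imp_continuous_within)
  have "set_integrable lborel {T q i..T q (Suc i)} ?e"
    by (rule borel_integrable_atLeastAtMost') (rule continuous_on_subset[OF cont], simp)
  moreover have "indicator {T q i..T q (Suc i)} r *\<^sub>R ?e r = ?e r" for r
    using sup[of r] by (auto simp: indicator_def)
  ultimately have igr: "integrable lborel ?e" by (simp only: set_integrable_def)
  have val: "(\<integral>r. ?e r \<partial>lborel) = 1"
    using has_integral_unique[OF has_integral_integral_lborel[OF igr] int] by simp
  show "bump ?e (T q i) (T q (Suc i))"
    using T_mono[of i "Suc i" q] nn sup igr val by (intro bumpI) auto
  show "bump (\<lambda>t. ?e (1 - t)) (1 - T q (Suc i)) (1 - T q i)"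
  proof (rule bumpI)
    show "integrable lborel (\<lambda>t. ?e (1 - t))"
      using lborel_integrable_real_affine_iff[of "-1" ?e 1] igr by simp
    show "(\<integral>t. ?e (1 - t) \<partial>lborel) = 1"
      using lborel_integral_real_affine[of "-1" ?e 1] val by simp
    show "r \<in> {1 - T q (Suc i)..1 - T q i}" if "?e (1 - r) \<noteq> 0" for r using sup[OF that] by auto
  qed (use T_mono[of i "Suc i" q] nn in auto)
qed

locale scheme =
  fixes a :: "nat \<Rightarrow> real" and \<gamma> \<delta> :: real and \<phi> :: "nat \<Rightarrow> real \<Rightarrow> real" and \<rho> :: "real \<Rightarrow> real"
    and \<eta> :: "nat \<Rightarrow> nat \<Rightarrow> real \<Rightarrow> real"
  assumes \<delta>_pos: "0 < \<delta>" and \<gamma>: "1/2 < \<gamma>" "\<gamma> < 1"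
    and scales: "admissible_scales \<delta> \<gamma> a"
    and saw: "\<And>q. sawtooth (a q) (a (Suc q)) (\<phi> (Suc q))"
    and moll: "standard_mollifier \<rho>"
    and cut: "cutoffs \<eta>"
begin

section \<open>The scales as powers of the ratio of neighbours\<close>

lemma a_pos: "0 < a q"
proof (induction q)
  case 0 then show ?case using scales by (simp add: admissible_scales_def)
next
  case (Suc q)
  have "a q powr (-\<delta>) \<le> a q / a (Suc q)" using scales unfolding admissible_scales_def by auto
  moreover have "0 < a q powr (-\<delta>)" using Suc by simp
  ultimately have "0 < a q / a (Suc q)" by linarith
  then show ?case using Suc by (simp add: zero_less_divide_iff)
qed

lemma ratio: "\<exists>n>0. a q = 4 * real n * a (Suc q)"
proof -
  obtain n :: nat where n: "a q / a (Suc q) = 4 * real n"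
    using scales unfolding admissible_scales_def by blast
  then have "a q = 4 * real n * a (Suc q)" using a_pos[of "Suc q"] by (simp add: field_simps)
  moreover have "n > 0" using calculation a_pos[of q] by (cases n) auto
  ultimately show ?thesis by blast
qed

lemma a_Suc_le: "a (Suc q) \<le> a q / 4"
proof -
  obtain n where n: "n > 0" "a q = 4 * real n * a (Suc q)" using ratio by blast
  have "1 * a (Suc q) \<le> real n * a (Suc q)" using n a_pos[of "Suc q"] by (intro mult_right_mono) auto
  then show ?thesis using n(2) by simp
qed

lemma a_Suc_less: "a (Suc q) < a q"
  using a_Suc_le[of q] a_pos[of q] by linarith

lemma a_geometric: "a q \<le> (1/4) ^ q"
proof (induction q)
  case 0 then show ?case using scales by (simp add: admissible_scales_def)
next
  case (Suc q) then show ?case using a_Suc_le[of q] by simp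
qed

text \<open>All lengths of stage \<open>q\<close> are \<open>a q\<close> times a power of this
  ratio: exponent 1 - \<gamma> for \<open>ell\<close>, 1/2 for \<open>kappa\<close> and 1 for
  \<open>a (Suc q)\<close>.\<close>

definition r :: "nat \<Rightarrow> real" where "r q = a (Suc q) / a q"

lemma r_pos: "0 < r q" and r_less_1: "r q < 1"
  using a_pos[of q] a_pos[of "Suc q"] a_Suc_less[of q] by (auto simp: r_def)

text \<open>The ratio is at most \<open>a q powr \<delta>\<close>, and the scales shrink at least by
  a factor 4 per stage; \<delta> > 0 turns this into geometric decay.\<close>

lemma r_le: "r q \<le> ((1/4) powr \<delta>) ^ q"
proof -
  have "a q powr (-\<delta>) \<le> a q / a (Suc q)" using scales unfolding admissible_scales_def by auto
  then have "r q \<le> 1 / (a q powr (-\<delta>))"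
    unfolding r_def using a_pos[of q] a_pos[of "Suc q"] by (simp add: field_simps)
  also have "\<dots> = a q powr \<delta>" by (simp add: powr_minus divide_inverse)
  also have "\<dots> \<le> ((1/4) ^ q) powr \<delta>" using a_geometric a_pos[of q] \<delta>_pos by (intro powr_mono2) auto
  also have "\<dots> = ((1/4) powr \<delta>) ^ q" by (simp add: powr_realpow[symmetric] powr_powr mult.commute)
  finally show ?thesis .
qed

lemma r_powr_le: "0 < \<theta> \<Longrightarrow> r q powr \<theta> \<le> ((1/4) powr (\<delta> * \<theta>)) ^ q"
proof -
  assume \<theta>: "0 < \<theta>"
  have "r q powr \<theta> \<le> (((1/4) powr \<delta>) ^ q) powr \<theta>" using r_le r_pos[of q] \<theta> by (intro powr_mono2) auto
  also have "\<dots> = ((1/4) powr (\<delta> * \<theta>)) ^ q" by (simp add: powr_realpow[symmetric] powr_powr mult_ac)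
  finally show ?thesis .
qed

lemma powr_quarter_less_1: "0 < \<theta> \<Longrightarrow> (1/4) powr \<theta> < (1::real)"
  using powr_less_mono2[of \<theta> "1/4" 1] by simp

text \<open>The factor q + 1 pays for the square root of the supremum of the cutoffs, whose time
  intervals have length of order (q + 1)^(-2).\<close>

lemma summable_r: "0 < \<theta> \<Longrightarrow> summable (\<lambda>q. (real q + 1) * r q powr \<theta>)"
proof -
  assume \<theta>: "0 < \<theta>"
  define z where "z = (1/4) powr (\<delta> * \<theta>)"
  have z: "0 < z" "z < 1" using \<theta> \<delta>_pos powr_quarter_less_1[of "\<delta> * \<theta>"] by (auto simp: z_def)
  have "summable (\<lambda>q. (real q + 1) * z ^ q)"
  proof -
    have "summable (\<lambda>q. real (Suc q) * z ^ q)"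
      using termdiff_converges[of z 1 "\<lambda>_. 1::real"] z by (auto simp: diffs_def summable_geometric)
    then show ?thesis by (simp add: add.commute)
  qed
  then show ?thesis
  proof (rule summable_comparison_test')
    show "norm ((real q + 1) * r q powr \<theta>) \<le> (real q + 1) * z ^ q" for q
      using r_powr_le[OF \<theta>, of q] by (simp add: z_def mult_left_mono abs_mult)
  qed
qed

lemma r_powr_tendsto: "0 < \<theta> \<Longrightarrow> (\<lambda>q. r q powr \<theta>) \<longlonglongrightarrow> 0"
proof (rule Lim_null_comparison)
  assume "0 < \<theta>"
  then show "(\<lambda>q. (real q + 1) * r q powr \<theta>) \<longlonglongrightarrow> 0" by (intro summable_LIMSEQ_zero summable_r)
  show "\<forall>\<^sub>F q in sequentially. norm (r q powr \<theta>) \<le> (real q + 1) * r q powr \<theta>"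
    by (intro always_eventually allI) (simp add: mult_le_cancel_right1)
qed

abbreviation "l \<equiv> ell a \<gamma>"

lemma a_r_powr: "a q * r q powr \<theta> = a q powr (1 - \<theta>) * a (Suc q) powr \<theta>"
proof -
  have "a q powr (1 - \<theta>) = a q / a q powr \<theta>" using a_pos[of q] by (simp add: powr_diff)
  moreover have "r q powr \<theta> = a (Suc q) powr \<theta> / a q powr \<theta>"
    unfolding r_def by (rule powr_divide)
  ultimately show ?thesis by simp
qed

lemma ell_eq: "l q = a q * r q powr (1 - \<gamma>)"
proof -
  have h: "1 - (1 - \<gamma>) = \<gamma>" by simp
  show ?thesis using a_r_powr[of q "1 - \<gamma>"] unfolding ell_def h by (rule sym)
qed

lemma kappa_eq: "kappa a q = a q * r q powr (1/2)"
proof -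
  have h: "(1::real) - 1/2 = 1/2" by simp
  show ?thesis using a_r_powr[of q "1/2"] unfolding kappa_def h by (rule sym)
qed

lemma a_Suc_eq: "a (Suc q) = a q * r q"
  using a_pos[of q] by (simp add: r_def)

lemma ell_pos: "0 < l q"
  unfolding ell_eq using a_pos[of q] r_pos[of q] by simp

lemma kappa_pos: "0 < kappa a q"
  unfolding kappa_eq using a_pos[of q] r_pos[of q] by (intro mult_pos_pos) auto

lemma ell_le: "l q \<le> a q"
proof -
  have "r q powr (1 - \<gamma>) \<le> 1 powr (1 - \<gamma>)" using r_pos[of q] r_less_1[of q] \<gamma> by (intro powr_mono2) auto
  then show ?thesis unfolding ell_eq using a_pos[of q] by (simp add: mult_left_le)
qed

lemma a_Suc_le_ell: "a (Suc q) \<le> l q"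
proof -
  have "r q powr 1 \<le> r q powr (1 - \<gamma>)" using r_pos[of q] r_less_1[of q] \<gamma> by (intro powr_mono') auto
  then have "r q \<le> r q powr (1 - \<gamma>)" using r_pos[of q] by simp
  then show ?thesis unfolding ell_eq a_Suc_eq using a_pos[of q] by (intro mult_left_mono) auto
qed

lemma ell_Suc_le: "l (Suc q) \<le> l q"
  using ell_le[of "Suc q"] a_Suc_le_ell[of q] by linarith

lemma ell_antimono: "i \<le> j \<Longrightarrow> l j \<le> l i"
  by (rule lift_Suc_antimono_le[of l, OF ell_Suc_le])

lemma a_antimono: "i \<le> j \<Longrightarrow> a j \<le> a i"
  by (rule lift_Suc_antimono_le[of a, OF less_imp_le[OF a_Suc_less]])

text \<open>The first quotient is r powr (\<gamma> - 1/2), so \<gamma> > 1/2 is what keeps the noise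
  below the mollification scale \<open>l q\<close> of the shears of stage q - 1. The second is r
  powr \<gamma>.\<close>

lemma ratios_tendsto: "(\<lambda>q. kappa a q / l q) \<longlonglongrightarrow> 0" "(\<lambda>q. a (Suc q) / l q) \<longlonglongrightarrow> 0"
  and ell_div_a: "l q / a q = r q powr (1 - \<gamma>)"
  and ell_tendsto: "l \<longlonglongrightarrow> 0"
proof -
  have "kappa a q / l q = r q powr (\<gamma> - 1/2)" for q
  proof -
    have "kappa a q / l q = r q powr (1/2) / r q powr (1 - \<gamma>)"
      unfolding ell_eq kappa_eq using a_pos[of q] by (intro nonzero_mult_divide_mult_cancel_left) auto
    also have "\<dots> = r q powr (1/2 - (1 - \<gamma>))" by (rule powr_diff[symmetric])
    also have "1/2 - (1 - \<gamma>) = \<gamma> - 1/2" by simp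
    finally show ?thesis .
  qed
  then show "(\<lambda>q. kappa a q / l q) \<longlonglongrightarrow> 0" using r_powr_tendsto[of "\<gamma> - 1/2"] \<gamma> by simp
  have "a (Suc q) / l q = r q powr \<gamma>" for q
  proof -
    have "a (Suc q) / l q = r q powr 1 / r q powr (1 - \<gamma>)" unfolding ell_eq a_Suc_eq using a_pos[of q] r_pos[of q] by simp
    also have "\<dots> = r q powr \<gamma>" by (simp only: powr_diff[symmetric]) simp
    finally show ?thesis .
  qed
  then show "(\<lambda>q. a (Suc q) / l q) \<longlonglongrightarrow> 0" using r_powr_tendsto[of \<gamma>] \<gamma> by simp
  show "l q / a q = r q powr (1 - \<gamma>)" for q unfolding ell_eq using a_pos[of q] by simp
  show "l \<longlonglongrightarrow> 0"
  proof (rule Lim_null_comparison)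
    show "\<forall>\<^sub>F q in sequentially. norm (l q) \<le> (1/4) ^ q"
      using order_trans[OF ell_le a_geometric] ell_pos by (intro always_eventually allI) (simp add: less_imp_le)
  qed (rule LIMSEQ_power_zero, simp)
qed

definition g :: "nat \<Rightarrow> real \<Rightarrow> real" where
  "g q = avg \<rho> (l (Suc q)) (\<lambda>y. sqw (y / a (Suc q)) * sqw (y / a q))"

section \<open>The velocity field on each subinterval\<close>

lemma mollify_eq:
  "mollify \<rho> (l (Suc q)) (v1 a \<phi> q) z = (a q / 2 * g q z, 0)"
  "mollify \<rho> (l (Suc q)) (v2 a \<phi> q) z = (0, a (Suc q) / 2 * (g q z + 1))"
proof -
  obtain n where n: "n > 0" "a q = 4 * real n * a (Suc q)" using ratio by blast
  show "mollify \<rho> (l (Suc q)) (v1 a \<phi> q) z = (a q / 2 * g q z, 0)"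
    "mollify \<rho> (l (Suc q)) (v2 a \<phi> q) z = (0, a (Suc q) / 2 * (g q z + 1))"
    unfolding g_def using mollify_v[of a q \<phi> n \<rho> "l (Suc q)", OF saw a_pos n(2,1) moll ell_pos] by auto
qed

lemma g_measurable: "(\<lambda>y. sqw (y / a (Suc q)) * sqw (y / a q)) \<in> borel_measurable borel"
  by measurable

lemma abs_g_le: "\<bar>g q z\<bar> \<le> 1"
  unfolding g_def by (rule abs_avg_le[OF moll g_measurable]) (simp add: abs_mult abs_sqw)

lemma g_lipschitz: "\<exists>L\<ge>0. \<forall>z z'. \<bar>g q z - g q z'\<bar> \<le> L * \<bar>z - z'\<bar>"
  unfolding g_def by (rule avg_lipschitz[OF moll g_measurable]) (auto simp: abs_mult abs_sqw ell_pos)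

abbreviation "uu \<equiv> u a \<gamma> \<phi> \<rho> \<eta>"

lemma u_forward:
  assumes i: "i < 3" and t: "t \<in> J q (Suc i)"
  shows "uu t x = (if i = 0 then (\<eta> q 1 t * (a q / 2 * g q (snd x)), 0)
     else if i = 1 then (0, \<eta> q 2 t * (a (Suc q) / 2 * (g q (fst x) + 1))) else 0)"
proof -
  have i': "Suc i \<in> {1, 2, 3}" using i by auto
  note lv = J_level[OF t i']
  have n: "t \<notin> J q j" if "j \<in> {1, 2, 3}" "j \<noteq> Suc i" for j using J_disjoint[OF t _ i' that(1)] that(2) by auto
  show ?thesis
    using i lv n[of 1] n[of 2] t unfolding u_def u_early_def Let_def
    by (cases "i = 0"; cases "i = 1") (auto simp: mollify_eq numeral_2_eq_2)
qed

lemma u_backward: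
  assumes i: "i < 3" and t: "1 - t \<in> J q (Suc i)"
  shows "uu t x = (if i = 0 then (- (\<eta> q 1 (1 - t) * (a q / 2 * g q (snd x))), 0)
     else if i = 1 then (0, - (\<eta> q 2 (1 - t) * (a (Suc q) / 2 * (g q (fst x) + 1))))
     else (\<eta> q 3 (1 - t) * a (Suc q), 0))"
proof -
  have i': "Suc i \<in> {1, 2, 3}" using i by auto
  note lv = J_level[OF t i']
  have n: "1 - t \<notin> J q j" if "j \<in> {1, 2, 3}" "j \<noteq> Suc i" for j using J_disjoint[OF t _ i' that(1)] that(2) by auto
  have sup: "1 - t \<in> J p 3" if "\<eta> p 3 (1 - t) \<noteq> 0" for p
  proof -
    have "closure {t. \<eta> p 3 t \<noteq> 0} \<subseteq> J p 3" using cut unfolding cutoffs_def by blast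
    then show ?thesis using that closure_subset[of "{t. \<eta> p 3 t \<noteq> 0}"] by auto
  qed
  \<comment> \<open>The swap cutoffs of different stages have disjoint supports, so at most the term
    p = q of the series is nonzero.\<close>
  have swap: "(\<Sum>p. \<eta> p 3 (1 - t) *\<^sub>R v_swap a p) = (if i = 2 then (\<eta> q 3 (1 - t) * a (Suc q), 0) else 0)"
  proof -
    have z: "\<eta> p 3 (1 - t) = 0" if "p \<noteq> q \<or> i \<noteq> 2" for p
    proof (rule ccontr)
      assume "\<eta> p 3 (1 - t) \<noteq> 0"
      from J_disjoint[OF t sup[OF this] i'] show False using that by auto
    qed
    have "(\<Sum>p. \<eta> p 3 (1 - t) *\<^sub>R v_swap a p) = (\<Sum>p\<in>{q}. \<eta> p 3 (1 - t) *\<^sub>R v_swap a p)"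
      by (rule suminf_finite) (use z in auto)
    then show ?thesis using z[of q] by (auto simp: v_swap_def zero_prod_def)
  qed
  have "u_early a \<gamma> \<phi> \<rho> \<eta> (1 - t) x = (if i = 0 then (\<eta> q 1 (1 - t) * (a q / 2 * g q (snd x)), 0)
     else if i = 1 then (0, \<eta> q 2 (1 - t) * (a (Suc q) / 2 * (g q (fst x) + 1))) else 0)"
    using i lv(3) n[of 1] n[of 2] t unfolding u_early_def Let_def
    by (cases "i = 0"; cases "i = 1") (auto simp: mollify_eq numeral_2_eq_2)
  then show ?thesis
    unfolding u_def using lv(4,5) i swap by (auto simp: less_Suc_eq numeral_3_eq_3 numeral_2_eq_2)
qed

end

section \<open>Shears along perturbed solutions\<close>

declare tm.simps [simp del]

text \<open>\<open>P\<close> is a solution with driving solves \<open>Z\<close>, from which \<open>Z\<close> has been subtracted.\<close>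

definition solves :: "(real \<Rightarrow> pt \<Rightarrow> pt) \<Rightarrow> (real \<Rightarrow> pt) \<Rightarrow> (real \<Rightarrow> pt) \<Rightarrow> bool" where
  "solves b Z P \<longleftrightarrow> (\<forall>s t. 0 \<le> s \<and> s \<le> t \<and> t \<le> 1 \<longrightarrow>
     ((\<lambda>r. b r (P r + Z r)) has_integral (P t - P s)) {s..t})"

definition shear :: "(real \<Rightarrow> real) \<Rightarrow> (real \<Rightarrow> real) \<Rightarrow> (real \<Rightarrow> real) \<Rightarrow> (real \<Rightarrow> real) \<Rightarrow> (real \<Rightarrow> real) \<Rightarrow> real \<Rightarrow> real \<Rightarrow> bool" where
  "shear e h y z w s t \<longleftrightarrow> (\<forall>r\<in>{s..t}. z r = z s) \<and>
     ((\<lambda>r. e r * h (z s + w r)) has_integral (y t - y s)) {s..t}"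

lemma path_shear_fst:
  assumes p: "solves b Z P" and st: "0 \<le> s" "s \<le> t" "t \<le> 1"
    and b: "\<And>r x. r \<in> {s<..<t} \<Longrightarrow> b r x = (e r * h (snd x), 0)"
  shows "shear e h (\<lambda>r. fst (P r)) (\<lambda>r. snd (P r)) (\<lambda>r. snd (Z r)) s t"
proof -
  have z: "snd (P r) = snd (P s)" if r: "r \<in> {s..t}" for r
  proof -
    have "((\<lambda>r. b r (P r + Z r)) has_integral (P r - P s)) {s..r}" using p st r by (auto simp: solves_def)
    from has_integral_linear[OF this bounded_linear_snd]
    have 1: "((\<lambda>r. snd (b r (P r + Z r))) has_integral (snd (P r) - snd (P s))) {s..r}" by (simp add: o_def)
    \<comment> \<open>The form of the field is known on the open interval only; the two end points
      do not change the integral.\<close>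
    have "((\<lambda>r. 0::real) has_integral (snd (P r) - snd (P s))) {s..r}"
      by (rule has_integral_spike_finite[of "{s, t}" _ _ _ _, OF _ _ 1]) (use b r in auto)
    then show ?thesis by simp
  qed
  have "((\<lambda>r. b r (P r + Z r)) has_integral (P t - P s)) {s..t}" using p st by (auto simp: solves_def)
  from has_integral_linear[OF this bounded_linear_fst]
  have 1: "((\<lambda>r. fst (b r (P r + Z r))) has_integral (fst (P t) - fst (P s))) {s..t}" by (simp add: o_def)
  have "((\<lambda>r. e r * h (snd (P s) + snd (Z r))) has_integral (fst (P t) - fst (P s))) {s..t}"
  proof (rule has_integral_spike_finite[of "{s, t}", OF _ _ 1])
    fix r assume r: "r \<in> {s..t} - {s, t}"
    then have "snd (P r + Z r) = snd (P s) + snd (Z r)" using z[of r] by (simp only: DiffD1 snd_add)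
    moreover have "b r (P r + Z r) = (e r * h (snd (P r + Z r)), 0)"
      using r by (intro b) auto
    ultimately show "e r * h (snd (P s) + snd (Z r)) = fst (b r (P r + Z r))" by simp
  qed simp
  then show ?thesis unfolding shear_def using z by blast
qed

lemma path_shear_snd:
  assumes p: "solves b Z P" and st: "0 \<le> s" "s \<le> t" "t \<le> 1"
    and b: "\<And>r x. r \<in> {s<..<t} \<Longrightarrow> b r x = (0, e r * h (fst x))"
  shows "shear e h (\<lambda>r. snd (P r)) (\<lambda>r. fst (P r)) (\<lambda>r. fst (Z r)) s t"
proof -
  have z: "fst (P r) = fst (P s)" if r: "r \<in> {s..t}" for r
  proof -
    have "((\<lambda>r. b r (P r + Z r)) has_integral (P r - P s)) {s..r}" using p st r by (auto simp: solves_def)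
    from has_integral_linear[OF this bounded_linear_fst]
    have 1: "((\<lambda>r. fst (b r (P r + Z r))) has_integral (fst (P r) - fst (P s))) {s..r}" by (simp add: o_def)
    have "((\<lambda>r. 0::real) has_integral (fst (P r) - fst (P s))) {s..r}"
      by (rule has_integral_spike_finite[of "{s, t}" _ _ _ _, OF _ _ 1]) (use b r in auto)
    then show ?thesis by simp
  qed
  have "((\<lambda>r. b r (P r + Z r)) has_integral (P t - P s)) {s..t}" using p st by (auto simp: solves_def)
  from has_integral_linear[OF this bounded_linear_snd]
  have 1: "((\<lambda>r. snd (b r (P r + Z r))) has_integral (snd (P t) - snd (P s))) {s..t}" by (simp add: o_def)
  have "((\<lambda>r. e r * h (fst (P s) + fst (Z r))) has_integral (snd (P t) - snd (P s))) {s..t}"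
  proof (rule has_integral_spike_finite[of "{s, t}", OF _ _ 1])
    fix r assume r: "r \<in> {s..t} - {s, t}"
    then have "fst (P r + Z r) = fst (P s) + fst (Z r)" using z[of r] by (simp only: DiffD1 fst_add)
    moreover have "b r (P r + Z r) = (0, e r * h (fst (P r + Z r)))"
      using r by (intro b) auto
    ultimately show "e r * h (fst (P s) + fst (Z r)) = snd (b r (P r + Z r))" by simp
  qed simp
  then show ?thesis unfolding shear_def using z by blast
qed

lemma path_rest:
  assumes p: "solves b Z P" and st: "0 \<le> s" "s \<le> t" "t \<le> 1"
    and b: "\<And>r x. r \<in> {s<..<t} \<Longrightarrow> b r x = 0"
  shows "P t = P s"
proof -
  have 1: "((\<lambda>r. b r (P r + Z r)) has_integral (P t - P s)) {s..t}" using p st by (auto simp: solves_def)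
  have "((\<lambda>r. 0::pt) has_integral (P t - P s)) {s..t}"
    by (rule has_integral_spike_finite[of "{s, t}" _ _ _ _, OF _ _ 1]) (use b in auto)
  then show ?thesis by simp
qed

text \<open>The weight \<open>e\<close> has mass 1, so the displacement is an average of
  \<open>h\<close> along the path.\<close>

lemma shear_near:
  assumes sh: "shear e h y z w s t" and b: "bump e s t"
    and near: "\<And>r. r \<in> {s..t} \<Longrightarrow> \<bar>h (z s + w r) - c\<bar> \<le> d"
  shows "\<bar>y t - y s - c\<bar> \<le> d"
proof -
  have I: "((\<lambda>r. e r * h (z s + w r)) has_integral (y t - y s)) {s..t}" using sh by (simp add: shear_def)
  have e1: "(e has_integral 1) {s..t}" and e0: "\<And>r. 0 \<le> e r" using b by (auto simp: bump_def)
  have k: "((\<lambda>r. e r * k) has_integral k) {s..t}" for k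
    using has_integral_mult_left[OF e1, of k] by simp
  have "y t - y s \<le> c + d"
  proof (rule has_integral_le[OF I k])
    fix r assume "r \<in> {s..t}"
    then have "h (z s + w r) \<le> c + d" using near[of r] by linarith
    then show "e r * h (z s + w r) \<le> e r * (c + d)" using e0[of r] by (rule mult_left_mono)
  qed
  moreover have "c - d \<le> y t - y s"
  proof (rule has_integral_le[OF k I])
    fix r assume "r \<in> {s..t}"
    then have "c - d \<le> h (z s + w r)" using near[of r] by linarith
    then show "e r * (c - d) \<le> e r * h (z s + w r)" using e0[of r] by (rule mult_left_mono)
  qed
  ultimately show ?thesis by linarith
qed

lemma shear_const:
  assumes "shear e h y z w s t" "bump e s t" "\<And>r. r \<in> {s..t} \<Longrightarrow> h (z s + w r) = c"
  shows "y t = y s + c"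
proof -
  have "\<bar>y t - y s - c\<bar> \<le> 0" by (rule shear_near[OF assms(1,2)]) (simp add: assms(3))
  then show ?thesis by linarith
qed

lemma shear_rigid: "shear e h y z w s t \<Longrightarrow> s \<le> t \<Longrightarrow> z t = z s"
  unfolding shear_def by (metis atLeastAtMost_iff order_refl)

context scheme
begin

lemma forward_steps:
  assumes p: "solves b Z P" and b: "\<And>r x. r \<in> {tm j<..<tm (Suc j)} \<Longrightarrow> b r x = uu r x"
  shows "shear (\<eta> j 1) (\<lambda>z. a j / 2 * g j z) (\<lambda>r. fst (P r)) (\<lambda>r. snd (P r)) (\<lambda>r. snd (Z r)) (T j 0) (T j 1)"
    "shear (\<eta> j 2) (\<lambda>z. a (Suc j) / 2 * (g j z + 1)) (\<lambda>r. snd (P r)) (\<lambda>r. fst (P r)) (\<lambda>r. fst (Z r)) (T j 1) (T j 2)"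
    "P (T j 3) = P (T j 2)"
proof -
  have bu: "b r x = uu r x" if "r \<in> {T j i<..<T j (Suc i)}" "i < 3" for r x i
    using that T_bounds(1)[of i j] T_bounds(2)[of "Suc i" j] by (intro b) auto
  have rJ: "r \<in> J j (Suc i)" if "r \<in> {T j i<..<T j (Suc i)}" for r i using that by (auto simp: J_eq)
  have T1: "T j i \<le> 1" if "i \<le> 3" for i using T_bounds(4)[OF that, of j] by simp
  show "shear (\<eta> j 1) (\<lambda>z. a j / 2 * g j z) (\<lambda>r. fst (P r)) (\<lambda>r. snd (P r)) (\<lambda>r. snd (Z r)) (T j 0) (T j 1)"
    by (rule path_shear_fst[OF p T_bounds(3) T_mono T1]) (use bu[of _ 0] u_forward[of 0, OF _ rJ[of _ 0]] in auto)
  show "shear (\<eta> j 2) (\<lambda>z. a (Suc j) / 2 * (g j z + 1)) (\<lambda>r. snd (P r)) (\<lambda>r. fst (P r)) (\<lambda>r. fst (Z r)) (T j 1) (T j 2)"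
    by (rule path_shear_snd[OF p T_bounds(3) T_mono T1]) (use bu[of _ 1] u_forward[of 1, OF _ rJ[of _ 1]] in \<open>auto simp: numeral_2_eq_2\<close>)
  show "P (T j 3) = P (T j 2)"
    by (rule path_rest[OF p T_bounds(3) T_mono T1]) (use bu[of _ 2] u_forward[of 2, OF _ rJ[of _ 2]] in \<open>auto simp: numeral_3_eq_3 numeral_2_eq_2\<close>)
qed

lemma backward_steps:
  assumes p: "solves b Z P" and b: "\<And>r x. r \<in> {1 - tm (Suc j)<..<1 - tm j} \<Longrightarrow> b r x = uu r x"
  shows "shear (\<lambda>t. \<eta> j 3 (1 - t)) (\<lambda>z. a (Suc j)) (\<lambda>r. fst (P r)) (\<lambda>r. snd (P r)) (\<lambda>r. snd (Z r)) (1 - T j 3) (1 - T j 2)"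
    "shear (\<lambda>t. \<eta> j 2 (1 - t)) (\<lambda>z. - (a (Suc j) / 2 * (g j z + 1))) (\<lambda>r. snd (P r)) (\<lambda>r. fst (P r)) (\<lambda>r. fst (Z r)) (1 - T j 2) (1 - T j 1)"
    "shear (\<lambda>t. \<eta> j 1 (1 - t)) (\<lambda>z. - (a j / 2 * g j z)) (\<lambda>r. fst (P r)) (\<lambda>r. snd (P r)) (\<lambda>r. snd (Z r)) (1 - T j 1) (1 - T j 0)"
proof -
  have bu: "b r x = uu r x" if "r \<in> {1 - T j (Suc i)<..<1 - T j i}" "i < 3" for r x i
    using that T_bounds(1)[of i j] T_bounds(2)[of "Suc i" j] by (intro b) auto
  have rJ: "1 - r \<in> J j (Suc i)" if "r \<in> {1 - T j (Suc i)<..<1 - T j i}" for r i using that by (auto simp: J_eq)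
  have T0: "0 \<le> 1 - T j i" if "i \<le> 3" for i using T_bounds(4)[OF that, of j] by simp
  have T1: "1 - T j i \<le> 1" for i using T_bounds(3)[of j i] by simp
  have Tm: "1 - T j (Suc i) \<le> 1 - T j i" for i using T_mono[of i "Suc i" j] by simp
  show "shear (\<lambda>t. \<eta> j 3 (1 - t)) (\<lambda>z. a (Suc j)) (\<lambda>r. fst (P r)) (\<lambda>r. snd (P r)) (\<lambda>r. snd (Z r)) (1 - T j 3) (1 - T j 2)"
    by (rule path_shear_fst[OF p T0 _ T1]) (use Tm[of 2] bu[of _ 2] u_backward[of 2, OF _ rJ[of _ 2]] in \<open>auto simp: numeral_3_eq_3 numeral_2_eq_2\<close>)
  show "shear (\<lambda>t. \<eta> j 2 (1 - t)) (\<lambda>z. - (a (Suc j) / 2 * (g j z + 1))) (\<lambda>r. snd (P r)) (\<lambda>r. fst (P r)) (\<lambda>r. fst (Z r)) (1 - T j 2) (1 - T j 1)"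
    by (rule path_shear_snd[OF p T0 _ T1]) (use Tm[of 1] bu[of _ 1] u_backward[of 1, OF _ rJ[of _ 1]] in \<open>auto simp: numeral_2_eq_2\<close>)
  show "shear (\<lambda>t. \<eta> j 1 (1 - t)) (\<lambda>z. - (a j / 2 * g j z)) (\<lambda>r. fst (P r)) (\<lambda>r. snd (P r)) (\<lambda>r. snd (Z r)) (1 - T j 1) (1 - T j 0)"
    by (rule path_shear_fst[OF p T0 _ T1]) (use Tm[of 0] bu[of _ 0] u_backward[of 0, OF _ rJ[of _ 0]] in auto)
qed

lemma bumps:
  "bump (\<eta> j 1) (T j 0) (T j 1)" "bump (\<eta> j 2) (T j 1) (T j 2)"
  "bump (\<lambda>t. \<eta> j 3 (1 - t)) (1 - T j 3) (1 - T j 2)"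
  "bump (\<lambda>t. \<eta> j 2 (1 - t)) (1 - T j 2) (1 - T j 1)"
  "bump (\<lambda>t. \<eta> j 1 (1 - t)) (1 - T j 1) (1 - T j 0)"
  using cutoffs_bump[OF cut, of 0 j] cutoffs_bump[OF cut, of 1 j] cutoffs_bump[OF cut, of 2 j]
  by (auto simp: numeral_3_eq_3 numeral_2_eq_2)

text \<open>One estimate for three uses: d = 0 where \<open>g\<close> is constant along the path, d
  proportional to the noise by Lipschitz continuity, and c = 0, d = 1 where only the bound 1 on
  \<open>g\<close> is known. The second coordinate rests during the first shear and the first one
  afterwards, so positions at the ends of the stage suffice.\<close>

lemma forward_stage:
  assumes p: "solves b Z P" and b: "\<And>r x. r \<in> {tm j<..<tm (Suc j)} \<Longrightarrow> b r x = uu r x"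
  shows "(\<And>r. r \<in> {0..1} \<Longrightarrow> \<bar>g j (snd (P (tm j)) + snd (Z r)) - c\<bar> \<le> d) \<Longrightarrow>
      \<bar>fst (P (tm (Suc j))) - fst (P (tm j)) - a j / 2 * c\<bar> \<le> a j / 2 * d"
    and "(\<And>r. r \<in> {0..1} \<Longrightarrow> \<bar>g j (fst (P (tm (Suc j))) + fst (Z r)) - c\<bar> \<le> d) \<Longrightarrow>
      \<bar>snd (P (tm (Suc j))) - snd (P (tm j)) - a (Suc j) / 2 * (c + 1)\<bar> \<le> a (Suc j) / 2 * d"
proof -
  note st = forward_steps[OF assms]
  have in01: "r \<in> {0..1}" if "r \<in> {T j i..T j k}" "k \<le> 3" for r i k
    using that T_bounds(3)[of j i] T_bounds(4)[of k j] by auto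
  have e1: "fst (P (tm (Suc j))) = fst (P (T j 1))"
    using shear_rigid[OF st(2)] T_mono[of 1 2 j] st(3) by (simp add: T_3)
  have e2: "snd (P (T j 1)) = snd (P (tm j))"
    using shear_rigid[OF st(1)] T_mono[of 0 1 j] by (simp add: T_0)
  have e3: "snd (P (tm (Suc j))) = snd (P (T j 2))" using st(3) by (simp add: T_3)
  show "\<bar>fst (P (tm (Suc j))) - fst (P (tm j)) - a j / 2 * c\<bar> \<le> a j / 2 * d"
    if n: "\<And>r. r \<in> {0..1} \<Longrightarrow> \<bar>g j (snd (P (tm j)) + snd (Z r)) - c\<bar> \<le> d"
    unfolding e1
  proof (rule shear_near[OF st(1) bumps(1), unfolded T_0])
    fix r assume "r \<in> {tm j..T j 1}"
    then have r: "r \<in> {0..1}" using in01[of r 0 1] by (simp add: T_0)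
    have "\<bar>a j / 2 * (g j (snd (P (tm j)) + snd (Z r)) - c)\<bar> \<le> a j / 2 * d"
      unfolding abs_mult using n[OF r] a_pos[of j] by (intro mult_mono) auto
    then show "\<bar>a j / 2 * g j (snd (P (tm j)) + snd (Z r)) - a j / 2 * c\<bar> \<le> a j / 2 * d"
      by (simp only: right_diff_distrib)
  qed
  show "\<bar>snd (P (tm (Suc j))) - snd (P (tm j)) - a (Suc j) / 2 * (c + 1)\<bar> \<le> a (Suc j) / 2 * d"
    if n: "\<And>r. r \<in> {0..1} \<Longrightarrow> \<bar>g j (fst (P (tm (Suc j))) + fst (Z r)) - c\<bar> \<le> d"
    unfolding e3 e2[symmetric]
  proof (rule shear_near[OF st(2) bumps(2)])
    fix r assume "r \<in> {T j 1..T j 2}"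
    then have r: "r \<in> {0..1}" using in01[of r 1 2] by simp
    have "\<bar>a (Suc j) / 2 * ((g j (fst (P (T j 1)) + fst (Z r)) + 1) - (c + 1))\<bar> \<le> a (Suc j) / 2 * d"
      unfolding abs_mult using n[OF r, unfolded e1] a_pos[of "Suc j"] by (intro mult_mono) auto
    then show "\<bar>a (Suc j) / 2 * (g j (fst (P (T j 1)) + fst (Z r)) + 1) - a (Suc j) / 2 * (c + 1)\<bar> \<le> a (Suc j) / 2 * d"
      by (simp only: right_diff_distrib)
  qed
qed

text \<open>The order is reversed: swap, second shear, first shear. The swap precedes the second
  shear, hence the shift by \<open>a (Suc j)\<close> in its argument; the first shear is evaluated
  at the final second coordinate.\<close>

lemma backward_stage:
  assumes p: "solves b Z P" and b: "\<And>r x. r \<in> {1 - tm (Suc j)<..<1 - tm j} \<Longrightarrow> b r x = uu r x"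
  shows "(\<And>r. r \<in> {0..1} \<Longrightarrow> \<bar>g j (fst (P (1 - tm (Suc j))) + a (Suc j) + fst (Z r)) - c\<bar> \<le> d) \<Longrightarrow>
      \<bar>snd (P (1 - tm j)) - snd (P (1 - tm (Suc j))) + a (Suc j) / 2 * (c + 1)\<bar> \<le> a (Suc j) / 2 * d"
    and "(\<And>r. r \<in> {0..1} \<Longrightarrow> \<bar>g j (snd (P (1 - tm j)) + snd (Z r)) - c\<bar> \<le> d) \<Longrightarrow>
      \<bar>fst (P (1 - tm j)) - fst (P (1 - tm (Suc j))) - a (Suc j) + a j / 2 * c\<bar> \<le> a j / 2 * d"
proof -
  note st = backward_steps[OF assms]
  have in01: "r \<in> {0..1}" if "r \<in> {1 - T j k..1 - T j i}" "k \<le> 3" for r i k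
    using that T_bounds(3)[of j i] T_bounds(4)[of k j] by auto
  have e1: "fst (P (1 - T j 2)) = fst (P (1 - tm (Suc j))) + a (Suc j)"
    using shear_const[OF st(1) bumps(3), where c = "a (Suc j)"] by (simp add: T_3)
  have e1': "fst (P (1 - T j 1)) = fst (P (1 - T j 2))"
    using shear_rigid[OF st(2)] T_mono[of 1 2 j] by simp
  have e2: "snd (P (1 - T j 2)) = snd (P (1 - tm (Suc j)))"
    using shear_rigid[OF st(1)] T_mono[of 2 3 j] by (simp add: T_3)
  have e3: "snd (P (1 - T j 1)) = snd (P (1 - tm j))"
    using shear_rigid[OF st(3)] T_mono[of 0 1 j] by (simp add: T_0)
  show "\<bar>snd (P (1 - tm j)) - snd (P (1 - tm (Suc j))) + a (Suc j) / 2 * (c + 1)\<bar> \<le> a (Suc j) / 2 * d"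
    if n: "\<And>r. r \<in> {0..1} \<Longrightarrow> \<bar>g j (fst (P (1 - tm (Suc j))) + a (Suc j) + fst (Z r)) - c\<bar> \<le> d"
  proof -
    have "\<bar>snd (P (1 - T j 1)) - snd (P (1 - T j 2)) - (- (a (Suc j) / 2 * (c + 1)))\<bar> \<le> a (Suc j) / 2 * d"
    proof (rule shear_near[OF st(2) bumps(4)])
      fix r assume "r \<in> {1 - T j 2..1 - T j 1}"
      then have r: "r \<in> {0..1}" using in01[of r 2 1] by simp
      have "\<bar>a (Suc j) / 2 * ((c + 1) - (g j (fst (P (1 - T j 2)) + fst (Z r)) + 1))\<bar> \<le> a (Suc j) / 2 * d"
        unfolding abs_mult using n[OF r] a_pos[of "Suc j"] by (intro mult_mono) (auto simp: e1 abs_minus_commute)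
      then show "\<bar>- (a (Suc j) / 2 * (g j (fst (P (1 - T j 2)) + fst (Z r)) + 1)) - - (a (Suc j) / 2 * (c + 1))\<bar> \<le> a (Suc j) / 2 * d"
        unfolding right_diff_distrib by linarith
    qed
    then show ?thesis unfolding e2 e3 by simp
  qed
  show "\<bar>fst (P (1 - tm j)) - fst (P (1 - tm (Suc j))) - a (Suc j) + a j / 2 * c\<bar> \<le> a j / 2 * d"
    if n: "\<And>r. r \<in> {0..1} \<Longrightarrow> \<bar>g j (snd (P (1 - tm j)) + snd (Z r)) - c\<bar> \<le> d"
  proof -
    have "\<bar>fst (P (1 - T j 0)) - fst (P (1 - T j 1)) - (- (a j / 2 * c))\<bar> \<le> a j / 2 * d"
    proof (rule shear_near[OF st(3) bumps(5)])
      fix r assume "r \<in> {1 - T j 1..1 - T j 0}"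
      then have r: "r \<in> {0..1}" using in01[of r 1 0] by simp
      have "\<bar>a j / 2 * (c - g j (snd (P (1 - T j 1)) + snd (Z r)))\<bar> \<le> a j / 2 * d"
        unfolding abs_mult using n[OF r, folded e3] a_pos[of j] by (intro mult_mono) (auto simp: abs_minus_commute)
      then show "\<bar>- (a j / 2 * g j (snd (P (1 - T j 1)) + snd (Z r))) - - (a j / 2 * c)\<bar> \<le> a j / 2 * d"
        unfolding right_diff_distrib by linarith
    qed
    then show ?thesis unfolding e1 e1' T_0 by (simp add: algebra_simps)
  qed
qed

end

section \<open>Distance to the jumps of the shears\<close>

definition far :: "real \<Rightarrow> real \<Rightarrow> real \<Rightarrow> bool" where
  "far b m z \<longleftrightarrow> (\<forall>k::int. m < \<bar>z - of_int k * b\<bar>)"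

lemma far_mono: "far b m z \<Longrightarrow> m' \<le> m \<Longrightarrow> far b m' z"
  unfolding far_def by (meson le_less_trans)

lemma far_shift: "far b m z \<Longrightarrow> far b m (z + of_int k * b)"
  unfolding far_def
proof
  fix i assume *: "\<forall>k::int. m < \<bar>z - of_int k * b\<bar>"
  show "m < \<bar>z + of_int k * b - of_int i * b\<bar>" using *[rule_format, of "i - k"] by (simp add: algebra_simps)
qed

lemma far_perturb: "far b m z \<Longrightarrow> \<bar>z' - z\<bar> \<le> d \<Longrightarrow> far b (m - d) z'"
  unfolding far_def
proof
  fix k assume *: "\<forall>k::int. m < \<bar>z - of_int k * b\<bar>" and d: "\<bar>z' - z\<bar> \<le> d"
  show "m - d < \<bar>z' - of_int k * b\<bar>" using *[rule_format, of k] d by linarith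
qed

lemma far_interval:
  assumes "far b m z" "0 < b" "0 \<le> m"
  shows "\<exists>n::int. of_int n * b + m < z \<and> z < (of_int n + 1) * b - m"
proof (intro exI conjI)
  define n where "n = \<lfloor>z / b\<rfloor>"
  have n: "of_int n * b \<le> z" "z < (of_int n + 1) * b"
    unfolding n_def using floor_divide_lower[OF assms(2)] floor_divide_upper[OF assms(2)] by auto
  show "of_int n * b + m < z" using assms(1)[unfolded far_def, rule_format, of n] n by linarith
  show "z < (of_int n + 1) * b - m" using assms(1)[unfolded far_def, rule_format, of "n + 1"] n by simp
qed

lemma sqw_constant:
  assumes "0 < b" "of_int n * b < y" "y < (of_int n + 1) * b" "of_int n * b < y'" "y' < (of_int n + 1) * b"
  shows "sqw (y / b) = sqw (y' / b)"
proof -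
  have "sqw (x / b) = (if even n then 1 else - 1)" if "of_int n * b < x" "x < (of_int n + 1) * b" for x
    using that assms(1) by (intro sqw_eqI) (auto simp: field_simps)
  then show ?thesis using assms by simp
qed

context scheme
begin

text \<open>Cells of the fast wave are nested in cells of the slow one because \<open>a j\<close> is
  a multiple of \<open>a (Suc j)\<close>. Hence the distance to multiples of
  \<open>a (Suc j)\<close> controls both factors; the margin is shared by the displacement
  \<open>d\<close> and the width of the mollifier.\<close>

lemma g_locally_constant:
  assumes f: "far (a (Suc j)) m z" and m: "d + l (Suc j) \<le> m" "0 \<le> d"
  shows "\<exists>c\<in>{-1, 1}. \<forall>z'. \<bar>z' - z\<bar> \<le> d \<longrightarrow> g j z' = c"
proof -
  let ?b = "a (Suc j)"
  obtain n where n: "of_int n * ?b + m < z" "z < (of_int n + 1) * ?b - m"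
    using far_interval[OF f a_pos] m ell_pos[of "Suc j"] by auto
  obtain p where p: "p > 0" "a j = 4 * real p * ?b" using ratio by blast
  \<comment> \<open>Index of the slow cell that contains the fast cell \<open>n\<close>;
    \<open>div\<close> rounds down for negative \<open>n\<close> too, as needed here.\<close>
  define N where "N = n div (4 * int p)"
  have nest: "of_int N * a j \<le> of_int n * ?b" "(of_int n + 1) * ?b \<le> (of_int N + 1) * a j"
  proof -
    define M where "M = 4 * int p"
    have M: "0 < M" "real_of_int M = 4 * real p" using p(1) by (auto simp: M_def)
    have "n = N * M + n mod M" by (simp only: N_def M_def div_mult_mod_eq)
    moreover have "0 \<le> n mod M" "n mod M < M" using M(1) by auto
    moreover have "(N + 1) * M = N * M + M" by (simp add: distrib_right)
    ultimately have "N * M \<le> n" "n + 1 \<le> (N + 1) * M" by linarith+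
    then have "real_of_int (N * M) \<le> of_int n" "real_of_int (n + 1) \<le> of_int ((N + 1) * M)"
      by (simp_all only: of_int_le_iff)
    then have i: "of_int N * (4 * real p) \<le> (of_int n :: real)" "(of_int n :: real) + 1 \<le> (of_int N + 1) * (4 * real p)"
      by (simp_all only: of_int_mult of_int_add of_int_1 M(2))
    show "of_int N * a j \<le> of_int n * ?b" using mult_right_mono[OF i(1), of ?b] a_pos[of "Suc j"] p(2) by (simp add: mult_ac)
    show "(of_int n + 1) * ?b \<le> (of_int N + 1) * a j" using mult_right_mono[OF i(2), of ?b] a_pos[of "Suc j"] p(2) by (simp add: mult_ac)
  qed
  define c where "c = sqw (z / ?b) * sqw (z / a j)"
  have "g j z' = c" if z': "\<bar>z' - z\<bar> \<le> d" for z'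
    unfolding g_def
  proof (rule avg_const[OF moll])
    fix y assume y: "\<bar>y - z'\<bar> \<le> l (Suc j)"
    have "\<bar>y - z\<bar> \<le> m" using y z' m(1) by linarith
    then have y1: "of_int n * ?b < y" "y < (of_int n + 1) * ?b" using n by linarith+
    have m0: "0 \<le> m" using m ell_pos[of "Suc j"] by linarith
    have z1: "of_int n * ?b < z" "z < (of_int n + 1) * ?b" using n m0 by linarith+
    have 1: "sqw (y / ?b) = sqw (z / ?b)" by (rule sqw_constant[OF a_pos y1 z1])
    have 2: "sqw (y / a j) = sqw (z / a j)"
      by (rule sqw_constant[OF a_pos, of N]) (use y1 z1 nest in linarith)+
    show "sqw (y / ?b) * sqw (y / a j) = c" unfolding c_def 1 2 ..
  qed (use ell_pos[of "Suc j"] in simp)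
  moreover have "c \<in> {-1, 1}" by (auto simp: c_def sqw_def)
  ultimately show ?thesis by blast
qed

text \<open>Position at time \<open>tm j\<close> of the noiseless solution started at
  \<open>x\<close>, by \<open>forward_exact\<close>. The second shear already uses the updated first
  coordinate.\<close>

primrec flow_pt :: "nat \<Rightarrow> pt \<Rightarrow> pt" where
  "flow_pt 0 x = x"
| "flow_pt (Suc j) x = (let y = flow_pt j x; y1 = fst y + a j / 2 * g j (snd y)
     in (y1, snd y + a (Suc j) / 2 * (g j y1 + 1)))"

lemma fst_flow_pt_Suc: "fst (flow_pt (Suc j) x) = fst (flow_pt j x) + a j / 2 * g j (snd (flow_pt j x))"
  and snd_flow_pt_Suc: "snd (flow_pt (Suc j) x) = snd (flow_pt j x) + a (Suc j) / 2 * (g j (fst (flow_pt (Suc j) x)) + 1)"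
  by (simp_all add: Let_def)

declare flow_pt.simps(2) [simp del]

text \<open>These are the arguments at which the two shears of stage \<open>j\<close> are evaluated.
  The factor 10 is a budget in units of \<open>l (Suc j)\<close>: the forward pass needs 2 units,
  the backward pass loses at most 4 to the drift recorded in \<open>shadows\<close> and needs 2
  more, and \<open>middle\<close> in the next stage consumes at most 8.\<close>

definition good_pt :: "nat \<Rightarrow> pt \<Rightarrow> bool" where
  "good_pt j x \<longleftrightarrow> far (a (Suc j)) (10 * l (Suc j)) (snd (flow_pt j x)) \<and>
     far (a (Suc j)) (10 * l (Suc j)) (fst (flow_pt (Suc j) x))"

definition small :: "(real \<Rightarrow> pt) \<Rightarrow> real \<Rightarrow> bool" where
  "small Z \<zeta> \<longleftrightarrow> 0 \<le> \<zeta> \<and> (\<forall>r\<in>{0..1}. \<bar>fst (Z r)\<bar> \<le> \<zeta> \<and> \<bar>snd (Z r)\<bar> \<le> \<zeta>)"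

text \<open>The maximum norm, so that every estimate splits into two linear ones.\<close>

definition close :: "pt \<Rightarrow> pt \<Rightarrow> real \<Rightarrow> bool" where
  "close x y d \<longleftrightarrow> \<bar>fst x - fst y\<bar> \<le> d \<and> \<bar>snd x - snd y\<bar> \<le> d"

lemma smallD: "small Z \<zeta> \<Longrightarrow> t \<in> {0..1} \<Longrightarrow> \<bar>fst (Z t)\<bar> \<le> \<zeta>" "small Z \<zeta> \<Longrightarrow> t \<in> {0..1} \<Longrightarrow> \<bar>snd (Z t)\<bar> \<le> \<zeta>"
  by (auto simp: small_def)

text \<open>For the finitely many stages before a point becomes good. Each shear is Lipschitz with a
  constant that depends on the stage but not on the noise, so the error is a fixed multiple of the
  noise amplitude.\<close>

lemma forward_lipschitz:
  "\<exists>c\<ge>0. \<forall>Z P \<zeta>. solves uu Z P \<and> small Z \<zeta> \<longrightarrow> close (P (tm j)) (flow_pt j (P 0)) (c * \<zeta>)"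
proof (induction j)
  case 0
  show ?case by (intro exI[of _ 0]) (simp add: close_def tm.simps)
next
  case (Suc j)
  then obtain c where c: "0 \<le> c" "\<And>Z P \<zeta>. solves uu Z P \<and> small Z \<zeta> \<Longrightarrow> close (P (tm j)) (flow_pt j (P 0)) (c * \<zeta>)"
    by auto
  obtain L where L: "0 \<le> L" "\<And>z z'. \<bar>g j z - g j z'\<bar> \<le> L * \<bar>z - z'\<bar>" using g_lipschitz by blast
  define c1 where "c1 = c + a j / 2 * (L * (c + 1))"
  define c2 where "c2 = c + a (Suc j) / 2 * (L * (c1 + 1))"
  have aj: "0 \<le> a j / 2" "0 \<le> a (Suc j) / 2" using a_pos[of j] a_pos[of "Suc j"] by auto
  have c1: "0 \<le> c1" unfolding c1_def using c(1) L(1) aj by simp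
  have c2: "0 \<le> c2" unfolding c2_def using c(1) L(1) aj c1 by simp
  have "close (P (tm (Suc j))) (flow_pt (Suc j) (P 0)) ((c1 + c2) * \<zeta>)"
    if h: "solves uu Z P" "small Z \<zeta>" for Z P \<zeta>
  proof -
    define x where "x = P 0"
    have z0: "0 \<le> \<zeta>" using h by (simp add: small_def)
    have cl: "\<bar>fst (P (tm j)) - fst (flow_pt j x)\<bar> \<le> c * \<zeta>" "\<bar>snd (P (tm j)) - snd (flow_pt j x)\<bar> \<le> c * \<zeta>"
      using c(2) h unfolding close_def x_def by blast+
    have "\<bar>fst (P (tm (Suc j))) - fst (P (tm j)) - a j / 2 * g j (snd (flow_pt j x))\<bar> \<le> a j / 2 * (L * (c * \<zeta> + \<zeta>))"
    proof (rule forward_stage(1)[OF h(1)])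
      fix r :: real assume "r \<in> {0..1}"
      then have "\<bar>snd (P (tm j)) + snd (Z r) - snd (flow_pt j x)\<bar> \<le> c * \<zeta> + \<zeta>"
        using cl(2) smallD(2)[OF h(2)] by (smt (verit))
      then show "\<bar>g j (snd (P (tm j)) + snd (Z r)) - g j (snd (flow_pt j x))\<bar> \<le> L * (c * \<zeta> + \<zeta>)"
        by (intro order_trans[OF L(2)] mult_left_mono L(1))
    qed simp
    note F = this
    have 1: "\<bar>fst (P (tm (Suc j))) - fst (flow_pt (Suc j) x)\<bar> \<le> c1 * \<zeta>"
    proof -
      have "c1 * \<zeta> = c * \<zeta> + a j / 2 * (L * (c * \<zeta> + \<zeta>))"
        unfolding c1_def by (simp only: distrib_right distrib_left mult_ac mult_1)
      then show ?thesis using F cl(1) unfolding fst_flow_pt_Suc by linarith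
    qed
    have "\<bar>snd (P (tm (Suc j))) - snd (P (tm j)) - a (Suc j) / 2 * (g j (fst (flow_pt (Suc j) x)) + 1)\<bar> \<le> a (Suc j) / 2 * (L * (c1 * \<zeta> + \<zeta>))"
    proof (rule forward_stage(2)[OF h(1)])
      fix r :: real assume "r \<in> {0..1}"
      then have "\<bar>fst (P (tm (Suc j))) + fst (Z r) - fst (flow_pt (Suc j) x)\<bar> \<le> c1 * \<zeta> + \<zeta>"
        using 1 smallD(1)[OF h(2)] by (smt (verit))
      then show "\<bar>g j (fst (P (tm (Suc j))) + fst (Z r)) - g j (fst (flow_pt (Suc j) x))\<bar> \<le> L * (c1 * \<zeta> + \<zeta>)"
        by (intro order_trans[OF L(2)] mult_left_mono L(1))
    qed simp
    note S = this
    have 2: "\<bar>snd (P (tm (Suc j))) - snd (flow_pt (Suc j) x)\<bar> \<le> c2 * \<zeta>"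
    proof -
      have "c2 * \<zeta> = c * \<zeta> + a (Suc j) / 2 * (L * (c1 * \<zeta> + \<zeta>))"
        unfolding c2_def by (simp only: distrib_right distrib_left mult_ac mult_1)
      then show ?thesis using S cl(2) unfolding snd_flow_pt_Suc[of j x] by linarith
    qed
    show ?thesis unfolding close_def distrib_right x_def[symmetric]
      using 1 2 mult_nonneg_nonneg[OF c1 z0] mult_nonneg_nonneg[OF c2 z0] by linarith
  qed
  then show ?case using c1 c2 by (intro exI[of _ "c1 + c2"]) auto
qed

lemma forward_exact:
  assumes p: "solves b (\<lambda>_. 0) D" and b: "\<And>r x. r < tm q \<Longrightarrow> 0 \<le> r \<Longrightarrow> b r x = uu r x" and j: "j \<le> q"
  shows "D (tm j) = flow_pt j (D 0)"
  using j
proof (induction j)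
  case 0 then show ?case by (simp add: tm.simps)
next
  case (Suc j)
  have tq: "tm (Suc j) \<le> tm q" using Suc.prems by (simp add: strict_mono_less_eq[OF tm_strict_mono])
  have bb: "b r x = uu r x" if "r \<in> {tm j<..<tm (Suc j)}" for r x
    using that tq tm_nonneg[of j] by (intro b) auto
  have IH: "D (tm j) = flow_pt j (D 0)" using Suc by simp
  have "\<bar>fst (D (tm (Suc j))) - fst (D (tm j)) - a j / 2 * g j (snd (flow_pt j (D 0)))\<bar> \<le> a j / 2 * 0"
    by (rule forward_stage(1)[OF p bb]) (simp_all add: IH)
  then have 1: "fst (D (tm (Suc j))) = fst (flow_pt (Suc j) (D 0))" unfolding fst_flow_pt_Suc IH by simp
  have "\<bar>snd (D (tm (Suc j))) - snd (D (tm j)) - a (Suc j) / 2 * (g j (fst (flow_pt (Suc j) (D 0))) + 1)\<bar> \<le> a (Suc j) / 2 * 0"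
    by (rule forward_stage(2)[OF p bb]) (simp_all add: 1)
  then have 2: "snd (D (tm (Suc j))) = snd (flow_pt (Suc j) (D 0))" unfolding snd_flow_pt_Suc[of j "D 0"] IH by simp
  show ?case using 1 2 by (rule prod_eqI)
qed

text \<open>
  At a good point each forward shear is locally constant around the noiseless position, so that the
  noise enters as a rigid translation.
\<close>

lemma forward_good:
  assumes p: "solves uu Z P" and Z: "small Z \<zeta>"
    and good: "\<And>j. j0 \<le> j \<Longrightarrow> good_pt j x"
    and cl: "close (P (tm j0)) (flow_pt j0 x) d" and d: "d + \<zeta> \<le> l q" and j: "j0 \<le> j" "j \<le> q"
  shows "P (tm j) - flow_pt j x = P (tm j0) - flow_pt j0 x"
  using j
proof (induction j rule: dec_induct)
  case (step j)
  have IH: "P (tm j) - flow_pt j x = P (tm j0) - flow_pt j0 x" using step by simp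
  have d0: "0 \<le> d" using cl unfolding close_def by linarith
  have z0: "0 \<le> \<zeta>" using Z by (simp add: small_def)
  have lj: "l q \<le> l (Suc j)" using step by (intro ell_antimono) simp
  have f1: "far (a (Suc j)) (10 * l (Suc j)) (snd (flow_pt j x))" and f2: "far (a (Suc j)) (10 * l (Suc j)) (fst (flow_pt (Suc j) x))"
    using good[of j] step by (auto simp: good_pt_def)
  have m: "(d + \<zeta>) + l (Suc j) \<le> 10 * l (Suc j)" using d lj ell_pos[of "Suc j"] by linarith
  obtain c1 where c1: "\<And>z'. \<bar>z' - snd (flow_pt j x)\<bar> \<le> d + \<zeta> \<Longrightarrow> g j z' = c1"
    using g_locally_constant[OF f1 m] d0 z0 by auto
  obtain c2 where c2: "\<And>z'. \<bar>z' - fst (flow_pt (Suc j) x)\<bar> \<le> d + \<zeta> \<Longrightarrow> g j z' = c2"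
    using g_locally_constant[OF f2 m] d0 z0 by auto
  have clj: "\<bar>fst (P (tm j)) - fst (flow_pt j x)\<bar> \<le> d" "\<bar>snd (P (tm j)) - snd (flow_pt j x)\<bar> \<le> d"
    using cl arg_cong[OF IH, of fst] arg_cong[OF IH, of snd] unfolding close_def by simp_all
  have "\<bar>fst (P (tm (Suc j))) - fst (P (tm j)) - a j / 2 * c1\<bar> \<le> a j / 2 * 0"
  proof (rule forward_stage(1)[OF p])
    fix r :: real assume r: "r \<in> {0..1}"
    have "\<bar>snd (P (tm j)) + snd (Z r) - snd (flow_pt j x)\<bar> \<le> d + \<zeta>"
      using clj(2) smallD(2)[OF Z r] by linarith
    then show "\<bar>g j (snd (P (tm j)) + snd (Z r)) - c1\<bar> \<le> 0" using c1 by simp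
  qed simp
  moreover have "g j (snd (flow_pt j x)) = c1" using c1 d0 z0 by simp
  ultimately have 1: "fst (P (tm (Suc j))) - fst (flow_pt (Suc j) x) = fst (P (tm j)) - fst (flow_pt j x)"
    unfolding fst_flow_pt_Suc by simp
  have "\<bar>snd (P (tm (Suc j))) - snd (P (tm j)) - a (Suc j) / 2 * (c2 + 1)\<bar> \<le> a (Suc j) / 2 * 0"
  proof (rule forward_stage(2)[OF p])
    fix r :: real assume r: "r \<in> {0..1}"
    have "\<bar>fst (P (tm (Suc j))) + fst (Z r) - fst (flow_pt (Suc j) x)\<bar> \<le> d + \<zeta>"
      using clj(1) smallD(1)[OF Z r] 1 by linarith
    then show "\<bar>g j (fst (P (tm (Suc j))) + fst (Z r)) - c2\<bar> \<le> 0" using c2 by simp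
  qed simp
  moreover have "g j (fst (flow_pt (Suc j) x)) = c2" using c2 d0 z0 by simp
  ultimately have 2: "snd (P (tm (Suc j))) - snd (flow_pt (Suc j) x) = snd (P (tm j)) - snd (flow_pt j x)"
    unfolding snd_flow_pt_Suc[of j x] by simp
  show ?case unfolding IH[symmetric] using 1 2 by (intro prod_eqI) simp_all
qed simp

end

section \<open>The passage through time 1/2 and the averaged stage\<close>

context scheme
begin

text \<open>The driving path may jump; with it subtracted the solution is an indefinite integral,
  hence continuous, and can be followed through time 1/2, where infinitely many stages
  accumulate.\<close>

lemma solves_continuous:
  assumes "solves b Z P"
  shows "continuous_on {0..1} P"
proof -
  have i: "((\<lambda>r. b r (P r + Z r)) has_integral (P t - P 0)) {0..t}" if "t \<in> {0..1}" for t
    using assms that by (auto simp: solves_def)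
  have "continuous_on {0..1} (\<lambda>t. integral {0..t} (\<lambda>r. b r (P r + Z r)))"
    by (rule indefinite_integral_continuous_1[OF has_integral_integrable[OF i]]) simp
  then have "continuous_on {0..1} (\<lambda>t. integral {0..t} (\<lambda>r. b r (P r + Z r)) + P 0)"
    by (intro continuous_intros)
  then show ?thesis
  proof (rule continuous_on_eq)
    fix t :: real assume "t \<in> {0..1}"
    from integral_unique[OF i[OF this]] show "integral {0..t} (\<lambda>r. b r (P r + Z r)) + P 0 = P t" by simp
  qed
qed

lemma half_limits:
  assumes "solves b Z P"
  shows "(\<lambda>j. P (tm j)) \<longlonglongrightarrow> P (1/2)" "(\<lambda>j. P (1 - tm j)) \<longlonglongrightarrow> P (1/2)"
proof -
  have t: "tm j \<in> {0..1}" "1 - tm j \<in> {0..1}" for j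
    using tm_nonneg[of j] tm_less_half[of j] by auto
  show "(\<lambda>j. P (tm j)) \<longlonglongrightarrow> P (1/2)"
    by (rule continuous_on_tendsto_compose[OF solves_continuous[OF assms] tm_tendsto]) (use t in auto)
  have "(\<lambda>j. 1 - tm j) \<longlonglongrightarrow> 1 - 1/2" by (intro tendsto_intros tm_tendsto)
  then have l: "(\<lambda>j. 1 - tm j) \<longlonglongrightarrow> 1/2" by simp
  show "(\<lambda>j. P (1 - tm j)) \<longlonglongrightarrow> P (1/2)"
    by (rule continuous_on_tendsto_compose[OF solves_continuous[OF assms] l]) (use t in auto)
qed

lemma forward_crude:
  assumes p: "solves uu Z P"
  shows "close (P (tm (Suc j))) (P (tm j)) (a j)"
proof -
  have "\<bar>fst (P (tm (Suc j))) - fst (P (tm j)) - a j / 2 * 0\<bar> \<le> a j / 2 * 1"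
    by (rule forward_stage(1)[OF p]) (auto simp: abs_g_le)
  then have 1: "\<bar>fst (P (tm (Suc j))) - fst (P (tm j))\<bar> \<le> a j / 2" by (simp only: mult_zero_right diff_zero mult_1_right)
  have "\<bar>snd (P (tm (Suc j))) - snd (P (tm j)) - a (Suc j) / 2 * (0 + 1)\<bar> \<le> a (Suc j) / 2 * 1"
    by (rule forward_stage(2)[OF p]) (auto simp: abs_g_le)
  then have 2: "\<bar>snd (P (tm (Suc j))) - snd (P (tm j)) - a (Suc j) / 2\<bar> \<le> a (Suc j) / 2" by (simp only: add_0 mult_1_right)
  from 1 2 show ?thesis unfolding close_def using a_Suc_le[of j] a_pos[of j] a_pos[of "Suc j"]
    by (intro conjI) linarith+
qed

lemma backward_crude:
  assumes p: "solves uu Z P"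
  shows "close (P (1 - tm j)) (P (1 - tm (Suc j))) (a j)"
proof -
  have "\<bar>snd (P (1 - tm j)) - snd (P (1 - tm (Suc j))) + a (Suc j) / 2 * (0 + 1)\<bar> \<le> a (Suc j) / 2 * 1"
    by (rule backward_stage(1)[OF p]) (auto simp: abs_g_le)
  then have 1: "\<bar>snd (P (1 - tm j)) - snd (P (1 - tm (Suc j))) + a (Suc j) / 2\<bar> \<le> a (Suc j) / 2" by (simp only: add_0 mult_1_right)
  have "\<bar>fst (P (1 - tm j)) - fst (P (1 - tm (Suc j))) - a (Suc j) + a j / 2 * 0\<bar> \<le> a j / 2 * 1"
    by (rule backward_stage(2)[OF p]) (auto simp: abs_g_le)
  then have 2: "\<bar>fst (P (1 - tm j)) - fst (P (1 - tm (Suc j))) - a (Suc j)\<bar> \<le> a j / 2" by (simp only: mult_zero_right add_0_right mult_1_right)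
  from 1 2 show ?thesis unfolding close_def using a_Suc_le[of j] a_pos[of j] a_pos[of "Suc j"]
    by (intro conjI) linarith+
qed

text \<open>As \<open>a (Suc j)\<close> is at most a quarter of \<open>a j\<close>, each step is
  bounded by \<open>2 * (a j - a (Suc j))\<close>. The sum telescopes and the limit inherits the
  bound.\<close>

lemma telescoping_close:
  fixes Q :: "nat \<Rightarrow> pt"
  assumes "\<And>j. close (Q (Suc j)) (Q j) (a j)" "Q \<longlonglongrightarrow> q"
  shows "close q (Q m) (2 * a m)"
proof -
  have *: "close (Q j) (Q m) (2 * (a m - a j))" if "m \<le> j" for j
    using that
  proof (induction j rule: dec_induct)
    case base then show ?case by (simp add: close_def)
  next
    case (step j)
    have "a j \<le> 2 * (a j - a (Suc j))"
      using a_Suc_le[of j] a_pos[of j] unfolding right_diff_distrib by linarith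
    then show ?case using step.IH assms(1)[of j] unfolding close_def right_diff_distrib by linarith
  qed
  have "\<bar>fst q - fst (Q m)\<bar> \<le> 2 * a m"
  proof (rule LIMSEQ_le_const2)
    show "(\<lambda>j. \<bar>fst (Q j) - fst (Q m)\<bar>) \<longlonglongrightarrow> \<bar>fst q - fst (Q m)\<bar>"
      by (intro tendsto_intros assms(2))
    show "\<exists>N. \<forall>j\<ge>N. \<bar>fst (Q j) - fst (Q m)\<bar> \<le> 2 * a m"
    proof (intro exI allI impI)
      fix j assume "m \<le> j"
      from *[OF this] a_pos[of j] show "\<bar>fst (Q j) - fst (Q m)\<bar> \<le> 2 * a m"
        unfolding close_def right_diff_distrib by linarith
    qed
  qed
  moreover have "\<bar>snd q - snd (Q m)\<bar> \<le> 2 * a m"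
  proof (rule LIMSEQ_le_const2)
    show "(\<lambda>j. \<bar>snd (Q j) - snd (Q m)\<bar>) \<longlonglongrightarrow> \<bar>snd q - snd (Q m)\<bar>"
      by (intro tendsto_intros assms(2))
    show "\<exists>N. \<forall>j\<ge>N. \<bar>snd (Q j) - snd (Q m)\<bar> \<le> 2 * a m"
    proof (intro exI allI impI)
      fix j assume "m \<le> j"
      from *[OF this] a_pos[of j] show "\<bar>snd (Q j) - snd (Q m)\<bar> \<le> 2 * a m"
        unfolding close_def right_diff_distrib by linarith
    qed
  qed
  ultimately show ?thesis by (simp add: close_def)
qed

text \<open>The tails on the two sides of time 1/2 are joined there; of the shears only the
  amplitudes enter.\<close>

lemma core_crude:
  assumes p: "solves uu Z P"
  shows "close (P (1 - tm m)) (P (tm m)) (4 * a m)"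
proof -
  have "close (P (1/2)) (P (tm m)) (2 * a m)"
    by (rule telescoping_close[OF forward_crude[OF p] half_limits(1)[OF p]])
  moreover have "close (P (1/2)) (P (1 - tm m)) (2 * a m)"
  proof (rule telescoping_close[OF _ half_limits(2)[OF p]])
    show "close (P (1 - tm (Suc j))) (P (1 - tm j)) (a j)" for j
      using backward_crude[OF p, of j] by (simp add: close_def abs_minus_commute)
  qed
  ultimately show ?thesis unfolding close_def by linarith
qed

text \<open>The offset \<open>Y\<close> is arbitrary because the actual one is the position of the
  noisy solution, which depends on the noise. The bound is asked only for paths within one cell of
  the slow wave and away from its ends by the mollification width, where the slow factor is a
  constant sign.\<close>

definition averages :: "(real \<Rightarrow> real) \<Rightarrow> real \<Rightarrow> real \<Rightarrow> (real \<Rightarrow> pt) \<Rightarrow> nat \<Rightarrow> real \<Rightarrow> bool" where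
  "averages e s t Z q K \<longleftrightarrow> (\<forall>Y n I.
     (\<forall>t\<in>{0..1}. of_int n * a q + l (Suc q) < Y + snd (Z t) \<and> Y + snd (Z t) < (of_int n + 1) * a q - l (Suc q)) \<longrightarrow>
     ((\<lambda>t. e t * g q (Y + snd (Z t))) has_integral I) {s..t} \<longrightarrow> \<bar>I\<bar> \<le> K)"

lemma far_in_cell:
  assumes "far (a q) m z" "\<bar>y - z\<bar> \<le> d" "small Z \<zeta>" "d + \<zeta> + l (Suc q) \<le> m" "0 \<le> d"
  shows "\<exists>n. \<forall>t\<in>{0..1}. of_int n * a q + l (Suc q) < y + snd (Z t) \<and> y + snd (Z t) < (of_int n + 1) * a q - l (Suc q)"
proof -
  have "0 \<le> m" using assms ell_pos[of "Suc q"] by (simp add: small_def)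
  then obtain n where n: "of_int n * a q + m < z" "z < (of_int n + 1) * a q - m"
    using far_interval[OF assms(1) a_pos] by auto
  show ?thesis
  proof (intro exI ballI)
    fix t :: real assume "t \<in> {0..1}"
    then have "\<bar>snd (Z t)\<bar> \<le> \<zeta>" using smallD(2)[OF assms(3)] by simp
    then show "of_int n * a q + l (Suc q) < y + snd (Z t) \<and> y + snd (Z t) < (of_int n + 1) * a q - l (Suc q)"
      using n assms(2,4) by linarith
  qed
qed

lemma averages_shear:
  assumes av: "averages e s t Z q K"
    and sh: "shear e (\<lambda>z. \<sigma> * (a q / 2 * g q z)) y z (\<lambda>r. snd (Z r)) s t" and \<sigma>: "\<bar>\<sigma>\<bar> = 1"
    and f: "far (a q) m x" "\<bar>z s - x\<bar> \<le> d" "small Z \<zeta>" "d + \<zeta> + l (Suc q) \<le> m" "0 \<le> d"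
  shows "\<bar>y t - y s\<bar> \<le> a q / 2 * K"
proof -
  define A where "A = a q / 2"
  have A: "0 < A" using a_pos[of q] by (simp add: A_def)
  obtain n where n: "\<forall>t\<in>{0..1}. of_int n * a q + l (Suc q) < z s + snd (Z t) \<and> z s + snd (Z t) < (of_int n + 1) * a q - l (Suc q)"
    using far_in_cell[OF f] by blast
  have "((\<lambda>r. e r * (\<sigma> * (A * g q (z s + snd (Z r))))) has_integral (y t - y s)) {s..t}"
    using sh by (simp add: shear_def A_def)
  then have "((\<lambda>r. (\<sigma> / A) * (e r * (\<sigma> * (A * g q (z s + snd (Z r)))))) has_integral ((\<sigma> / A) * (y t - y s))) {s..t}"
    by (rule has_integral_mult_right)
  note I = this
  have eq: "(\<sigma> / A) * (e r * (\<sigma> * (A * g q (z s + snd (Z r))))) = e r * g q (z s + snd (Z r))" for r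
  proof -
    have "\<sigma> * \<sigma> = 1" using \<sigma> by (metis abs_mult_self_eq mult_1)
    then have "(\<sigma> / A) * (e r * (\<sigma> * (A * x))) = e r * x" for x
      using A by (simp add: field_simps)
    then show ?thesis .
  qed
  have "\<bar>(\<sigma> / A) * (y t - y s)\<bar> \<le> K"
    by (rule av[unfolded averages_def, rule_format, OF _ I[unfolded eq], of n]) (use n in blast)
  then have "\<bar>y t - y s\<bar> / A \<le> K" using \<sigma> A by (simp add: abs_mult)
  then show ?thesis using A unfolding A_def[symmetric] by (simp add: field_simps)
qed

text \<open>Only the two passages through the first shear of stage \<open>q\<close> have amplitude
  of order \<open>a q\<close>; averaging bounds each by \<open>a q / 2 * K\<close>. The rest is
  estimated by its size in units of \<open>a (Suc q)\<close>: 4 for the core in either coordinate, 1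
  for the swap in the first coordinate, 1 for each of the two second shears in the second
  one.\<close>

lemma middle:
  assumes p: "solves uu Z P" and Z: "small Z \<zeta>"
    and av: "averages (\<eta> q 1) (T q 0) (T q 1) Z q K" "averages (\<lambda>t. \<eta> q 1 (1 - t)) (1 - T q 1) (1 - T q 0) Z q K"
    and f: "far (a q) (10 * l q) z" and z: "\<bar>snd (P (tm q)) - z\<bar> \<le> d" and d: "0 \<le> d" "d + \<zeta> \<le> l q"
  shows "close (P (1 - tm q)) (P (tm q)) (a q * K + 6 * a (Suc q))"
proof -
  note F = forward_steps[OF p, of q, OF refl] and B = backward_steps[OF p, of q, OF refl]
  note lq = ell_Suc_le[of q] ell_pos[of q] a_Suc_le_ell[of q]
  have T12: "T q 1 \<le> T q 2" "T q 0 \<le> T q 1" "T q 2 \<le> T q 3" by (rule T_mono, simp)+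
  have F1: "\<bar>fst (P (T q 1)) - fst (P (T q 0))\<bar> \<le> a q / 2 * K"
    by (rule averages_shear[OF av(1), where \<sigma> = 1 and z = "\<lambda>r. snd (P r)" and y = "\<lambda>r. fst (P r)", OF _ _ f _ Z _ d(1)])
      (use F(1) z d lq in \<open>simp_all add: T_0\<close>)
  have F1': "fst (P (tm (Suc q))) = fst (P (T q 1))"
    using shear_rigid[OF F(2) T12(1)] F(3) by (simp add: T_3)
  have F2: "\<bar>snd (P (tm (Suc q))) - snd (P (tm q)) - a (Suc q) / 2 * (0 + 1)\<bar> \<le> a (Suc q) / 2 * 1"
    by (rule forward_stage(2)[OF p]) (auto simp: abs_g_le)
  then have F2: "\<bar>snd (P (tm (Suc q))) - snd (P (tm q)) - a (Suc q) / 2\<bar> \<le> a (Suc q) / 2" by (simp only: add_0 mult_1_right)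
  have C: "close (P (1 - tm (Suc q))) (P (tm (Suc q))) (4 * a (Suc q))" by (rule core_crude[OF p])
  have B2: "\<bar>snd (P (1 - tm q)) - snd (P (1 - tm (Suc q))) + a (Suc q) / 2 * (0 + 1)\<bar> \<le> a (Suc q) / 2 * 1"
    by (rule backward_stage(1)[OF p]) (auto simp: abs_g_le)
  then have B2: "\<bar>snd (P (1 - tm q)) - snd (P (1 - tm (Suc q))) + a (Suc q) / 2\<bar> \<le> a (Suc q) / 2" by (simp only: add_0 mult_1_right)
  have B1: "fst (P (1 - T q 1)) = fst (P (1 - tm (Suc q))) + a (Suc q)"
    using shear_const[OF B(1) bumps(3), where c = "a (Suc q)"] shear_rigid[OF B(2)] T12 by (simp add: T_3)
  have B3: "snd (P (1 - T q 1)) = snd (P (1 - tm q))"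
    using shear_rigid[OF B(3)] T12 by (simp add: T_0)
  \<comment> \<open>The backward first shear is evaluated at the final second coordinate. Its return
    to within 6 * a (Suc q) of the entry value keeps the path in a slow cell, so that the second
    averaging bound applies.\<close>
  have s: "\<bar>snd (P (1 - tm q)) - snd (P (tm q))\<bar> \<le> 6 * a (Suc q)"
    using F2 C B2 a_pos[of "Suc q"] unfolding close_def by linarith
  have B4: "\<bar>fst (P (1 - T q 0)) - fst (P (1 - T q 1))\<bar> \<le> a q / 2 * K"
  proof (rule averages_shear[OF av(2), where \<sigma> = "-1" and z = "\<lambda>r. snd (P r)" and y = "\<lambda>r. fst (P r)", OF _ _ f _ Z])
    show "shear (\<lambda>t. \<eta> q 1 (1 - t)) (\<lambda>z. - 1 * (a q / 2 * g q z)) (\<lambda>r. fst (P r)) (\<lambda>r. snd (P r)) (\<lambda>r. snd (Z r)) (1 - T q 1) (1 - T q 0)"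
      using B(3) by simp
    show "\<bar>snd (P (1 - T q 1)) - z\<bar> \<le> d + 6 * a (Suc q)" unfolding B3 using s z by linarith
    show "d + 6 * a (Suc q) + \<zeta> + l (Suc q) \<le> 10 * l q" using d lq by linarith
    show "0 \<le> d + 6 * a (Suc q)" using d a_pos[of "Suc q"] by simp
  qed simp
  have K: "a q * K = a q / 2 * K + a q / 2 * K" by simp
  have "\<bar>fst (P (1 - tm q)) - fst (P (tm q))\<bar> \<le> a q * K + 6 * a (Suc q)"
    unfolding K using F1 F1' C B1 B4 a_pos[of "Suc q"] unfolding close_def T_0 by linarith
  moreover have "0 \<le> a q * K" unfolding K using F1 by linarith
  ultimately show ?thesis using s unfolding close_def by linarith
qed

text \<open>Counterpart of \<open>forward_lipschitz\<close> for the finitely many last stages. The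
  comparison is with the noiseless solution, which need not be back at a forward position, and an
  initial error \<open>e\<close> is propagated.\<close>

lemma backward_lipschitz:
  "\<exists>c\<ge>0. \<forall>Z P \<zeta> b D e. solves uu Z P \<and> small Z \<zeta> \<and> solves b (\<lambda>_. 0) D \<and>
      (\<forall>r x. 1 - tm j < r \<and> r \<le> 1 \<longrightarrow> b r x = uu r x) \<and> close (P (1 - tm j)) (D (1 - tm j)) e \<longrightarrow>
      close (P 1) (D 1) (c * (e + \<zeta>))"
proof (induction j)
  case 0
  show ?case by (intro exI[of _ 1]) (auto simp: close_def tm.simps small_def)
next
  case (Suc j)
  then obtain c where c: "0 \<le> c" "\<And>Z P \<zeta> b D e. solves uu Z P \<and> small Z \<zeta> \<and> solves b (\<lambda>_. 0) D \<and>
      (\<forall>r x. 1 - tm j < r \<and> r \<le> 1 \<longrightarrow> b r x = uu r x) \<and> close (P (1 - tm j)) (D (1 - tm j)) e \<Longrightarrow>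
      close (P 1) (D 1) (c * (e + \<zeta>))" by auto
  obtain L where L: "0 \<le> L" "\<And>z z'. \<bar>g j z - g j z'\<bar> \<le> L * \<bar>z - z'\<bar>" using g_lipschitz by blast
  define c1 where "c1 = 1 + a (Suc j) * L"
  define c2 where "c2 = 1 + a j * (L * (c1 + 1))"
  have aj: "0 \<le> a j" "0 \<le> a (Suc j)" using a_pos[of j] a_pos[of "Suc j"] by auto
  have c1: "0 \<le> c1" unfolding c1_def using L(1) aj by simp
  have c2: "0 \<le> c2" unfolding c2_def using L(1) aj c1 by simp
  have "close (P 1) (D 1) (c * (c1 + c2 + 1) * (e + \<zeta>))"
    if h: "solves uu Z P" "small Z \<zeta>" "solves b (\<lambda>_. 0) D"
      "\<And>r x. 1 - tm (Suc j) < r \<and> r \<le> 1 \<Longrightarrow> b r x = uu r x"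
      "close (P (1 - tm (Suc j))) (D (1 - tm (Suc j))) e" for Z P \<zeta> b D e
  proof -
    define E where "E = e + \<zeta>"
    have z0: "0 \<le> \<zeta>" using h by (simp add: small_def)
    have cl: "\<bar>fst (P (1 - tm (Suc j))) - fst (D (1 - tm (Suc j)))\<bar> \<le> e" "\<bar>snd (P (1 - tm (Suc j))) - snd (D (1 - tm (Suc j)))\<bar> \<le> e"
      using h(5) unfolding close_def by auto
    have e0: "0 \<le> e" using cl by linarith
    have E0: "0 \<le> E" "e \<le> E" "\<zeta> \<le> E" using e0 z0 by (auto simp: E_def)
    have bb: "b r x = uu r x" if "r \<in> {1 - tm (Suc j)<..<1 - tm j}" for r x
      using that tm_nonneg[of j] by (intro h(4)) auto
    define g2 where "g2 = g j (fst (D (1 - tm (Suc j))) + a (Suc j))"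
    have "\<bar>snd (P (1 - tm j)) - snd (P (1 - tm (Suc j))) + a (Suc j) / 2 * (g2 + 1)\<bar> \<le> a (Suc j) / 2 * (L * E)"
    proof (rule backward_stage(1)[OF h(1)])
      fix r :: real assume "r \<in> {0..1}"
      then have "\<bar>fst (P (1 - tm (Suc j))) + a (Suc j) + fst (Z r) - (fst (D (1 - tm (Suc j))) + a (Suc j))\<bar> \<le> E"
        using cl(1) smallD(1)[OF h(2), of r] unfolding E_def by linarith
      then show "\<bar>g j (fst (P (1 - tm (Suc j))) + a (Suc j) + fst (Z r)) - g2\<bar> \<le> L * E"
        unfolding g2_def by (intro order_trans[OF L(2)] mult_left_mono L(1))
    qed simp
    moreover have "\<bar>snd (D (1 - tm j)) - snd (D (1 - tm (Suc j))) + a (Suc j) / 2 * (g2 + 1)\<bar> \<le> a (Suc j) / 2 * 0"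
      by (rule backward_stage(1)[OF h(3) bb]) (simp_all add: g2_def)
    ultimately have "\<bar>snd (P (1 - tm j)) - snd (D (1 - tm j))\<bar> \<le> E + a (Suc j) / 2 * (L * E)"
      using cl(2) E0 by linarith
    also have "\<dots> \<le> c1 * E"
    proof -
      have "c1 * E = E + a (Suc j) / 2 * (L * E) + a (Suc j) / 2 * (L * E)" unfolding c1_def by (simp add: distrib_right)
      moreover have "0 \<le> a (Suc j) / 2 * (L * E)" using aj L(1) E0 by simp
      ultimately show ?thesis by linarith
    qed
    finally have 2: "\<bar>snd (P (1 - tm j)) - snd (D (1 - tm j))\<bar> \<le> c1 * E" .
    define g1 where "g1 = g j (snd (D (1 - tm j)))"
    have "\<bar>fst (P (1 - tm j)) - fst (P (1 - tm (Suc j))) - a (Suc j) + a j / 2 * g1\<bar> \<le> a j / 2 * (L * (c1 * E + E))"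
    proof (rule backward_stage(2)[OF h(1)])
      fix r :: real assume "r \<in> {0..1}"
      then have "\<bar>snd (P (1 - tm j)) + snd (Z r) - snd (D (1 - tm j))\<bar> \<le> c1 * E + E"
        using 2 smallD(2)[OF h(2), of r] E0 by linarith
      then show "\<bar>g j (snd (P (1 - tm j)) + snd (Z r)) - g1\<bar> \<le> L * (c1 * E + E)"
        unfolding g1_def by (intro order_trans[OF L(2)] mult_left_mono L(1))
    qed simp
    moreover have "\<bar>fst (D (1 - tm j)) - fst (D (1 - tm (Suc j))) - a (Suc j) + a j / 2 * g1\<bar> \<le> a j / 2 * 0"
      by (rule backward_stage(2)[OF h(3) bb]) (simp_all add: g1_def)
    ultimately have "\<bar>fst (P (1 - tm j)) - fst (D (1 - tm j))\<bar> \<le> E + a j / 2 * (L * (c1 * E + E))"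
      using cl(1) E0 by linarith
    also have "\<dots> \<le> c2 * E"
    proof -
      have "c2 * E = E + a j / 2 * (L * (c1 * E + E)) + a j / 2 * (L * (c1 * E + E))"
        unfolding c2_def by (simp add: distrib_right distrib_left)
      moreover have "0 \<le> a j / 2 * (L * (c1 * E + E))" using aj L(1) E0 c1 by simp
      ultimately show ?thesis by linarith
    qed
    finally have 1: "\<bar>fst (P (1 - tm j)) - fst (D (1 - tm j))\<bar> \<le> c2 * E" .
    have clj: "close (P (1 - tm j)) (D (1 - tm j)) ((c1 + c2) * E)"
      using 1 2 mult_nonneg_nonneg[OF c1 E0(1)] mult_nonneg_nonneg[OF c2 E0(1)]
      unfolding close_def distrib_right by linarith
    have tj: "1 - tm (Suc j) < 1 - tm j" using tm_less_Suc[of j] by simp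
    have "close (P 1) (D 1) (c * ((c1 + c2) * E + \<zeta>))"
      by (rule c(2)) (use h clj tj in \<open>auto intro: less_trans\<close>)
    moreover have "c * ((c1 + c2) * E + \<zeta>) \<le> c * (c1 + c2 + 1) * E"
    proof -
      have "c * ((c1 + c2) * E + \<zeta>) \<le> c * ((c1 + c2) * E + E)" using E0 c(1) by (intro mult_left_mono) auto
      then show ?thesis by (simp add: algebra_simps)
    qed
    ultimately show ?thesis unfolding close_def E_def by linarith
  qed
  then show ?case using c1 c2 c(1) by (intro exI[of _ "c * (c1 + c2 + 1)"]) auto
qed

end

section \<open>Tracking the backward flow\<close>

context scheme
begin

text \<open>
  Going backwards, the noiseless solution follows the forward positions only up to multiples of the
  scale: both shears are undone up to sign, and the swap adds a multiple of the scale. Since the jump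
  set of the shears is periodic, it still stays away from it.
\<close>

definition shadows :: "pt \<Rightarrow> nat \<Rightarrow> pt \<Rightarrow> bool" where
  "shadows y j x \<longleftrightarrow> (\<exists>k\<in>{-1, 0, 1}. \<bar>fst y - fst (flow_pt j x) - of_int k * a j\<bar> \<le> 4 * a (Suc j)) \<and>
     \<bar>snd y - snd (flow_pt j x)\<bar> \<le> 4 * a (Suc j)"

text \<open>Undoing a shear with the wrong sign leaves an integer multiple of twice its amplitude,
  that is of \<open>a j\<close> or \<open>a (Suc j)\<close>; such multiples are invisible to a jump
  set with that period.\<close>

lemma half_sign_sum:
  assumes "c \<in> {-1, 1::real}" "c' \<in> {-1, 1::real}"
  shows "\<exists>k\<in>{-1, 0, 1::int}. \<forall>x. x / 2 * c - x / 2 * c' = of_int k * x"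
proof -
  consider "c = c'" | "c = 1" "c' = -1" | "c = -1" "c' = 1" using assms by auto
  then show ?thesis
  proof cases
    case 1 then show ?thesis by (intro bexI[of _ 0]) auto
  next
    case 2 then show ?thesis by (intro bexI[of _ 1]) auto
  next
    case 3 then show ?thesis by (intro bexI[of _ "-1"]) auto
  qed
qed

text \<open>Both paths see the same constant value of each shear, so their difference is carried
  along. The multiple \<open>k\<close> of \<open>a (Suc j)\<close> is ignored by periodicity while
  stage \<open>j\<close> is undone; together with the swap it then counts as an error at the coarser
  scale, and this is how the induction on \<open>shadows\<close> closes.\<close>

lemma backward_good_step:
  assumes p: "solves uu Z P" and Z: "small Z \<zeta>" and D: "solves b (\<lambda>_. 0) D"
    and b: "\<And>r x. r \<in> {1 - tm (Suc j)<..<1 - tm j} \<Longrightarrow> b r x = uu r x"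
    and good: "good_pt j x" and sh: "shadows (D (1 - tm (Suc j))) (Suc j) x"
    and cl: "close (P (1 - tm (Suc j))) (D (1 - tm (Suc j))) d" and d: "d + \<zeta> \<le> l (Suc j)"
  shows "shadows (D (1 - tm j)) j x"
    "P (1 - tm j) - D (1 - tm j) = P (1 - tm (Suc j)) - D (1 - tm (Suc j))"
proof -
  let ?b = "a (Suc j)" and ?l = "l (Suc j)"
  let ?P0 = "P (1 - tm (Suc j))" and ?D0 = "D (1 - tm (Suc j))" and ?P1 = "P (1 - tm j)" and ?D1 = "D (1 - tm j)"
  have d0: "0 \<le> d" using cl unfolding close_def by linarith
  have z0: "0 \<le> \<zeta>" using Z by (simp add: small_def)
  have ab: "a (Suc (Suc j)) \<le> ?l" "4 * a (Suc (Suc j)) \<le> ?b" "0 < ?b" "0 < ?l"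
    using a_Suc_le_ell[of "Suc j"] a_Suc_le[of "Suc j"] a_pos[of "Suc j"] ell_pos[of "Suc j"] by auto
  have f1: "far ?b (10 * ?l) (snd (flow_pt j x))" and f2: "far ?b (10 * ?l) (fst (flow_pt (Suc j) x))"
    using good by (auto simp: good_pt_def)
  obtain k where k: "k \<in> {-1, 0, 1::int}" and k': "\<bar>fst ?D0 - fst (flow_pt (Suc j) x) - of_int k * ?b\<bar> \<le> 4 * a (Suc (Suc j))"
    and s: "\<bar>snd ?D0 - snd (flow_pt (Suc j) x)\<bar> \<le> 4 * a (Suc (Suc j))"
    using sh unfolding shadows_def by blast
  have kr: "of_int k \<in> {-1, 0, 1::real}" using k by auto
  \<comment> \<open>Argument of the second shear, after the swap. Modulo \<open>a (Suc j)\<close> it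
    is still the forward position, up to the drift.\<close>
  define y1 where "y1 = fst ?D0 + ?b"
  have "\<bar>y1 - (fst (flow_pt (Suc j) x) + of_int (k + 1) * ?b)\<bar> \<le> 4 * a (Suc (Suc j))"
    using k' unfolding y1_def by (simp add: algebra_simps)
  then have "far ?b (10 * ?l - 4 * a (Suc (Suc j))) y1"
    by (rule far_perturb[OF far_shift[OF f2]])
  \<comment> \<open>The drift is at most 4 * l (Suc j), which leaves 6 of the 10 units of
    \<open>good_pt\<close>.\<close>
  then have fy1: "far ?b (6 * ?l) y1" by (rule far_mono) (use ab in linarith)
  have m: "(d + \<zeta>) + ?l \<le> 6 * ?l" using d ab by linarith
  obtain c2 where c2: "c2 \<in> {-1, 1}" "\<And>z'. \<bar>z' - y1\<bar> \<le> d + \<zeta> \<Longrightarrow> g j z' = c2"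
    using g_locally_constant[OF fy1 m] d0 z0 by auto
  have clf: "\<bar>fst ?P0 - fst ?D0\<bar> \<le> d" "\<bar>snd ?P0 - snd ?D0\<bar> \<le> d" using cl by (auto simp: close_def)
  have "\<bar>snd ?P1 - snd ?P0 + ?b / 2 * (c2 + 1)\<bar> \<le> ?b / 2 * 0"
  proof (rule backward_stage(1)[OF p])
    fix r :: real assume r: "r \<in> {0..1}"
    have "\<bar>fst ?P0 + ?b + fst (Z r) - y1\<bar> \<le> d + \<zeta>" using clf(1) smallD(1)[OF Z r] unfolding y1_def by linarith
    then show "\<bar>g j (fst ?P0 + ?b + fst (Z r)) - c2\<bar> \<le> 0" using c2(2) by simp
  qed simp
  then have P2: "snd ?P1 = snd ?P0 - ?b / 2 * (c2 + 1)" by simp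
  have "\<bar>snd ?D1 - snd ?D0 + ?b / 2 * (c2 + 1)\<bar> \<le> ?b / 2 * 0"
  proof (rule backward_stage(1)[OF D b])
    fix r :: real
    have "\<bar>fst ?D0 + ?b + fst (0::pt) - y1\<bar> \<le> d + \<zeta>" using d0 z0 unfolding y1_def by simp
    then show "\<bar>g j (fst ?D0 + ?b + fst (0::pt)) - c2\<bar> \<le> 0" using c2(2) by simp
  qed simp
  then have D2: "snd ?D1 = snd ?D0 - ?b / 2 * (c2 + 1)" by simp
  define c where "c = g j (fst (flow_pt (Suc j) x))"
  have c: "c \<in> {-1, 1}" using g_locally_constant[OF f2, of 0] ab unfolding c_def by auto
  obtain i where i: "i \<in> {-1, 0, 1::int}" "\<And>x. x / 2 * c - x / 2 * c2 = of_int i * x" using half_sign_sum[OF c c2(1)] by blast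
  have "snd ?D1 - snd (flow_pt j x) - of_int i * ?b = snd ?D0 - snd (flow_pt (Suc j) x)"
    unfolding D2 snd_flow_pt_Suc[of j x] c_def[symmetric] i(2)[symmetric] distrib_left by linarith
  then have e2: "\<bar>snd ?D1 - (snd (flow_pt j x) + of_int i * ?b)\<bar> \<le> 4 * a (Suc (Suc j))" using s by (simp add: algebra_simps)
  then have "far ?b (10 * ?l - 4 * a (Suc (Suc j))) (snd ?D1)"
    by (rule far_perturb[OF far_shift[OF f1]])
  then have fy2: "far ?b (6 * ?l) (snd ?D1)" by (rule far_mono) (use ab in linarith)
  obtain c1 where c1: "c1 \<in> {-1, 1}" "\<And>z'. \<bar>z' - snd ?D1\<bar> \<le> d + \<zeta> \<Longrightarrow> g j z' = c1"
    using g_locally_constant[OF fy2 m] d0 z0 by auto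
  have clP: "\<bar>snd ?P1 - snd ?D1\<bar> \<le> d" unfolding P2 D2 using clf(2) by simp
  have "\<bar>fst ?P1 - fst ?P0 - ?b + a j / 2 * c1\<bar> \<le> a j / 2 * 0"
  proof (rule backward_stage(2)[OF p])
    fix r :: real assume r: "r \<in> {0..1}"
    have "\<bar>snd ?P1 + snd (Z r) - snd ?D1\<bar> \<le> d + \<zeta>" using clP smallD(2)[OF Z r] by linarith
    then show "\<bar>g j (snd ?P1 + snd (Z r)) - c1\<bar> \<le> 0" using c1(2) by simp
  qed simp
  then have P1: "fst ?P1 = fst ?P0 + ?b - a j / 2 * c1" by simp
  have "\<bar>fst ?D1 - fst ?D0 - ?b + a j / 2 * c1\<bar> \<le> a j / 2 * 0"
  proof (rule backward_stage(2)[OF D b])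
    fix r :: real
    have "\<bar>snd ?D1 + snd (0::pt) - snd ?D1\<bar> \<le> d + \<zeta>" using d0 z0 by simp
    then show "\<bar>g j (snd ?D1 + snd (0::pt)) - c1\<bar> \<le> 0" using c1(2) by simp
  qed simp
  then have D1: "fst ?D1 = fst ?D0 + ?b - a j / 2 * c1" by simp
  show "?P1 - ?D1 = ?P0 - ?D0"
    by (rule prod_eqI) (simp_all add: P1 D1 P2 D2)
  define c' where "c' = g j (snd (flow_pt j x))"
  have c': "c' \<in> {-1, 1}" using g_locally_constant[OF f1, of 0] ab unfolding c'_def by auto
  obtain m where m: "m \<in> {-1, 0, 1::int}" "\<And>x. x / 2 * c' - x / 2 * c1 = of_int m * x" using half_sign_sum[OF c' c1(1)] by blast
  have e1: "fst ?D1 - fst (flow_pt j x) - of_int m * a j = (fst ?D0 - fst (flow_pt (Suc j) x) - of_int k * ?b) + (of_int k * ?b + ?b)"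
    unfolding D1 fst_flow_pt_Suc c'_def[symmetric] m(2)[symmetric] by simp
  \<comment> \<open>Old multiple and swap give at most 2 * ?b, the old error at most ?b; the bound 4
    * ?b of \<open>shadows\<close> has room for both.\<close>
  have "\<bar>of_int k * ?b + ?b\<bar> \<le> 2 * ?b" using kr ab(3) by auto
  then have "\<bar>fst ?D1 - fst (flow_pt j x) - of_int m * a j\<bar> \<le> 4 * ?b"
    unfolding e1 using k' ab by linarith
  moreover have "\<bar>snd ?D1 - snd (flow_pt j x)\<bar> \<le> 4 * ?b"
  proof -
    have "of_int i \<in> {-1, 0, 1::real}" using i(1) by auto
    then have "\<bar>of_int i * ?b\<bar> \<le> ?b" using ab(3) by auto
    then show ?thesis using e2 ab by linarith
  qed
  ultimately show "shadows ?D1 j x" unfolding shadows_def using m(1) by blast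
qed

lemma backward_good:
  assumes p: "solves uu Z P" and Z: "small Z \<zeta>" and D: "solves b (\<lambda>_. 0) D"
    and b: "\<And>r x. 1 - tm q < r \<Longrightarrow> r \<le> 1 \<Longrightarrow> b r x = uu r x"
    and good: "\<And>j. j0 \<le> j \<Longrightarrow> good_pt j x" and D0: "D (1 - tm q) = flow_pt q x"
    and cl: "close (P (1 - tm q)) (D (1 - tm q)) d" and d: "d + \<zeta> \<le> l q" and j: "j0 \<le> j" "j \<le> q"
  shows "shadows (D (1 - tm j)) j x \<and> P (1 - tm j) - D (1 - tm j) = P (1 - tm q) - D (1 - tm q)"
  using j(2,1)
proof (induction j rule: inc_induct)
  case base
  show ?case using D0 a_pos[of "Suc q"] by (auto simp: shadows_def)
next
  case (step j)
  then have IH: "shadows (D (1 - tm (Suc j))) (Suc j) x" "P (1 - tm (Suc j)) - D (1 - tm (Suc j)) = P (1 - tm q) - D (1 - tm q)"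
    by auto
  have tq: "tm (Suc j) \<le> tm q" using step by (simp add: strict_mono_less_eq[OF tm_strict_mono])
  have bb: "b r x = uu r x" if "r \<in> {1 - tm (Suc j)<..<1 - tm j}" for r x
    using that tq tm_nonneg[of j] by (intro b) auto
  have clj: "close (P (1 - tm (Suc j))) (D (1 - tm (Suc j))) d"
    using cl arg_cong[OF IH(2), of fst] arg_cong[OF IH(2), of snd] unfolding close_def by simp
  have dj: "d + \<zeta> \<le> l (Suc j)" using d ell_antimono[of "Suc j" q] step by linarith
  from backward_good_step[OF p Z D bb good IH(1) clj dj] step IH(2) show ?case by simp
qed

text \<open>At a good point the second shear moves \<open>snd\<close> by 0 or by
  \<open>a (Suc q)\<close>, so stage q + 1 starts far from the jumps of its own slow wave, as
  \<open>middle\<close> asks.\<close>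

lemma far_prev:
  assumes "good_pt q x"
  shows "far (a (Suc q)) (10 * l (Suc q)) (snd (flow_pt (Suc q) x))"
proof -
  have f: "far (a (Suc q)) (10 * l (Suc q)) (snd (flow_pt q x))" "far (a (Suc q)) (10 * l (Suc q)) (fst (flow_pt (Suc q) x))"
    using assms by (auto simp: good_pt_def)
  define c where "c = g q (fst (flow_pt (Suc q) x))"
  have "c \<in> {-1, 1}" using g_locally_constant[OF f(2), of 0] ell_pos[of "Suc q"] unfolding c_def by auto
  then have "a (Suc q) / 2 * (c + 1) = of_int 0 * a (Suc q) \<or> a (Suc q) / 2 * (c + 1) = of_int 1 * a (Suc q)" by auto
  then show ?thesis unfolding snd_flow_pt_Suc[of q x] c_def[symmetric] using far_shift[OF f(1)] by metis
qed

lemma dist_close: "close x y d \<Longrightarrow> dist x y \<le> 2 * d"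
proof -
  assume "close x y d"
  then have "dist (fst x) (fst y) \<le> d" "dist (snd x) (snd y) \<le> d" by (auto simp: close_def dist_real_def)
  moreover have "dist x y \<le> dist (fst x) (fst y) + dist (snd x) (snd y)"
    unfolding dist_prod_def by (rule sqrt_sum_squares_le_sum) auto
  ultimately show ?thesis by linarith
qed

text \<open>Errors are measured against \<open>l q\<close>: \<open>d q\<close> before and
  \<open>d' q\<close> after the middle part are both of smaller order, which is what the local
  constancy of the shears of earlier stages tolerates. The stages before \<open>j0\<close> only
  contribute factors independent of \<open>q\<close>.\<close>

lemma deterministic_convergence:
  fixes Z P D :: "nat \<Rightarrow> real \<Rightarrow> pt"
  assumes good: "\<And>j. j0 \<le> j \<Longrightarrow> good_pt j x"
    and p: "\<And>q. solves uu (Z q) (P q)" and P0: "\<And>q. P q 0 = x" and Z: "\<And>q. small (Z q) (\<zeta> q)"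
    and D: "\<And>q. solves (b q) (\<lambda>_. 0) (D q)" and D0: "\<And>q. D q 0 = x"
    and b: "\<And>q r x. 0 \<le> r \<Longrightarrow> r < tm q \<Longrightarrow> b q r x = uu r x"
      "\<And>q r x. 1 - tm q < r \<Longrightarrow> r \<le> 1 \<Longrightarrow> b q r x = uu r x"
      "\<And>q r x. tm q < r \<Longrightarrow> r < 1 - tm q \<Longrightarrow> b q r x = 0"
    and av: "\<forall>\<^sub>F q in sequentially. averages (\<eta> q 1) (T q 0) (T q 1) (Z q) q (K q) \<and>
        averages (\<lambda>t. \<eta> q 1 (1 - t)) (1 - T q 1) (1 - T q 0) (Z q) q (K q)"
    and lim: "(\<lambda>q. \<zeta> q / l q) \<longlonglongrightarrow> 0" "(\<lambda>q. a q / l q * K q) \<longlonglongrightarrow> 0"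
  shows "(\<lambda>q. dist (P q 1 + Z q 1) (D q 1)) \<longlonglongrightarrow> 0"
proof -
  obtain c0 where c0: "0 \<le> c0" "\<And>Z P \<zeta>. solves uu Z P \<and> small Z \<zeta> \<Longrightarrow> close (P (tm j0)) (flow_pt j0 (P 0)) (c0 * \<zeta>)"
    using forward_lipschitz[of j0] by auto
  obtain c1 where c1: "0 \<le> c1" "\<And>Z P \<zeta> b D e. solves uu Z P \<and> small Z \<zeta> \<and> solves b (\<lambda>_. 0) D \<and>
      (\<forall>r x. 1 - tm j0 < r \<and> r \<le> 1 \<longrightarrow> b r x = uu r x) \<and> close (P (1 - tm j0)) (D (1 - tm j0)) e \<Longrightarrow>
      close (P 1) (D 1) (c1 * (e + \<zeta>))"
    using backward_lipschitz[of j0] by auto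
  define d where "d = (\<lambda>q. c0 * \<zeta> q)"
  define d' where "d' = (\<lambda>q. d q + (a q * K q + 6 * a (Suc q)))"
  have dl: "(\<lambda>q. (d q + \<zeta> q) / l q) \<longlonglongrightarrow> 0"
  proof -
    have "(\<lambda>q. (c0 + 1) * (\<zeta> q / l q)) \<longlonglongrightarrow> (c0 + 1) * 0" by (intro tendsto_intros lim)
    moreover have "(d q + \<zeta> q) / l q = (c0 + 1) * (\<zeta> q / l q)" for q
      by (simp add: d_def distrib_right add_divide_distrib)
    ultimately show ?thesis by (simp only: mult_zero_right)
  qed
  have dl': "(\<lambda>q. (d' q + \<zeta> q) / l q) \<longlonglongrightarrow> 0"
  proof -
    have "(\<lambda>q. (d q + \<zeta> q) / l q + (a q / l q * K q + 6 * (a (Suc q) / l q))) \<longlonglongrightarrow> 0 + (0 + 6 * 0)"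
      by (intro tendsto_intros lim dl ratios_tendsto)
    moreover have "(d' q + \<zeta> q) / l q = (d q + \<zeta> q) / l q + (a q / l q * K q + 6 * (a (Suc q) / l q))" for q
      by (simp add: d'_def add_divide_distrib)
    ultimately show ?thesis by simp
  qed
  have le_of: "\<forall>\<^sub>F q in sequentially. f q \<le> l q" if "(\<lambda>q. f q / l q) \<longlonglongrightarrow> 0" for f
    using order_tendstoD(2)[OF that zero_less_one]
    by eventually_elim (use ell_pos in \<open>simp add: divide_less_eq less_imp_le\<close>)
  have main: "\<forall>\<^sub>F q in sequentially. dist (P q 1 + Z q 1) (D q 1) \<le> 2 * ((c1 + 1) * (d' q + \<zeta> q))"
    using av le_of[OF dl] le_of[OF dl'] eventually_gt_at_top[of j0]
  proof eventually_elim
    case (elim q)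
    have z0: "0 \<le> \<zeta> q" using Z by (simp add: small_def)
    have dq0: "0 \<le> d q" using c0(1) z0 by (simp add: d_def)
    have cl0: "close (P q (tm j0)) (flow_pt j0 x) (d q)" using c0(2)[of "Z q" "P q" "\<zeta> q"] p Z P0 unfolding d_def by auto
    have "P q (tm q) - flow_pt q x = P q (tm j0) - flow_pt j0 x"
      by (rule forward_good[OF p Z good cl0 elim(2)]) (use elim in auto)
    then have clq: "close (P q (tm q)) (flow_pt q x) (d q)"
      using cl0 unfolding close_def by (metis fst_diff snd_diff)
    \<comment> \<open>Here \<open>q\<close> must exceed \<open>j0\<close>: goodness of the preceding
      stage places the solution well inside a slow cell of stage \<open>q\<close>.\<close>
    obtain q' where q': "q = Suc q'" "j0 \<le> q'" using elim(4) by (cases q) auto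
    have farq: "far (a q) (10 * l q) (snd (flow_pt q x))" unfolding q'(1) by (rule far_prev[OF good[OF q'(2)]])
    have mid: "close (P q (1 - tm q)) (P q (tm q)) (a q * K q + 6 * a (Suc q))"
      using elim(1) clq dq0 elim(2) by (intro middle[OF p Z _ _ farq]) (auto simp: close_def)
    have Dq: "D q (tm q) = flow_pt q x" using forward_exact[OF D b(1), of q q] D0 by simp
    \<comment> \<open>The truncated field vanishes in between, so the noiseless solution waits at
      its forward position.\<close>
    have Dq': "D q (1 - tm q) = flow_pt q x"
      using path_rest[OF D[of q], of "tm q" "1 - tm q"] b(3)[of q] tm_nonneg[of q] tm_less_half[of q] Dq by auto
    have cl1: "close (P q (1 - tm q)) (D q (1 - tm q)) (d' q)"
      using clq mid unfolding Dq' close_def d'_def by linarith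
    have "P q (1 - tm j0) - D q (1 - tm j0) = P q (1 - tm q) - D q (1 - tm q)"
      using backward_good[OF p Z D b(2) good Dq' cl1 elim(3), of j0 j0] elim(4) by auto
    then have cl2: "close (P q (1 - tm j0)) (D q (1 - tm j0)) (d' q)"
      using cl1 unfolding close_def by (metis fst_diff snd_diff)
    have tj: "1 - tm q \<le> 1 - tm j0" using elim(4) by (simp add: strict_mono_less_eq[OF tm_strict_mono] less_imp_le)
    have "close (P q 1) (D q 1) (c1 * (d' q + \<zeta> q))"
      using p Z D b(2)[of q] cl2 tj by (intro c1(2)[of "Z q" "P q" "\<zeta> q" "b q" "D q" "d' q"]) auto
    moreover have "0 \<le> d' q" using cl1 unfolding close_def by linarith
    ultimately have "close (P q 1 + Z q 1) (D q 1) ((c1 + 1) * (d' q + \<zeta> q))"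
      using smallD(1)[OF Z, of 1 q] smallD(2)[OF Z, of 1 q] unfolding close_def distrib_right by auto
    then show ?case by (rule dist_close)
  qed
  have "(\<lambda>q. 2 * ((c1 + 1) * (((d' q + \<zeta> q) / l q) * l q))) \<longlonglongrightarrow> 2 * ((c1 + 1) * (0 * 0))"
    by (intro tendsto_intros dl' ell_tendsto)
  moreover have "2 * ((c1 + 1) * (((d' q + \<zeta> q) / l q) * l q)) = 2 * ((c1 + 1) * (d' q + \<zeta> q))" for q
    using ell_pos[of q] by simp
  ultimately have "(\<lambda>q. 2 * ((c1 + 1) * (d' q + \<zeta> q))) \<longlonglongrightarrow> 0" by (simp only: mult_zero_right)
  then show ?thesis
    by (rule Lim_null_comparison[rotated]) (use main in \<open>auto elim: eventually_mono\<close>)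
qed

end

section \<open>Almost every starting point\<close>

lemma lborel_translate:
  assumes "S \<in> sets borel"
  shows "emeasure lborel {x. x + c \<in> S} = emeasure lborel (S :: real set)"
proof -
  have "emeasure lborel S = emeasure (distr lborel borel ((+) c)) S" by (simp only: lborel_distr_plus)
  also have "\<dots> = emeasure lborel ((+) c -` S \<inter> space lborel)" using assms by (intro emeasure_distr) auto
  also have "(+) c -` S \<inter> space lborel = {x. x + c \<in> S}" by (auto simp: add.commute)
  finally show ?thesis by simp
qed

lemma pt_measurable:
  fixes f h :: "pt \<Rightarrow> real"
  assumes "f \<in> borel_measurable borel" "h \<in> borel_measurable borel"
  shows "(\<lambda>p. (f p, h p)) \<in> borel_measurable borel"
  using assms by (rule borel_measurable_Pair)

lemma fst_measurable: "(fst :: pt \<Rightarrow> real) \<in> borel_measurable borel"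
  and snd_measurable: "(snd :: pt \<Rightarrow> real) \<in> borel_measurable borel"
  by (intro borel_measurable_continuous_onI continuous_on_fst continuous_on_snd continuous_on_id)+

lemma vimage_borel:
  assumes "f \<in> borel_measurable borel" "S \<in> sets borel"
  shows "f -` S \<in> sets borel"
  using measurable_sets[OF assms] by simp

text \<open>Cavalieri: a shear translates every line parallel to its direction.\<close>

lemma shear_emeasure:
  fixes S :: "pt set"
  assumes f: "f \<in> borel_measurable borel" and S: "S \<in> sets borel"
  shows "emeasure lborel ((\<lambda>p. (fst p + f (snd p), snd p)) -` S) = emeasure lborel S"
    "emeasure lborel ((\<lambda>p. (fst p, snd p + f (fst p))) -` S) = emeasure lborel S"
proof -
  let ?h = "\<lambda>p. (fst p + f (snd p), snd p)" and ?v = "\<lambda>p. (fst p, snd p + f (fst p))"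
  have hm: "?h -` S \<in> sets borel" and vm: "?v -` S \<in> sets borel"
    by (intro vimage_borel[OF pt_measurable S] borel_measurable_add fst_measurable snd_measurable
        measurable_compose[OF snd_measurable f] measurable_compose[OF fst_measurable f])+
  have s: "A \<in> sets (lborel \<Otimes>\<^sub>M lborel)" if "A \<in> sets borel" for A :: "pt set"
    using that unfolding lborel_prod by simp
  have sec: "(\<lambda>x. (x, y)) -` S \<in> sets borel" "Pair x -` S \<in> sets borel" for x y
    using sets_Pair2[OF s[OF S], of y] sets_Pair1[OF s[OF S], of x] by simp_all
  show "emeasure lborel (?h -` S) = emeasure lborel S"
    unfolding lborel_prod[symmetric] lborel_pair.emeasure_pair_measure_alt2[OF s[OF hm]] lborel_pair.emeasure_pair_measure_alt2[OF s[OF S]]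
  proof (intro nn_integral_cong)
    fix y :: real
    have "(\<lambda>x. (x, y)) -` (?h -` S) = {x. x + f y \<in> (\<lambda>x. (x, y)) -` S}" by auto
    then show "emeasure lborel ((\<lambda>x. (x, y)) -` (?h -` S)) = emeasure lborel ((\<lambda>x. (x, y)) -` S)"
      by (simp only: lborel_translate[OF sec(1)])
  qed
  show "emeasure lborel (?v -` S) = emeasure lborel S"
    unfolding lborel_prod[symmetric] lborel.emeasure_pair_measure_alt[OF s[OF vm]] lborel.emeasure_pair_measure_alt[OF s[OF S]]
  proof (intro nn_integral_cong)
    fix x :: real
    have "Pair x -` (?v -` S) = {y. y + f x \<in> Pair x -` S}" by auto
    then show "emeasure lborel (Pair x -` (?v -` S)) = emeasure lborel (Pair x -` S)"
      by (simp only: lborel_translate[OF sec(2)])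
  qed
qed

text \<open>The neighbourhoods of jumps that can meet [-3, 3]: for m \<le> 3 only the indices with
  \<bar>k\<bar> * b \<le> 6 matter.\<close>

definition strips :: "real \<Rightarrow> real \<Rightarrow> real set" where
  "strips b m = (\<Union>k\<in>{-\<lceil>6 / b\<rceil>..\<lceil>6 / b\<rceil>}. {of_int k * b - m..of_int k * b + m})"

lemma not_far_strips:
  assumes "\<not> far b m z" "\<bar>z\<bar> \<le> 3" "0 < b" "m \<le> 3"
  shows "z \<in> strips b m"
proof -
  obtain k :: int where k: "\<bar>z - of_int k * b\<bar> \<le> m" using assms(1) unfolding far_def not_all not_less by (elim exE)
  have "\<bar>of_int k * b\<bar> \<le> 6" using k assms by linarith
  then have "\<bar>of_int k\<bar> \<le> 6 / b" using assms(3) by (simp add: abs_mult pos_le_divide_eq)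
  then have "\<bar>k\<bar> \<le> \<lceil>6 / b\<rceil>" by (metis le_of_int_ceiling of_int_abs of_int_le_iff order_trans)
  then have "k \<in> {-\<lceil>6 / b\<rceil>..\<lceil>6 / b\<rceil>}" by auto
  moreover have "z \<in> {of_int k * b - m..of_int k * b + m}" using k by auto
  ultimately show ?thesis unfolding strips_def by blast
qed

text \<open>There are at most 12 / b + 3 \<le> 15 / b intervals, each of length 2 * m.\<close>

lemma strips_emeasure:
  assumes "0 < b" "b \<le> 1" "0 \<le> m"
  shows "strips b m \<in> sets borel" "emeasure lborel (strips b m) \<le> ennreal (30 * (m / b))"
proof -
  define N where "N = \<lceil>6 / b\<rceil>"
  have N: "0 \<le> N" "real_of_int N \<le> 6 / b + 1"
  proof -
    have "0 \<le> 6 / b" using assms by simp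
    also have "6 / b \<le> real_of_int N" unfolding N_def by (rule le_of_int_ceiling)
    finally show "0 \<le> N" by simp
    show "real_of_int N \<le> 6 / b + 1" unfolding N_def by (rule of_int_ceiling_le_add_one)
  qed
  have card: "real (card {-N..N}) \<le> 15 / b"
  proof -
    have "real (card {-N..N}) = 2 * real_of_int N + 1" using N(1) by simp
    also have "\<dots> \<le> 2 * (6 / b + 1) + 1" using N by simp
    also have "\<dots> \<le> 12 / b + 3 / b" using assms by (simp add: field_simps)
    finally show ?thesis by (simp add: add_divide_distrib[symmetric])
  qed
  show "strips b m \<in> sets borel" unfolding strips_def by (intro sets.finite_UN) auto
  have "emeasure lborel (strips b m) \<le> (\<Sum>k\<in>{-N..N}. emeasure lborel {of_int k * b - m..of_int k * b + m})"
    unfolding strips_def N_def by (intro emeasure_subadditive_finite) auto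
  also have "\<dots> = (\<Sum>k\<in>{-N..N}. ennreal (2 * m))" using assms by (intro sum.cong) auto
  also have "\<dots> = ennreal (real (card {-N..N}) * (2 * m))"
    using assms by (simp add: ennreal_of_nat_eq_real_of_nat ennreal_mult)
  also have "\<dots> \<le> ennreal (15 / b * (2 * m))" using card assms by (intro ennreal_leI mult_right_mono) auto
  finally show "emeasure lborel (strips b m) \<le> ennreal (30 * (m / b))" by (simp add: mult_ac)
qed

section \<open>Area preservation and exceptional starting points\<close>

context scheme
begin

lemma g_measurable_borel: "g j \<in> borel_measurable borel"
proof -
  obtain L where L: "0 \<le> L" "\<And>z z'. \<bar>g j z - g j z'\<bar> \<le> L * \<bar>z - z'\<bar>" using g_lipschitz by blast
  have "L-lipschitz_on UNIV (g j)" by (rule lipschitz_onI) (use L in \<open>auto simp: dist_real_def\<close>)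
  then show ?thesis by (intro borel_measurable_continuous_onI lipschitz_on_continuous_on)
qed

lemma flow_pt_compose:
  "flow_pt (Suc j) = (\<lambda>p. (fst p, snd p + a (Suc j) / 2 * (g j (fst p) + 1))) \<circ> (\<lambda>p. (fst p + a j / 2 * g j (snd p), snd p)) \<circ> flow_pt j"
  by (rule ext) (simp add: flow_pt.simps Let_def)

lemma flow_pt_preserves:
  "flow_pt j \<in> borel_measurable borel \<and> (\<forall>S\<in>sets borel. emeasure lborel (flow_pt j -` S) = emeasure lborel S)"
proof (induction j)
  case 0
  have "flow_pt 0 = (\<lambda>x. x)" by (rule ext) simp
  then show ?case by simp
next
  case (Suc j)
  let ?v = "\<lambda>p. (fst p, snd p + a (Suc j) / 2 * (g j (fst p) + 1))" and ?h = "\<lambda>p. (fst p + a j / 2 * g j (snd p), snd p)"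
  note gm = g_measurable_borel[of j]
  have m1: "(\<lambda>x. a j / 2 * g j x) \<in> borel_measurable borel" and m2: "(\<lambda>x. a (Suc j) / 2 * (g j x + 1)) \<in> borel_measurable borel"
    using gm by measurable
  have hm: "?h \<in> borel_measurable borel"
    by (intro pt_measurable borel_measurable_add fst_measurable snd_measurable measurable_compose[OF snd_measurable m1])
  have vm: "?v \<in> borel_measurable borel"
    by (intro pt_measurable borel_measurable_add fst_measurable snd_measurable measurable_compose[OF fst_measurable m2])
  have "flow_pt (Suc j) \<in> borel_measurable borel"
    unfolding flow_pt_compose using Suc.IH hm vm by (intro measurable_comp) auto
  moreover have "emeasure lborel (flow_pt (Suc j) -` S) = emeasure lborel S" if S: "S \<in> sets borel" for S
  proof -
    have "flow_pt (Suc j) -` S = flow_pt j -` (?h -` (?v -` S))" unfolding flow_pt_compose by auto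
    then have "emeasure lborel (flow_pt (Suc j) -` S) = emeasure lborel (?h -` (?v -` S))"
      using Suc.IH vimage_borel[OF hm vimage_borel[OF vm S]] by auto
    also have "\<dots> = emeasure lborel (?v -` S)" by (rule shear_emeasure(1)[OF m1 vimage_borel[OF vm S]])
    also have "\<dots> = emeasure lborel S" by (rule shear_emeasure(2)[OF m2 S])
    finally show ?thesis .
  qed
  ultimately show ?case by blast
qed

text \<open>Points live in the plane, where the neighbourhoods of the jumps have infinite area. A
  displacement below 2 confines the orbits of the unit square to a bounded window.\<close>

lemma flow_pt_displacement: "close (flow_pt j x) x (2 * (a 0 - a j))"
proof (induction j)
  case 0 then show ?case by (simp add: close_def)
next
  case (Suc j)
  have "\<bar>a j / 2 * g j (snd (flow_pt j x))\<bar> \<le> a j / 2 * 1"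
    unfolding abs_mult using abs_g_le a_pos[of j] by (intro mult_mono) auto
  then have 1: "\<bar>fst (flow_pt (Suc j) x) - fst (flow_pt j x)\<bar> \<le> a j" unfolding fst_flow_pt_Suc using a_pos[of j] by simp
  have "\<bar>a (Suc j) / 2 * (g j (fst (flow_pt (Suc j) x)) + 1)\<bar> \<le> a (Suc j) / 2 * 2"
    unfolding abs_mult using abs_g_le[of j "fst (flow_pt (Suc j) x)"] a_pos[of "Suc j"] by (intro mult_mono) auto
  then have 2: "\<bar>snd (flow_pt (Suc j) x) - snd (flow_pt j x)\<bar> \<le> a j"
    unfolding snd_flow_pt_Suc[of j x] using a_Suc_less[of j] by simp
  have "a j \<le> 2 * (a j - a (Suc j))" using a_Suc_le[of j] a_pos[of j] unfolding right_diff_distrib by linarith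
  then show ?case using 1 2 Suc.IH unfolding close_def right_diff_distrib by linarith
qed

text \<open>The flow preserves area, so the starting points that come near a jump in stage
  \<open>j\<close> occupy at most a constant times the quotient of \<open>l (Suc j)\<close> and
  \<open>a (Suc j)\<close>, a power of \<open>r (Suc j)\<close>. This is summable and Borel-Cantelli
  applies.\<close>

lemma AE_good:
  "AE x in lborel. x \<in> {0..1} \<times> {0..1} \<longrightarrow> (\<exists>j0. \<forall>j\<ge>j0. good_pt j x)"
proof -
  define m where "m = (\<lambda>j. 10 * l (Suc j))"
  define S2 where "S2 = (\<lambda>j. {-3..3::real} \<times> strips (a (Suc j)) (m j))"
  define S1 where "S1 = (\<lambda>j. strips (a (Suc j)) (m j) \<times> {-3..3::real})"
  define bad where "bad = (\<lambda>j. flow_pt j -` S2 j \<union> flow_pt (Suc j) -` S1 j)"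
  have a14: "a (Suc j) \<le> 1/4" for j
  proof -
    have "a (Suc j) \<le> a 1" by (rule a_antimono) simp
    also have "\<dots> \<le> 1/4" using a_geometric[of 1] by simp
    finally show ?thesis .
  qed
  have a1: "a (Suc j) \<le> 1" for j using a14[of j] by simp
  have m0: "0 \<le> m j" and m3: "m j \<le> 3" for j
    using ell_pos[of "Suc j"] ell_le[of "Suc j"] a14[of j] by (auto simp: m_def)
  note st = strips_emeasure[OF a_pos a1 m0]
  have Sm: "S1 j \<in> sets borel" "S2 j \<in> sets borel" for j
    unfolding S1_def S2_def using st(1) by (auto intro: borel_Times)
  have Se: "emeasure lborel (S1 j) \<le> ennreal (1800 * r (Suc j) powr (1 - \<gamma>))" "emeasure lborel (S2 j) \<le> ennreal (1800 * r (Suc j) powr (1 - \<gamma>))" for j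
  proof -
    \<comment> \<open>The constant is 30 from \<open>strips_emeasure\<close>, times 10 from
      \<open>good_pt\<close>, times the length 6 of the window.\<close>
    have e: "emeasure lborel (strips (a (Suc j)) (m j)) * 6 \<le> ennreal (1800 * r (Suc j) powr (1 - \<gamma>))"
    proof -
      have "emeasure lborel (strips (a (Suc j)) (m j)) * 6 \<le> ennreal (30 * (m j / a (Suc j))) * 6" using st(2) by (rule mult_right_mono) simp
      also have "\<dots> = ennreal (30 * (m j / a (Suc j)) * 6)" using m0[of j] a_pos[of "Suc j"] ennreal_mult[of "30 * (m j / a (Suc j))" 6] by simp
      also have "30 * (m j / a (Suc j)) * 6 = 1800 * r (Suc j) powr (1 - \<gamma>)"
        using ell_div_a[of "Suc j"] by (simp add: m_def)
      finally show ?thesis .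
    qed
    have "emeasure lborel (S1 j) = emeasure lborel (strips (a (Suc j)) (m j)) * 6"
      unfolding S1_def lborel_prod[symmetric] using st(1)[of j] by (subst lborel.emeasure_pair_measure_Times) auto
    then show "emeasure lborel (S1 j) \<le> ennreal (1800 * r (Suc j) powr (1 - \<gamma>))" using e by simp
    have "emeasure lborel (S2 j) = 6 * emeasure lborel (strips (a (Suc j)) (m j))"
      unfolding S2_def lborel_prod[symmetric] using st(1)[of j] by (subst lborel.emeasure_pair_measure_Times) auto
    then show "emeasure lborel (S2 j) \<le> ennreal (1800 * r (Suc j) powr (1 - \<gamma>))" using e by (simp add: mult.commute)
  qed
  have bm: "bad j \<in> sets lborel" for j
    unfolding bad_def using vimage_borel[OF conjunct1[OF flow_pt_preserves]] Sm by auto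
  have be: "emeasure lborel (bad j) \<le> ennreal (3600 * r (Suc j) powr (1 - \<gamma>))" for j
  proof -
    have "emeasure lborel (bad j) \<le> emeasure lborel (flow_pt j -` S2 j) + emeasure lborel (flow_pt (Suc j) -` S1 j)"
      unfolding bad_def using vimage_borel[OF conjunct1[OF flow_pt_preserves]] Sm by (intro emeasure_subadditive) auto
    also have "\<dots> = emeasure lborel (S2 j) + emeasure lborel (S1 j)" using flow_pt_preserves Sm by auto
    also have "\<dots> \<le> ennreal (1800 * r (Suc j) powr (1 - \<gamma>)) + ennreal (1800 * r (Suc j) powr (1 - \<gamma>))" by (intro add_mono Se)
    also have "\<dots> = ennreal (3600 * r (Suc j) powr (1 - \<gamma>))" by (subst ennreal_plus[symmetric]) auto
    finally show ?thesis .
  qed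
  have "AE x in lborel. eventually (\<lambda>j. x \<in> space lborel - bad j) sequentially"
  proof (rule borel_cantelli_AE1)
    show fin: "emeasure lborel (bad j) < \<infinity>" for j using order_le_less_trans[OF be] by simp
    have "summable (\<lambda>j. 3600 * r (Suc j) powr (1 - \<gamma>))"
    proof (intro summable_mult)
      have "summable (\<lambda>j. (real (Suc j) + 1) * r (Suc j) powr (1 - \<gamma>))"
        using summable_r[of "1 - \<gamma>"] \<gamma> by (subst summable_Suc_iff[of "\<lambda>j. (real j + 1) * r j powr (1 - \<gamma>)"]) auto
      then show "summable (\<lambda>j. r (Suc j) powr (1 - \<gamma>))"
        by (rule summable_comparison_test'[of _ 0]) (simp add: mult_le_cancel_right1)
    qed
    then show "summable (\<lambda>j. measure lborel (bad j))"
    proof (rule summable_comparison_test'[of _ 0])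
      show "norm (measure lborel (bad j)) \<le> 3600 * r (Suc j) powr (1 - \<gamma>)" for j
        using be[of j] by (simp add: measure_def enn2real_leI)
    qed
  qed (rule bm)
  then show ?thesis
  proof (eventually_elim, intro impI)
    fix x assume ev: "eventually (\<lambda>j. x \<in> space lborel - bad j) sequentially" and x: "x \<in> {0..1} \<times> {0..1::real}"
    have in3: "\<bar>fst (flow_pt j x)\<bar> \<le> 3" "\<bar>snd (flow_pt j x)\<bar> \<le> 3" for j
    proof -
      have "a 0 \<le> 1" using a_geometric[of 0] by simp
      then have "close (flow_pt j x) x 2" using flow_pt_displacement[of j x] a_pos[of j] unfolding close_def right_diff_distrib by linarith
      then show "\<bar>fst (flow_pt j x)\<bar> \<le> 3" "\<bar>snd (flow_pt j x)\<bar> \<le> 3" using x unfolding close_def by (auto simp: mem_Times_iff)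
    qed
    have "good_pt j x" if "x \<notin> bad j" for j
    proof -
      have "snd (flow_pt j x) \<notin> strips (a (Suc j)) (m j)"
        using that in3(1)[of j] unfolding bad_def S2_def by (auto simp: mem_Times_iff abs_le_iff)
      moreover have "fst (flow_pt (Suc j) x) \<notin> strips (a (Suc j)) (m j)"
        using that in3(2)[of "Suc j"] unfolding bad_def S1_def by (auto simp: mem_Times_iff abs_le_iff)
      ultimately show ?thesis unfolding good_pt_def
        using not_far_strips[OF _ in3(2) a_pos m3] not_far_strips[OF _ in3(1) a_pos m3] unfolding m_def by blast
    qed
    then show "\<exists>j0. \<forall>j\<ge>j0. good_pt j x" using ev unfolding eventually_sequentially by auto
  qed
qed

end

section \<open>The selection result\<close>

lemma solvesI:
  assumes i: "\<And>t. t \<in> {0..1} \<Longrightarrow> ((\<lambda>r. b r (P r + Z r)) has_integral (P t - P 0)) {0..t}"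
  shows "solves b Z P"
  unfolding solves_def
proof (intro allI impI)
  fix s t :: real assume st: "0 \<le> s \<and> s \<le> t \<and> t \<le> 1"
  let ?f = "\<lambda>r. b r (P r + Z r)"
  have It: "(?f has_integral (P t - P 0)) {0..t}" and Is: "(?f has_integral (P s - P 0)) {0..s}"
    using i st by auto
  have ist: "?f integrable_on {s..t}"
    by (rule integrable_on_subinterval[OF has_integral_integrable[OF It]]) (use st in auto)
  have "integral {0..s} ?f + integral {s..t} ?f = integral {0..t} ?f"
    by (rule Henstock_Kurzweil_Integration.integral_combine) (use st It in \<open>auto intro: has_integral_integrable\<close>)
  then have "integral {s..t} ?f = P t - P s"
    unfolding integral_unique[OF It] integral_unique[OF Is] by (simp add: algebra_simps)
  then show "(?f has_integral (P t - P s)) {s..t}" using ist by (metis integrable_integral)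
qed

lemma ode_flow_solves:
  assumes "ode_flow b X"
  shows "solves b (\<lambda>_. 0) (\<lambda>t. X t x)"
proof (rule solvesI)
  fix t :: real assume t: "t \<in> {0..1}"
  have "((\<lambda>r. b r (X r x)) has_integral (X t x - X 0 x)) {0..t}"
  proof (rule fundamental_theorem_of_calculus)
    fix r assume r: "r \<in> {0..t}"
    have "((\<lambda>r. X r x) has_vector_derivative b r (X r x)) (at r within {0..1})"
    proof -
      have "r \<in> {0..1}" using r t by simp
      then show ?thesis using assms unfolding ode_flow_def by blast
    qed
    then show "((\<lambda>r. X r x) has_vector_derivative b r (X r x)) (at r within {0..t})"
      by (rule has_vector_derivative_within_subset) (use t in auto)
  qed (use t in auto)
  then show "((\<lambda>r. b r (X r x + 0)) has_integral (X t x - X 0 x)) {0..t}" by simp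
qed

lemma torus_dist_props:
  "0 \<le> torus_dist x y" "torus_dist x y \<le> dist x y" "torus_dist x y \<le> dist x x' + torus_dist x' y"
proof -
  have L0: "0 \<in> lattice" by (simp add: lattice_def zero_prod_def)
  then have ne: "lattice \<noteq> {}" by auto
  have bdd: "bdd_below ((\<lambda>k. dist x (y + k)) ` lattice)" for x by (rule bdd_belowI[of _ 0]) auto
  show "0 \<le> torus_dist x y" unfolding torus_dist_def by (rule cINF_greatest[OF ne]) simp
  show "torus_dist x y \<le> dist x y" unfolding torus_dist_def using cINF_lower[OF bdd L0] by simp
  have "torus_dist x y - dist x x' \<le> torus_dist x' y"
    unfolding torus_dist_def[of x' y]
  proof (rule cINF_greatest[OF ne])
    fix k assume "k \<in> lattice"
    then have "torus_dist x y \<le> dist x (y + k)" unfolding torus_dist_def by (rule cINF_lower[OF bdd])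
    also have "\<dots> \<le> dist x x' + dist x' (y + k)" by (rule dist_triangle)
    finally show "torus_dist x y - dist x x' \<le> dist x' (y + k)" by simp
  qed
  then show "torus_dist x y \<le> dist x x' + torus_dist x' y" by simp
qed

lemma torus_dist_measurable:
  assumes "f \<in> borel_measurable M"
  shows "(\<lambda>\<omega>. torus_dist (f \<omega>) y) \<in> borel_measurable M"
proof (rule measurable_compose[OF assms])
  have "1-lipschitz_on UNIV (\<lambda>x. torus_dist x y)"
  proof (rule lipschitz_onI)
    fix x x' :: pt
    show "dist (torus_dist x y) (torus_dist x' y) \<le> 1 * dist x x'"
      using torus_dist_props(3)[of x y x'] torus_dist_props(3)[of x' y x]
      by (simp add: dist_real_def dist_commute abs_le_iff)
  qed simp
  then show "(\<lambda>x. torus_dist x y) \<in> borel_measurable borel"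
    by (intro borel_measurable_continuous_onI lipschitz_on_continuous_on)
qed

text \<open>Convergence to 0 is expressed by countably many quantifiers, which makes the event
  measurable.\<close>

lemma LIMSEQ_zero_event:
  fixes f :: "nat \<Rightarrow> 'w \<Rightarrow> real"
  assumes [measurable]: "\<And>n. f n \<in> borel_measurable M"
  shows "{\<omega> \<in> space M. (\<lambda>n. f n \<omega>) \<longlonglongrightarrow> 0} \<in> sets M"
proof -
  have "(\<lambda>n. f n \<omega>) \<longlonglongrightarrow> 0 \<longleftrightarrow> (\<forall>m::nat. \<exists>N. \<forall>n\<ge>N. \<bar>f n \<omega>\<bar> < 1 / real (Suc m))" for \<omega>
  proof
    assume l: "(\<lambda>n. f n \<omega>) \<longlonglongrightarrow> 0"
    show "\<forall>m::nat. \<exists>N. \<forall>n\<ge>N. \<bar>f n \<omega>\<bar> < 1 / real (Suc m)"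
    proof
      fix m
      have "0 < 1 / real (Suc m)" by simp
      from LIMSEQ_D[OF l this] show "\<exists>N. \<forall>n\<ge>N. \<bar>f n \<omega>\<bar> < 1 / real (Suc m)" by simp
    qed
  next
    assume r: "\<forall>m::nat. \<exists>N. \<forall>n\<ge>N. \<bar>f n \<omega>\<bar> < 1 / real (Suc m)"
    show "(\<lambda>n. f n \<omega>) \<longlonglongrightarrow> 0"
    proof (rule LIMSEQ_I)
      fix e :: real assume "0 < e"
      then obtain m where m: "1 / real (Suc m) < e" using nat_approx_posE by blast
      obtain N where "\<forall>n\<ge>N. \<bar>f n \<omega>\<bar> < 1 / real (Suc m)" using r by blast
      then have "\<forall>n\<ge>N. norm (f n \<omega> - 0) < e" using m by (auto intro: less_trans)
      then show "\<exists>N. \<forall>n\<ge>N. norm (f n \<omega> - 0) < e" by blast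
    qed
  qed
  then show ?thesis by simp
qed

section \<open>Averaging for the actual noise and the almost sure statement\<close>

context scheme
begin

text \<open>The constant \<open>z0\<close>, later the scaled initial value of the noise, is absorbed
  by the arbitrary offset. The gauge integral in \<open>averages\<close> is a Lebesgue integral
  here, since its integrand is dominated by the weight.\<close>

lemma averages_of_osc:
  assumes b: "bump e s t" and st: "0 \<le> s" "t \<le> 1"
    and B: "B \<in> borel_measurable lborel" and BV: "\<And>\<tau>. e \<tau> \<noteq> 0 \<Longrightarrow> snd (Z \<tau>) = \<kappa> * B \<tau> - z0"
    and sm: "summable (osc e (\<lambda>\<tau>. \<kappa> / a (Suc q) * B \<tau>))"
  shows "averages e s t Z q (4 / pi * (\<Sum>n. osc e (\<lambda>\<tau>. \<kappa> / a (Suc q) * B \<tau>) n))"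
  unfolding averages_def
proof (intro allI impI)
  fix Y n I
  assume cell: "\<forall>t\<in>{0..1}. of_int n * a q + l (Suc q) < Y + snd (Z t) \<and> Y + snd (Z t) < (of_int n + 1) * a q - l (Suc q)"
    and I: "((\<lambda>t. e t * g q (Y + snd (Z t))) has_integral I) {s..t}"
  have e: "integrable lborel e" and supp: "\<And>\<tau>. e \<tau> \<noteq> 0 \<Longrightarrow> \<tau> \<in> {s..t}" using b by (auto simp: bump_def)
  have em: "e \<in> borel_measurable borel" using e by auto
  have eqw: "\<kappa> / a (Suc q) * B \<tau> = \<kappa> * B \<tau> / a (Suc q)" for \<tau> by simp
  have wm: "(\<lambda>\<tau>. \<kappa> * B \<tau>) \<in> borel_measurable lborel" using B by (intro borel_measurable_times) auto
  define f where "f = (\<lambda>\<tau>. e \<tau> * g q ((Y - z0) + \<kappa> * B \<tau>))"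
  have feq: "e \<tau> * g q (Y + snd (Z \<tau>)) = f \<tau>" for \<tau>
  proof (cases "e \<tau> = 0")
    case False
    then have "Y + snd (Z \<tau>) = Y - z0 + \<kappa> * B \<tau>" using BV[of \<tau>] by simp
    then show ?thesis by (simp only: f_def)
  qed (simp add: f_def)
  have fi: "integrable lborel f"
  proof (rule Bochner_Integration.integrable_bound[OF e])
    have "(\<lambda>\<tau>. g q ((Y - z0) + \<kappa> * B \<tau>)) \<in> borel_measurable lborel"
      by (rule measurable_compose[OF _ g_measurable_borel]) (use wm in \<open>intro borel_measurable_add, auto\<close>)
    then show "f \<in> borel_measurable lborel" unfolding f_def using em by (intro borel_measurable_times) auto
    show "AE \<tau> in lborel. norm (f \<tau>) \<le> norm (e \<tau>)"
      unfolding f_def by (intro AE_I2) (simp add: abs_mult mult_left_le abs_g_le)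
  qed
  have "(f has_integral (\<integral>\<tau>. f \<tau> \<partial>lborel)) UNIV" by (rule has_integral_integral_lborel[OF fi])
  moreover have "(\<lambda>\<tau>. if \<tau> \<in> {s..t} then f \<tau> else 0) = f"
    using supp by (intro ext) (auto simp: f_def)
  ultimately have "(f has_integral (\<integral>\<tau>. f \<tau> \<partial>lborel)) {s..t}"
    using has_integral_restrict_UNIV[of "{s..t}" f] by simp
  then have "I = (\<integral>\<tau>. f \<tau> \<partial>lborel)" using I unfolding feq by (rule has_integral_unique[rotated])
  moreover have "\<bar>\<integral>\<tau>. f \<tau> \<partial>lborel\<bar> \<le> 4 / pi * (\<Sum>n. osc e (\<lambda>\<tau>. \<kappa> * B \<tau> / a (Suc q)) n)"
    unfolding f_def g_def
  proof (rule abs_integral_avg_le[OF moll _ e wm a_pos a_pos])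
    show "0 \<le> l (Suc q)" using ell_pos[of "Suc q"] by simp
    show "summable (osc e (\<lambda>\<tau>. \<kappa> * B \<tau> / a (Suc q)))" using sm unfolding eqw .
    fix \<tau> assume "e \<tau> \<noteq> 0"
    then have "\<tau> \<in> {0..1}" "snd (Z \<tau>) = \<kappa> * B \<tau> - z0" using supp[of \<tau>] st BV[of \<tau>] by auto
    then show "of_int n * a q + l (Suc q) < Y - z0 + \<kappa> * B \<tau> \<and> Y - z0 + \<kappa> * B \<tau> < (of_int n + 1) * a q - l (Suc q)"
      using cell[rule_format, of \<tau>] by simp
  qed
  ultimately show "\<bar>I\<bar> \<le> 4 / pi * (\<Sum>n. osc e (\<lambda>\<tau>. \<kappa> / a (Suc q) * B \<tau>) n)" unfolding eqw by simp
qed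

lemma averages_mono: "averages e s t Z q K \<Longrightarrow> K \<le> K' \<Longrightarrow> averages e s t Z q K'"
  unfolding averages_def by (meson order_trans)

text \<open>Amplitude of the noise in cells of the fast wave; it is the factor of the path in the
  phases of \<open>osc\<close>.\<close>

definition rate :: "nat \<Rightarrow> real" where "rate q = kappa a q / a (Suc q)"

lemma rate_eq: "rate q = r q powr (- (1/2))"
proof -
  have "rate q = r q powr (1/2) / r q powr 1"
    unfolding rate_def kappa_eq a_Suc_eq using a_pos[of q] r_pos[of q] by simp
  also have "\<dots> = r q powr (1/2 - 1)" by (rule powr_diff[symmetric])
  also have "1/2 - 1 = (- (1/2) :: real)" by simp
  finally show ?thesis .
qed

text \<open>The weight \<open>a q / l q\<close> is r powr (\<gamma> - 1), the cutoffs contribute a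
  multiple of q + 1, and decorrelation gives \<open>rate q powr (- (p / 2))\<close>, which is r powr
  (p/4). The product is summable because p/4 exceeds 1 - \<gamma>.\<close>

lemma averaging_limit:
  assumes M: "prob_space M" and W: "regular_paths M W" and d: "decorrelating M (\<lambda>t \<omega>. snd (W t \<omega>)) p"
    and p: "1 - \<gamma> < p / 4" and Q: "3/10 \<le> tm Q"
  shows "AE \<omega> in M. \<exists>B. B \<in> borel_measurable lborel \<and> (\<forall>t\<in>{3/10..7/10}. B t = snd (W t \<omega>)) \<and>
     (\<forall>q\<ge>Q. summable (osc (\<eta> q 1) (\<lambda>t. rate q * B t)) \<and> summable (osc (\<lambda>t. \<eta> q 1 (1 - t)) (\<lambda>t. rate q * B t))) \<and>
     (\<lambda>q. a q / l q * (\<Sum>n. osc (\<eta> q 1) (\<lambda>t. rate q * B t) n)) \<longlonglongrightarrow> 0 \<and>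
     (\<lambda>q. a q / l q * (\<Sum>n. osc (\<lambda>t. \<eta> q 1 (1 - t)) (\<lambda>t. rate q * B t) n)) \<longlonglongrightarrow> 0"
proof -
  obtain C where C: "\<And>q t. \<bar>\<eta> q 1 t\<bar> \<le> C / (tm (Suc q) - tm q)"
  proof -
    have "\<exists>C :: nat \<Rightarrow> real. \<forall>k q. \<forall>i\<in>{1,2,3}. \<forall>j\<le>k. \<forall>t. \<bar>(deriv ^^ j) (\<eta> q i) t\<bar> \<le> C k / (tm (Suc q) - tm q) ^ (k + 1)"
      using cut unfolding cutoffs_def by (rule conjunct2)
    then obtain C :: "nat \<Rightarrow> real" where C: "\<And>k q i j t. i \<in> {1,2,3} \<Longrightarrow> j \<le> k \<Longrightarrow> \<bar>(deriv ^^ j) (\<eta> q i) t\<bar> \<le> C k / (tm (Suc q) - tm q) ^ (k + 1)"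
      by blast
    have "\<bar>\<eta> q 1 t\<bar> \<le> C 0 / (tm (Suc q) - tm q)" for q t using C[of 1 0 0 q t] by simp
    then show thesis by (rule that)
  qed
  \<comment> \<open>The supremum bound of the cutoffs, written with the length 3 / (pi^2 (q + 1)^2)
    of stage \<open>q\<close>.\<close>
  define E where "E = (\<lambda>q. C * pi\<^sup>2 / 3 * (real q + 1)\<^sup>2)"
  have EC: "C / (tm (Suc q) - tm q) = E q" for q unfolding tm_Suc_diff E_def by simp
  have E0: "0 \<le> E q" for q using C[of q 0] unfolding EC by linarith
  have C0: "0 \<le> C" using E0[of 0] by (simp add: E_def zero_le_mult_iff)
  define w where "w = (\<lambda>q. a q / l q)"
  have w0: "0 < w q" for q using a_pos[of q] ell_pos[of q] by (simp add: w_def)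
  have r0: "0 < rate q" for q using kappa_pos[of q] a_pos[of "Suc q"] by (simp add: rate_def)
  have sm: "summable (\<lambda>q. w q * sqrt (E q) * rate q powr (- (p / 2)))"
  proof -
    have "w q * sqrt (E q) * rate q powr (- (p / 2)) = sqrt (C * pi\<^sup>2 / 3) * ((real q + 1) * r q powr (p / 4 - (1 - \<gamma>)))" for q
    proof -
      have "w q = 1 / r q powr (1 - \<gamma>)" unfolding w_def ell_div_a[symmetric] by simp
      moreover have "sqrt (E q) = sqrt (C * pi\<^sup>2 / 3) * (real q + 1)" unfolding E_def real_sqrt_mult by simp
      moreover have "rate q powr (- (p / 2)) = r q powr (p / 4)" unfolding rate_eq powr_powr by (rule arg_cong2[of _ _ _ _ "(powr)"]) auto
      ultimately show ?thesis unfolding powr_diff by simp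
    qed
    then show ?thesis using summable_mult[OF summable_r[of "p / 4 - (1 - \<gamma>)"]] p by simp
  qed
  \<comment> \<open>The stages before \<open>Q\<close> are dropped, because their cutoffs may leave
    the time window on which decorrelation is known.\<close>
  have smQ: "summable (\<lambda>q. w (q + Q) * sqrt (E (q + Q)) * rate (q + Q) powr (- (p / 2)))"
    using summable_ignore_initial_segment[OF sm, of Q] by simp
  have tQ: "3/10 \<le> tm (q + Q)" for q
    using Q strict_mono_less_eq[OF tm_strict_mono, of Q "q + Q"] by simp
  have supp1: "t \<in> {3/10..1/2}" if "\<eta> (q + Q) 1 t \<noteq> 0" for q t
  proof -
    have "t \<in> {T (q + Q) 0..T (q + Q) 1}" using bumps(1)[of "q + Q"] that unfolding bump_def by blast
    then show ?thesis using tQ[of q] T_bounds(4)[of 1 "q + Q"] by (auto simp: T_0)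
  qed
  have b1: "integrable lborel (\<eta> q 1)" "(\<integral>t. \<eta> q 1 t \<partial>lborel) = 1" "0 \<le> \<eta> q 1 t" for q t
    using bumps(1)[of q] by (auto simp: bump_def)
  have b2: "integrable lborel (\<lambda>t. \<eta> q 1 (1 - t))" "(\<integral>t. \<eta> q 1 (1 - t) \<partial>lborel) = 1" for q
    using bumps(5)[of q] by (auto simp: bump_def)
  have bd: "\<eta> q 1 t \<le> E q" for q t using C[of q t] unfolding EC by linarith
  define BB where "BB = (\<lambda>\<omega> t. indicator {3/10..7/10} t * snd (W t \<omega>))"
  have F: "AE \<omega> in M. BB \<omega> \<in> borel_measurable lborel \<and>
     (\<forall>q. summable (osc (\<eta> (q + Q) 1) (\<lambda>t. rate (q + Q) * BB \<omega> t))) \<and>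
     (\<lambda>q. w (q + Q) * (\<Sum>n. osc (\<eta> (q + Q) 1) (\<lambda>t. rate (q + Q) * BB \<omega> t) n)) \<longlonglongrightarrow> 0"
    unfolding BB_def
    by (rule AE_averaging[OF M W d b1(1) b1(2) b1(3) bd _ r0 w0 smQ]) (use supp1 in force)
  have G: "AE \<omega> in M. BB \<omega> \<in> borel_measurable lborel \<and>
     (\<forall>q. summable (osc (\<lambda>t. \<eta> (q + Q) 1 (1 - t)) (\<lambda>t. rate (q + Q) * BB \<omega> t))) \<and>
     (\<lambda>q. w (q + Q) * (\<Sum>n. osc (\<lambda>t. \<eta> (q + Q) 1 (1 - t)) (\<lambda>t. rate (q + Q) * BB \<omega> t) n)) \<longlonglongrightarrow> 0"
    unfolding BB_def
    by (rule AE_averaging[OF M W d b2(1) b2(2) b1(3) bd _ r0 w0 smQ]) (use supp1 in force)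
  from F G show ?thesis
  proof eventually_elim
    case (elim \<omega>)
    have "\<forall>q\<ge>Q. summable (osc (\<eta> q 1) (\<lambda>t. rate q * BB \<omega> t)) \<and> summable (osc (\<lambda>t. \<eta> q 1 (1 - t)) (\<lambda>t. rate q * BB \<omega> t))"
    proof (intro allI impI)
      fix q assume "Q \<le> q"
      then have "q = (q - Q) + Q" by simp
      then show "summable (osc (\<eta> q 1) (\<lambda>t. rate q * BB \<omega> t)) \<and> summable (osc (\<lambda>t. \<eta> q 1 (1 - t)) (\<lambda>t. rate q * BB \<omega> t))"
        using elim by metis
    qed
    moreover have "(\<lambda>q. w q * (\<Sum>n. osc (\<eta> q 1) (\<lambda>t. rate q * BB \<omega> t) n)) \<longlonglongrightarrow> 0"
      by (rule LIMSEQ_offset[of _ Q]) (use elim in blast)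
    moreover have "(\<lambda>q. w q * (\<Sum>n. osc (\<lambda>t. \<eta> q 1 (1 - t)) (\<lambda>t. rate q * BB \<omega> t) n)) \<longlonglongrightarrow> 0"
      by (rule LIMSEQ_offset[of _ Q]) (use elim in blast)
    moreover have "\<forall>t\<in>{3/10..7/10}. BB \<omega> t = snd (W t \<omega>)" by (simp add: BB_def)
    ultimately show ?case using elim unfolding w_def by (intro exI[of _ "BB \<omega>"]) blast
  qed
qed

lemma u_approx_cases:
  "0 \<le> t \<Longrightarrow> t < tm q \<Longrightarrow> u_approx a \<gamma> \<phi> \<rho> \<eta> q t x = uu t x"
  "1 - tm q < t \<Longrightarrow> u_approx a \<gamma> \<phi> \<rho> \<eta> q t x = uu t x"
  "tm q < t \<Longrightarrow> t < 1 - tm q \<Longrightarrow> u_approx a \<gamma> \<phi> \<rho> \<eta> q t x = 0"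
  by (auto simp: u_approx_def)

text \<open>Probability enters through one almost sure event, common to the countably many
  \<open>q\<close>: the integral equations, a bounded path and decaying modes. On it
  \<open>deterministic_convergence\<close> applies to the single path.\<close>

lemma selection:
  assumes M: "prob_space M" and W: "regular_paths M W" and d: "decorrelating M (\<lambda>t \<omega>. snd (W t \<omega>)) p"
    and p: "1 - \<gamma> < p / 4"
    and X: "\<And>\<kappa>. \<kappa> > 0 \<Longrightarrow> stochastic_flow M W uu \<kappa> (X \<kappa>)"
    and Xdet: "\<And>q. ode_flow (u_approx a \<gamma> \<phi> \<rho> \<eta> q) (Xdet q)"
    and good: "\<And>j. j0 \<le> j \<Longrightarrow> good_pt j x"
  shows "measure M {\<omega> \<in> space M. (\<lambda>q. torus_dist (X (kappa a q) 0 1 x \<omega>) (Xdet q 1 x)) \<longlonglongrightarrow> 0} = 1"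
proof -
  interpret prob_space M by fact
  have "\<forall>\<^sub>F q in sequentially. 3/10 < tm q" using order_tendstoD(1)[OF tm_tendsto, of "3/10"] by simp
  then obtain Q where Q: "3/10 \<le> tm Q" by (auto simp: eventually_sequentially intro: less_imp_le)
  define \<kappa> where "\<kappa> = (\<lambda>q. kappa a q)"
  have k0: "0 < \<kappa> q" for q by (simp add: \<kappa>_def kappa_pos)
  have "AE \<omega> in M. \<forall>q. \<forall>t\<in>{0..1}. ((\<lambda>r. uu r (X (\<kappa> q) 0 r x \<omega>)) has_integral
                 (X (\<kappa> q) 0 t x \<omega> - x - \<kappa> q *\<^sub>R (W t \<omega> - W 0 \<omega>))) {0..t}"
    unfolding AE_all_countable
  proof
    fix q
    have "AE \<omega> in M. \<forall>s t. 0 \<le> s \<and> s \<le> t \<and> t \<le> 1 \<longrightarrow>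
        (\<forall>x. ((\<lambda>r. uu r (X (\<kappa> q) s r x \<omega>)) has_integral
                 (X (\<kappa> q) s t x \<omega> - x - \<kappa> q *\<^sub>R (W t \<omega> - W s \<omega>))) {s..t})"
      using conjunct2[OF X[OF k0[of q], unfolded stochastic_flow_def]]
    proof eventually_elim
      case (elim \<omega>)
      show ?case
      proof (intro allI impI)
        fix s t :: real and x assume "0 \<le> s \<and> s \<le> t \<and> t \<le> 1"
        from elim[THEN spec, of s, THEN spec, of t, THEN mp, OF this, THEN conjunct1, THEN spec, of x]
        show "((\<lambda>r. uu r (X (\<kappa> q) s r x \<omega>)) has_integral (X (\<kappa> q) s t x \<omega> - x - \<kappa> q *\<^sub>R (W t \<omega> - W s \<omega>))) {s..t}" .
      qed
    qed
    then show "AE \<omega> in M. \<forall>t\<in>{0..1}. ((\<lambda>r. uu r (X (\<kappa> q) 0 r x \<omega>)) has_integral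
                 (X (\<kappa> q) 0 t x \<omega> - x - \<kappa> q *\<^sub>R (W t \<omega> - W 0 \<omega>))) {0..t}"
    proof (eventually_elim, intro ballI)
      fix \<omega> and t :: real
      assume A: "\<forall>s t. 0 \<le> s \<and> s \<le> t \<and> t \<le> 1 \<longrightarrow>
        (\<forall>x. ((\<lambda>r. uu r (X (\<kappa> q) s r x \<omega>)) has_integral
                 (X (\<kappa> q) s t x \<omega> - x - \<kappa> q *\<^sub>R (W t \<omega> - W s \<omega>))) {s..t})" and t: "t \<in> {0..1}"
      show "((\<lambda>r. uu r (X (\<kappa> q) 0 r x \<omega>)) has_integral
                 (X (\<kappa> q) 0 t x \<omega> - x - \<kappa> q *\<^sub>R (W t \<omega> - W 0 \<omega>))) {0..t}"
        by (rule A[THEN spec, of 0, THEN spec, of t, THEN mp, THEN spec, of x]) (use t in simp)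
    qed
  qed
  moreover have "AE \<omega> in M. bounded ((\<lambda>t. W t \<omega>) ` {0..1})" using W unfolding regular_paths_def by auto
  ultimately have "AE \<omega> in M. (\<lambda>q. torus_dist (X (kappa a q) 0 1 x \<omega>) (Xdet q 1 x)) \<longlonglongrightarrow> 0"
    using averaging_limit[OF M W d p Q]
  proof eventually_elim
    case (elim \<omega>)
    from elim(3) obtain B where B: "B \<in> borel_measurable lborel" and BW: "\<forall>t\<in>{3/10..7/10}. B t = snd (W t \<omega>)"
      and sm: "\<forall>q\<ge>Q. summable (osc (\<eta> q 1) (\<lambda>t. rate q * B t)) \<and> summable (osc (\<lambda>t. \<eta> q 1 (1 - t)) (\<lambda>t. rate q * B t))"
      and lim: "(\<lambda>q. a q / l q * (\<Sum>n. osc (\<eta> q 1) (\<lambda>t. rate q * B t) n)) \<longlonglongrightarrow> 0"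
        "(\<lambda>q. a q / l q * (\<Sum>n. osc (\<lambda>t. \<eta> q 1 (1 - t)) (\<lambda>t. rate q * B t) n)) \<longlonglongrightarrow> 0"
      by (elim exE conjE)
    obtain R where R: "\<And>t. t \<in> {0..1} \<Longrightarrow> norm (W t \<omega>) \<le> R" using elim(2) unfolding bounded_iff by blast
    have R0: "0 \<le> R" using order_trans[OF norm_ge_zero R[of 0]] by simp
    \<comment> \<open>The driver starts at 0 even if the noise does not; \<open>P\<close> is the
      solution in its frame.\<close>
    define Z where "Z = (\<lambda>q t. \<kappa> q *\<^sub>R (W t \<omega> - W 0 \<omega>))"
    define P where "P = (\<lambda>q t. X (\<kappa> q) 0 t x \<omega> - Z q t)"
    define K1 where "K1 = (\<lambda>q. \<Sum>n. osc (\<eta> q 1) (\<lambda>t. rate q * B t) n)"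
    define K2 where "K2 = (\<lambda>q. \<Sum>n. osc (\<lambda>t. \<eta> q 1 (1 - t)) (\<lambda>t. rate q * B t) n)"
    \<comment> \<open>The sum of the two mode bounds, so that one constant serves both passages
      through the shear.\<close>
    define K where "K = (\<lambda>q. 4 / pi * (K1 q + K2 q))"
    have P0: "P q 0 = x" for q
    proof -
      \<comment> \<open>At time 0 the integral equation lives on a degenerate interval and yields
        the initial condition.\<close>
      have "((\<lambda>r. uu r (X (\<kappa> q) 0 r x \<omega>)) has_integral (X (\<kappa> q) 0 0 x \<omega> - x - \<kappa> q *\<^sub>R (W 0 \<omega> - W 0 \<omega>))) {0..0}"
        by (rule elim(1)[THEN spec, of q, THEN bspec]) simp
      then have "X (\<kappa> q) 0 0 x \<omega> - x - \<kappa> q *\<^sub>R (W 0 \<omega> - W 0 \<omega>) = 0"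
        unfolding atLeastAtMost_singleton by (rule has_integral_unique[OF _ has_integral_refl(2)])
      then have "X (\<kappa> q) 0 0 x \<omega> - x = 0" by simp
      then show ?thesis by (simp add: P_def Z_def)
    qed
    have sol: "solves uu (Z q) (P q)" for q
    proof (rule solvesI)
      fix t :: real assume t: "t \<in> {0..1}"
      have "((\<lambda>r. uu r (X (\<kappa> q) 0 r x \<omega>)) has_integral (X (\<kappa> q) 0 t x \<omega> - x - \<kappa> q *\<^sub>R (W t \<omega> - W 0 \<omega>))) {0..t}"
        using elim(1)[THEN spec, of q] t by (rule bspec)
      moreover have "P q r + Z q r = X (\<kappa> q) 0 r x \<omega>" for r by (simp add: P_def)
      moreover have "P q t - P q 0 = X (\<kappa> q) 0 t x \<omega> - x - \<kappa> q *\<^sub>R (W t \<omega> - W 0 \<omega>)"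
        unfolding P0 by (simp add: P_def Z_def)
      ultimately show "((\<lambda>r. uu r (P q r + Z q r)) has_integral (P q t - P q 0)) {0..t}"
        by (simp only:)
    qed
    have Zs: "small (Z q) (\<kappa> q * (2 * R))" for q
      unfolding small_def
    proof (intro conjI ballI)
      show "0 \<le> \<kappa> q * (2 * R)" using k0[of q] R0 by simp
      fix t :: real assume t: "t \<in> {0..1}"
      have "norm (W t \<omega> - W 0 \<omega>) \<le> norm (W t \<omega>) + norm (W 0 \<omega>)" by (rule norm_triangle_ineq4)
      also have "\<dots> \<le> 2 * R" using R[OF t] R[of 0] by simp
      finally have "norm (Z q t) \<le> \<kappa> q * (2 * R)" unfolding Z_def using k0[of q] by (simp add: mult_left_mono)
      moreover have "\<bar>fst (Z q t)\<bar> \<le> norm (Z q t)" "\<bar>snd (Z q t)\<bar> \<le> norm (Z q t)"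
        using norm_fst_le[of "fst (Z q t)" "snd (Z q t)"] norm_snd_le[of "snd (Z q t)" "fst (Z q t)"] by simp_all
      ultimately show "\<bar>fst (Z q t)\<bar> \<le> \<kappa> q * (2 * R)" "\<bar>snd (Z q t)\<bar> \<le> \<kappa> q * (2 * R)"
        by linarith+
    qed
    have av: "averages (\<eta> q 1) (T q 0) (T q 1) (Z q) q (K q) \<and>
        averages (\<lambda>t. \<eta> q 1 (1 - t)) (1 - T q 1) (1 - T q 0) (Z q) q (K q)" if q: "Q \<le> q" for q
    proof -
      have tq: "3/10 \<le> tm q" using Q q by (meson order_trans strict_mono_less_eq[OF tm_strict_mono])
      have T01: "3/10 \<le> T q 0" "T q 1 < 1/2" using tq T_bounds(4)[of 1 q] by (auto simp: T_0)
      have Tm: "T q 0 \<le> T q 1" by (rule T_mono) simp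
      have V: "snd (Z q t) = \<kappa> q * B t - \<kappa> q * snd (W 0 \<omega>)" if "t \<in> {3/10..7/10}" for t
        unfolding Z_def BW[rule_format, OF that] by (simp add: right_diff_distrib)
      have o: "0 \<le> K1 q" "0 \<le> K2 q"
        unfolding K1_def K2_def using sm[rule_format, OF q] by (auto intro!: suminf_nonneg simp: osc_def)
      have "averages (\<eta> q 1) (T q 0) (T q 1) (Z q) q (4 / pi * K1 q)"
        unfolding K1_def rate_def \<kappa>_def[symmetric]
      proof (rule averages_of_osc[OF bumps(1) _ _ B])
        show "summable (osc (\<eta> q 1) (\<lambda>\<tau>. \<kappa> q / a (Suc q) * B \<tau>))" using sm[rule_format, OF q, THEN conjunct1] unfolding rate_def \<kappa>_def .
        fix \<tau> assume "\<eta> q 1 \<tau> \<noteq> 0"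
        then have "\<tau> \<in> {T q 0..T q 1}" using bumps(1)[of q] unfolding bump_def by blast
        then show "snd (Z q \<tau>) = \<kappa> q * B \<tau> - \<kappa> q * snd (W 0 \<omega>)" using T01 by (intro V) auto
      qed (use T01 Tm in auto)
      moreover have "averages (\<lambda>t. \<eta> q 1 (1 - t)) (1 - T q 1) (1 - T q 0) (Z q) q (4 / pi * K2 q)"
        unfolding K2_def rate_def \<kappa>_def[symmetric]
      proof (rule averages_of_osc[OF bumps(5) _ _ B])
        show "summable (osc (\<lambda>t. \<eta> q 1 (1 - t)) (\<lambda>\<tau>. \<kappa> q / a (Suc q) * B \<tau>))" using sm[rule_format, OF q, THEN conjunct2] unfolding rate_def \<kappa>_def .
        fix \<tau> assume "\<eta> q 1 (1 - \<tau>) \<noteq> 0"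
        then have "\<tau> \<in> {1 - T q 1..1 - T q 0}" using bumps(5)[of q] unfolding bump_def by blast
        then show "snd (Z q \<tau>) = \<kappa> q * B \<tau> - \<kappa> q * snd (W 0 \<omega>)" using T01 by (intro V) auto
      qed (use T01 Tm in auto)
      moreover have "4 / pi * K1 q \<le> K q" "4 / pi * K2 q \<le> K q"
        unfolding K_def using o by (auto intro!: divide_right_mono)
      ultimately show ?thesis using averages_mono by blast
    qed
    have "(\<lambda>q. dist (P q 1 + Z q 1) (Xdet q 1 x)) \<longlonglongrightarrow> 0"
    proof (rule deterministic_convergence[OF good sol P0 Zs ode_flow_solves[OF Xdet]])
      show "Xdet q 0 x = x" for q using Xdet[of q] unfolding ode_flow_def by blast
      show "\<forall>\<^sub>F q in sequentially. averages (\<eta> q 1) (T q 0) (T q 1) (Z q) q (K q) \<and>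
        averages (\<lambda>t. \<eta> q 1 (1 - t)) (1 - T q 1) (1 - T q 0) (Z q) q (K q)"
        using av unfolding eventually_sequentially by blast
      have "(\<lambda>q. kappa a q / l q * (2 * R)) \<longlonglongrightarrow> 0 * (2 * R)" by (intro tendsto_intros ratios_tendsto)
      then show "(\<lambda>q. \<kappa> q * (2 * R) / l q) \<longlonglongrightarrow> 0" by (simp add: \<kappa>_def)
      have "(\<lambda>q. 4 / pi * (a q / l q * K1 q + a q / l q * K2 q)) \<longlonglongrightarrow> 4 / pi * (0 + 0)"
        unfolding K1_def K2_def by (intro tendsto_intros lim)
      moreover have "4 / pi * (a q / l q * K1 q + a q / l q * K2 q) = a q / l q * K q" for q
        unfolding K_def distrib_left by (simp only: mult_ac)
      ultimately show "(\<lambda>q. a q / l q * K q) \<longlonglongrightarrow> 0" by (simp only: add_0 mult_zero_right)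
    qed (simp_all add: u_approx_cases)
    then have "(\<lambda>q. dist (X (\<kappa> q) 0 1 x \<omega>) (Xdet q 1 x)) \<longlonglongrightarrow> 0" by (simp add: P_def)
    then show ?case unfolding \<kappa>_def
      by (rule Lim_null_comparison[rotated]) (simp add: torus_dist_props)
  qed
  moreover have "X (kappa a q) 0 1 x \<in> borel_measurable M" for q
    using conjunct1[OF X[OF kappa_pos[of q], unfolded stochastic_flow_def], rule_format, of 0 1 x] by simp
  then have "{\<omega> \<in> space M. (\<lambda>q. torus_dist (X (kappa a q) 0 1 x \<omega>) (Xdet q 1 x)) \<longlonglongrightarrow> 0} \<in> events"
    by (intro LIMSEQ_zero_event torus_dist_measurable)
  ultimately show ?thesis by (subst prob_Collect_eq_1)
qed

end

text \<open>Of the noise only regular paths and decorrelation with 1 - \<gamma> < p/4 are used,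
  which unites all cases. Both thresholds are instantiated by 1: the argument is asymptotic in
  \<open>q\<close>, and what it uses of the sequence \<open>a\<close> is contained in
  \<open>admissible_scales\<close>.\<close>

theorem proposition6p1:
  fixes N :: noise and \<alpha> \<gamma> :: real
  assumes "valid_noise N"
    and "alpha_noise N < \<alpha>" and "\<alpha> < 1"
    and "admissible_gamma N \<gamma>"
  shows "\<exists>\<delta>0>0. \<forall>\<delta>. 0 < \<delta> \<and> \<delta> < \<delta>0 \<and> \<delta> < 1/100 \<longrightarrow>
    (\<exists>abar>0. \<forall>a \<phi> \<rho> \<eta>.
       a 0 < abar \<and> admissible_scales \<delta> \<gamma> a \<and>
       (\<forall>q. sawtooth (a q) (a (Suc q)) (\<phi> (Suc q))) \<and>
       standard_mollifier \<rho> \<and> cutoffs \<eta> \<and>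
       holder_torus \<alpha> (u a \<gamma> \<phi> \<rho> \<eta>) \<longrightarrow>
       (\<forall>(M :: 'w measure) W X Xdet.
          prob_space M \<and> is_noise N M W \<and>
          (\<forall>\<kappa>>0. stochastic_flow M W (u a \<gamma> \<phi> \<rho> \<eta>) \<kappa> (X \<kappa>)) \<and>
          (\<forall>q. ode_flow (u_approx a \<gamma> \<phi> \<rho> \<eta> q) (Xdet q)) \<longrightarrow>
          (AE x\<in>{0..1} \<times> {0..1} in lborel.
             measure M {\<omega> \<in> space M.
               (\<lambda>q. torus_dist (X (kappa a q) 0 1 x \<omega>) (Xdet q 1 x)) \<longlonglongrightarrow> 0} = 1)))"
proof (intro exI[of _ 1] conjI allI impI; (elim conjE)?)
  fix \<delta> a \<phi> \<rho> \<eta> and M :: "'w measure" and W X Xdet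
  assume h: "0 < \<delta>" "admissible_scales \<delta> \<gamma> a" "\<forall>q. sawtooth (a q) (a (Suc q)) (\<phi> (Suc q))"
    "standard_mollifier \<rho>" "cutoffs \<eta>" "prob_space M" "is_noise N M W"
    "\<forall>\<kappa>>0. stochastic_flow M W (u a \<gamma> \<phi> \<rho> \<eta>) \<kappa> (X \<kappa>)"
    "\<forall>q. ode_flow (u_approx a \<gamma> \<phi> \<rho> \<eta> q) (Xdet q)"
  note np = noise_properties[OF h(6) assms(1) h(7) assms(4)]
  interpret scheme a \<gamma> \<delta> \<phi> \<rho> \<eta>
    using h np(3,4) by unfold_locales auto
  obtain p where p: "decorrelating M (\<lambda>t \<omega>. snd (W t \<omega>)) p" "1 - \<gamma> < p / 4" using np(2) by blast
  show "AE x\<in>{0..1} \<times> {0..1} in lborel. measure M {\<omega> \<in> space M.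
      (\<lambda>q. torus_dist (X (kappa a q) 0 1 x \<omega>) (Xdet q 1 x)) \<longlonglongrightarrow> 0} = 1"
    using AE_good
  proof (eventually_elim, intro impI)
    fix x assume "x \<in> {0..1} \<times> {0..1} \<longrightarrow> (\<exists>j0. \<forall>j\<ge>j0. good_pt j x)" and "x \<in> {0..1} \<times> {0..1}"
    then obtain j0 where "\<And>j. j0 \<le> j \<Longrightarrow> good_pt j x" by blast
    then show "measure M {\<omega> \<in> space M. (\<lambda>q. torus_dist (X (kappa a q) 0 1 x \<omega>) (Xdet q 1 x)) \<longlonglongrightarrow> 0} = 1"
      using h(8,9) by (intro selection[OF h(6) np(1) p]) auto
  qed
qed auto

end
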